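(* The continued fraction \[ 112+\cfrac{16}{4\cdot(68\cdot1^2+3)-\cfrac{3^6}{8\cdot(68\cdot2^2+3)-\cfrac{5^6}{12\cdot(68\cdot3^2+3)-\cdots}}}, \] i.e. with $a(0)=112$, $a(n)=4n(68n^2+3)$ for $n\ge1$, $b(0)=16$, $b(n)=-(2n+1)^6$ for $n\ge1$, converges to $-3\eta_+/\omega_+$. Moreover, if $p(n)/q(n)$ denotes its $n$-th convergent, then as $n\to\infty$ \[ -3\frac{\eta_+}{\omega_+}-\frac{p(n)}{q(n)}\sim\frac{192\pi^3/\omega_+^2}{(1+\sqrt2)^{8n+8}}. \]
   Context: Let $f(\tau)=\eta(2\tau)^4\eta(4\tau)^4$, where $\eta$ is the Dedekind eta function; $f$ is a Hecke eigenform of weight $4$ on $\Gamma_0(8)$ with $L$-function $L(f,s)$. Put $\omega_+=8L(f,3)=6.99756301668063\dots$. Let \[ I_3(n)=\iiint_{[0,1]^3}\frac{x^{n-1/2}(1-x)^{n-1/2}y^{n-1/2}(1-y)^{n-1/2}z^{n-1/2}(1-z)^{n-1/2}}{(1-(1-xy)z)^{n+1/2}}\,dx\,dy\,dz . \] The real quasiperiod $\eta_+=-261.37391590940420\dots$ of $f$ satisfies $I_3(1)=-56\omega_+-\tfrac32\eta_+$ (this may be taken as its definition). For sequences $a(n),b(n)$, the continued fraction is $a(0)+\cfrac{b(0)}{a(1)+\cfrac{b(1)}{a(2)+\cdots}}$ and its $n$-th convergent $p(n)/q(n)$ is the truncation ending with $b(n-1)/a(n)$. *)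

theory Defs
  imports "HOL-Analysis.Analysis" "HOL-Computational_Algebra.Formal_Power_Series"
    "HOL-Library.Landau_Symbols"
begin

text \<open>Fourier coefficients of f(tau) = eta(2 tau)^4 eta(4 tau)^4 = q prod_{k>=1} (1-q^(2k))^4 (1-q^(4k))^4.
  The coefficient of q^n only depends on the factors with k <= n, so the finite product suffices.\<close>
definition f_coeff :: "nat \<Rightarrow> real" where
  "f_coeff n = fps_nth (fps_X * (\<Prod>k\<in>{1..n}. (1 - fps_X ^ (2*k)) ^ 4 * (1 - fps_X ^ (4*k)) ^ 4)) n"

text \<open>L(f,3) = sum_{n>=1} a_n / n^3 (absolutely convergent).\<close>
definition L_f_3 :: real where
  "L_f_3 = (\<Sum>n. f_coeff (Suc n) / (real (Suc n)) ^ 3)"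

definition omega_plus :: real where
  "omega_plus = 8 * L_f_3"

definition I3 :: "nat \<Rightarrow> real" where
  "I3 n = (LINT v : {0..1} \<times> {0..1} \<times> {0..1} | (lborel :: (real \<times> real \<times> real) measure).
     (case v of (x, y, z) \<Rightarrow>
       (x powr (real n - 1/2) * (1 - x) powr (real n - 1/2) *
        y powr (real n - 1/2) * (1 - y) powr (real n - 1/2) *
        z powr (real n - 1/2) * (1 - z) powr (real n - 1/2)) /
       (1 - (1 - x * y) * z) powr (real n + 1/2)))"

text \<open>eta_+ defined by I_3(1) = -56 omega_+ - 3/2 eta_+.\<close>
definition eta_plus :: real where
  "eta_plus = - (2/3) * (I3 1 + 56 * omega_plus)"

text \<open>Numerators and denominators of the convergents of
  a(0) + b(0)/(a(1) + b(1)/(a(2) + ...)); p n / q n is the truncation ending with b(n-1)/a(n).\<close>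
fun cf_p :: "(nat \<Rightarrow> real) \<Rightarrow> (nat \<Rightarrow> real) \<Rightarrow> nat \<Rightarrow> real" where
  "cf_p a b 0 = a 0"
| "cf_p a b (Suc 0) = a 1 * a 0 + b 0"
| "cf_p a b (Suc (Suc n)) = a (n + 2) * cf_p a b (Suc n) + b (Suc n) * cf_p a b n"

fun cf_q :: "(nat \<Rightarrow> real) \<Rightarrow> (nat \<Rightarrow> real) \<Rightarrow> nat \<Rightarrow> real" where
  "cf_q a b 0 = 1"
| "cf_q a b (Suc 0) = a 1"
| "cf_q a b (Suc (Suc n)) = a (n + 2) * cf_q a b (Suc n) + b (Suc n) * cf_q a b n"

definition cf_a :: "nat \<Rightarrow> real" where
  "cf_a n = (if n = 0 then 112 else 4 * real n * (68 * (real n)^2 + 3))"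

definition cf_b :: "nat \<Rightarrow> real" where
  "cf_b n = (if n = 0 then 16 else - ((2 * real n + 1) ^ 6))"

end

(*
  Write I_3(n) as the integral over 0 < s < 1 of 2 (s (1 - s^2))^(2n) K_n(s)^2, where K_n(s) is the integral over
  the real line of (1 + s^2 + 2 s cosh u)^(-n-1/2). Creative telescoping gives the three-term recurrence satisfied by
  I_3, and Laplace's method gives I_3(n) ~ C (1 + sqrt 2)^(-4n) n^(-3/2). Up to the factor (1 3 5 ... (2n-1))^3 the
  recurrence is that of the convergents, so I_3 is the minimal solution, and its values at 0 and 1 determine the limit of
  the continued fraction; the Casoratian then gives the error term.

  It remains to see that I_3(0) = 64 L(f,3). The integral K_0 is an arithmetic-geometric mean integral, so its value
  at s = theta(-q)^2 / theta(q)^2 is pi theta(q)^2, while its value at the complementary modulus is -(ln q) theta(q)^2.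
  Comparing the two yields theta(exp(-pi/t))^2 = t theta(exp(-pi t))^2. With q = exp(-pi t) as variable, I_3(0) becomes
  16 pi^3 times the integral of f(exp(-pi t)) over t > 0, since f = theta(q)^2 theta(-q)^2 (theta(q)^4 - theta(-q)^4) / 16.
  The inversion t -> 1/t turns this into a Mellin transform, which is evaluated term by term; this is legitimate because
  Hecke's bound for f and Parseval's identity make sum |a_n| / n^3 converge.
*)
theory Submission
  imports Defs "HOL-Complex_Analysis.Complex_Analysis" "HOL-Probability.Distributions"
    "HOL-Probability.Sinc_Integral" "HOL-Real_Asymp.Real_Asymp"
begin

section \<open>Integrals of powers of a hyperbolic cosine\<close>

text \<open>Neither Poisson summation nor the Jacobi triple product enters. The quadratic theta
  identities come from regrouping lattice sums; they say that q -> q^2 is a step of the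
  arithmetic-geometric mean, and the inversion formula follows from this. The product for f rests on
  a finite identity that telescopes. The parametrisation turns I_3(0) into a Mellin transform of f
  at s = 1, outside the range where the Dirichlet series is shown to converge absolutely; this is
  why the inversion, combined with the doubling of q, is applied to reach s = 3. Even there Hecke's
  bound gives only a_n = O(n^2), hence a_n / n^3 = O(1/n), which just fails. Applied through
  Parseval it gives an estimate in mean square, and that suffices. The first entries 112 and 16 of
  the fraction are fixed by I_3(1) and I_3(0): twice the 56 in the definition of the quasiperiod,
  and the quotient of I_3(0) = 8 omega by omega / 2. Minimality removes the need for asymptotics of
  numerators and denominators: the error is 2 / (omega R), where R grows by terms that contain only
  products of two consecutive integrals.\<close>

lemma DERIV_lebesgue_integral:
  fixes f f' :: "real \<Rightarrow> 'a \<Rightarrow> real"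
  assumes "\<delta> > 0"
    and int: "\<And>s. \<bar>s - saddle\<bar> < \<delta> \<Longrightarrow> integrable M (f s)"
    and der: "\<And>s u. \<bar>s - saddle\<bar> < \<delta> \<Longrightarrow> ((\<lambda>s. f s u) has_real_derivative f' s u) (at s)"
    and bnd: "\<And>s u. \<bar>s - saddle\<bar> < \<delta> \<Longrightarrow> \<bar>f' s u\<bar> \<le> g u"
    and g: "integrable M g"
    and meas: "f' saddle \<in> borel_measurable M"
  shows "((\<lambda>s. \<integral>u. f s u \<partial>M) has_real_derivative (\<integral>u. f' saddle u \<partial>M)) (at saddle)"
  unfolding DERIV_def tendsto_at_iff_sequentially comp_def
proof (intro allI impI)
  fix X :: "nat \<Rightarrow> real"
  assume X: "\<forall>i. X i \<in> UNIV - {0}" and X0: "X \<longlonglongrightarrow> 0"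
  obtain N where N: "\<And>i. i \<ge> N \<Longrightarrow> \<bar>X i\<bar> < \<delta>"
    using X0 \<open>\<delta> > 0\<close> unfolding LIMSEQ_iff by (metis diff_zero real_norm_def)
  \<comment> \<open>Dropping the first \<open>N\<close> terms keeps all increments inside the
    neighbourhood on which \<open>g\<close> dominates; dominated convergence asks for this at every
    index.\<close>
  define h where "h i = X (i + N)" for i
  have h: "h i \<noteq> 0" "\<bar>h i\<bar> < \<delta>" for i using X N by (auto simp: h_def)
  have h0: "h \<longlonglongrightarrow> 0" unfolding h_def using X0 by (rule LIMSEQ_ignore_initial_segment)
  have int0: "integrable M (f saddle)" using int[of saddle] \<open>\<delta> > 0\<close> by simp
  have "(\<lambda>i. \<integral>u. (f (saddle + h i) u - f saddle u) / h i \<partial>M) \<longlonglongrightarrow> (\<integral>u. f' saddle u \<partial>M)"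
  proof (rule integral_dominated_convergence[where w = g])
    show "(\<lambda>u. (f (saddle + h i) u - f saddle u) / h i) \<in> borel_measurable M" for i
      using int[of "saddle + h i"] int0 h[of i] by auto
    show "AE u in M. (\<lambda>i. (f (saddle + h i) u - f saddle u) / h i) \<longlonglongrightarrow> f' saddle u"
    proof (intro always_eventually allI)
      fix u
      have "((\<lambda>s. f s u) has_real_derivative f' saddle u) (at saddle)" using der \<open>\<delta> > 0\<close> by simp
      then show "(\<lambda>i. (f (saddle + h i) u - f saddle u) / h i) \<longlonglongrightarrow> f' saddle u"
        unfolding DERIV_def tendsto_at_iff_sequentially comp_def using h h0 by auto
    qed
    show "AE u in M. norm ((f (saddle + h i) u - f saddle u) / h i) \<le> g u" for i
    proof (intro always_eventually allI)
      fix u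
      have "\<bar>f (saddle + h i) u - f saddle u\<bar> \<le> g u * \<bar>(saddle + h i) - saddle\<bar>"
      proof (rule field_differentiable_bound[where S = "{x. \<bar>x - saddle\<bar> < \<delta>}" and f' = "\<lambda>s. f' s u", simplified real_norm_def])
        show "convex {x. \<bar>x - saddle\<bar> < \<delta>}"
        proof -
          have "{x. \<bar>x - saddle\<bar> < \<delta>} = ball saddle \<delta>" by (auto simp: dist_real_def)
          then show ?thesis by simp
        qed
        show "((\<lambda>s. f s u) has_real_derivative f' s u) (at s within {x. \<bar>x - saddle\<bar> < \<delta>})"
          if "s \<in> {x. \<bar>x - saddle\<bar> < \<delta>}" for s using der[of s] that by (auto intro: has_field_derivative_at_within)
      qed (use bnd h \<open>\<delta> > 0\<close> in auto)
      then show "norm ((f (saddle + h i) u - f saddle u) / h i) \<le> g u"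
        using h(1)[of i] by (simp add: field_simps)
    qed
  qed (use g meas in auto)
  moreover have "(\<integral>u. (f (saddle + h i) u - f saddle u) / h i \<partial>M) = ((\<integral>u. f (saddle + h i) u \<partial>M) - (\<integral>u. f saddle u \<partial>M)) / h i" for i
    using int[of "saddle + h i"] int0 h[of i] by (simp add: Bochner_Integration.integral_diff)
  ultimately have "(\<lambda>i. ((\<integral>u. f (saddle + h i) u \<partial>M) - (\<integral>u. f saddle u \<partial>M)) / h i) \<longlonglongrightarrow> (\<integral>u. f' saddle u \<partial>M)"
    by (simp only:)
  then show "(\<lambda>i. ((\<integral>u. f (saddle + X i) u \<partial>M) - (\<integral>u. f saddle u \<partial>M)) / X i) \<longlonglongrightarrow> (\<integral>u. f' saddle u \<partial>M)"
    unfolding h_def by (rule LIMSEQ_offset)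
qed

lemma integrable_exp_neg_abs:
  assumes "c > 0"
  shows "integrable lborel (\<lambda>u::real. exp (- (c * \<bar>u\<bar>)))"
proof -
  have *: "(\<integral>\<^sup>+u. ennreal (exp (- (c * u))) * indicator {0..} u \<partial>lborel) = ennreal (0 - (- (1/c) * exp (- (c * 0))))"
  proof (rule nn_integral_FTC_atLeast)
    show "DERIV (\<lambda>u. - (1/c) * exp (- (c * u))) u :> exp (- (c * u))" for u
      using assms by (auto intro!: derivative_eq_intros)
    show "((\<lambda>u. - (1/c) * exp (- (c * u))) \<longlongrightarrow> 0) at_top"
      using assms by real_asymp
  qed (use assms in auto)
  have "(\<integral>\<^sup>+u. ennreal (norm (exp (- (c * u)) * indicator {0..} u :: real)) \<partial>lborel) < \<infinity>"
    using * by (simp add: ennreal_mult'' ennreal_indicator abs_mult)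
  then have i1: "integrable lborel (\<lambda>u::real. exp (- (c * u)) * indicator {0..} u)"
    by (intro integrableI_bounded) auto
  have i2: "integrable lborel (\<lambda>u::real. exp (- (c * (-u))) * indicator {0..} (-u))"
    using lborel_integrable_real_affine[OF i1, of "-1" 0] by simp
  show ?thesis
    by (rule Bochner_Integration.integrable_bound[OF Bochner_Integration.integrable_add[OF i1 i2]])
      (auto split: split_indicator)
qed

text \<open>It equals \<open>(1 + s * exp u) * (1 + s * exp (- u))\<close>. With this factorisation
  the integral below is a hypergeometric function of Euler type in \<open>1 - s\<^sup>2\<close>, and
  for n = 0 a complete elliptic integral.\<close>

definition cosh_quadratic :: "real \<Rightarrow> real \<Rightarrow> real" where
  "cosh_quadratic s u = 1 + s\<^sup>2 + 2 * s * cosh u"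

definition cosh_integral :: "nat \<Rightarrow> real \<Rightarrow> real" where
  "cosh_integral n s = (LINT u|lborel. cosh_quadratic s u powr (- (real n + 1/2)))"

lemma cosh_quadratic_ge: assumes "s > 0" shows "cosh_quadratic s u \<ge> 1" "cosh_quadratic s u \<ge> s * exp \<bar>u\<bar>" "cosh_quadratic s u > 0" "cosh_quadratic s u \<ge> s\<^sup>2"
    "cosh_quadratic s u \<ge> 2 * s * cosh u"
proof -
  have "0 \<le> s\<^sup>2" "0 < 2 * s * cosh u" using assms by auto
  then show "cosh_quadratic s u \<ge> 1" "cosh_quadratic s u > 0" "cosh_quadratic s u \<ge> s\<^sup>2" "cosh_quadratic s u \<ge> 2 * s * cosh u"
    unfolding cosh_quadratic_def by linarith+
  have "exp \<bar>u\<bar> \<le> 2 * cosh u" by (cases "u \<ge> 0") (auto simp: cosh_def)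
  then have "s * exp \<bar>u\<bar> \<le> s * (2 * cosh u)" using assms by (intro mult_left_mono) auto
  moreover have "s * (2 * cosh u) = 2 * s * cosh u" by simp
  ultimately show "cosh_quadratic s u \<ge> s * exp \<bar>u\<bar>" unfolding cosh_quadratic_def using \<open>0 \<le> s\<^sup>2\<close> by linarith
qed

lemma borel_measurable_cosh [measurable]: "(cosh :: real \<Rightarrow> real) \<in> borel_measurable borel"
  by (intro borel_measurable_continuous_onI continuous_intros)

lemma cosh_quadratic_measurable [measurable]: "(\<lambda>u. cosh_quadratic s u) \<in> borel_measurable borel"
  unfolding cosh_quadratic_def by measurable

text \<open>The exponent 1/8 stands for any number strictly between 0 and 1/2. Being positive it
  keeps exponential decay in \<open>u\<close>; being small it lets the square of the integral grow
  at most like \<open>s powr (-1/4)\<close> at s = 0, which is integrable. It does not depend on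
  \<open>p\<close>, so the bound is uniform in n.\<close>

lemma cosh_quadratic_powr_bound:
  assumes "s > 0" "p \<ge> 1/8"
  shows "cosh_quadratic s u powr (-p) \<le> s powr (-1/8) * exp (- (1/8 * \<bar>u\<bar>))"
proof -
  have "cosh_quadratic s u powr (-p) \<le> cosh_quadratic s u powr (-1/8)"
    using cosh_quadratic_ge[OF assms(1), of u] assms(2) by (intro powr_mono) auto
  also have "\<dots> \<le> (s * exp \<bar>u\<bar>) powr (-1/8)"
    using cosh_quadratic_ge[OF assms(1), of u] assms by (intro powr_mono2') auto
  also have "\<dots> = s powr (-1/8) * exp (- (1/8 * \<bar>u\<bar>))"
    using assms by (simp add: powr_def ln_mult exp_add[symmetric] add_divide_distrib)
  finally show ?thesis .
qed

lemma cosh_quadratic_powr_integrable: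
  assumes "s > 0" "p \<ge> 1/8"
  shows "integrable lborel (\<lambda>u. cosh_quadratic s u powr (-p))"
proof (rule Bochner_Integration.integrable_bound)
  show "integrable lborel (\<lambda>u. s powr (-1/8) * exp (- (1/8 * \<bar>u\<bar>)))"
    by (intro integrable_mult_right integrable_exp_neg_abs) simp
  show "AE u in lborel. norm (cosh_quadratic s u powr - p) \<le> norm (s powr (-1/8) * exp (- (1/8 * \<bar>u\<bar>)))"
    using cosh_quadratic_powr_bound[OF assms] by (intro always_eventually allI) (simp add: abs_mult)
qed measurable

lemma cosh_integral_bound: "\<exists>C>0. \<forall>n s. s > 0 \<longrightarrow> cosh_integral n s \<le> C * s powr (-1/8)"
proof (intro exI conjI allI impI)
  let ?I = "LINT u|lborel. exp (- (1/8 * \<bar>u\<bar>)) :: real"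
  show "?I + 1 > 0"
    by (smt (verit) Bochner_Integration.integral_nonneg exp_ge_zero)
  fix n and s :: real assume s: "s > 0"
  have "cosh_integral n s \<le> (LINT u|lborel. s powr (-1/8) * exp (- (1/8 * \<bar>u\<bar>)))"
    unfolding cosh_integral_def
    by (intro integral_mono cosh_quadratic_powr_integrable integrable_mult_right integrable_exp_neg_abs cosh_quadratic_powr_bound) (use s in auto)
  also have "\<dots> = s powr (-1/8) * ?I" by simp
  also have "\<dots> \<le> s powr (-1/8) * (?I + 1)" by (intro mult_left_mono) auto
  finally show "cosh_integral n s \<le> (?I + 1) * s powr (-1/8)" by (simp add: mult.commute)
qed

lemma cosh_integral_nonneg: "cosh_integral n s \<ge> 0"
  unfolding cosh_integral_def by (intro Bochner_Integration.integral_nonneg) auto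

lemma cosh_quadratic_powr_minus1: "s > 0 \<Longrightarrow> cosh_quadratic s u powr (-p) = cosh_quadratic s u * cosh_quadratic s u powr (-p-1)"
  using cosh_quadratic_ge(3)[of s u] by (simp add: powr_diff)

text \<open>Since s (2 s + 2 cosh u) = E + s^2 - 1 for E = \<open>cosh_quadratic s u\<close>, the
  derivative of a power of E is a combination of two powers of E whose exponents differ by one. The
  point \<open>saddle\<close> is an arbitrary positive number here, as it is an arbitrary real in
  \<open>DERIV_lebesgue_integral\<close>; the constant of that name belongs to the Laplace
  method.\<close>

lemma cosh_integral_has_derivative:
  assumes saddle: "saddle > 0"
  shows "(cosh_integral n has_real_derivative (real n + 1/2) * ((1 - saddle\<^sup>2) * cosh_integral (Suc n) saddle - cosh_integral n saddle) / saddle) (at saddle)"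
proof -
  define p where "p = real n + 1/2"
  have p: "p \<ge> 1/2" by (simp add: p_def)
  let ?f' = "\<lambda>s u. -p * (2 * s + 2 * cosh u) * cosh_quadratic s u powr (-p-1)"
  \<comment> \<open>On the neighbourhood of radius saddle/2 one has s > saddle/2, which bounds both
    1/s and \<open>s powr (-1/8)\<close>; this is where the halves in the majorant come
    from.\<close>
  let ?g = "\<lambda>u. (2 / saddle) * (2 * p * ((saddle/2) powr (-1/8) * exp (- (1/8 * \<bar>u\<bar>))))"
  have gen: "X \<le> (2 / saddle) * Y" if "(saddle/2) * X \<le> Y" for X Y using that saddle by (simp add: field_simps)
  have eq: "s * ?f' s u = -p * ((cosh_quadratic s u + s\<^sup>2 - 1) * cosh_quadratic s u powr (-p-1))" for s u
    by (simp add: cosh_quadratic_def power2_eq_square algebra_simps)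
  have "((\<lambda>s. LINT u|lborel. cosh_quadratic s u powr (-p)) has_real_derivative (LINT u|lborel. ?f' saddle u)) (at saddle)"
  proof (rule DERIV_lebesgue_integral[where \<delta> = "saddle/2" and g = ?g])
    show "saddle/2 > 0" using saddle by simp
    fix s assume s: "\<bar>s - saddle\<bar> < saddle/2"
    then have s': "s > saddle/2" "s > 0" using saddle by (auto simp: abs_if split: if_splits)
    show "integrable lborel (\<lambda>u. cosh_quadratic s u powr - p)" using s' p by (intro cosh_quadratic_powr_integrable) auto
    fix u
    show "((\<lambda>s. cosh_quadratic s u powr (-p)) has_real_derivative ?f' s u) (at s)"
    proof -
      have "((\<lambda>s. cosh_quadratic s u) has_real_derivative 2 * s + 2 * cosh u) (at s)"
        unfolding cosh_quadratic_def by (auto intro!: derivative_eq_intros)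
      from DERIV_fun_powr[OF this cosh_quadratic_ge(3)[OF s'(2)], of "-p"] show ?thesis by (simp add: mult_ac)
    qed
    have "s * \<bar>?f' s u\<bar> = \<bar>s * ?f' s u\<bar>" using s' by (simp add: abs_mult)
    also have "\<dots> = p * ((cosh_quadratic s u + s\<^sup>2 - 1) * cosh_quadratic s u powr (-p-1))"
    proof -
      have "cosh_quadratic s u + s\<^sup>2 - 1 \<ge> 0" using cosh_quadratic_ge(1)[OF s'(2), of u] zero_le_power2[of s] by linarith
      then show ?thesis unfolding eq abs_mult using p by simp
    qed
    also have "\<dots> \<le> p * ((2 * cosh_quadratic s u) * cosh_quadratic s u powr (-p-1))"
      using cosh_quadratic_ge[OF s'(2), of u] p by (intro mult_left_mono mult_right_mono) auto
    also have "\<dots> = 2 * p * cosh_quadratic s u powr (-p)" using cosh_quadratic_powr_minus1[OF s'(2)] by simp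
    also have "\<dots> \<le> 2 * p * (s powr (-1/8) * exp (- (1/8 * \<bar>u\<bar>)))"
      using cosh_quadratic_powr_bound[OF s'(2), of p u] p by (intro mult_left_mono) auto
    also have "\<dots> \<le> 2 * p * ((saddle/2) powr (-1/8) * exp (- (1/8 * \<bar>u\<bar>)))"
      using s' saddle p by (intro mult_left_mono mult_right_mono powr_mono2') auto
    finally have 1: "s * \<bar>?f' s u\<bar> \<le> 2 * p * ((saddle/2) powr (-1/8) * exp (- (1/8 * \<bar>u\<bar>)))" .
    have "(saddle/2) * \<bar>?f' s u\<bar> \<le> s * \<bar>?f' s u\<bar>" using s' by (intro mult_right_mono) auto
    also note 1
    finally show "\<bar>?f' s u\<bar> \<le> ?g u" by (rule gen)
  next
    show "integrable lborel ?g"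
      by (intro integrable_mult_right integrable_exp_neg_abs) simp
    show "?f' saddle \<in> borel_measurable lborel" by measurable
  qed
  moreover have "(LINT u|lborel. ?f' saddle u) = p * ((1 - saddle\<^sup>2) * cosh_integral (Suc n) saddle - cosh_integral n saddle) / saddle"
  proof -
    have "?f' saddle u = (p / saddle) * ((1 - saddle\<^sup>2) * cosh_quadratic saddle u powr (-(real (Suc n) + 1/2)) - cosh_quadratic saddle u powr (-(real n + 1/2)))" for u
    proof -
      have a: "-(real (Suc n) + 1/2) = -p-1" "-(real n + 1/2) = -p" by (auto simp: p_def)
      have "saddle * ?f' saddle u = saddle * ((p / saddle) * ((1 - saddle\<^sup>2) * cosh_quadratic saddle u powr (-p-1) - cosh_quadratic saddle u powr (-p)))"
      proof -
        have "saddle * ((p / saddle) * (y * a - e * a)) = - p * ((e - y) * a)" for y a e using saddle by (simp add: algebra_simps)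
        from this[of "1 - saddle\<^sup>2" "cosh_quadratic saddle u powr (-p-1)" "cosh_quadratic saddle u"] show ?thesis
          unfolding eq cosh_quadratic_powr_minus1[OF saddle, of u p] by (simp add: algebra_simps)
      qed
      then show ?thesis unfolding a by (rule mult_left_cancel[THEN iffD1, rotated]) (use saddle in simp)
    qed
    then have "(LINT u|lborel. ?f' saddle u) = (LINT u|lborel. (p / saddle) * ((1 - saddle\<^sup>2) * cosh_quadratic saddle u powr (-(real (Suc n) + 1/2)) - cosh_quadratic saddle u powr (-(real n + 1/2))))"
      by (simp only:)
    also have "\<dots> = (p / saddle) * ((1 - saddle\<^sup>2) * cosh_integral (Suc n) saddle - cosh_integral n saddle)"
    proof -
      have i: "integrable lborel (\<lambda>u. cosh_quadratic saddle u powr (-(real k + 1/2)))" for k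
        using saddle by (intro cosh_quadratic_powr_integrable) auto
      show ?thesis unfolding cosh_integral_def
        by (simp only: Bochner_Integration.integral_diff integral_mult_right_zero integrable_mult_right i)
    qed
    finally show ?thesis by simp
  qed
  ultimately show ?thesis unfolding cosh_integral_def[abs_def] p_def by simp
qed

text \<open>The corresponding combination of integrands is 2 s times the derivative of
  \<open>sinh u * cosh_quadratic s u powr (-p-1)\<close>, which vanishes at both ends of the line.
  The square of 1 - s^2 comes from 4 s^2 sinh^2 u = (E - 1 - s^2)^2 - 4 s^2, where E =
  \<open>cosh_quadratic s u\<close>.\<close>

lemma cosh_integral_three_term:
  assumes s: "s > 0"
  shows "(real n + 3/2) * (1 - s\<^sup>2)\<^sup>2 * cosh_integral (Suc (Suc n)) s
       = 2 * (real n + 1) * (1 + s\<^sup>2) * cosh_integral (Suc n) s - (real n + 1/2) * cosh_integral n s"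
proof -
  define p where "p = real n + 1/2"
  let ?F = "\<lambda>u. sinh u * cosh_quadratic s u powr (-p-1)"
  let ?h = "\<lambda>u. - p * cosh_quadratic s u powr (-(real n + 1/2)) + 2 * (real n + 1) * (1 + s\<^sup>2) * cosh_quadratic s u powr (-(real (Suc n) + 1/2))
      - (p+1) * (1 - s\<^sup>2)\<^sup>2 * cosh_quadratic s u powr (-(real (Suc (Suc n)) + 1/2))"
  have a: "-(real n + 1/2) = -p" "-(real (Suc n) + 1/2) = -p-1" "-(real (Suc (Suc n)) + 1/2) = -p-2" "real n = p - 1/2"
    by (auto simp: p_def)
  have e: "cosh_quadratic s u powr (-p) = (cosh_quadratic s u)\<^sup>2 * cosh_quadratic s u powr (-p-2)" "cosh_quadratic s u powr (-p-1) = cosh_quadratic s u * cosh_quadratic s u powr (-p-2)" for u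
    using cosh_quadratic_ge(3)[OF s, of u] by (auto simp: powr_diff power2_eq_square)
  have deriv: "(?F has_real_derivative ?h u / (2 * s)) (at u)" for u
  proof -
    have "(?F has_real_derivative (cosh u * cosh_quadratic s u powr (-p-1) + sinh u * ((-p-1) * cosh_quadratic s u powr (-p-2) * (2 * s * sinh u)))) (at u)"
      using cosh_quadratic_ge(3)[OF s, of u] unfolding cosh_quadratic_def
      by (auto intro!: derivative_eq_intros simp: diff_diff_eq add.commute)
    moreover have "cosh u * cosh_quadratic s u powr (-p-1) + sinh u * ((-p-1) * cosh_quadratic s u powr (-p-2) * (2 * s * sinh u)) = ?h u / (2 * s)"
    proof -
      have sh: "(sinh u)\<^sup>2 = (cosh u)\<^sup>2 - 1" using cosh_square_eq[of u] by simp
      have "2 * s * (cosh u * (cosh_quadratic s u * x) + sinh u * ((-p-1) * x * (2 * s * sinh u))) =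
         - p * ((cosh_quadratic s u)\<^sup>2 * x) + 2 * (p - 1/2 + 1) * (1 + s\<^sup>2) * (cosh_quadratic s u * x) - (p+1) * (1 - s\<^sup>2)\<^sup>2 * x" for x
      proof -
        have "2 * s * (cosh u * (cosh_quadratic s u * x) + sinh u * ((-p-1) * x * (2 * s * sinh u))) =
           2 * s * (cosh u * (cosh_quadratic s u * x)) + (-p-1) * x * (4 * s\<^sup>2 * (sinh u)\<^sup>2)"
          by (simp add: power2_eq_square algebra_simps)
        also have "\<dots> = - p * ((cosh_quadratic s u)\<^sup>2 * x) + 2 * (p - 1/2 + 1) * (1 + s\<^sup>2) * (cosh_quadratic s u * x) - (p+1) * (1 - s\<^sup>2)\<^sup>2 * x"
          unfolding sh cosh_quadratic_def by algebra
        finally show ?thesis .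
      qed
      from this[of "cosh_quadratic s u powr (-p-2)"]
      have "2 * s * (cosh u * cosh_quadratic s u powr (-p-1) + sinh u * ((-p-1) * cosh_quadratic s u powr (-p-2) * (2 * s * sinh u))) = ?h u"
        unfolding e(1)[of u, symmetric] e(2)[of u, symmetric] a by simp
      moreover have "2 * s \<noteq> 0" using s by simp
      ultimately show ?thesis by (metis nonzero_mult_div_cancel_left)
    qed
    ultimately show ?thesis by simp
  qed
  have int: "integrable lborel ?h"
    by (intro Bochner_Integration.integrable_add Bochner_Integration.integrable_diff integrable_mult_right cosh_quadratic_powr_integrable) (use s in auto)
  have bnd: "\<bar>?F u\<bar> \<le> 1 / (2 * s) * (s powr (-1/8) * exp (- (1/8 * \<bar>u\<bar>)))" for u
  proof -
    have "\<bar>sinh u\<bar> \<le> cosh u"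
      using cosh_square_eq[of u] abs_le_square_iff[of "sinh u" "cosh u"] by simp
    also have "cosh u \<le> cosh_quadratic s u / (2 * s)" using cosh_quadratic_ge(5)[OF s, of u] s by (simp add: field_simps)
    finally have "\<bar>?F u\<bar> \<le> cosh_quadratic s u / (2 * s) * cosh_quadratic s u powr (-p-1)"
      unfolding abs_mult abs_of_nonneg[OF powr_ge_zero] by (rule mult_right_mono) simp
    also have "\<dots> = 1 / (2 * s) * cosh_quadratic s u powr (-p)" unfolding e by (simp add: power2_eq_square)
    also have "\<dots> \<le> 1 / (2 * s) * (s powr (-1/8) * exp (- (1/8 * \<bar>u\<bar>)))"
      using s by (intro mult_left_mono cosh_quadratic_powr_bound) (auto simp: p_def)
    finally show ?thesis .
  qed
  have lim: "(?F \<longlongrightarrow> 0) at_top" "(?F \<longlongrightarrow> 0) at_bot"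
  proof -
    have "((\<lambda>u. 1 / (2 * s) * (s powr (-1/8) * exp (- (1/8 * \<bar>u\<bar>)))) \<longlongrightarrow> 1 / (2 * s) * (s powr (-1/8) * 0)) at_top"
      by (intro tendsto_intros) real_asymp
    then show "(?F \<longlongrightarrow> 0) at_top"
      using bnd by (intro Lim_null_comparison[of ?F]) (auto intro!: always_eventually)
    have "((\<lambda>u. 1 / (2 * s) * (s powr (-1/8) * exp (- (1/8 * \<bar>u\<bar>)))) \<longlongrightarrow> 1 / (2 * s) * (s powr (-1/8) * 0)) at_bot"
      by (intro tendsto_intros) real_asymp
    then show "(?F \<longlongrightarrow> 0) at_bot"
      using bnd by (intro Lim_null_comparison[of ?F]) (auto intro!: always_eventually)
  qed
  have "(LBINT u=-\<infinity>..\<infinity>. ?h u / (2 * s)) = 0 - 0"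
  proof (rule interval_integral_FTC_integrable[where F = ?F])
    show "(?F has_vector_derivative ?h u / (2 * s)) (at u)" for u
      using deriv by (simp add: has_real_derivative_iff_has_vector_derivative)
    show "isCont (\<lambda>u. ?h u / (2 * s)) u" for u
      using cosh_quadratic_ge(3)[OF s, of u] s unfolding cosh_quadratic_def by (auto intro!: continuous_intros)
    show "set_integrable lborel (einterval (-\<infinity>) \<infinity>) (\<lambda>u. ?h u / (2 * s))"
      using int by (simp add: set_integrable_def)
    show "((?F \<circ> real_of_ereal) \<longlongrightarrow> 0) (at_right (-\<infinity>))" "((?F \<circ> real_of_ereal) \<longlongrightarrow> 0) (at_left \<infinity>)"
      using lim by (simp_all add: ereal_tendsto_simps)
  qed simp
  then have "(LINT u|lborel. ?h u) = 0" using s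
    by (simp add: interval_lebesgue_integral_def set_lebesgue_integral_def)
  moreover have "(LINT u|lborel. ?h u) = - p * cosh_integral n s + 2 * (real n + 1) * (1 + s\<^sup>2) * cosh_integral (Suc n) s - (p+1) * (1 - s\<^sup>2)\<^sup>2 * cosh_integral (Suc (Suc n)) s"
    unfolding cosh_integral_def
  proof -
    have i: "integrable lborel (\<lambda>u. cosh_quadratic s u powr (-(real k + 1/2)))" for k
      using s by (intro cosh_quadratic_powr_integrable) auto
    show "(LINT u|lborel. ?h u) = - p * (LINT u|lborel. cosh_quadratic s u powr (-(real n + 1/2)))
        + 2 * (real n + 1) * (1 + s\<^sup>2) * (LINT u|lborel. cosh_quadratic s u powr (-(real (Suc n) + 1/2)))
        - (p+1) * (1 - s\<^sup>2)\<^sup>2 * (LINT u|lborel. cosh_quadratic s u powr (-(real (Suc (Suc n)) + 1/2)))"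
      by (simp only: Bochner_Integration.integral_diff Bochner_Integration.integral_add integral_mult_right_zero
          Bochner_Integration.integrable_add integrable_mult_right i)
  qed
  ultimately show ?thesis unfolding p_def by (simp add: field_simps)
qed

section \<open>The weighted integral of squares and its recurrence\<close>

definition reduced_integral :: "nat \<Rightarrow> real" where
  "reduced_integral n = (LINT s:{0<..<1}|lborel. 2 * (s * (1 - s\<^sup>2)) ^ (2 * n) * (cosh_integral n s)\<^sup>2)"

lemma cosh_integral_continuous_on: "continuous_on {0<..} (cosh_integral n)"
  using cosh_integral_has_derivative by (intro DERIV_continuous_on) (auto intro: has_field_derivative_at_within)

lemma powr_neg_quarter_integrable: "set_integrable lborel {0<..<1::real} (\<lambda>s. s powr (-1/4))"
proof -
  have "set_integrable lborel (einterval 0 1) (\<lambda>s::real. s powr (-1/4))"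
  proof (rule interval_integral_FTC_nonneg)
    show "DERIV (\<lambda>s. 4/3 * s powr (3/4)) s :> s powr (-1/4)" if "0 < ereal s" for s
      using that by (auto intro!: derivative_eq_intros)
    show "(((\<lambda>s. 4/3 * s powr (3/4)) \<circ> real_of_ereal) \<longlongrightarrow> 0) (at_right 0)"
      unfolding zero_ereal_def ereal_tendsto_simps by real_asymp
    show "(((\<lambda>s. 4/3 * s powr (3/4)) \<circ> real_of_ereal) \<longlongrightarrow> 4/3) (at_left 1)"
      unfolding one_ereal_def ereal_tendsto_simps by real_asymp
  qed (auto intro!: continuous_intros)
  then show ?thesis by (simp add: zero_ereal_def one_ereal_def)
qed

lemma reduced_integral_integrable: "set_integrable lborel {0<..<1} (\<lambda>s. 2 * (s * (1 - s\<^sup>2)) ^ (2 * n) * (cosh_integral n s)\<^sup>2)"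
proof -
  obtain C where C: "C > 0" "\<And>n s. s > 0 \<Longrightarrow> cosh_integral n s \<le> C * s powr (-1/8)" using cosh_integral_bound by blast
  show ?thesis
  proof (rule set_integrable_bound)
    show "set_integrable lborel {0<..<1} (\<lambda>s. 2 * C\<^sup>2 * s powr (-1/4))"
      by (intro set_integrable_mult_right powr_neg_quarter_integrable)
    have "continuous_on {0<..<1} (\<lambda>s. 2 * (s * (1 - s\<^sup>2)) ^ (2 * n) * (cosh_integral n s)\<^sup>2)"
      by (intro continuous_intros continuous_on_subset[OF cosh_integral_continuous_on]) auto
    then show "set_borel_measurable lborel {0<..<1} (\<lambda>s. 2 * (s * (1 - s\<^sup>2)) ^ (2 * n) * (cosh_integral n s)\<^sup>2)"
      unfolding set_borel_measurable_def measurable_lborel2 by (rule borel_measurable_continuous_on_indicator[rotated]) simp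
    show "AE s in lborel. s \<in> {0<..<1} \<longrightarrow> norm (2 * (s * (1 - s\<^sup>2)) ^ (2 * n) * (cosh_integral n s)\<^sup>2) \<le> norm (2 * C\<^sup>2 * s powr (-1/4))"
    proof (intro always_eventually allI impI)
      fix s :: real assume "s \<in> {0<..<1}"
      then have s: "0 < s" "s < 1" by auto
      have "s\<^sup>2 \<le> 1" using s by (simp add: abs_square_le_1)
      then have y: "0 \<le> 1 - s\<^sup>2" "1 - s\<^sup>2 \<le> 1" by auto
      have "0 \<le> s * (1 - s\<^sup>2)" "s * (1 - s\<^sup>2) \<le> 1" using s y by (auto simp: mult_le_one)
      then have 1: "0 \<le> (s * (1 - s\<^sup>2)) ^ (2 * n)" "(s * (1 - s\<^sup>2)) ^ (2 * n) \<le> 1" by (auto simp: power_le_one)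
      have "(cosh_integral n s)\<^sup>2 \<le> (C * s powr (-1/8))\<^sup>2" using C s cosh_integral_nonneg by (intro power_mono) auto
      also have "\<dots> = C\<^sup>2 * s powr (-1/4)" using s by (simp add: power_mult_distrib power2_eq_square powr_add[symmetric])
      finally have 2: "(cosh_integral n s)\<^sup>2 \<le> C\<^sup>2 * s powr (-1/4)" .
      have "(s * (1 - s\<^sup>2)) ^ (2 * n) * (cosh_integral n s)\<^sup>2 \<le> 1 * (C\<^sup>2 * s powr (-1/4))"
        using 1 2 by (intro mult_mono) auto
      then show "norm (2 * (s * (1 - s\<^sup>2)) ^ (2 * n) * (cosh_integral n s)\<^sup>2) \<le> norm (2 * C\<^sup>2 * s powr (-1/4))"
        using 1 by (simp add: abs_mult)
    qed
  qed
qed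

text \<open>Creative telescoping: the recurrence holds for the integrands up to the derivative of a
  quadratic form in two consecutive functions \<open>cosh_integral\<close>; its polynomial coefficients were found by
  solving a linear system. The primed polynomials satisfy \<open>d/ds (s A(s\<^sup>2)) = A'(s\<^sup>2)\<close>.\<close>

definition teleA :: "real \<Rightarrow> real \<Rightarrow> real" where
  "teleA N x = (2*N+1)\<^sup>2 - 4 * (32 * (N+1)\<^sup>2 + 2 * (N+1) + 1) * x + 2 * (180 * (N+1)\<^sup>2 + 8 * (N+1) + 3) * x ^ 2
        - 4 * (72 * (N+1)\<^sup>2 - 2 * (N+1) + 1) * x ^ 3 + (52 * (N+1)\<^sup>2 - 12 * (N+1) + 1) * x ^ 4"

definition teleB :: "real \<Rightarrow> real \<Rightarrow> real" where
  "teleB N x = 4 * (2*N+1) * (- (2 * N + 1) - (8 * N + 9) * x + (18 * N + 17) * x ^ 2 - (8 * N + 7) * x ^ 3)"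

definition teleG :: "real \<Rightarrow> real \<Rightarrow> real" where
  "teleG N x = 5 * (2*N+1)\<^sup>2 * (1 - x)\<^sup>2"

definition teleA' :: "real \<Rightarrow> real \<Rightarrow> real" where
  "teleA' N x = (2*N+1)\<^sup>2 - 12 * (32 * (N+1)\<^sup>2 + 2 * (N+1) + 1) * x + 10 * (180 * (N+1)\<^sup>2 + 8 * (N+1) + 3) * x ^ 2
        - 28 * (72 * (N+1)\<^sup>2 - 2 * (N+1) + 1) * x ^ 3 + 9 * (52 * (N+1)\<^sup>2 - 12 * (N+1) + 1) * x ^ 4"

definition teleB' :: "real \<Rightarrow> real \<Rightarrow> real" where
  "teleB' N x = 4 * (2*N+1) * (- (2 * N + 1) - 3 * (8 * N + 9) * x + 5 * (18 * N + 17) * x ^ 2 - 7 * (8 * N + 7) * x ^ 3)"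

definition teleG' :: "real \<Rightarrow> real \<Rightarrow> real" where
  "teleG' N x = 5 * (2*N+1)\<^sup>2 * (1 - 6 * x + 5 * x ^ 2)"

definition tele :: "nat \<Rightarrow> real \<Rightarrow> real" where
  "tele n s = (s * (1 - s\<^sup>2)) ^ (2 * n) * (s * teleA (real n) (s\<^sup>2) * (cosh_integral (Suc n) s)\<^sup>2
     + s * teleB (real n) (s\<^sup>2) * (cosh_integral (Suc n) s * cosh_integral n s) + s * teleG (real n) (s\<^sup>2) * (cosh_integral n s)\<^sup>2)"

lemma DERIV_times_poly_square:
  fixes s :: real
  shows "((\<lambda>s. s * (c0 + c1 * s\<^sup>2 + c2 * (s\<^sup>2)\<^sup>2 + c3 * (s\<^sup>2) ^ 3 + c4 * (s\<^sup>2) ^ 4)) has_real_derivative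
    (c0 + 3 * c1 * s\<^sup>2 + 5 * c2 * (s\<^sup>2)\<^sup>2 + 7 * c3 * (s\<^sup>2) ^ 3 + 9 * c4 * (s\<^sup>2) ^ 4)) (at s)"
  by (rule derivative_eq_intros refl)+ (simp add: eval_nat_numeral algebra_simps)

lemma tele_coeff_derivs:
  "((\<lambda>s. s * teleA N (s\<^sup>2)) has_real_derivative teleA' N (s\<^sup>2)) (at s)"
  "((\<lambda>s. s * teleB N (s\<^sup>2)) has_real_derivative teleB' N (s\<^sup>2)) (at s)"
  "((\<lambda>s. s * teleG N (s\<^sup>2)) has_real_derivative teleG' N (s\<^sup>2)) (at s)"
proof -
  define c1 c2 c3 c4 where "c1 = - 4 * (32 * (N+1)\<^sup>2 + 2 * (N+1) + 1)" and "c2 = 2 * (180 * (N+1)\<^sup>2 + 8 * (N+1) + 3)"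
    and "c3 = - 4 * (72 * (N+1)\<^sup>2 - 2 * (N+1) + 1)" and "c4 = 52 * (N+1)\<^sup>2 - 12 * (N+1) + 1"
  have "teleA N x = (2*N+1)\<^sup>2 + c1 * x + c2 * x\<^sup>2 + c3 * x ^ 3 + c4 * x ^ 4"
    "teleA' N x = (2*N+1)\<^sup>2 + 3 * c1 * x + 5 * c2 * x\<^sup>2 + 7 * c3 * x ^ 3 + 9 * c4 * x ^ 4" for x
    by (simp_all add: teleA_def teleA'_def c1_def c2_def c3_def c4_def algebra_simps)
  then show "((\<lambda>s. s * teleA N (s\<^sup>2)) has_real_derivative teleA' N (s\<^sup>2)) (at s)"
    using DERIV_times_poly_square by simp
  define d d0 d1 d2 d3 where "d = 4 * (2*N+1)" and "d0 = - (2 * N + 1)" and "d1 = - (8 * N + 9)" and "d2 = 18 * N + 17" and "d3 = - (8 * N + 7)"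
  have "teleB N x = d * d0 + d * d1 * x + d * d2 * x\<^sup>2 + d * d3 * x ^ 3 + 0 * x ^ 4"
    "teleB' N x = d * d0 + 3 * (d * d1) * x + 5 * (d * d2) * x\<^sup>2 + 7 * (d * d3) * x ^ 3 + 9 * 0 * x ^ 4" for x
    unfolding teleB_def teleB'_def d_def[symmetric] d0_def d1_def d2_def d3_def by algebra+
  then show "((\<lambda>s. s * teleB N (s\<^sup>2)) has_real_derivative teleB' N (s\<^sup>2)) (at s)"
    using DERIV_times_poly_square[of "d * d0" "d * d1" "d * d2" "d * d3" 0] by simp
  define g where "g = 5 * (2*N+1)\<^sup>2"
  have "teleG N x = g + (- 2 * g) * x + g * x\<^sup>2 + 0 * x ^ 3 + 0 * x ^ 4"
    "teleG' N x = g + 3 * (- 2 * g) * x + 5 * g * x\<^sup>2 + 7 * 0 * x ^ 3 + 9 * 0 * x ^ 4" for x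
    unfolding teleG_def teleG'_def g_def[symmetric] by algebra+
  then show "((\<lambda>s. s * teleG N (s\<^sup>2)) has_real_derivative teleG' N (s\<^sup>2)) (at s)"
    using DERIV_times_poly_square[of g "- 2 * g" g 0 0] by simp
qed

text \<open>These are the coefficients of K1^2, K1 K0 and K0^2 in the telescoping identity at x =
  s^2, after multiplication by 2 (1 - x) and elimination of the derivatives and of K2. The first two
  are verified by comparing powers of x, which leaves identities in \<open>N\<close> alone.\<close>

lemma tele_coeffs:
  fixes x N :: real
  defines "A \<equiv> teleA N x" and "B \<equiv> teleB N x" and "G \<equiv> teleG N x"
    and "A' \<equiv> teleA' N x" and "B' \<equiv> teleB' N x" and "G' \<equiv> teleG' N x"
  assumes y: "y = 1 - x"
  shows "4 * N * (1 - 3 * x) * A + 2 * y * A' + 2 * A * (4 * (N + 1) * (1 + x) - y * (2*N + 3)) + B * (2*N + 1) * y\<^sup>2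
      = y * (16 * (2*N + 3) * x ^ 2 * (2 * (N + 1) * (1 + x))\<^sup>2 - 16 * (N + 1) * (68 * (N + 1)\<^sup>2 + 3) * x * y\<^sup>2)" (is ?one)
   and "4 * N * (1 - 3 * x) * B + 2 * y * B' - 2 * A * (2*N + 1) + B * (4 * (N + 1) * (1 + x) - y * (2*N + 3))
        - B * y * (2*N + 1) + 2 * G * (2*N + 1) * y\<^sup>2
      = y * (- 16 * ((2*N + 3) * x\<^sup>2 * (2 * (N + 1) * (1 + x)) * (2*N + 1)))" (is ?two)
   and "4 * N * (1 - 3 * x) * G + 2 * y * G' - B * (2*N + 1) - 2 * G * y * (2*N + 1)
      = y * (4 * (2*N + 3) * x\<^sup>2 * (2*N + 1)\<^sup>2 + 4 * (2*N + 1) ^ 3)" (is ?three)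
proof -
  note A = A_def[unfolded teleA_def] and B = B_def[unfolded teleB_def] and G = G_def[unfolded teleG_def]
    and A' = A'_def[unfolded teleA'_def] and B' = B'_def[unfolded teleB'_def] and G' = G'_def[unfolded teleG'_def]
  define M where "M = 2 * N + 1"
  define a0 where "a0 = (2*N+1)\<^sup>2"
  define a1 where "a1 = - 4 * (32 * (N+1)\<^sup>2 + 2 * (N+1) + 1)"
  define a2 where "a2 = 2 * (180 * (N+1)\<^sup>2 + 8 * (N+1) + 3)"
  define a3 where "a3 = - 4 * (72 * (N+1)\<^sup>2 - 2 * (N+1) + 1)"
  define a4 where "a4 = 52 * (N+1)\<^sup>2 - 12 * (N+1) + 1"
  define b0 where "b0 = - 4 * (2*N+1) * (2 * N + 1)"
  define b1 where "b1 = - 4 * (2*N+1) * (8 * N + 9)"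
  define b2 where "b2 = 4 * (2*N+1) * (18 * N + 17)"
  define b3 where "b3 = - 4 * (2*N+1) * (8 * N + 7)"
  define g where "g = 5 * (2*N+1)\<^sup>2"
  define P where "P = 64 * (2*N + 3) * (N + 1)\<^sup>2"
  define Q where "Q = 16 * (N + 1) * (68 * (N + 1)\<^sup>2 + 3)"
  define R where "R = 32 * (2*N + 3) * (N + 1) * (2*N + 1)"
  have AB: "A = a0 + a1 * x + a2 * x\<^sup>2 + a3 * x^3 + a4 * x^4" "A' = a0 + 3 * a1 * x + 5 * a2 * x\<^sup>2 + 7 * a3 * x^3 + 9 * a4 * x^4"
    "B = b0 + b1 * x + b2 * x\<^sup>2 + b3 * x^3" "B' = b0 + 3 * b1 * x + 5 * b2 * x\<^sup>2 + 7 * b3 * x^3"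
    unfolding A A' B B' a0_def a1_def a2_def a3_def a4_def b0_def b1_def b2_def b3_def by (simp_all add: algebra_simps)
  note d = M_def a0_def a1_def a2_def a3_def a4_def b0_def b1_def b2_def b3_def g_def P_def Q_def R_def
  \<comment> \<open>One equation for each power of x from 0 to 5 in the first identity; the
    expansion that follows puts them together.\<close>
  have "(8*N+4) * a0 + M * b0 = 0" 
    "(8*N+8) * a1 + 12 * a0 + M * (b1 - 2 * b0) = - Q"
    "(8*N+12) * a2 + 8 * a1 + M * (b2 - 2 * b1 + b0) = P + 3 * Q"
    "(8*N+16) * a3 + 4 * a2 + M * (b3 - 2 * b2 + b1) = P - 3 * Q"
    "(8*N+20) * a4 + M * (- 2 * b3 + b2) = - P + Q"
    "- 4 * a4 + M * b3 = - P"
    unfolding d by algebra+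
  moreover have "4 * N * (1 - 3 * x) * A + 2 * y * A' + 2 * A * (4 * (N + 1) * (1 + x) - y * (2*N + 3)) + B * M * y\<^sup>2
     = ((8*N+4) * a0 + M * b0) + ((8*N+8) * a1 + 12 * a0 + M * (b1 - 2 * b0)) * x 
      + ((8*N+12) * a2 + 8 * a1 + M * (b2 - 2 * b1 + b0)) * x\<^sup>2 + ((8*N+16) * a3 + 4 * a2 + M * (b3 - 2 * b2 + b1)) * x^3
      + ((8*N+20) * a4 + M * (- 2 * b3 + b2)) * x^4 + (- 4 * a4 + M * b3) * x^5"
    unfolding AB y by algebra
  ultimately have "4 * N * (1 - 3 * x) * A + 2 * y * A' + 2 * A * (4 * (N + 1) * (1 + x) - y * (2*N + 3)) + B * M * y\<^sup>2
     = 0 + - Q * x + (P + 3 * Q) * x\<^sup>2 + (P - 3 * Q) * x^3 + (- P + Q) * x^4 + (- P) * x^5"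
    by (simp only:)
  also have "\<dots> = y * (P * x\<^sup>2 * (1 + x)\<^sup>2 - Q * x * y\<^sup>2)" unfolding y by algebra
  finally show ?one unfolding P_def Q_def M_def by algebra
  have "(4*N+2) * b0 - 2 * M * a0 + 2 * g * M = 0"
    "(4*N+6) * b1 + (6 - 4*N) * b0 - 2 * M * a1 - 8 * g * M = 0"
    "(4*N+10) * b2 + (2 - 4*N) * b1 - 2 * M * a2 + 12 * g * M = - R"
    "(4*N+14) * b3 + (- 2 - 4*N) * b2 - 2 * M * a3 - 8 * g * M = 0"
    "(- 6 - 4*N) * b3 - 2 * M * a4 + 2 * g * M = R"
    unfolding d by algebra+
  moreover have "4 * N * (1 - 3 * x) * B + 2 * y * B' - 2 * A * M + B * (4 * (N + 1) * (1 + x) - y * (2*N + 3))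
        - B * y * (2*N + 1) + 2 * (g * y\<^sup>2) * M * y\<^sup>2
     = ((4*N+2) * b0 - 2 * M * a0 + 2 * g * M) + ((4*N+6) * b1 + (6 - 4*N) * b0 - 2 * M * a1 - 8 * g * M) * x
      + ((4*N+10) * b2 + (2 - 4*N) * b1 - 2 * M * a2 + 12 * g * M) * x\<^sup>2 + ((4*N+14) * b3 + (- 2 - 4*N) * b2 - 2 * M * a3 - 8 * g * M) * x^3
      + ((- 6 - 4*N) * b3 - 2 * M * a4 + 2 * g * M) * x^4"
    unfolding AB y by algebra
  ultimately have "4 * N * (1 - 3 * x) * B + 2 * y * B' - 2 * A * M + B * (4 * (N + 1) * (1 + x) - y * (2*N + 3))
        - B * y * (2*N + 1) + 2 * (g * y\<^sup>2) * M * y\<^sup>2 = 0 + 0 * x + (- R) * x\<^sup>2 + 0 * x^3 + R * x^4"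
    by (simp only:)
  also have "\<dots> = y * (- (R * x\<^sup>2 * (1 + x)))" unfolding y by algebra
  finally show ?two unfolding G y[symmetric] M_def R_def g_def by (simp add: algebra_simps)
  \<comment> \<open>What remains of the third identity once the common factor 4 (2 N + 1)^2 is taken
    out.\<close>
  have 1: "(2*N+1) + (8*N+9) * x - (18*N+17) * x\<^sup>2 + (8*N+7) * x^3 - 10 * (N+1) * x * (1-x)\<^sup>2
    = (1 - x) * ((2*N+3) * x\<^sup>2 + (2*N+1))" by algebra
  have "4 * N * (1 - 3 * x) * G + 2 * y * G' - B * (2*N + 1) - 2 * G * y * (2*N + 1)
    = 4 * (2*N+1)\<^sup>2 * ((2*N+1) + (8*N+9) * x - (18*N+17) * x\<^sup>2 + (8*N+7) * x^3 - 10 * (N+1) * x * (1-x)\<^sup>2)"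
    unfolding G G' B y by algebra
  also have "\<dots> = y * (4 * (2*N + 3) * x\<^sup>2 * (2*N + 1)\<^sup>2 + 4 * (2*N + 1) ^ 3)"
    unfolding 1 y by algebra
  finally show ?three .
qed

text \<open>The telescoping identity with the analysis stripped off: \<open>K0\<close>,
  \<open>K1\<close>, \<open>K2\<close> stand for three consecutive cosh integrals,
  \<open>D0\<close>, \<open>D1\<close> for the derivatives of the first two, and the leading
  fraction is the logarithmic derivative of the weight (s (1 - s^2))^(2 N). Eliminating
  \<open>D0\<close>, \<open>D1\<close> and \<open>K2\<close> leaves a quadratic form in
  \<open>K1\<close>, \<open>K0\<close>, compared coefficient by coefficient.\<close>

lemma tele_alg:
  fixes s N K1 K0 K2 D0 D1 :: real
  assumes s: "0 < s" "s < 1"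
    and K2: "(N + 3/2) * (1 - s\<^sup>2)\<^sup>2 * K2 = 2 * (N + 1) * (1 + s\<^sup>2) * K1 - (N + 1/2) * K0"
    and D0: "D0 = (N + 1/2) * ((1 - s\<^sup>2) * K1 - K0) / s"
    and D1: "D1 = (N + 3/2) * ((1 - s\<^sup>2) * K2 - K1) / s"
  defines "A \<equiv> teleA N (s\<^sup>2)" and "B \<equiv> teleB N (s\<^sup>2)" and "G \<equiv> teleG N (s\<^sup>2)"
    and "A' \<equiv> teleA' N (s\<^sup>2)" and "B' \<equiv> teleB' N (s\<^sup>2)" and "G' \<equiv> teleG' N (s\<^sup>2)"
  shows "2 * N * (1 - 3 * s\<^sup>2) / (s * (1 - s\<^sup>2)) * (s * A * K1\<^sup>2 + s * B * (K1 * K0) + s * G * K0\<^sup>2)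
      + (A' * K1\<^sup>2 + s * A * (2 * K1 * D1) + (B' * (K1 * K0) + s * B * (D1 * K0 + K1 * D0)) + (G' * K0\<^sup>2 + s * G * (2 * K0 * D0)))
    = 16 * ((N + 3/2) ^ 3 * (s * (1 - s\<^sup>2)) ^ 4 * K2\<^sup>2 - 2 * (N + 1) * (17 * (N + 1)\<^sup>2 + 3/4) * (s * (1 - s\<^sup>2)) ^ 2 * K1\<^sup>2
      + (N + 1/2) ^ 3 * K0\<^sup>2)"
proof -
  define x where "x = s\<^sup>2"
  define y where "y = 1 - x"
  have y: "y > 0" using s by (simp add: y_def x_def power_less_one_iff)
  \<comment> \<open>This is (2 N + 3) (1 - s^2)^2 K2. Working with it instead of \<open>K2\<close>
    keeps denominators out of the quadratic form.\<close>
  define R where "R = 4 * (N + 1) * (1 + x) * K1 - (2 * N + 1) * K0"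
  have R: "(2*N + 3) * K2 = R / y\<^sup>2" 
  proof -
    have "(2*N+3) * y\<^sup>2 * K2 = 2 * ((N + 3/2) * (1 - s\<^sup>2)\<^sup>2 * K2)" by (simp add: y_def x_def algebra_simps)
    also have "\<dots> = R" unfolding K2 R_def x_def by (simp add: algebra_simps)
    finally show ?thesis using y by (simp add: field_simps)
  qed
  have D1': "2 * y * (s * D1) = R - y * (2*N + 3) * K1"
  proof -
    have "2 * y * (s * D1) = (2*N+3) * K2 * y\<^sup>2 - y * (2*N + 3) * K1"
    proof -
      have "s * D1 = (N + 3/2) * (y * K2 - K1)" unfolding D1 y_def[unfolded x_def, symmetric] using s by simp
      then show ?thesis by algebra
    qed
    then show ?thesis unfolding R using y by simp
  qed
  have D0': "2 * (s * D0) = (2 * N + 1) * (y * K1 - K0)"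
  proof -
    have "s * D0 = (N + 1/2) * (y * K1 - K0)" unfolding D0 y_def[unfolded x_def, symmetric] using s by simp
    then show ?thesis by algebra
  qed
  have K2': "16 * ((N + 3/2) ^ 3 * (s * y) ^ 4 * K2\<^sup>2) = 2 * (2*N + 3) * x\<^sup>2 * R\<^sup>2"
  proof -
    have "16 * ((N + 3/2) ^ 3 * (s * y) ^ 4 * K2\<^sup>2) = 2 * (2*N + 3) * x\<^sup>2 * (y\<^sup>2 * ((2*N + 3) * K2))\<^sup>2"
      unfolding x_def by algebra
    also have "y\<^sup>2 * ((2*N + 3) * K2) = R" unfolding R using y by simp
    finally show ?thesis .
  qed
  define q r where "q = A * K1\<^sup>2 + B * (K1 * K0) + G * K0\<^sup>2"
    and "r = A' * K1\<^sup>2 + s * A * (2 * K1 * D1) + (B' * (K1 * K0) + s * B * (D1 * K0 + K1 * D0)) + (G' * K0\<^sup>2 + s * G * (2 * K0 * D0))"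
  note c = tele_coeffs[where x = x and N = N, OF y_def, folded A_def[folded x_def] B_def[folded x_def] G_def[folded x_def]
      A'_def[folded x_def] B'_def[folded x_def] G'_def[folded x_def]]
  have "2 * y * (2 * N * (1 - 3 * x) / (s * y) * (s * q) + r) = 4 * N * (1 - 3 * x) * q + 2 * y * r"
    using s y by (simp add: field_simps)
  also have "2 * y * r = 2 * y * (A' * K1\<^sup>2 + B' * (K1 * K0) + G' * K0\<^sup>2)
      + (2 * A * K1 + B * K0) * (2 * y * (s * D1)) + y * (B * K1 + 2 * G * K0) * (2 * (s * D0))"
    unfolding r_def by algebra
  also have "4 * N * (1 - 3 * x) * q + \<dots>
      = (4 * N * (1 - 3 * x) * A + 2 * y * A' + 2 * A * (4 * (N + 1) * (1 + x) - y * (2*N + 3)) + B * (2*N + 1) * y\<^sup>2) * K1\<^sup>2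
      + (4 * N * (1 - 3 * x) * B + 2 * y * B' - 2 * A * (2*N + 1) + B * (4 * (N + 1) * (1 + x) - y * (2*N + 3))
        - B * y * (2*N + 1) + 2 * G * (2*N + 1) * y\<^sup>2) * (K1 * K0)
      + (4 * N * (1 - 3 * x) * G + 2 * y * G' - B * (2*N + 1) - 2 * G * y * (2*N + 1)) * K0\<^sup>2"
  proof -
    define P e1 e2 e3 where "P = 4 * N * (1 - 3 * x)" and "e1 = 4 * (N + 1) * (1 + x)" and "e2 = 2 * N + 1" and "e3 = 2 * N + 3"
    show ?thesis
      unfolding D1' D0' R_def q_def P_def[symmetric] e1_def[symmetric] e2_def[symmetric] e3_def[symmetric] by algebra
  qed
  also have "\<dots> = 2 * y * (2 * (2*N + 3) * x\<^sup>2 * R\<^sup>2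
      + 16 * (- 2 * (N + 1) * (17 * (N + 1)\<^sup>2 + 3/4) * (x * y\<^sup>2) * K1\<^sup>2 + (N + 1/2) ^ 3 * K0\<^sup>2))"
  proof -
    define Q U e1 e2 where "Q = 16 * (N + 1) * (68 * (N + 1)\<^sup>2 + 3)" and "U = (2 * N + 3) * x\<^sup>2"
      and "e1 = 4 * (N + 1) * (1 + x)" and "e2 = 2 * N + 1"
    have Q: "16 * (- 2 * (N + 1) * (17 * (N + 1)\<^sup>2 + 3/4) * (x * y\<^sup>2) * K1\<^sup>2 + (N + 1/2) ^ 3 * K0\<^sup>2)
      = - (Q / 2) * x * y\<^sup>2 * K1\<^sup>2 + 2 * e2 ^ 3 * K0\<^sup>2"
    proof -
      have "16 * (2 * (N + 1) * (17 * (N + 1)\<^sup>2 + 3/4)) = Q / 2" unfolding Q_def by algebra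
      moreover have "16 * (N + 1/2) ^ 3 = 2 * e2 ^ 3" unfolding e2_def by algebra
      ultimately show ?thesis by algebra
    qed
    have c1: "16 * (2*N + 3) * x ^ 2 * (2 * (N + 1) * (1 + x))\<^sup>2 = 4 * U * e1\<^sup>2"
      unfolding U_def e1_def by algebra
    have c2: "- 16 * ((2*N + 3) * x\<^sup>2 * (2 * (N + 1) * (1 + x)) * (2*N + 1)) = - 8 * U * e1 * e2"
      unfolding U_def e1_def e2_def by algebra
    have c3: "4 * (2*N + 3) * x\<^sup>2 * (2*N + 1)\<^sup>2 + 4 * (2*N + 1) ^ 3 = 4 * U * e2\<^sup>2 + 4 * e2 ^ 3"
      unfolding U_def e2_def by algebra
    have U: "2 * (2*N + 3) * x\<^sup>2 = 2 * U" unfolding U_def by simp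
    show ?thesis unfolding c Q U c1 c2 c3 R_def unfolding Q_def[symmetric] e1_def[symmetric] e2_def[symmetric] by algebra
  qed
  finally have "2 * N * (1 - 3 * x) / (s * y) * (s * q) + r = 2 * (2*N + 3) * x\<^sup>2 * R\<^sup>2
      + 16 * (- 2 * (N + 1) * (17 * (N + 1)\<^sup>2 + 3/4) * (x * y\<^sup>2) * K1\<^sup>2 + (N + 1/2) ^ 3 * K0\<^sup>2)"
    by (rule mult_left_cancel[THEN iffD1, rotated]) (use y in simp)
  also have "x * y\<^sup>2 = (s * y)\<^sup>2" by (simp add: x_def power_mult_distrib)
  also have "2 * (2*N + 3) * x\<^sup>2 * R\<^sup>2 + 16 * (- 2 * (N + 1) * (17 * (N + 1)\<^sup>2 + 3/4) * (s * y)\<^sup>2 * K1\<^sup>2 + (N + 1/2) ^ 3 * K0\<^sup>2)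
    = 16 * ((N + 3/2) ^ 3 * (s * y) ^ 4 * K2\<^sup>2 - 2 * (N + 1) * (17 * (N + 1)\<^sup>2 + 3/4) * (s * y) ^ 2 * K1\<^sup>2
      + (N + 1/2) ^ 3 * K0\<^sup>2)"
  proof -
    have "16 * a + 16 * (- 2 * b * c * d * e + f) = 16 * (a - 2 * b * c * d * e + f)" for a b c d e f :: real by algebra
    then show ?thesis unfolding K2'[symmetric] .
  qed
  also have "s * q = s * A * K1\<^sup>2 + s * B * (K1 * K0) + s * G * K0\<^sup>2" unfolding q_def by algebra
  finally show ?thesis unfolding r_def y_def x_def .
qed

lemma tele_has_derivative:
  assumes s: "0 < s" "s < 1"
  shows "(tele n has_real_derivative
     16 * ((real n + 3/2) ^ 3 * ((s * (1 - s\<^sup>2)) ^ (2 * (n+2)) * (cosh_integral (n+2) s)\<^sup>2)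
      - 2 * (real n + 1) * (17 * (real n + 1)\<^sup>2 + 3/4) * ((s * (1 - s\<^sup>2)) ^ (2 * (n+1)) * (cosh_integral (n+1) s)\<^sup>2)
      + (real n + 1/2) ^ 3 * ((s * (1 - s\<^sup>2)) ^ (2 * n) * (cosh_integral n s)\<^sup>2))) (at s)"
proof -
  define N where "N = real n"
  note al = tele_coeff_derivs(1)[of N s] and be = tele_coeff_derivs(2)[of N s] and ga = tele_coeff_derivs(3)[of N s]
  define D0 where "D0 = (N + 1/2) * ((1 - s\<^sup>2) * cosh_integral (Suc n) s - cosh_integral n s) / s"
  define D1 where "D1 = (N + 3/2) * ((1 - s\<^sup>2) * cosh_integral (Suc (Suc n)) s - cosh_integral (Suc n) s) / s"
  have D0: "(cosh_integral n has_real_derivative D0) (at s)"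
    using cosh_integral_has_derivative[of s n] s by (simp add: D0_def N_def)
  have D1: "(cosh_integral (Suc n) has_real_derivative D1) (at s)"
    using cosh_integral_has_derivative[of s "Suc n"] s by (simp add: D1_def N_def add.commute)
  define y where "y = 1 - s\<^sup>2"
  have y: "y > 0" using s by (simp add: y_def power_less_one_iff)
  define W where "W = (s * y) ^ (2 * n)"
  have W: "((\<lambda>s. (s * (1 - s\<^sup>2)) ^ (2 * n)) has_real_derivative W * (2 * N * (1 - 3 * s\<^sup>2) / (s * y))) (at s)"
  proof -
    have "((\<lambda>s. (s * (1 - s\<^sup>2)) ^ (2 * n)) has_real_derivative (real (2 * n) * (s * (1 - s\<^sup>2)) ^ (2 * n - 1) * (1 - 3 * s\<^sup>2))) (at s)"
      by (auto intro!: derivative_eq_intros simp: power2_eq_square algebra_simps)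
    moreover have "real (2 * n) * (s * (1 - s\<^sup>2)) ^ (2 * n - 1) = W * (2 * N / (s * y))"
      using s y unfolding W_def y_def[symmetric] N_def by (cases n) (auto simp: field_simps)
    moreover have "W * (2 * N / (s * y)) * (1 - 3 * s\<^sup>2) = W * (2 * N * (1 - 3 * s\<^sup>2) / (s * y))" by simp
    ultimately show ?thesis by metis
  qed
  define q where "q = s * teleA N (s\<^sup>2) * (cosh_integral (Suc n) s)\<^sup>2 + s * teleB N (s\<^sup>2) * (cosh_integral (Suc n) s * cosh_integral n s) + s * teleG N (s\<^sup>2) * (cosh_integral n s)\<^sup>2"
  define q' where "q' = (teleA' N (s\<^sup>2) * (cosh_integral (Suc n) s)\<^sup>2 + s * teleA N (s\<^sup>2) * (2 * cosh_integral (Suc n) s * D1)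
         + (teleB' N (s\<^sup>2) * (cosh_integral (Suc n) s * cosh_integral n s) + s * teleB N (s\<^sup>2) * (D1 * cosh_integral n s + cosh_integral (Suc n) s * D0))
         + (teleG' N (s\<^sup>2) * (cosh_integral n s)\<^sup>2 + s * teleG N (s\<^sup>2) * (2 * cosh_integral n s * D0)))"
  have q: "((\<lambda>s. s * teleA N (s\<^sup>2) * (cosh_integral (Suc n) s)\<^sup>2 + s * teleB N (s\<^sup>2) * (cosh_integral (Suc n) s * cosh_integral n s) + s * teleG N (s\<^sup>2) * (cosh_integral n s)\<^sup>2)
      has_real_derivative q') (at s)"
    unfolding q'_def power2_eq_square[of "cosh_integral _ _"]
    by (rule DERIV_cong[OF DERIV_add[OF DERIV_add[OF DERIV_mult[OF al DERIV_mult[OF D1 D1]]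
        DERIV_mult[OF be DERIV_mult[OF D1 D0]]] DERIV_mult[OF ga DERIV_mult[OF D0 D0]]]]) (simp add: algebra_simps)
  have tele: "tele n = (\<lambda>s. (s * (1 - s\<^sup>2)) ^ (2 * n) * (s * teleA N (s\<^sup>2) * (cosh_integral (Suc n) s)\<^sup>2 + s * teleB N (s\<^sup>2) * (cosh_integral (Suc n) s * cosh_integral n s) + s * teleG N (s\<^sup>2) * (cosh_integral n s)\<^sup>2))"
    unfolding tele_def N_def by (rule ext) simp
  have comm: "W * e * q + q' * W = W * (e * q + q')" for e by (simp add: algebra_simps)
  have "(tele n has_real_derivative W * (2 * N * (1 - 3 * s\<^sup>2) / (s * y) * q + q')) (at s)"
    unfolding tele comm[symmetric] using DERIV_mult[OF W q] unfolding W_def y_def q_def .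
  also have "2 * N * (1 - 3 * s\<^sup>2) / (s * y) * q + q'
     = 16 * ((N + 3/2) ^ 3 * (s * (1 - s\<^sup>2)) ^ 4 * (cosh_integral (Suc (Suc n)) s)\<^sup>2 - 2 * (N + 1) * (17 * (N + 1)\<^sup>2 + 3/4) * (s * (1 - s\<^sup>2)) ^ 2 * (cosh_integral (Suc n) s)\<^sup>2
      + (N + 1/2) ^ 3 * (cosh_integral n s)\<^sup>2)"
    unfolding q_def q'_def y_def
    by (rule tele_alg[OF s _ D0_def D1_def]) (use s cosh_integral_three_term[OF s(1), of n] in \<open>simp add: N_def\<close>)
  finally show ?thesis
  proof (rule DERIV_cong)
    have p: "(s * (1 - s\<^sup>2)) ^ (2 * (n+2)) = W * (s * (1 - s\<^sup>2)) ^ 4" "(s * (1 - s\<^sup>2)) ^ (2 * (n+1)) = W * (s * (1 - s\<^sup>2)) ^ 2"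
      "(s * (1 - s\<^sup>2)) ^ (2 * n) = W"
    proof -
      have e: "2 * (n+2) = 2 * n + 4" "2 * (n+1) = 2 * n + 2" by auto
      show "(s * (1 - s\<^sup>2)) ^ (2 * (n+2)) = W * (s * (1 - s\<^sup>2)) ^ 4" "(s * (1 - s\<^sup>2)) ^ (2 * (n+1)) = W * (s * (1 - s\<^sup>2)) ^ 2"
        unfolding W_def y_def e power_add by (rule refl)+
    qed (simp add: W_def y_def)
    show "W * (16 * ((N + 3/2) ^ 3 * (s * (1 - s\<^sup>2)) ^ 4 * (cosh_integral (Suc (Suc n)) s)\<^sup>2 - 2 * (N + 1) * (17 * (N + 1)\<^sup>2 + 3/4) * (s * (1 - s\<^sup>2)) ^ 2 * (cosh_integral (Suc n) s)\<^sup>2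
      + (N + 1/2) ^ 3 * (cosh_integral n s)\<^sup>2)) = 16 * ((real n + 3/2) ^ 3 * ((s * (1 - s\<^sup>2)) ^ (2 * (n+2)) * (cosh_integral (n+2) s)\<^sup>2)
      - 2 * (real n + 1) * (17 * (real n + 1)\<^sup>2 + 3/4) * ((s * (1 - s\<^sup>2)) ^ (2 * (n+1)) * (cosh_integral (n+1) s)\<^sup>2)
      + (real n + 1/2) ^ 3 * ((s * (1 - s\<^sup>2)) ^ (2 * n) * (cosh_integral n s)\<^sup>2))"
      unfolding p N_def by (simp add: right_diff_distrib distrib_left mult_ac)
  qed
qed

text \<open>Each of the three coefficient polynomials vanishes at s = 1, its coefficients adding up
  to 0. The resulting factor 1 - s^2 removes the boundary term at 1 even for n = 0, where the weight
  is 1 and gives no help.\<close>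

lemma tele_factor:
  "\<exists>a b c. continuous_on {0..1} a \<and> continuous_on {0..1} b \<and> continuous_on {0..1} c \<and>
    (\<forall>s. tele n s = (s * (1 - s\<^sup>2)) ^ (2 * n) * (s * (1 - s\<^sup>2) * (a s * (cosh_integral (Suc n) s)\<^sup>2 + b s * (cosh_integral (Suc n) s * cosh_integral n s) + c s * (cosh_integral n s)\<^sup>2)))"
proof -
  define N where "N = real n"
  define c1 c2 c3 c4 c5 where "c1 = (2*N+1)\<^sup>2" and "c2 = 4 * (32 * (N+1)\<^sup>2 + 2 * (N+1) + 1)"
    and "c3 = 2 * (180 * (N+1)\<^sup>2 + 8 * (N+1) + 3)" and "c4 = 4 * (72 * (N+1)\<^sup>2 - 2 * (N+1) + 1)"
    and "c5 = 52 * (N+1)\<^sup>2 - 12 * (N+1) + 1"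
  define d0 d1 d2 d3 d4 where "d0 = 4 * (2*N+1)" and "d1 = 2 * N + 1" and "d2 = 8 * N + 9" and "d3 = 18 * N + 17" and "d4 = 8 * N + 7"
  have c: "c5 = - c1 + c2 - c3 + c4" unfolding c1_def c2_def c3_def c4_def c5_def by algebra
  have d: "d4 = - d1 - d2 + d3" unfolding d1_def d2_def d3_def d4_def by algebra
  define a b g where "a = (\<lambda>s::real. c1 * (1 + s\<^sup>2 + s ^ 4 + s ^ 6) - c2 * s ^ 2 * (1 + s\<^sup>2 + s ^ 4) + c3 * s ^ 4 * (1 + s\<^sup>2) - c4 * s ^ 6)"
    and "b = (\<lambda>s::real. d0 * (- d1 * (1 + s\<^sup>2 + s ^ 4) - d2 * s ^ 2 * (1 + s\<^sup>2) + d3 * s ^ 4))"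
    and "g = (\<lambda>s::real. 5 * c1 * (1 - s\<^sup>2))"
  have A: "teleA N (s\<^sup>2) = (1 - s\<^sup>2) * a s" for s
    unfolding teleA_def c1_def[symmetric] c2_def[symmetric] c3_def[symmetric] c4_def[symmetric] c5_def[symmetric] c a_def
    by algebra
  have B: "teleB N (s\<^sup>2) = (1 - s\<^sup>2) * b s" for s
    unfolding teleB_def d0_def[symmetric] d1_def[symmetric] d2_def[symmetric] d3_def[symmetric] d4_def[symmetric] d b_def
    unfolding d0_def d1_def by algebra
  have G: "teleG N (s\<^sup>2) = (1 - s\<^sup>2) * g s" for s
    unfolding teleG_def g_def c1_def by (simp add: power2_eq_square)
  have "continuous_on {0..1} a" "continuous_on {0..1} b" "continuous_on {0..1} g"
    unfolding a_def b_def g_def by (intro continuous_intros)+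
  moreover have "tele n s = (s * (1 - s\<^sup>2)) ^ (2 * n) * (s * (1 - s\<^sup>2) * (a s * (cosh_integral (Suc n) s)\<^sup>2 + b s * (cosh_integral (Suc n) s * cosh_integral n s) + g s * (cosh_integral n s)\<^sup>2))" for s
    unfolding tele_def N_def[symmetric] A B G by (simp add: distrib_left mult.assoc)
  ultimately show ?thesis by blast
qed

text \<open>The exponent 3/4 combines the factor s of \<open>tele\<close> with the square of the
  bound \<open>s powr (-1/8)\<close>. The right side tends to 0 at both ends of the interval, so
  that no boundary terms survive.\<close>

lemma tele_bound: "\<exists>C. \<forall>s. 0 < s \<and> s < 1 \<longrightarrow> \<bar>tele n s\<bar> \<le> C * (s powr (3/4) * (1 - s\<^sup>2))"
proof -
  obtain C where C: "C > 0" "\<And>n s. s > 0 \<Longrightarrow> cosh_integral n s \<le> C * s powr (-1/8)" using cosh_integral_bound by blast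
  obtain a b c where abc: "continuous_on {0..1} a" "continuous_on {0..1} b" "continuous_on {0..1} c"
    and fac: "\<And>s. tele n s = (s * (1 - s\<^sup>2)) ^ (2 * n) * (s * (1 - s\<^sup>2) * (a s * (cosh_integral (Suc n) s)\<^sup>2 + b s * (cosh_integral (Suc n) s * cosh_integral n s) + c s * (cosh_integral n s)\<^sup>2))"
    using tele_factor[of n] by blast
  have bdd: "\<exists>B. \<forall>s\<in>{0..1}. \<bar>f s\<bar> \<le> B" if "continuous_on {0..1} f" for f :: "real \<Rightarrow> real"
  proof -
    have "bounded (f ` {0..1})" by (intro compact_imp_bounded compact_continuous_image that) auto
    then show ?thesis by (auto simp: bounded_iff)
  qed
  then obtain A B D where A: "\<And>s. s \<in> {0..1} \<Longrightarrow> \<bar>a s\<bar> \<le> A" and B: "\<And>s. s \<in> {0..1} \<Longrightarrow> \<bar>b s\<bar> \<le> B"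
    and D: "\<And>s. s \<in> {0..1} \<Longrightarrow> \<bar>c s\<bar> \<le> D" using bdd[OF abc(1)] bdd[OF abc(2)] bdd[OF abc(3)] by metis
  have "\<bar>tele n s\<bar> \<le> ((A + B + D) * C\<^sup>2) * (s powr (3/4) * (1 - s\<^sup>2))" if s: "0 < s" "s < 1" for s
  proof -
    have "s\<^sup>2 \<le> 1" using s by (simp add: abs_square_le_1)
    then have y: "0 \<le> 1 - s\<^sup>2" "1 - s\<^sup>2 \<le> 1" by auto
    have w0: "0 \<le> s * (1 - s\<^sup>2)" "s * (1 - s\<^sup>2) \<le> 1" using s y by (auto simp: mult_le_one)
    then have w: "0 \<le> (s * (1 - s\<^sup>2)) ^ (2 * n)" "(s * (1 - s\<^sup>2)) ^ (2 * n) \<le> 1" by (auto simp: power_le_one)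
    have sq: "C\<^sup>2 * s powr (-1/4) = (C * s powr (-1/8)) * (C * s powr (-1/8))"
      using s by (simp add: power2_eq_square powr_add[symmetric])
    have KK2: "\<bar>cosh_integral i s * cosh_integral j s\<bar> \<le> C\<^sup>2 * s powr (-1/4)" for i j
      unfolding sq abs_mult using C(2)[OF s(1)] cosh_integral_nonneg C(1) by (intro mult_mono) auto
    have "\<bar>a s * (cosh_integral (Suc n) s)\<^sup>2 + b s * (cosh_integral (Suc n) s * cosh_integral n s) + c s * (cosh_integral n s)\<^sup>2\<bar>
       \<le> A * (C\<^sup>2 * s powr (-1/4)) + B * (C\<^sup>2 * s powr (-1/4)) + D * (C\<^sup>2 * s powr (-1/4))"
    proof -
      have m: "\<bar>u * (cosh_integral i s * cosh_integral j s)\<bar> \<le> U * (C\<^sup>2 * s powr (-1/4))" if "\<bar>u\<bar> \<le> U" for u U i j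
        unfolding abs_mult[of u] using that KK2[of i j] by (intro mult_mono) auto
      have "\<bar>a s * (cosh_integral (Suc n) s * cosh_integral (Suc n) s)\<bar> \<le> A * (C\<^sup>2 * s powr (-1/4))" by (rule m[OF A]) (use s in auto)
      moreover have "\<bar>b s * (cosh_integral (Suc n) s * cosh_integral n s)\<bar> \<le> B * (C\<^sup>2 * s powr (-1/4))" by (rule m[OF B]) (use s in auto)
      moreover have "\<bar>c s * (cosh_integral n s * cosh_integral n s)\<bar> \<le> D * (C\<^sup>2 * s powr (-1/4))" by (rule m[OF D]) (use s in auto)
      ultimately show ?thesis unfolding power2_eq_square[of "cosh_integral _ s"] by linarith
    qed
    then have 1: "\<bar>a s * (cosh_integral (Suc n) s)\<^sup>2 + b s * (cosh_integral (Suc n) s * cosh_integral n s) + c s * (cosh_integral n s)\<^sup>2\<bar> \<le> (A + B + D) * C\<^sup>2 * s powr (-1/4)"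
      by (simp add: algebra_simps)
    have "\<bar>tele n s\<bar> = (s * (1 - s\<^sup>2)) ^ (2 * n) * (s * (1 - s\<^sup>2) * \<bar>a s * (cosh_integral (Suc n) s)\<^sup>2 + b s * (cosh_integral (Suc n) s * cosh_integral n s) + c s * (cosh_integral n s)\<^sup>2\<bar>)"
      unfolding fac abs_mult using w w0 s y by simp
    also have "\<dots> \<le> 1 * (s * (1 - s\<^sup>2) * ((A + B + D) * C\<^sup>2 * s powr (-1/4)))"
      using w w0 1 s y by (intro mult_mono mult_left_mono mult_nonneg_nonneg) auto
    also have "\<dots> = ((A + B + D) * C\<^sup>2) * ((s powr 1 * s powr (-1/4)) * (1 - s\<^sup>2))"
      using s by (simp add: algebra_simps)
    also have "s powr 1 * s powr (-1/4) = s powr (3/4)" by (simp only: powr_add[symmetric]) simp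
    finally show ?thesis .
  qed
  then show ?thesis by blast
qed

lemma reduced_integral_recurrence:
  "(real n + 3/2) ^ 3 * reduced_integral (n+2) - 2 * (real n + 1) * (17 * (real n + 1)\<^sup>2 + 3/4) * reduced_integral (n+1) + (real n + 1/2) ^ 3 * reduced_integral n = 0"
proof -
  let ?w = "\<lambda>n s. 2 * (s * (1 - s\<^sup>2)) ^ (2 * n) * (cosh_integral n s)\<^sup>2"
  let ?h = "\<lambda>s. (real n + 3/2) ^ 3 * ?w (n+2) s - 2 * (real n + 1) * (17 * (real n + 1)\<^sup>2 + 3/4) * ?w (n+1) s + (real n + 1/2) ^ 3 * ?w n s"
  obtain C where C: "\<And>s. 0 < s \<Longrightarrow> s < 1 \<Longrightarrow> \<bar>tele n s\<bar> \<le> C * (s powr (3/4) * (1 - s\<^sup>2))" using tele_bound by blast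
  have int: "set_integrable lborel {0<..<1} ?h"
    by (intro set_integral_add set_integral_diff set_integrable_mult_right reduced_integral_integrable)
  have "(LBINT s=0..1. ?h s) = 1/8 * 0 - 1/8 * 0"
  \<comment> \<open>The derivative of \<open>tele\<close> is 16 times the combination of weighted
    squares, while each integrand of \<open>reduced_integral\<close> carries a factor 2; hence the
    1/8.\<close>
  proof (rule interval_integral_FTC_integrable[where F = "\<lambda>s. 1/8 * tele n s"])
    fix s assume "0 < ereal s" "ereal s < 1"
    then have s: "0 < s" "s < 1" by (auto simp: zero_ereal_def one_ereal_def)
    show "((\<lambda>s. 1/8 * tele n s) has_vector_derivative ?h s) (at s)"
      unfolding has_real_derivative_iff_has_vector_derivative[symmetric]
      by (rule DERIV_cong[OF DERIV_cmult[OF tele_has_derivative[OF s]]]) (simp add: algebra_simps)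
    have c: "isCont (cosh_integral k) s" for k using cosh_integral_has_derivative[OF s(1)] by (rule DERIV_isCont)
    show "isCont ?h s" by (intro continuous_intros c)
  next
    show "set_integrable lborel (einterval 0 1) ?h" using int by (simp add: zero_ereal_def one_ereal_def)
    have ev: "\<forall>\<^sub>F s::real in at_right 0. 0 < s \<and> s < 1"
      by (rule eventually_at_rightI[of 0 1]) auto
    have "((\<lambda>s. C * (s powr (3/4) * (1 - s\<^sup>2))) \<longlongrightarrow> 0) (at_right 0)" by real_asymp
    then have "(tele n \<longlongrightarrow> 0) (at_right 0)"
      using eventually_mono[OF ev] C by (intro Lim_null_comparison[of "tele n"]) auto
    then show "(((\<lambda>s. 1/8 * tele n s) \<circ> real_of_ereal) \<longlongrightarrow> 1/8 * 0) (at_right 0)"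
      unfolding zero_ereal_def ereal_tendsto_simps by (intro tendsto_intros)
    have ev: "\<forall>\<^sub>F s::real in at_left 1. 0 < s \<and> s < 1"
      by (rule eventually_at_leftI[of 0 1]) auto
    have "((\<lambda>s. C * (s powr (3/4) * (1 - s\<^sup>2))) \<longlongrightarrow> 0) (at_left 1)" by real_asymp
    then have "(tele n \<longlongrightarrow> 0) (at_left 1)"
      using eventually_mono[OF ev] C by (intro Lim_null_comparison[of "tele n"]) auto
    then show "(((\<lambda>s. 1/8 * tele n s) \<circ> real_of_ereal) \<longlongrightarrow> 1/8 * 0) (at_left 1)"
      unfolding one_ereal_def ereal_tendsto_simps by (intro tendsto_intros)
  qed simp
  then have "(LINT s:{0<..<1}|lborel. ?h s) = 0"
    by (simp add: interval_lebesgue_integral_def zero_ereal_def one_ereal_def)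
  also have "(LINT s:{0<..<1}|lborel. ?h s) = (real n + 3/2) ^ 3 * reduced_integral (n+2) - 2 * (real n + 1) * (17 * (real n + 1)\<^sup>2 + 3/4) * reduced_integral (n+1) + (real n + 1/2) ^ 3 * reduced_integral n"
    unfolding reduced_integral_def set_integral_mult_right[symmetric]
    by (simp only: set_integral_add set_integral_diff set_integrable_mult_right reduced_integral_integrable)
  finally show ?thesis by simp
qed

section \<open>Asymptotics by the Laplace method\<close>

lemma gauss_integral:
  assumes "c > 0"
  shows "has_bochner_integral lborel (\<lambda>v::real. exp (- (c * v\<^sup>2))) (sqrt (pi / c))"
proof -
  have "has_bochner_integral lborel (\<lambda>x::real. exp (- x\<^sup>2)) (2 *\<^sub>R (sqrt pi / 2))"
    by (rule has_bochner_integral_even_function[OF gaussian_moment_0]) simp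
  then have "has_bochner_integral lborel (\<lambda>x::real. exp (- x\<^sup>2)) (sqrt pi)" by simp
  then have "has_bochner_integral lborel (\<lambda>v::real. exp (- (0 + sqrt c * v)\<^sup>2)) (sqrt pi /\<^sub>R \<bar>sqrt c\<bar>)"
    using assms by (subst (asm) lborel_has_bochner_integral_real_affine_iff[where c = "sqrt c" and t = 0]) auto
  moreover have "sqrt pi /\<^sub>R \<bar>sqrt c\<bar> = sqrt (pi / c)"
    using assms unfolding real_sqrt_divide by (simp add: divide_inverse)
  ultimately show ?thesis using assms by (simp add: power_mult_distrib)
qed

lemma inverse_1_plus_square_integral:
  assumes "c > 0"
  shows "has_bochner_integral lborel (\<lambda>v::real. 1 / (1 + c * v\<^sup>2)) (pi / sqrt c)"
proof -
  have "integrable lborel (\<lambda>x::real. inverse (1 + x\<^sup>2))" "(LINT x::real|lborel. inverse (1 + x\<^sup>2)) = pi"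
    using integrable_inverse_1_plus_square LBINT_inverse_1_plus_square
    by (simp_all add: set_integrable_def interval_lebesgue_integral_def set_lebesgue_integral_def)
  then have "has_bochner_integral lborel (\<lambda>x::real. inverse (1 + x\<^sup>2)) pi"
    by (simp add: has_bochner_integral_iff)
  then have "has_bochner_integral lborel (\<lambda>v::real. inverse (1 + (0 + sqrt c * v)\<^sup>2)) (pi /\<^sub>R \<bar>sqrt c\<bar>)"
    using assms by (subst (asm) lborel_has_bochner_integral_real_affine_iff[where c = "sqrt c" and t = 0]) auto
  then show ?thesis using assms by (simp add: power_mult_distrib divide_inverse mult.commute)
qed

text \<open>Squeezing by x (1 - x) <= ln (1 + x) <= x; the convergence of n x_n already forces x_n
  to 0.\<close>

lemma tendsto_one_plus_powr_exp:
  fixes x :: "nat \<Rightarrow> real"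
  assumes x0: "\<And>n. x n \<ge> 0" and lim: "(\<lambda>n. real n * x n) \<longlonglongrightarrow> c"
  shows "(\<lambda>n. (1 + x n) powr (- (real n + 1/2))) \<longlonglongrightarrow> exp (- c)"
proof -
  have "(\<lambda>n. (real n * x n) * (1 / real n)) \<longlonglongrightarrow> c * 0"
    by (intro tendsto_mult lim) real_asymp
  moreover have "\<forall>\<^sub>F n in sequentially. (real n * x n) * (1 / real n) = x n"
    using eventually_gt_at_top[of 0] by eventually_elim auto
  ultimately have xl: "x \<longlonglongrightarrow> 0" by (simp add: tendsto_cong)
  have up: "(\<lambda>n. (real n + 1/2) * x n) \<longlonglongrightarrow> c"
    using tendsto_add[OF lim tendsto_mult[OF tendsto_const xl, of "1/2"]] by (simp add: algebra_simps)
  have "(\<lambda>n. ((real n + 1/2) * x n) * (1 - x n)) \<longlonglongrightarrow> c * (1 - 0)"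
    by (intro tendsto_intros up xl)
  then have lo: "(\<lambda>n. ((real n + 1/2) * x n) * (1 - x n)) \<longlonglongrightarrow> c" by simp
  have ev: "\<forall>\<^sub>F n in sequentially. x n < 1" using order_tendstoD(2)[OF xl, of 1] by simp
  have "(\<lambda>n. (real n + 1/2) * ln (1 + x n)) \<longlonglongrightarrow> c"
  proof (rule tendsto_sandwich[OF _ _ lo up])
    show "\<forall>\<^sub>F n in sequentially. (real n + 1/2) * x n * (1 - x n) \<le> (real n + 1/2) * ln (1 + x n)"
      using ev
    proof eventually_elim
      case (elim n)
      have "x n * (1 - x n) \<le> ln (1 + x n)"
        using ln_one_plus_pos_lower_bound[of "x n"] x0[of n] elim by (simp add: power2_eq_square algebra_simps)
      then show ?case unfolding mult.assoc by (intro mult_left_mono) auto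
    qed
    show "\<forall>\<^sub>F n in sequentially. (real n + 1/2) * ln (1 + x n) \<le> (real n + 1/2) * x n"
      using x0 by (intro always_eventually allI mult_left_mono ln_add_one_self_le_self) auto
  qed
  then have "(\<lambda>n. exp (- ((real n + 1/2) * ln (1 + x n)))) \<longlonglongrightarrow> exp (- c)"
    by (intro tendsto_intros)
  moreover have "(1 + x n) powr (- (real n + 1/2)) = exp (- ((real n + 1/2) * ln (1 + x n)))" for n
    unfolding powr_def minus_mult_left[symmetric] using x0[of n] by simp
  ultimately show ?thesis by simp
qed

lemma sinh_scaled_limit: "(\<lambda>n. real n * (sinh (v / (2 * sqrt (real n))))\<^sup>2) \<longlonglongrightarrow> v\<^sup>2 / 4"
proof (cases "v = 0")
  case False
  have "((\<lambda>h. (sinh (0 + h) - sinh 0) / h) \<longlongrightarrow> cosh (0::real)) (at 0)"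
    using has_field_derivative_sinh[OF DERIV_ident, of "0::real" UNIV] unfolding DERIV_def by simp
  then have s: "((\<lambda>h::real. sinh h / h) \<longlongrightarrow> 1) (at 0)" by simp
  have "filterlim (\<lambda>n. v / (2 * sqrt (real n))) (at 0) sequentially"
    unfolding filterlim_at
  proof
    show "\<forall>\<^sub>F n in sequentially. v / (2 * sqrt (real n)) \<in> UNIV \<and> v / (2 * sqrt (real n)) \<noteq> 0"
      using eventually_gt_at_top[of 0] by eventually_elim (use False in auto)
    show "(\<lambda>n. v / (2 * sqrt (real n))) \<longlonglongrightarrow> 0" by real_asymp
  qed
  from filterlim_compose[OF s this]
  have "(\<lambda>n. (sinh (v / (2 * sqrt (real n))) / (v / (2 * sqrt (real n))))\<^sup>2 * (v\<^sup>2 / 4)) \<longlonglongrightarrow> 1\<^sup>2 * (v\<^sup>2 / 4)"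
    by (intro tendsto_intros)
  moreover have "\<forall>\<^sub>F n in sequentially. (sinh (v / (2 * sqrt (real n))) / (v / (2 * sqrt (real n))))\<^sup>2 * (v\<^sup>2 / 4)
      = real n * (sinh (v / (2 * sqrt (real n))))\<^sup>2"
    using eventually_gt_at_top[of 0] by eventually_elim (use False in \<open>simp add: power_divide power_mult_distrib field_simps\<close>)
  ultimately show ?thesis by (simp add: tendsto_cong)
qed simp

lemma square_le_sinh_square: "y\<^sup>2 \<le> (sinh y)\<^sup>2" for y :: real
proof -
  have "z \<le> sinh z" if "z \<ge> 0" for z :: real
  proof -
    have "sinh 0 - 0 \<le> sinh z - z"
    proof (rule DERIV_nonneg_imp_nondecreasing[OF that])
      fix x :: real
      show "\<exists>y. ((\<lambda>x. sinh x - x) has_real_derivative y) (at x) \<and> y \<ge> 0"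
        by (rule exI[of _ "cosh x - 1"]) (auto intro!: derivative_eq_intros simp: cosh_real_ge_1)
    qed
    then show ?thesis by simp
  qed
  from this[of "\<bar>y\<bar>"] have "\<bar>y\<bar> \<le> \<bar>sinh y\<bar>" by (simp add: sinh_real_abs)
  then show ?thesis using abs_le_square_iff by blast
qed

text \<open>What remains of sqrt n times \<open>cosh_integral n s\<close> after the value (1 + s)^2
  at u = 0 is taken out of the quadratic and u = v / sqrt n is substituted, with a = 4 s / (1 +
  s)^2. For large n the integrand is close to the Gaussian exp (- a v^2 / 4).\<close>

definition sinh_integral :: "nat \<Rightarrow> real \<Rightarrow> real" where
  "sinh_integral n a = (LINT v|lborel. (1 + a * (sinh (v / (2 * sqrt (real n))))\<^sup>2) powr (- (real n + 1/2)))"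

text \<open>Bernoulli's inequality for the n-th power, together with sinh^2 y >= y^2, gives a
  majorant independent of n. The lower bound \<open>b\<close> in place of \<open>a\<close> serves
  the case where \<open>a\<close> varies with n.\<close>

lemma sinh_integral_integrand_bound:
  assumes "n > 0" "0 \<le> b" "b \<le> a"
  shows "(1 + a * (sinh (v / (2 * sqrt (real n))))\<^sup>2) powr (- (real n + 1/2)) \<le> 1 / (1 + b / 4 * v\<^sup>2)"
proof -
  let ?x = "a * (sinh (v / (2 * sqrt (real n))))\<^sup>2"
  have x: "?x \<ge> 0" using assms by simp
  have px: "1 + ?x > 0" using x by linarith
  have b: "b * (v\<^sup>2 / (4 * real n)) \<le> ?x"
    using square_le_sinh_square[of "v / (2 * sqrt (real n))"] assms
    by (intro mult_mono) (auto simp: power_divide power_mult_distrib)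
  have "1 + b / 4 * v\<^sup>2 = 1 + real n * (b * (v\<^sup>2 / (4 * real n)))" using assms by simp
  also have "\<dots> \<le> 1 + real n * ?x" using b by (intro add_mono mult_left_mono) auto
  also have "\<dots> \<le> (1 + ?x) ^ n" using x by (intro Bernoulli_inequality) auto
  finally have 1: "1 + b / 4 * v\<^sup>2 \<le> (1 + ?x) ^ n" .
  have "(1 + ?x) powr (- (real n + 1/2)) \<le> (1 + ?x) powr (- real n)" using x by (intro powr_mono) auto
  also have "\<dots> = 1 / (1 + ?x) ^ n" unfolding powr_minus_divide powr_realpow[OF px] ..
  also have "\<dots> \<le> 1 / (1 + b / 4 * v\<^sup>2)"
    using px assms by (intro divide_left_mono[OF 1] mult_pos_pos zero_less_power add_pos_nonneg) auto
  finally show ?thesis .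
qed

lemma borel_measurable_sinh [measurable]: "(sinh :: real \<Rightarrow> real) \<in> borel_measurable borel"
  by (intro borel_measurable_continuous_onI continuous_intros)

lemma sinh_integral_integrable: assumes "n > 0" "a > 0"
  shows "integrable lborel (\<lambda>v. (1 + a * (sinh (v / (2 * sqrt (real n))))\<^sup>2) powr (- (real n + 1/2)))"
proof (rule Bochner_Integration.integrable_bound)
  show "integrable lborel (\<lambda>v. 1 / (1 + a / 4 * v\<^sup>2))"
    using inverse_1_plus_square_integral[of "a/4"] assms by (auto simp: has_bochner_integral_iff)
  show "AE v in lborel. norm ((1 + a * (sinh (v / (2 * sqrt (real n))))\<^sup>2) powr (- (real n + 1/2))) \<le> norm (1 / (1 + a / 4 * v\<^sup>2))"
    using sinh_integral_integrand_bound[of n a a] assms by (intro always_eventually allI) auto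
qed measurable

lemma sinh_integral_bound: assumes "n > 0" "a > 0" shows "sinh_integral n a \<le> 2 * pi / sqrt a"
proof -
  have i: "has_bochner_integral lborel (\<lambda>v. 1 / (1 + a / 4 * v\<^sup>2)) (pi / sqrt (a/4))"
    using assms by (intro inverse_1_plus_square_integral) auto
  have "sinh_integral n a \<le> (LINT v|lborel. 1 / (1 + a / 4 * v\<^sup>2))"
    unfolding sinh_integral_def using i sinh_integral_integrable[OF assms] sinh_integral_integrand_bound[of n a a] assms
    by (intro integral_mono) (auto simp: has_bochner_integral_iff)
  also have "\<dots> = 2 * pi / sqrt a" using i by (simp add: has_bochner_integral_iff real_sqrt_divide)
  finally show ?thesis .
qed

lemma sinh_integral_nonneg: "sinh_integral n a \<ge> 0" unfolding sinh_integral_def by (intro Bochner_Integration.integral_nonneg) auto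

text \<open>The parameter is a sequence because in the Laplace method the point s, and with it 4 s /
  (1 + s)^2, moves with n.\<close>

lemma sinh_integral_tendsto:
  assumes a: "a \<longlonglongrightarrow> A" "A > 0"
  shows "(\<lambda>n. sinh_integral n (a n)) \<longlonglongrightarrow> sqrt (4 * pi / A)"
proof -
  have "\<forall>\<^sub>F n in sequentially. a n > A / 2" using order_tendstoD(1)[OF a(1), of "A/2"] a(2) by simp
  then obtain N0 where N0: "\<And>n. n \<ge> N0 \<Longrightarrow> a n > A / 2" unfolding eventually_sequentially by blast
  \<comment> \<open>The shift by \<open>N\<close> puts \<open>a n\<close> above A/2 from the start,
    since dominated convergence asks for the majorant at every index; it also excludes n =
    0.\<close>
  define N where "N = Suc N0"
  have N: "n + N > 0" "a (n + N) > A / 2" for n using N0[of "n + N"] by (auto simp: N_def)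
  let ?f = "\<lambda>n v. (1 + a n * (sinh (v / (2 * sqrt (real n))))\<^sup>2) powr (- (real n + 1/2))"
  have "(\<lambda>n. LINT v|lborel. ?f (n + N) v) \<longlonglongrightarrow> (LINT v|lborel. exp (- (A / 4 * v\<^sup>2)))"
  proof (rule integral_dominated_convergence[where w = "\<lambda>v. 1 / (1 + A / 2 / 4 * v\<^sup>2)"])
    show "integrable lborel (\<lambda>v. 1 / (1 + A / 2 / 4 * v\<^sup>2))"
      using inverse_1_plus_square_integral[of "A/2/4"] a by (auto simp: has_bochner_integral_iff)
    show "AE v in lborel. norm (?f (n + N) v) \<le> 1 / (1 + A / 2 / 4 * v\<^sup>2)" for n
      using sinh_integral_integrand_bound[OF N(1)[of n], of "A/2" "a (n + N)"] N(2)[of n] a by (intro always_eventually allI) auto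
    show "AE v in lborel. (\<lambda>n. ?f (n + N) v) \<longlonglongrightarrow> exp (- (A / 4 * v\<^sup>2))"
    proof (intro always_eventually allI)
      fix v :: real
      let ?s = "\<lambda>n. (sinh (v / (2 * sqrt (real n))))\<^sup>2"
      \<comment> \<open>\<open>max 0\<close> changes at most finitely many terms; it supplies the
        nonnegativity at all indices that \<open>tendsto_one_plus_powr_exp\<close> assumes.\<close>
      have "(\<lambda>n. max 0 (a n) * (real n * ?s n)) \<longlonglongrightarrow> max 0 A * (v\<^sup>2 / 4)"
        by (intro tendsto_mult tendsto_max tendsto_const a(1) sinh_scaled_limit)
      then have "(\<lambda>n. (1 + max 0 (a n) * ?s n) powr (- (real n + 1/2))) \<longlonglongrightarrow> exp (- (max 0 A * (v\<^sup>2 / 4)))"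
        by (intro tendsto_one_plus_powr_exp) (auto simp: mult_ac)
      from LIMSEQ_ignore_initial_segment[OF this, of N]
      show "(\<lambda>n. ?f (n + N) v) \<longlonglongrightarrow> exp (- (A / 4 * v\<^sup>2))"
      proof -
        have "max 0 (a (n + N)) = a (n + N)" for n using N(2)[of n] a(2) by simp
        then show ?thesis using \<open>(\<lambda>n. (1 + max 0 (a (n + N)) * _) powr _) \<longlonglongrightarrow> _\<close> a(2) by simp
      qed
    qed
  qed measurable
  also have "(LINT v|lborel. exp (- (A / 4 * v\<^sup>2))) = sqrt (4 * pi / A)"
    using gauss_integral[of "A/4"] a(2) by (simp add: has_bochner_integral_iff mult.commute)
  finally show ?thesis unfolding sinh_integral_def[symmetric] by (rule LIMSEQ_offset)
qed

text \<open>By cosh u = 1 + 2 sinh^2 (u/2) the quadratic equals (1 + s)^2 (1 + a sinh^2 (u/2)) with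
  a = 4 s / (1 + s)^2.\<close>

lemma cosh_integral_eq_sinh_integral:
  assumes s: "s > 0" and n: "n > 0"
  shows "sqrt (real n) * cosh_integral n s = (1 + s) powr (- (2 * real n + 1)) * sinh_integral n (4 * s / (1 + s)\<^sup>2)"
proof -
  define a where "a = 4 * s / (1 + s)\<^sup>2"
  have a: "a > 0" using s by (simp add: a_def)
  have E: "cosh_quadratic s u = (1 + s)\<^sup>2 * (1 + a * (sinh (u / 2))\<^sup>2)" for u
  proof -
    have "cosh u = 1 + 2 * (sinh (u/2))\<^sup>2"
      using cosh_double[of "u/2"] cosh_square_eq[of "u/2"] by simp
    then have "cosh_quadratic s u = 1 + s\<^sup>2 + 2 * s * (1 + 2 * (sinh (u/2))\<^sup>2)" by (simp add: cosh_quadratic_def)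
    also have "\<dots> = (1 + s)\<^sup>2 * (1 + a * (sinh (u / 2))\<^sup>2)"
    proof -
      have "(1 + s)\<^sup>2 * a = 4 * s" using s by (simp add: a_def)
      then show ?thesis by algebra
    qed
    finally show ?thesis .
  qed
  have p: "cosh_quadratic s u powr (- (real n + 1/2)) = (1 + s) powr (- (2 * real n + 1)) * (1 + a * (sinh (u / 2))\<^sup>2) powr (- (real n + 1/2))" for u
  proof -
    have e: "(1 + s)\<^sup>2 = (1 + s) powr 2" using s by simp
    have "((1 + s)\<^sup>2) powr (- (real n + 1/2)) = (1 + s) powr (- (2 * real n + 1))"
      unfolding e powr_powr by (rule arg_cong[where f = "\<lambda>x. (1 + s) powr x"]) simp
    then show ?thesis unfolding E powr_mult by (simp only:)
  qed
  have "cosh_integral n s = (1 + s) powr (- (2 * real n + 1)) * (LINT u|lborel. (1 + a * (sinh (u / 2))\<^sup>2) powr (- (real n + 1/2)))"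
    unfolding cosh_integral_def p by simp
  also have "(LINT u|lborel. (1 + a * (sinh (u / 2))\<^sup>2) powr (- (real n + 1/2)))
      = \<bar>1 / sqrt (real n)\<bar> *\<^sub>R (LINT v|lborel. (1 + a * (sinh ((0 + 1 / sqrt (real n) * v) / 2))\<^sup>2) powr (- (real n + 1/2)))"
    using n by (intro lborel_integral_real_affine) auto
  also have "\<dots> = 1 / sqrt (real n) * sinh_integral n a"
    unfolding sinh_integral_def by (simp add: mult.commute)
  finally show ?thesis unfolding a_def using n by simp
qed

text \<open>The function \<open>saddle_phase\<close> below attains its maximum \<open>saddle\<^sup>2\<close> on \<open>(0, 1)\<close> at \<open>saddle\<close>, where the
  mass of the integral concentrates.\<close>

definition saddle :: real where "saddle = sqrt 2 - 1"

lemma saddle: "0 < saddle" "saddle < 1" "1 + saddle = sqrt 2" "saddle\<^sup>2 = 1 - 2 * saddle" "1 / saddle = 1 + sqrt 2"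
proof -
  have "sqrt 2 > 1" "sqrt 2 < 2" by (simp_all add: real_less_lsqrt)
  then show "0 < saddle" "saddle < 1" "1 + saddle = sqrt 2" by (auto simp: saddle_def)
  show "saddle\<^sup>2 = 1 - 2 * saddle" by (simp add: saddle_def power2_eq_square algebra_simps)
  have "saddle * (1 + sqrt 2) = 1" by (simp add: saddle_def algebra_simps)
  then show "1 / saddle = 1 + sqrt 2" using \<open>0 < saddle\<close> by (simp add: field_simps)
qed

definition saddle_phase :: "real \<Rightarrow> real" where "saddle_phase s = s * (1 - s) / (1 + s)"

text \<open>Exact, thanks to saddle^2 = 1 - 2 saddle: no Taylor remainder has to be controlled, and
  the same identity yields both the pointwise limit and the Gaussian majorant.\<close>

lemma saddle_phase_eq: assumes "s > 0" shows "saddle_phase s / saddle\<^sup>2 = 1 - (s - saddle)\<^sup>2 / (saddle\<^sup>2 * (1 + s))"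
proof -
  have "saddle_phase s = saddle\<^sup>2 - (s - saddle)\<^sup>2 / (1 + s)"
  proof -
    have "saddle\<^sup>2 * (1 + s) - (s - saddle)\<^sup>2 = s * (1 - s)" using saddle(4) by algebra
    then show ?thesis using assms by (simp add: saddle_phase_def field_simps)
  qed
  then show ?thesis using saddle(1) by (simp add: diff_divide_distrib mult.commute)
qed

lemma saddle_phase_nonneg: "0 \<le> s \<Longrightarrow> s \<le> 1 \<Longrightarrow> saddle_phase s \<ge> 0" by (simp add: saddle_phase_def)

definition laplace_integrand :: "nat \<Rightarrow> real \<Rightarrow> real" where
  "laplace_integrand n w = (let s = saddle + w / sqrt (real n) in
     indicator {0<..<1} s * (2 * (saddle_phase s / saddle\<^sup>2) ^ (2 * n) / (1 + s)\<^sup>2 * (sinh_integral n (4 * s / (1 + s)\<^sup>2))\<^sup>2))"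

text \<open>The power n^(3/2) collects a factor n from the two rescaled cosh integrals and sqrt n
  from s = saddle + w / sqrt n. The factor (1 + sqrt 2)^(4 n) is saddle^(-4 n), the inverse of the
  maximum of \<open>saddle_phase\<close> raised to the power 2 n.\<close>

lemma reduced_integral_eq_laplace_integrand:
  assumes n: "n > 0"
  shows "reduced_integral n * (1 + sqrt 2) ^ (4 * n) * (real n * sqrt (real n)) = (LINT w|lborel. laplace_integrand n w)"
proof -
  let ?f = "\<lambda>s. indicator {0<..<1} s * (2 * (saddle_phase s) ^ (2 * n) / (1 + s)\<^sup>2 * (sinh_integral n (4 * s / (1 + s)\<^sup>2))\<^sup>2 / real n)"
  have f: "indicator {0<..<1} s *\<^sub>R (2 * (s * (1 - s\<^sup>2)) ^ (2 * n) * (cosh_integral n s)\<^sup>2) = ?f s" for s :: real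
  proof (cases "0 < s \<and> s < 1")
    case True
    then have s: "s > 0" "s < 1" by auto
    have "real n * (cosh_integral n s)\<^sup>2 = (sqrt (real n) * cosh_integral n s)\<^sup>2" by (simp add: power_mult_distrib)
    also have "\<dots> = ((1 + s) powr (- (2 * real n + 1)))\<^sup>2 * (sinh_integral n (4 * s / (1 + s)\<^sup>2))\<^sup>2"
      unfolding cosh_integral_eq_sinh_integral[OF s(1) n] by (simp add: power_mult_distrib)
    also have "((1 + s) powr (- (2 * real n + 1)))\<^sup>2 = 1 / ((1 + s) ^ (4 * n) * (1 + s)\<^sup>2)"
    proof -
      have "(1 + s) powr (- (2 * real n + 1)) = 1 / (1 + s) ^ (2 * n + 1)"
      proof -
        have "2 * real n + 1 = real (2 * n + 1)" by simp
        then show ?thesis using s by (simp only: powr_minus_divide powr_realpow)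
      qed
      then show ?thesis by (simp add: power_divide power_mult[symmetric] power_add[symmetric] mult.commute power2_eq_square)
    qed
    finally have 1: "real n * (cosh_integral n s)\<^sup>2 = 1 / ((1 + s) ^ (4 * n) * (1 + s)\<^sup>2) * (sinh_integral n (4 * s / (1 + s)\<^sup>2))\<^sup>2" .
    have 2: "(s * (1 - s\<^sup>2)) ^ (2 * n) / (1 + s) ^ (4 * n) = saddle_phase s ^ (2 * n)"
    proof -
      have "(1 + s) ^ (4 * n) = ((1 + s)\<^sup>2) ^ (2 * n)" by (simp add: power_mult[symmetric])
      then have "(s * (1 - s\<^sup>2)) ^ (2 * n) / (1 + s) ^ (4 * n) = (s * (1 - s\<^sup>2) / (1 + s)\<^sup>2) ^ (2 * n)"
        by (simp add: power_divide)
      also have "s * (1 - s\<^sup>2) / (1 + s)\<^sup>2 = saddle_phase s"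
      proof -
        have "1 - s\<^sup>2 = (1 - s) * (1 + s)" by (simp add: algebra_simps power2_eq_square)
        then show ?thesis using s by (simp add: saddle_phase_def power2_eq_square)
      qed
      finally show ?thesis .
    qed
    have "2 * (s * (1 - s\<^sup>2)) ^ (2 * n) * (cosh_integral n s)\<^sup>2 = 2 * (s * (1 - s\<^sup>2)) ^ (2 * n) * (real n * (cosh_integral n s)\<^sup>2) / real n" using n by simp
    also have "\<dots> = 2 * ((s * (1 - s\<^sup>2)) ^ (2 * n) / (1 + s) ^ (4 * n)) / (1 + s)\<^sup>2 * (sinh_integral n (4 * s / (1 + s)\<^sup>2))\<^sup>2 / real n"
      unfolding 1 by simp
    finally show ?thesis unfolding 2 using s by simp
  qed auto
  have "reduced_integral n = (LINT s|lborel. ?f s)" unfolding reduced_integral_def set_lebesgue_integral_def f ..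
  also have "\<dots> = \<bar>1 / sqrt (real n)\<bar> *\<^sub>R (LINT w|lborel. ?f (saddle + 1 / sqrt (real n) * w))"
    using n by (intro lborel_integral_real_affine) auto
  finally have "reduced_integral n * ((1 + sqrt 2) ^ (4 * n) * (real n * sqrt (real n)))
      = ((1 + sqrt 2) ^ (4 * n) * real n) * (LINT w|lborel. ?f (saddle + 1 / sqrt (real n) * w))"
    using n by simp
  also have "\<dots> = (LINT w|lborel. ((1 + sqrt 2) ^ (4 * n) * real n) * ?f (saddle + 1 / sqrt (real n) * w))"
    by (rule integral_mult_right_zero[symmetric])
  also have "(\<lambda>w. ((1 + sqrt 2) ^ (4 * n) * real n) * ?f (saddle + 1 / sqrt (real n) * w)) = laplace_integrand n"
  proof
    fix w
    have "(1 + sqrt 2) ^ (4 * n) = 1 / (saddle\<^sup>2) ^ (2 * n)"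
      unfolding saddle(5)[symmetric] by (simp add: power_divide power_mult[symmetric])
    then show "((1 + sqrt 2) ^ (4 * n) * real n) * ?f (saddle + 1 / sqrt (real n) * w) = laplace_integrand n w"
      unfolding laplace_integrand_def Let_def using n by (simp add: power_divide mult_ac)
  qed
  finally show ?thesis by (simp add: mult.assoc)
qed

text \<open>The bound on the square of \<open>sinh_integral\<close> is singular like 1/s at 0. One
  factor \<open>saddle_phase s\<close>, which is at most s, absorbs this, and the other 2 n - 1
  factors give the Gaussian by means of 1 + s < 2 and (2 n - 1) / n >= 1.\<close>

lemma laplace_integrand_bound:
  assumes n: "n > 0"
  shows "norm (laplace_integrand n w) \<le> 2 * pi\<^sup>2 / saddle\<^sup>2 * exp (- (1 / (2 * saddle\<^sup>2) * w\<^sup>2))"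
proof -
  define s where "s = saddle + w / sqrt (real n)"
  show ?thesis
  proof (cases "0 < s \<and> s < 1")
    case False
    then show ?thesis unfolding laplace_integrand_def s_def[symmetric] Let_def by (auto intro!: divide_nonneg_pos)
  next
    case True
    then have s: "s > 0" "s < 1" by auto
    define P where "P = saddle_phase s / saddle\<^sup>2"
    have P0: "P \<ge> 0" unfolding P_def using saddle_phase_nonneg s by simp
    have ws: "(s - saddle)\<^sup>2 = w\<^sup>2 / real n" unfolding s_def using n by (simp add: power_divide)
    have P1: "P \<le> exp (- (w\<^sup>2 / real n / (saddle\<^sup>2 * (1 + s))))"
      unfolding P_def saddle_phase_eq[OF s(1)] ws using exp_ge_add_one_self[of "- (w\<^sup>2 / real n / (saddle\<^sup>2 * (1 + s)))"] by simp
    have Pp: "P ^ (2 * n - 1) \<le> exp (- (1 / (2 * saddle\<^sup>2) * w\<^sup>2))"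
    proof -
      have "P ^ (2 * n - 1) \<le> exp (- (w\<^sup>2 / real n / (saddle\<^sup>2 * (1 + s)))) ^ (2 * n - 1)"
        using P0 P1 by (intro power_mono) auto
      also have "\<dots> = exp (- (real (2 * n - 1) / real n * (w\<^sup>2 / (saddle\<^sup>2 * (1 + s)))))"
        by (simp add: exp_of_nat_mult[symmetric] mult_ac)
      also have "\<dots> \<le> exp (- (1 * (w\<^sup>2 / (saddle\<^sup>2 * 2))))"
      proof -
        have "1 \<le> real (2 * n - 1) / real n" using n by (simp add: field_simps)
        moreover have "w\<^sup>2 / (saddle\<^sup>2 * 2) \<le> w\<^sup>2 / (saddle\<^sup>2 * (1 + s))" using s saddle(1) by (intro divide_left_mono mult_left_mono) auto
        ultimately have "1 * (w\<^sup>2 / (saddle\<^sup>2 * 2)) \<le> real (2 * n - 1) / real n * (w\<^sup>2 / (saddle\<^sup>2 * (1 + s)))"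
          by (intro mult_mono) auto
        then show ?thesis by simp
      qed
      finally show ?thesis by (simp add: mult.commute)
    qed
    have h: "(sinh_integral n (4 * s / (1 + s)\<^sup>2))\<^sup>2 \<le> pi\<^sup>2 * (1 + s)\<^sup>2 / s"
    proof -
      have a: "4 * s / (1 + s)\<^sup>2 > 0" using s by simp
      have "(sinh_integral n (4 * s / (1 + s)\<^sup>2))\<^sup>2 \<le> (2 * pi / sqrt (4 * s / (1 + s)\<^sup>2))\<^sup>2"
        by (intro power_mono sinh_integral_bound sinh_integral_nonneg n a)
      also have "\<dots> = pi\<^sup>2 * (1 + s)\<^sup>2 / s"
        using s by (simp add: power_divide power_mult_distrib real_sqrt_pow2 field_simps)
      finally show ?thesis .
    qed
    have Ps: "P \<le> s / saddle\<^sup>2" unfolding P_def saddle_phase_def using s by (intro divide_right_mono) (auto simp: field_simps)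
    have "laplace_integrand n w = 2 * P ^ (2 * n) / (1 + s)\<^sup>2 * (sinh_integral n (4 * s / (1 + s)\<^sup>2))\<^sup>2"
      unfolding laplace_integrand_def s_def[symmetric] Let_def P_def using s by simp
    also have "\<dots> \<le> 2 * P ^ (2 * n) / (1 + s)\<^sup>2 * (pi\<^sup>2 * (1 + s)\<^sup>2 / s)"
      using P0 h by (intro mult_left_mono) auto
    also have "\<dots> = 2 * pi\<^sup>2 * (P ^ (2 * n - 1) * (P / s))"
    proof -
      have "P ^ (2 * n) = P ^ (2 * n - 1) * P" using n by (simp add: power_Suc2[symmetric] del: power_Suc)
      then show ?thesis using s by (simp add: field_simps)
    qed
    also have "\<dots> \<le> 2 * pi\<^sup>2 * (exp (- (1 / (2 * saddle\<^sup>2) * w\<^sup>2)) * (1 / saddle\<^sup>2))"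
    proof -
      have "P / s \<le> 1 / saddle\<^sup>2" using Ps s saddle(1) by (simp add: field_simps)
      then show ?thesis using Pp P0 s by (intro mult_left_mono mult_mono) auto
    qed
    finally have "laplace_integrand n w \<le> 2 * pi\<^sup>2 / saddle\<^sup>2 * exp (- (1 / (2 * saddle\<^sup>2) * w\<^sup>2))" by (simp add: mult_ac)
    moreover have "laplace_integrand n w \<ge> 0" unfolding laplace_integrand_def Let_def by (auto simp: indicator_def)
    ultimately show ?thesis by simp
  qed
qed

lemma sinh_integral_measurable [measurable]: "(\<lambda>a. sinh_integral n a) \<in> borel_measurable borel"
  unfolding sinh_integral_def by measurable

text \<open>The power 2 n doubles the exponent w^2 / (saddle^2 (1 + saddle)) coming from
  \<open>saddle_phase_eq\<close>, and (1 + saddle)^2 = 2 cancels the leading 2 of the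
  integrand.\<close>

lemma laplace_integrand_tendsto: "(\<lambda>n. laplace_integrand n w) \<longlonglongrightarrow> 2 * pi / saddle * exp (- (2 / (saddle\<^sup>2 * sqrt 2) * w\<^sup>2))"
proof -
  let ?s = "\<lambda>n. saddle + w / sqrt (real n)"
  have "(\<lambda>n. w / sqrt (real n)) \<longlonglongrightarrow> 0" by real_asymp
  then have sl: "?s \<longlonglongrightarrow> saddle" using tendsto_add[OF tendsto_const, of "\<lambda>n. w / sqrt (real n)" 0 _ saddle] by simp
  have ev: "\<forall>\<^sub>F n in sequentially. 0 < ?s n \<and> ?s n < 1"
    using order_tendstoD(1)[OF sl saddle(1)] order_tendstoD(2)[OF sl saddle(2)] by eventually_elim auto
  have "(\<lambda>n. sinh_integral n (4 * ?s n / (1 + ?s n)\<^sup>2)) \<longlonglongrightarrow> sqrt (4 * pi / (4 * saddle / (1 + saddle)\<^sup>2))"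
    by (intro sinh_integral_tendsto tendsto_intros sl) (use saddle in auto)
  then have h: "(\<lambda>n. sinh_integral n (4 * ?s n / (1 + ?s n)\<^sup>2)) \<longlonglongrightarrow> sqrt (2 * pi / saddle)"
    using saddle by (simp add: mult.commute)
  have P: "(\<lambda>n. (saddle_phase (?s n) / saddle\<^sup>2) ^ (2 * n)) \<longlonglongrightarrow> exp (- (2 / (saddle\<^sup>2 * sqrt 2) * w\<^sup>2))"
  proof -
    define x where "x n = w\<^sup>2 / (saddle\<^sup>2 * (1 + ?s n))" for n
    have xl: "x \<longlonglongrightarrow> w\<^sup>2 / (saddle\<^sup>2 * (1 + saddle))" unfolding x_def by (intro tendsto_intros sl) (use saddle in auto)
    have "(\<lambda>n. (1 + (- x n) / real n) ^ n) \<longlonglongrightarrow> exp (- (w\<^sup>2 / (saddle\<^sup>2 * (1 + saddle))))"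
    proof -
      have "(\<lambda>n. real n * ln (1 + (- x n) / real n)) \<longlonglongrightarrow> - (w\<^sup>2 / (saddle\<^sup>2 * (1 + saddle)))"
      proof -
        have y0: "(\<lambda>n. (- x n) / real n) \<longlonglongrightarrow> 0"
          using tendsto_mult[OF tendsto_minus[OF xl] lim_inverse_n] by (simp add: divide_inverse)
        have "\<forall>\<^sub>F n in sequentially. \<bar>real n * ln (1 + (- x n) / real n) - (- x n)\<bar> \<le> 2 * (x n)\<^sup>2 / real n"
        proof -
          have "\<forall>\<^sub>F n in sequentially. - 1/2 < (- x n) / real n" "\<forall>\<^sub>F n in sequentially. (- x n) / real n < 1/2"
            using order_tendstoD(1)[OF y0, of "-1/2"] order_tendstoD(2)[OF y0, of "1/2"] by simp_all
          then show ?thesis using eventually_gt_at_top[of 0]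
        proof eventually_elim
          case (elim n)
          then have "\<bar>ln (1 + (- x n) / real n) - (- x n) / real n\<bar> \<le> 2 * ((- x n) / real n)\<^sup>2"
            by (intro abs_ln_one_plus_x_minus_x_bound) linarith
          then have "real n * \<bar>ln (1 + (- x n) / real n) - (- x n) / real n\<bar> \<le> real n * (2 * ((- x n) / real n)\<^sup>2)"
            by (intro mult_left_mono) auto
          moreover have "real n * \<bar>ln (1 + (- x n) / real n) - (- x n) / real n\<bar> = \<bar>real n * ln (1 + (- x n) / real n) - (- x n)\<bar>"
          proof -
            have "real n * \<bar>z - y / real n\<bar> = \<bar>real n * z - y\<bar>" for z y
            proof -
              have "real n * \<bar>z - y / real n\<bar> = \<bar>real n * (z - y / real n)\<bar>" by (simp add: abs_mult)
              also have "real n * (z - y / real n) = real n * z - y" using elim by (simp add: field_simps)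
              finally show ?thesis .
            qed
            then show ?thesis .
          qed
          moreover have "real n * (2 * ((- x n) / real n)\<^sup>2) = 2 * (x n)\<^sup>2 / real n" using elim by (simp add: power2_eq_square)
          ultimately show ?case by simp
        qed
        qed
        moreover have "(\<lambda>n. 2 * (x n)\<^sup>2 / real n) \<longlonglongrightarrow> 0"
          using tendsto_mult[OF tendsto_mult[OF tendsto_const[of 2] tendsto_power[OF xl, of 2]] lim_inverse_n] by (simp add: divide_inverse)
        ultimately have "(\<lambda>n. real n * ln (1 + (- x n) / real n) - (- x n)) \<longlonglongrightarrow> 0"
          by (intro Lim_null_comparison[of "\<lambda>n. real n * ln (1 + (- x n) / real n) - (- x n)" "\<lambda>n. 2 * (x n)\<^sup>2 / real n"]) auto
        from tendsto_add[OF this tendsto_minus[OF xl]] show ?thesis by simp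
      qed
      then have "(\<lambda>n. exp (real n * ln (1 + (- x n) / real n))) \<longlonglongrightarrow> exp (- (w\<^sup>2 / (saddle\<^sup>2 * (1 + saddle))))"
        by (intro tendsto_exp)
      moreover have "\<forall>\<^sub>F n in sequentially. exp (real n * ln (1 + (- x n) / real n)) = (1 + (- x n) / real n) ^ n"
      proof -
        have y0: "(\<lambda>n. (- x n) / real n) \<longlonglongrightarrow> 0"
          using tendsto_mult[OF tendsto_minus[OF xl] lim_inverse_n] by (simp add: divide_inverse)
        have "\<forall>\<^sub>F n in sequentially. - 1 < (- x n) / real n" using order_tendstoD(1)[OF y0, of "-1"] by simp
        then show ?thesis by eventually_elim (simp add: exp_of_nat_mult)
      qed
      ultimately show ?thesis by (simp add: tendsto_cong)
    qed
    then have "(\<lambda>n. ((1 + (- x n) / real n) ^ n)\<^sup>2) \<longlonglongrightarrow> (exp (- (w\<^sup>2 / (saddle\<^sup>2 * (1 + saddle)))))\<^sup>2" by (intro tendsto_intros)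
    also have "(exp (- (w\<^sup>2 / (saddle\<^sup>2 * (1 + saddle)))))\<^sup>2 = exp (- (2 / (saddle\<^sup>2 * sqrt 2) * w\<^sup>2))"
      unfolding saddle(3) by (simp add: exp_double[symmetric] mult.commute)
    finally show ?thesis
    proof (rule Lim_transform_eventually)
      show "\<forall>\<^sub>F n in sequentially. ((1 + (- x n) / real n) ^ n)\<^sup>2 = (saddle_phase (?s n) / saddle\<^sup>2) ^ (2 * n)"
        using ev eventually_gt_at_top[of 0]
      proof eventually_elim
        case (elim n)
        have "saddle_phase (?s n) / saddle\<^sup>2 = 1 + (- x n) / real n"
          using saddle_phase_eq[of "?s n"] elim by (simp add: x_def power_divide)
        then show ?case by (simp add: power_mult[symmetric] mult.commute)
      qed
    qed
  qed
  have "(\<lambda>n. 2 * (saddle_phase (?s n) / saddle\<^sup>2) ^ (2 * n) / (1 + ?s n)\<^sup>2 * (sinh_integral n (4 * ?s n / (1 + ?s n)\<^sup>2))\<^sup>2)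
     \<longlonglongrightarrow> 2 * exp (- (2 / (saddle\<^sup>2 * sqrt 2) * w\<^sup>2)) / (1 + saddle)\<^sup>2 * (sqrt (2 * pi / saddle))\<^sup>2"
    by (intro tendsto_intros P h sl) (use saddle in auto)
  also have "2 * exp (- (2 / (saddle\<^sup>2 * sqrt 2) * w\<^sup>2)) / (1 + saddle)\<^sup>2 * (sqrt (2 * pi / saddle))\<^sup>2 = 2 * pi / saddle * exp (- (2 / (saddle\<^sup>2 * sqrt 2) * w\<^sup>2))"
    using saddle by simp
  finally show ?thesis
  proof (rule Lim_transform_eventually)
    show "\<forall>\<^sub>F n in sequentially. 2 * (saddle_phase (?s n) / saddle\<^sup>2) ^ (2 * n) / (1 + ?s n)\<^sup>2 * (sinh_integral n (4 * ?s n / (1 + ?s n)\<^sup>2))\<^sup>2 = laplace_integrand n w"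
      using ev by eventually_elim (simp add: laplace_integrand_def Let_def)
  qed
qed

text \<open>The Gaussian integral of the limit in \<open>laplace_integrand_tendsto\<close>. The two
  occurrences of \<open>saddle\<close> cancel, and only the square 2 sqrt 2 pi^3 enters the error
  term.\<close>

definition asymp_const :: real where "asymp_const = 2 * pi / saddle * sqrt (pi / (2 / (saddle\<^sup>2 * sqrt 2)))"

lemma asymp_const: "asymp_const > 0" "asymp_const\<^sup>2 = 2 * sqrt 2 * pi ^ 3"
proof -
  show "asymp_const > 0" using saddle(1) by (simp add: asymp_const_def)
  have "asymp_const\<^sup>2 = (2 * pi / saddle)\<^sup>2 * (pi / (2 / (saddle\<^sup>2 * sqrt 2)))"
    unfolding asymp_const_def power_mult_distrib[of _ "sqrt _"] using saddle(1) by simp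
  also have "\<dots> = 2 * sqrt 2 * pi ^ 3" using saddle(1) by (simp add: power_divide power_mult_distrib power2_eq_square power3_eq_cube field_simps)
  finally show "asymp_const\<^sup>2 = 2 * sqrt 2 * pi ^ 3" .
qed

lemma reduced_integral_asymptotics: "(\<lambda>n. reduced_integral n * (1 + sqrt 2) ^ (4 * n) * (real n * sqrt (real n))) \<longlonglongrightarrow> asymp_const"
proof -
  have g: "has_bochner_integral lborel (\<lambda>w. exp (- (c * w\<^sup>2))) (sqrt (pi / c))" if "c > 0" for c :: real
    using gauss_integral[OF that] .
  have "(\<lambda>n. LINT w|lborel. laplace_integrand (Suc n) w) \<longlonglongrightarrow> (LINT w|lborel. 2 * pi / saddle * exp (- (2 / (saddle\<^sup>2 * sqrt 2) * w\<^sup>2)))"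
  proof (rule integral_dominated_convergence[where w = "\<lambda>w. 2 * pi\<^sup>2 / saddle\<^sup>2 * exp (- (1 / (2 * saddle\<^sup>2) * w\<^sup>2))"])
    show "integrable lborel (\<lambda>w. 2 * pi\<^sup>2 / saddle\<^sup>2 * exp (- (1 / (2 * saddle\<^sup>2) * w\<^sup>2)))"
      using g[of "1 / (2 * saddle\<^sup>2)"] saddle(1) by (intro integrable_mult_right) (auto simp: has_bochner_integral_iff)
    show "AE w in lborel. (\<lambda>n. laplace_integrand (Suc n) w) \<longlonglongrightarrow> 2 * pi / saddle * exp (- (2 / (saddle\<^sup>2 * sqrt 2) * w\<^sup>2))"
      using LIMSEQ_Suc[OF laplace_integrand_tendsto] by (intro always_eventually allI)
    show "AE w in lborel. norm (laplace_integrand (Suc n) w) \<le> 2 * pi\<^sup>2 / saddle\<^sup>2 * exp (- (1 / (2 * saddle\<^sup>2) * w\<^sup>2))" for n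
      using laplace_integrand_bound[of "Suc n"] by (intro always_eventually allI) simp
    show "laplace_integrand (Suc n) \<in> borel_measurable lborel" for n
      unfolding laplace_integrand_def Let_def saddle_phase_def by measurable
  qed measurable
  also have "(LINT w|lborel. 2 * pi / saddle * exp (- (2 / (saddle\<^sup>2 * sqrt 2) * w\<^sup>2))) = asymp_const"
    using g[of "2 / (saddle\<^sup>2 * sqrt 2)"] saddle(1) by (simp add: asymp_const_def has_bochner_integral_iff)
  also have "(\<lambda>n. LINT w|lborel. laplace_integrand (Suc n) w) = (\<lambda>n. reduced_integral (Suc n) * (1 + sqrt 2) ^ (4 * Suc n) * (real (Suc n) * sqrt (real (Suc n))))"
    by (intro ext, rule reduced_integral_eq_laplace_integrand[symmetric]) simp
  finally show ?thesis by (rule LIMSEQ_imp_Suc)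
qed

section \<open>Strict positivity of the integrals\<close>

lemma not_AE_notin_Ioo: "\<not> (AE s::real in lborel. s \<notin> {0<..<1})"
proof
  assume "AE s::real in lborel. s \<notin> {0<..<1}"
  then have "emeasure lborel {0<..<1::real} = 0"
  proof -
    have eq: "{s \<in> space lborel. \<not> s \<notin> {0<..<1::real}} = {0<..<1}" by auto
    show ?thesis using AE_iff_measurable[OF _ eq] \<open>AE s in lborel. s \<notin> {0<..<1::real}\<close> by simp
  qed
  then show False by simp
qed

lemma cosh_integral_pos: assumes "s > 0" shows "cosh_integral n s > 0"
proof -
  have "cosh_integral n s \<noteq> 0"
  proof
    assume "cosh_integral n s = 0"
    then have "AE u in lborel. cosh_quadratic s u powr (- (real n + 1/2)) = 0"
      unfolding cosh_integral_def using cosh_quadratic_powr_integrable[OF assms, of "real n + 1/2"]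
      by (subst (asm) integral_nonneg_eq_0_iff_AE) auto
    moreover have "cosh_quadratic s u powr (- (real n + 1/2)) \<noteq> 0" for u using cosh_quadratic_ge(3)[OF assms, of u] by simp
    ultimately have "AE u::real in lborel. False" by simp
    then have "AE u::real in lborel. u \<notin> {0<..<1}" by eventually_elim simp
    then show False using not_AE_notin_Ioo by blast
  qed
  then show ?thesis using cosh_integral_nonneg[of n s] by simp
qed

text \<open>Positivity at every n allows division by this solution of the recurrence; it also gives
  omega_+ > 0 and makes the quotients studied for the continued fraction increase.\<close>

lemma reduced_integral_pos: "reduced_integral n > 0"
proof -
  let ?f = "\<lambda>s. indicator {0<..<1} s *\<^sub>R (2 * (s * (1 - s\<^sup>2)) ^ (2 * n) * (cosh_integral n s)\<^sup>2)"
  have pos: "2 * (s * (1 - s\<^sup>2)) ^ (2 * n) * (cosh_integral n s)\<^sup>2 > 0" if "0 < s" "s < 1" for s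
    using cosh_integral_pos[OF that(1), of n] that by (simp add: power_less_one_iff)
  have nonneg: "?f s \<ge> 0" for s using pos[of s] by (auto simp: indicator_def)
  have "reduced_integral n \<ge> 0" unfolding reduced_integral_def set_lebesgue_integral_def by (intro Bochner_Integration.integral_nonneg nonneg)
  moreover have "reduced_integral n \<noteq> 0"
  proof
    assume "reduced_integral n = 0"
    then have "AE s in lborel. ?f s = 0"
      unfolding reduced_integral_def set_lebesgue_integral_def using reduced_integral_integrable[of n] nonneg
      by (subst (asm) integral_nonneg_eq_0_iff_AE) (auto simp: set_integrable_def)
    then have "AE s::real in lborel. s \<notin> {0<..<1}"
    proof eventually_elim
      case (elim s)
      show ?case
      proof
        assume "s \<in> {0<..<1}"
        then have "2 * (s * (1 - s\<^sup>2)) ^ (2 * n) * (cosh_integral n s)\<^sup>2 = 0"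
          using elim by (simp only: indicator_simps(1) scaleR_one)
        with pos[of s] \<open>s \<in> {0<..<1}\<close> show False by auto
      qed
    qed
    then show False using not_AE_notin_Ioo by blast
  qed
  ultimately show ?thesis by simp
qed

section \<open>The triple integral\<close>

text \<open>Bridge between extended nonnegative integrals, for which Tonelli's theorem applies
  freely, and absolute integrability, in terms of which the change of variables theorem is
  formulated.\<close>

lemma nn_set_integral_eq_iff_absolutely_integrable:
  fixes h :: "real \<Rightarrow> real"
  assumes S: "S \<in> sets borel" and meas: "(\<lambda>x. indicator S x * h x) \<in> borel_measurable borel"
    and nonneg: "\<And>x. x \<in> S \<Longrightarrow> h x \<ge> 0" and r: "r \<ge> 0"
  shows "(\<integral>\<^sup>+x\<in>S. ennreal (h x) \<partial>lborel) = ennreal r \<longleftrightarrow> h absolutely_integrable_on S \<and> integral S h = r"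
proof -
  let ?H = "\<lambda>x. indicator S x * h x"
  have "(\<integral>\<^sup>+x\<in>S. ennreal (h x) \<partial>lborel) = (\<integral>\<^sup>+x. ennreal (?H x) \<partial>lborel)"
    by (intro nn_integral_cong) (auto split: split_indicator)
  also have "\<dots> = (\<integral>\<^sup>+x. ennreal (?H x) \<partial>lebesgue)" by (simp add: nn_integral_completion)
  also have "\<dots> = ennreal r \<longleftrightarrow> (?H has_integral r) UNIV"
  proof -
    have "?H x \<ge> 0" for x using nonneg[of x] by (auto split: split_indicator)
    moreover have "?H \<in> lebesgue \<rightarrow>\<^sub>M borel" using meas by (intro measurable_completion) simp
    ultimately show ?thesis using has_integral_iff_nn_integral_lebesgue[of ?H r] r by auto
  qed
  also have "?H = (\<lambda>x. if x \<in> S then h x else 0)" by (auto split: split_indicator)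
  also have "(\<dots> has_integral r) UNIV \<longleftrightarrow> (h has_integral r) S" by (rule has_integral_restrict_UNIV)
  also have "\<dots> \<longleftrightarrow> h absolutely_integrable_on S \<and> integral S h = r"
    using nonnegative_absolutely_integrable_1[of h S] nonneg set_lebesgue_integral_eq_integral(1)[of S h]
    by (auto simp: has_integral_iff)
  finally show ?thesis .
qed

text \<open>The theorem for absolutely integrable functions shows that one side equals a given
  finite value exactly when the other does; hence both are infinite together. In this form a
  substitution can be made before finiteness is known.\<close>

lemma nn_integral_change_of_variables:
  fixes f g g' :: "real \<Rightarrow> real"
  assumes S: "S \<in> sets borel" "g ` S \<in> sets borel"
    and der: "\<And>x. x \<in> S \<Longrightarrow> (g has_real_derivative g' x) (at x within S)" and inj: "inj_on g S"
    and f: "(\<lambda>x. indicator (g ` S) x * f x) \<in> borel_measurable borel" "\<And>x. x \<in> S \<Longrightarrow> f (g x) \<ge> 0"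
    and fg: "(\<lambda>x. indicator S x * (\<bar>g' x\<bar> * f (g x))) \<in> borel_measurable borel"
  shows "(\<integral>\<^sup>+x\<in>g ` S. ennreal (f x) \<partial>lborel) = (\<integral>\<^sup>+x\<in>S. ennreal (\<bar>g' x\<bar> * f (g x)) \<partial>lborel)"
proof -
  have iff: "(\<integral>\<^sup>+x\<in>g ` S. ennreal (f x) \<partial>lborel) = ennreal r \<longleftrightarrow> (\<integral>\<^sup>+x\<in>S. ennreal (\<bar>g' x\<bar> * f (g x)) \<partial>lborel) = ennreal r"
    if "r \<ge> 0" for r
    using has_absolute_integral_change_of_variables_1'[of S g g' f r] assms that
    by (subst (1 2) nn_set_integral_eq_iff_absolutely_integrable) auto
  show ?thesis
  proof (cases "(\<integral>\<^sup>+x\<in>S. ennreal (\<bar>g' x\<bar> * f (g x)) \<partial>lborel)")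
    case (real r)
    then show ?thesis using iff[of r] by simp
  next
    case top
    show ?thesis
    proof (cases "(\<integral>\<^sup>+x\<in>g ` S. ennreal (f x) \<partial>lborel)")
      case (real r)
      then show ?thesis using iff[of r] by simp
    qed (use top in simp)
  qed
qed

lemma borel_measurable_indicator_times_continuous_on:
  fixes f :: "real \<Rightarrow> real"
  assumes "S \<in> sets borel" "continuous_on S f"
  shows "(\<lambda>x. indicator S x * f x) \<in> borel_measurable borel"
  using borel_measurable_continuous_on_indicator[OF assms] by simp

text \<open>The indicator is part of the weight, so that all integrals run over the whole line and
  affine substitutions need no bookkeeping of domains.\<close>

definition beta_weight :: "nat \<Rightarrow> real \<Rightarrow> real" where
  "beta_weight n x = indicator {0<..<1} x * (x powr (real n - 1/2) * (1 - x) powr (real n - 1/2))"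

lemma beta_weight_measurable [measurable]: "beta_weight n \<in> borel_measurable borel"
  unfolding beta_weight_def by measurable

lemma beta_weight_nonneg: "beta_weight n x \<ge> 0" by (simp add: beta_weight_def)

text \<open>The inner integral over z of the triple integral, with c in the place of the product x
  y.\<close>

definition beta_integral :: "nat \<Rightarrow> real \<Rightarrow> ennreal" where
  "beta_integral n c = (\<integral>\<^sup>+z. ennreal (beta_weight n z / (1 - (1 - c) * z) powr (real n + 1/2)) \<partial>lborel)"

lemma beta_integral_measurable [measurable]: "beta_integral n \<in> borel_measurable borel"
  unfolding beta_integral_def by measurable

text \<open>Substitution z = exp u / (exp u + s). Since z (1 - z) equals dz/du, the integrand
  becomes a p-th power, p = n + 1/2, of z (1 - z) / (1 - (1 - s^2) z), and this quotient is 1 /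
  \<open>cosh_quadratic s u\<close>.\<close>

lemma beta_integral_eq_cosh_integral:
  assumes s: "0 < s" "s \<le> 1"
  shows "beta_integral n (s\<^sup>2) = ennreal (cosh_integral n s)"
proof -
  define p where "p = real n + 1/2"
  let ?g = "\<lambda>u::real. exp u / (exp u + s)" and ?g' = "\<lambda>u. s * exp u / (exp u + s)\<^sup>2"
  let ?f = "\<lambda>z. z powr (p - 1) * (1 - z) powr (p - 1) / (1 - (1 - s\<^sup>2) * z) powr p"
  have pos: "exp u + s > 0" for u :: real using s by (simp add: add_pos_pos)
  have img: "?g ` UNIV = {0<..<1}"
  proof
    show "?g ` UNIV \<subseteq> {0<..<1}" using s by (auto simp: add_pos_pos divide_less_eq)
    show "{0<..<1} \<subseteq> ?g ` UNIV"
    proof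
      fix z :: real assume z: "z \<in> {0<..<1}"
      have "exp (ln (s * z / (1 - z))) = s * z / (1 - z)" using z s by (intro exp_ln) auto
      moreover have "s * z / (1 - z) + s = s / (1 - z)" using z by (simp add: field_simps)
      ultimately have "?g (ln (s * z / (1 - z))) = z" using z s by simp
      then show "z \<in> ?g ` UNIV" by (intro image_eqI[of _ _ "ln (s * z / (1 - z))"]) simp_all
    qed
  qed
  have D: "1 - (1 - s\<^sup>2) * z > 0" if "z \<in> {0<..<1}" for z
  proof -
    have "1 - (1 - s\<^sup>2) * z = (1 - z) + s\<^sup>2 * z" by algebra
    moreover have "s\<^sup>2 * z > 0" "1 - z > 0" using that s by auto
    ultimately show ?thesis by linarith
  qed
  have "beta_integral n (s\<^sup>2) = (\<integral>\<^sup>+z\<in>?g ` UNIV. ennreal (?f z) \<partial>lborel)"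
    unfolding beta_integral_def img beta_weight_def by (intro nn_integral_cong) (auto simp: p_def split: split_indicator)
  also have "\<dots> = (\<integral>\<^sup>+u\<in>UNIV. ennreal (\<bar>?g' u\<bar> * ?f (?g u)) \<partial>lborel)"
  proof (rule nn_integral_change_of_variables)
    show "?g ` UNIV \<in> sets borel" unfolding img by simp
    show "(?g has_real_derivative ?g' u) (at u within UNIV)" for u
      using pos[of u] by (auto intro!: derivative_eq_intros simp: power2_eq_square field_simps)
    show "inj ?g"
    proof (rule injI)
      fix u v assume "?g u = ?g v"
      then have "exp u * (exp v + s) = exp v * (exp u + s)" using pos[of u] pos[of v] by (simp add: frac_eq_eq)
      then have "s * exp u = s * exp v" by (simp add: algebra_simps)
      then show "u = v" using s by simp
    qed
    show "(\<lambda>x. indicator (range ?g) x * ?f x) \<in> borel_measurable borel"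
      unfolding img by measurable
    show "(\<lambda>x. indicator UNIV x * (\<bar>?g' x\<bar> * ?f (?g x))) \<in> borel_measurable borel"
      by measurable
  qed auto
  also have "\<dots> = (\<integral>\<^sup>+u. ennreal (cosh_quadratic s u powr (-p)) \<partial>lborel)"
  proof (intro nn_integral_cong)
    fix u :: real
    define e where "e = exp u"
    have e: "e > 0" by (simp add: e_def)
    define W where "W = s * e / (e + s)\<^sup>2"
    have W: "W > 0" using e s by (simp add: W_def)
    have 1: "1 - ?g u = s / (e + s)" using e s by (simp add: e_def[symmetric] field_simps)
    have 2: "1 - (1 - s\<^sup>2) * ?g u = s * (1 + s * e) / (e + s)" using e s by (simp add: e_def[symmetric] field_simps power2_eq_square)
    have E: "cosh_quadratic s u * e = (e + s) * (1 + s * e)"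
    proof -
      have "2 * cosh u * e = e * e + 1"
      proof -
        have "exp (- u) * e = 1" by (simp add: e_def exp_minus)
        then show ?thesis unfolding cosh_def by (simp add: e_def[symmetric] algebra_simps)
      qed
      then show ?thesis unfolding cosh_quadratic_def by algebra
    qed
    have "\<bar>?g' u\<bar> * ?f (?g u) = W * (((?g u) * (1 - ?g u)) powr (p - 1) / (1 - (1 - s\<^sup>2) * ?g u) powr p)"
    proof -
      have "\<bar>?g' u\<bar> = W" using W unfolding W_def e_def by (simp only: abs_of_pos)
      then show ?thesis unfolding powr_mult by (simp only: times_divide_eq_right)
    qed
    also have "(?g u) * (1 - ?g u) = W" unfolding 1 W_def by (simp add: e_def power2_eq_square)
    also have "W * (W powr (p - 1) / (1 - (1 - s\<^sup>2) * ?g u) powr p) = (W / (1 - (1 - s\<^sup>2) * ?g u)) powr p"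
      using W by (simp add: powr_divide powr_diff)
    also have "W / (1 - (1 - s\<^sup>2) * ?g u) = 1 / cosh_quadratic s u"
    proof -
      have "W / (1 - (1 - s\<^sup>2) * ?g u) = e / ((e + s) * (1 + s * e))"
      proof -
        have "s * e / D\<^sup>2 / (s * F / D) = e / (D * F)" if "D \<noteq> 0" "F \<noteq> 0" for D F
          using that s by (simp add: power2_eq_square)
        then show ?thesis unfolding 2 W_def using e s by (metis add_pos_pos less_irrefl mult_pos_pos zero_less_one)
      qed
      also have "\<dots> = 1 / cosh_quadratic s u" unfolding E[symmetric] using e by simp
      finally show ?thesis .
    qed
    also have "(1 / cosh_quadratic s u) powr p = cosh_quadratic s u powr (-p)"
      by (simp add: powr_minus_divide powr_divide)
    finally show "ennreal (\<bar>?g' u\<bar> * ?f (?g u)) * indicator UNIV u = ennreal (cosh_quadratic s u powr (-p))" by simp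
  qed
  also have "\<dots> = ennreal (cosh_integral n s)"
    unfolding cosh_integral_def p_def by (intro nn_integral_eq_integral cosh_quadratic_powr_integrable) (use s in auto)
  finally show ?thesis .
qed

text \<open>The origin of the square in \<open>reduced_integral\<close>: integrating over x with the
  product c = x y fixed and putting x = 1 - (1 - c) z yields, up to an elementary factor, the same
  beta integral that the integration over z has produced.\<close>

lemma beta_weight_conv_integral:
  assumes c: "0 < c" "c < 1"
  shows "(\<integral>\<^sup>+x. ennreal (beta_weight n x * beta_weight n (c / x) / x) \<partial>lborel) = ennreal (c powr (real n - 1/2) * (1 - c) ^ (2 * n)) * beta_integral n c"
proof -
  define m where "m = real n - 1/2"
  have "(\<integral>\<^sup>+x. ennreal (beta_weight n x * beta_weight n (c / x) / x) \<partial>lborel)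
     = ennreal \<bar>-(1 - c)\<bar> * (\<integral>\<^sup>+z. ennreal (beta_weight n (1 + (-(1 - c)) * z) * beta_weight n (c / (1 + (-(1 - c)) * z)) / (1 + (-(1 - c)) * z)) \<partial>lborel)"
    using c by (intro nn_integral_real_affine) auto
  also have "\<dots> = (\<integral>\<^sup>+z. ennreal (1 - c) * ennreal (beta_weight n (1 - (1 - c) * z) * beta_weight n (c / (1 - (1 - c) * z)) / (1 - (1 - c) * z)) \<partial>lborel)"
  proof -
    have e: "1 + (-(1 - c)) * z = 1 - (1 - c) * z" for z by (simp add: algebra_simps)
    have e2: "\<bar>-(1 - c)\<bar> = 1 - c" using c by simp
    show ?thesis unfolding e e2 by (intro nn_integral_cmult[symmetric]) measurable
  qed
  also have "\<dots> = (\<integral>\<^sup>+z. ennreal (c powr m * (1 - c) ^ (2 * n)) * ennreal (beta_weight n z / (1 - (1 - c) * z) powr (real n + 1/2)) \<partial>lborel)"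
  proof (intro nn_integral_cong)
    fix z :: real
    define x where "x = 1 - (1 - c) * z"
    have x: "1 - x = (1 - c) * z" "x - c = (1 - c) * (1 - z)" by (auto simp: x_def algebra_simps)
    show "ennreal (1 - c) * ennreal (beta_weight n (1 - (1 - c) * z) * beta_weight n (c / (1 - (1 - c) * z)) / (1 - (1 - c) * z))
      = ennreal (c powr m * (1 - c) ^ (2 * n)) * ennreal (beta_weight n z / (1 - (1 - c) * z) powr (real n + 1/2))"
      unfolding x_def[symmetric]
    proof (cases "0 < z \<and> z < 1")
      case True
      have xc: "c < x" "x < 1"
        using x True c by (smt (verit) mult_pos_pos)+
      have x0: "x > 0" using xc c by simp
      have "(1 - c) * (beta_weight n x * beta_weight n (c / x) / x) = (1 - c) * ((x * (1 - x) * ((c / x) * (1 - c / x))) powr m) / x"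
      proof -
        have e: "beta_weight n x = x powr m * (1 - x) powr m" "beta_weight n (c / x) = (c / x) powr m * (1 - c / x) powr m"
          using xc x0 c by (auto simp: beta_weight_def m_def)
        show ?thesis unfolding e powr_mult by (simp only: mult_ac times_divide_eq_right)
      qed
      also have "x * (1 - x) * ((c / x) * (1 - c / x)) = c * ((1 - c)\<^sup>2 * (z * (1 - z))) / x"
      proof -
        have "x * (1 - x) * ((c / x) * (1 - c / x)) = c * ((1 - x) * (x - c)) / x" using x0 by (simp add: field_simps)
        then show ?thesis unfolding x by (simp add: power2_eq_square mult_ac)
      qed
      also have "(1 - c) * ((c * ((1 - c)\<^sup>2 * (z * (1 - z))) / x) powr m) / x
         = c powr m * ((1 - c) * ((1 - c)\<^sup>2) powr m) * ((z * (1 - z)) powr m) / (x powr m * x)"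
        by (simp add: powr_mult powr_divide mult_ac)
      also have "x powr m * x = x powr (real n + 1/2)" using x0 powr_add[of x m 1] by (simp add: m_def add.commute)
      also have "(1 - c) * ((1 - c)\<^sup>2) powr m = (1 - c) ^ (2 * n)"
      proof -
        have e: "(1 - c)\<^sup>2 = (1 - c) powr 2" using c by simp
        have "(1 - c) * ((1 - c)\<^sup>2) powr m = (1 - c) powr 1 * (1 - c) powr (2 * m)"
          unfolding e powr_powr using c by simp
        also have "\<dots> = (1 - c) powr (real (2 * n))" unfolding powr_add[symmetric] m_def by simp
        also have "\<dots> = (1 - c) ^ (2 * n)" using c by (intro powr_realpow) auto
        finally show ?thesis .
      qed
      also have "(z * (1 - z)) powr m = beta_weight n z" using True by (simp add: beta_weight_def m_def powr_mult)
      finally have eq: "(1 - c) * (beta_weight n x * beta_weight n (c / x) / x) = c powr m * (1 - c) ^ (2 * n) * beta_weight n z / x powr (real n + 1/2)" .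
      show "ennreal (1 - c) * ennreal (beta_weight n x * beta_weight n (c / x) / x) = ennreal (c powr m * (1 - c) ^ (2 * n)) * ennreal (beta_weight n z / x powr (real n + 1/2))"
        using eq c x0 by (simp add: ennreal_mult'[symmetric] beta_weight_nonneg)
    next
      case False
      have "beta_weight n x = 0 \<or> beta_weight n (c / x) = 0"
      proof (cases "z \<le> 0")
        case True
        then have "1 - x \<le> 0" unfolding x using c by (simp add: mult_nonneg_nonpos)
        then show ?thesis by (simp add: beta_weight_def)
      next
        case f: False
        then have "z \<ge> 1" using False by simp
        then have "x - c \<le> 0" unfolding x using c by (simp add: mult_nonneg_nonpos)
        then have "x \<le> 0 \<or> c / x \<ge> 1" by (cases "x > 0") auto
        then show ?thesis by (auto simp: beta_weight_def)
      qed
      moreover have "beta_weight n z = 0" using False by (auto simp: beta_weight_def)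
      ultimately show "ennreal (1 - c) * ennreal (beta_weight n x * beta_weight n (c / x) / x) = ennreal (c powr m * (1 - c) ^ (2 * n)) * ennreal (beta_weight n z / x powr (real n + 1/2))"
        by auto
    qed
  qed
  also have "\<dots> = ennreal (c powr m * (1 - c) ^ (2 * n)) * beta_integral n c"
    unfolding beta_integral_def by (intro nn_integral_cmult) measurable
  finally show ?thesis unfolding m_def .
qed

text \<open>The chain runs through extended nonnegative integrals, so every interchange is free;
  finiteness enters only at its end, with \<open>reduced_integral_integrable\<close>.\<close>

lemma I3_eq_reduced_integral: "I3 n = reduced_integral n"
proof -
  define m where "m = real n - 1/2"
  define p where "p = real n + 1/2"
  let ?F = "\<lambda>x y z. beta_weight n x * beta_weight n y * beta_weight n z / (1 - (1 - x * y) * z) powr p"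
  let ?S = "{0..1} \<times> {0..1} \<times> {0..1} :: (real \<times> real \<times> real) set"
  let ?T = "\<integral>\<^sup>+x. \<integral>\<^sup>+y. \<integral>\<^sup>+z. ennreal (?F x y z) \<partial>lborel \<partial>lborel \<partial>lborel"
  have F: "indicator ?S (x, y, z) *\<^sub>R ((x powr (real n - 1/2) * (1 - x) powr (real n - 1/2) *
        y powr (real n - 1/2) * (1 - y) powr (real n - 1/2) *
        z powr (real n - 1/2) * (1 - z) powr (real n - 1/2)) /
       (1 - (1 - x * y) * z) powr (real n + 1/2)) = ?F x y z" for x y z :: real
  proof -
    \<comment> \<open>At t = 0 and t = 1 one factor is a power of 0, and \<open>powr\<close> gives 0
      there for every exponent, even the negative one at n = 0. So the closed cube may be replaced
      by the open one.\<close>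
    have a: "indicator {0..1} t * (t powr (real n - 1/2) * (1 - t) powr (real n - 1/2)) = beta_weight n t" for t :: real
      by (cases "t = 0 \<or> t = 1") (auto simp: beta_weight_def split: split_indicator)
    have "indicator ?S (x, y, z) = (indicator {0..1} x * indicator {0..1} y * indicator {0..1} z :: real)"
      by (auto split: split_indicator)
    then show ?thesis unfolding a[symmetric] p_def by (simp add: mult_ac)
  qed
  have I3: "I3 n = (LINT v|lborel. (case v of (x, y, z) \<Rightarrow> ?F x y z))"
    unfolding I3_def set_lebesgue_integral_def by (intro Bochner_Integration.integral_cong) (auto simp: F[symmetric])
  have meas3: "(\<lambda>v. case v of (x, y, z) \<Rightarrow> ?F x y z) \<in> borel_measurable (borel \<Otimes>\<^sub>M borel \<Otimes>\<^sub>M borel)" by measurable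
  have "I3 n = enn2real (\<integral>\<^sup>+v. ennreal (case v of (x, y, z) \<Rightarrow> ?F x y z) \<partial>(lborel :: (real \<times> real \<times> real) measure))"
    unfolding I3 using meas3 by (intro integral_eq_nn_integral) (auto simp: borel_prod beta_weight_nonneg)
  also have "(\<integral>\<^sup>+v. ennreal (case v of (x, y, z) \<Rightarrow> ?F x y z) \<partial>(lborel :: (real \<times> real \<times> real) measure))
     = (\<integral>\<^sup>+v. ennreal (case v of (x, y, z) \<Rightarrow> ?F x y z) \<partial>(lborel \<Otimes>\<^sub>M (lborel \<Otimes>\<^sub>M lborel)))"
    by (simp add: lborel_prod)
  also have "\<dots> = (\<integral>\<^sup>+x. \<integral>\<^sup>+w. ennreal (case w of (y, z) \<Rightarrow> ?F x y z) \<partial>(lborel \<Otimes>\<^sub>M lborel) \<partial>lborel)"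
    by (subst sigma_finite_measure.nn_integral_fst[symmetric])
       (use meas3 in \<open>auto simp: lborel_prod intro: lborel.sigma_finite_measure_axioms cong: measurable_cong_sets\<close>)
  also have "\<dots> = ?T"
    by (subst lborel.nn_integral_fst[symmetric]) auto
  also have "?T = (\<integral>\<^sup>+x. \<integral>\<^sup>+y. ennreal (beta_weight n x * beta_weight n y) * beta_integral n (x * y) \<partial>lborel \<partial>lborel)"
  proof (intro nn_integral_cong)
    fix x y :: real
    have "(\<integral>\<^sup>+z. ennreal (?F x y z) \<partial>lborel) = (\<integral>\<^sup>+z. ennreal (beta_weight n x * beta_weight n y) * ennreal (beta_weight n z / (1 - (1 - x * y) * z) powr p) \<partial>lborel)"
      by (intro nn_integral_cong) (simp add: ennreal_mult'[symmetric] beta_weight_nonneg)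
    also have "\<dots> = ennreal (beta_weight n x * beta_weight n y) * beta_integral n (x * y)"
      unfolding beta_integral_def p_def by (intro nn_integral_cmult) measurable
    finally show "(\<integral>\<^sup>+z. ennreal (?F x y z) \<partial>lborel) = ennreal (beta_weight n x * beta_weight n y) * beta_integral n (x * y)" .
  qed
  \<comment> \<open>Substitution y = c / x in the inner integral; for x <= 0 both sides vanish with
    the weight.\<close>
  also have "\<dots> = (\<integral>\<^sup>+x. \<integral>\<^sup>+c. ennreal (beta_weight n x * beta_weight n (c / x) / x) * beta_integral n c \<partial>lborel \<partial>lborel)"
  proof (rule nn_integral_cong)
    fix x :: real
    show "(\<integral>\<^sup>+y. ennreal (beta_weight n x * beta_weight n y) * beta_integral n (x * y) \<partial>lborel) = (\<integral>\<^sup>+c. ennreal (beta_weight n x * beta_weight n (c / x) / x) * beta_integral n c \<partial>lborel)"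
    proof (cases "x > 0")
      case True
      have "(\<integral>\<^sup>+y. ennreal (beta_weight n x * beta_weight n y) * beta_integral n (x * y) \<partial>lborel)
        = ennreal \<bar>1 / x\<bar> * (\<integral>\<^sup>+c. ennreal (beta_weight n x * beta_weight n (0 + 1 / x * c)) * beta_integral n (x * (0 + 1 / x * c)) \<partial>lborel)"
        using True by (intro nn_integral_real_affine) auto
      also have "\<dots> = (\<integral>\<^sup>+c. ennreal (1 / x) * (ennreal (beta_weight n x * beta_weight n (c / x)) * beta_integral n c) \<partial>lborel)"
        using True by (subst nn_integral_cmult[symmetric]) auto
      also have "\<dots> = (\<integral>\<^sup>+c. ennreal (beta_weight n x * beta_weight n (c / x) / x) * beta_integral n c \<partial>lborel)"
        using True by (intro nn_integral_cong) (simp add: mult.assoc[symmetric] ennreal_mult'[symmetric] beta_weight_nonneg)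
      finally show ?thesis .
    qed (simp add: beta_weight_def)
  qed
  also have "\<dots> = (\<integral>\<^sup>+c. \<integral>\<^sup>+x. ennreal (beta_weight n x * beta_weight n (c / x) / x) * beta_integral n c \<partial>lborel \<partial>lborel)"
    by (rule lborel_pair.Fubini'[symmetric]) measurable
  also have "\<dots> = (\<integral>\<^sup>+c\<in>{0<..<1}. ennreal (c powr m * (1 - c) ^ (2 * n) * (cosh_integral n (sqrt c))\<^sup>2) \<partial>lborel)"
  proof (rule nn_integral_cong)
    fix c :: real
    have "(\<integral>\<^sup>+x. ennreal (beta_weight n x * beta_weight n (c / x) / x) * beta_integral n c \<partial>lborel) = (\<integral>\<^sup>+x. ennreal (beta_weight n x * beta_weight n (c / x) / x) \<partial>lborel) * beta_integral n c"
      by (intro nn_integral_multc) measurable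
    also have "\<dots> = ennreal (c powr m * (1 - c) ^ (2 * n) * (cosh_integral n (sqrt c))\<^sup>2) * indicator {0<..<1} c"
    proof (cases "0 < c \<and> c < 1")
      case True
      have G: "beta_integral n c = ennreal (cosh_integral n (sqrt c))" using beta_integral_eq_cosh_integral[of "sqrt c" n] True by simp
      show ?thesis using True unfolding beta_weight_conv_integral[OF conjunct1[OF True] conjunct2[OF True]] G m_def[symmetric]
        by (simp add: ennreal_mult'[symmetric] cosh_integral_nonneg power2_eq_square mult_ac)
    next
      case False
      have z: "beta_weight n x * beta_weight n (c / x) / x = 0" for x
      proof (cases "0 < x \<and> x < 1")
        case True
        then have "c / x \<le> 0 \<or> c / x \<ge> 1" using False by (auto simp: divide_le_0_iff)
        then show ?thesis by (auto simp: beta_weight_def)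
      qed (auto simp: beta_weight_def)
      show ?thesis unfolding z using False by auto
    qed
    finally show "(\<integral>\<^sup>+x. ennreal (beta_weight n x * beta_weight n (c / x) / x) * beta_integral n c \<partial>lborel) = ennreal (c powr m * (1 - c) ^ (2 * n) * (cosh_integral n (sqrt c))\<^sup>2) * indicator {0<..<1} c" .
  qed
  \<comment> \<open>Substitution c = s^2: its derivative 2 s turns the power of c with exponent n -
    1/2 into 2 s^(2 n).\<close>
  also have "\<dots> = (\<integral>\<^sup>+s\<in>{0<..<1}. ennreal (2 * (s * (1 - s\<^sup>2)) ^ (2 * n) * (cosh_integral n s)\<^sup>2) \<partial>lborel)"
  proof -
    let ?f = "\<lambda>c. c powr m * (1 - c) ^ (2 * n) * (cosh_integral n (sqrt c))\<^sup>2"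
    have img: "(\<lambda>s. s\<^sup>2) ` {0<..<1} = {0<..<1::real}"
    proof
      show "(\<lambda>s. s\<^sup>2) ` {0<..<1} \<subseteq> {0<..<1::real}" by (auto simp: power_less_one_iff)
      show "{0<..<1::real} \<subseteq> (\<lambda>s. s\<^sup>2) ` {0<..<1}"
      proof
        fix c :: real assume "c \<in> {0<..<1}"
        then show "c \<in> (\<lambda>s. s\<^sup>2) ` {0<..<1}" by (intro image_eqI[of _ _ "sqrt c"]) auto
      qed
    qed
    have cont: "continuous_on {0<..<1} ?f"
      by (intro continuous_intros continuous_on_compose2[OF cosh_integral_continuous_on]) auto
    have val: "\<bar>2 * s\<bar> * ?f (s\<^sup>2) = 2 * (s * (1 - s\<^sup>2)) ^ (2 * n) * (cosh_integral n s)\<^sup>2" if s: "s \<in> {0<..<1}" for s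
    proof -
      have e: "s\<^sup>2 = s powr 2" using s by simp
      have "s * (s\<^sup>2) powr m = s powr 1 * s powr (2 * m)" unfolding e powr_powr using s by simp
      also have "\<dots> = s powr (real (2 * n))" unfolding powr_add[symmetric] m_def by simp
      also have "\<dots> = s ^ (2 * n)" using s by (intro powr_realpow) auto
      finally have "s * (s\<^sup>2) powr m = s ^ (2 * n)" .
      then show ?thesis using s by (simp add: power_mult_distrib mult_ac)
    qed
    have "(\<integral>\<^sup>+c\<in>(\<lambda>s. s\<^sup>2) ` {0<..<1}. ennreal (?f c) \<partial>lborel) = (\<integral>\<^sup>+s\<in>{0<..<1}. ennreal (\<bar>2 * s\<bar> * ?f (s\<^sup>2)) \<partial>lborel)"
    proof (rule nn_integral_change_of_variables)
      show "inj_on (\<lambda>s::real. s\<^sup>2) {0<..<1}" by (auto intro!: inj_onI)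
      show "((\<lambda>s. s\<^sup>2) has_real_derivative 2 * s) (at s within {0<..<1})" for s :: real
        by (auto intro!: derivative_eq_intros)
      show "(\<lambda>x. indicator ((\<lambda>s. s\<^sup>2) ` {0<..<1}) x * ?f x) \<in> borel_measurable borel"
        unfolding img by (intro borel_measurable_indicator_times_continuous_on cont) auto
      show "(\<lambda>s. indicator {0<..<1} s * (\<bar>2 * s\<bar> * ?f (s\<^sup>2))) \<in> borel_measurable borel"
        by (intro borel_measurable_indicator_times_continuous_on continuous_intros continuous_on_compose2[OF cont])
          (use img in auto)
    qed (use img in auto)
    also have "\<dots> = (\<integral>\<^sup>+s\<in>{0<..<1}. ennreal (2 * (s * (1 - s\<^sup>2)) ^ (2 * n) * (cosh_integral n s)\<^sup>2) \<partial>lborel)"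
      using val by (intro nn_integral_cong) (auto split: split_indicator)
    finally show ?thesis unfolding img .
  qed
  also have "\<dots> = (\<integral>\<^sup>+s. ennreal (indicator {0<..<1} s *\<^sub>R (2 * (s * (1 - s\<^sup>2)) ^ (2 * n) * (cosh_integral n s)\<^sup>2)) \<partial>lborel)"
    by (intro nn_integral_cong) (auto split: split_indicator)
  also have "\<dots> = ennreal (reduced_integral n)"
    unfolding reduced_integral_def set_lebesgue_integral_def using reduced_integral_integrable[of n] unfolding set_integrable_def
    by (intro nn_integral_eq_integral) (auto split: split_indicator)
  finally show ?thesis using reduced_integral_pos[of n] by simp
qed

section \<open>The continued fraction\<close>

text \<open>The deviation from the limit satisfies the same recurrence with a perturbation tending
  to 0, and the contraction by l < 1 makes the initial deviation disappear.\<close>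

lemma linear_recurrence_limit:
  fixes x d :: "nat \<Rightarrow> real"
  assumes l: "0 \<le> l" "l < 1" and rec: "\<And>n. x (Suc n) = l * x n + d n" and d: "d \<longlonglongrightarrow> D"
  shows "x \<longlonglongrightarrow> D / (1 - l)"
proof -
  define e where "e n = x n - D / (1 - l)" for n
  define \<epsilon> where "\<epsilon> n = d n - D" for n
  have rec': "e (Suc n) = l * e n + \<epsilon> n" for n
    unfolding e_def \<epsilon>_def rec using l by (simp add: field_simps)
  have eps: "\<epsilon> \<longlonglongrightarrow> 0" unfolding \<epsilon>_def using d by (simp add: LIM_zero)
  have "e \<longlonglongrightarrow> 0"
  proof (rule LIMSEQ_I)
    fix r :: real assume r: "r > 0"
    obtain N where N: "\<And>n. n \<ge> N \<Longrightarrow> \<bar>\<epsilon> n\<bar> < r / 2 * (1 - l)"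
      using eps r l unfolding LIMSEQ_iff by (metis diff_zero diff_gt_0_iff_gt half_gt_zero mult_pos_pos real_norm_def)
    have bnd: "\<bar>e (N + k)\<bar> \<le> l ^ k * \<bar>e N\<bar> + r / 2" for k
    proof (induction k)
      case (Suc k)
      have "\<bar>e (N + Suc k)\<bar> \<le> l * \<bar>e (N + k)\<bar> + \<bar>\<epsilon> (N + k)\<bar>"
        using rec'[of "N + k"] abs_triangle_ineq[of "l * e (N + k)" "\<epsilon> (N + k)"] l by (simp add: abs_mult)
      also have "\<dots> \<le> l * (l ^ k * \<bar>e N\<bar> + r / 2) + r / 2 * (1 - l)"
        using Suc N[of "N + k"] l by (intro add_mono mult_left_mono) auto
      also have "\<dots> = l ^ Suc k * \<bar>e N\<bar> + r / 2" by (simp add: field_simps)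
      finally show ?case .
    qed (use r in simp)
    have "(\<lambda>k. l ^ k * \<bar>e N\<bar>) \<longlonglongrightarrow> 0 * \<bar>e N\<bar>"
      using l by (intro tendsto_intros LIMSEQ_power_zero) auto
    then obtain K where K: "\<And>k. k \<ge> K \<Longrightarrow> \<bar>l ^ k * \<bar>e N\<bar>\<bar> < r / 2"
      using r unfolding LIMSEQ_iff by (metis diff_zero half_gt_zero mult_zero_left real_norm_def)
    show "\<exists>no. \<forall>n\<ge>no. norm (e n - 0) < r"
    proof (intro exI allI impI)
      fix n assume "n \<ge> N + K"
      then have "n = N + (n - N)" "n - N \<ge> K" by auto
      then show "norm (e n - 0) < r" using bnd[of "n - N"] K[of "n - N"] l by (simp add: abs_mult)
    qed
  qed
  then show ?thesis unfolding e_def using LIM_zero_iff by blast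
qed

text \<open>The central quantity is the quotient of the denominators by the minimal solution
  \<open>J\<close>: the Casoratian makes its increments explicit, and the asymptotics assumed for
  \<open>I\<close> then decides its growth.\<close>

lemma continued_fraction_asymptotics:
  fixes I :: "nat \<Rightarrow> real" and \<omega> \<eta> C :: real
  assumes pos: "\<And>n. I n > 0"
    and rec: "\<And>n. (real n + 3/2) ^ 3 * I (n+2) - 2 * (real n + 1) * (17 * (real n + 1)\<^sup>2 + 3/4) * I (n+1) + (real n + 1/2) ^ 3 * I n = 0"
    and I0: "I 0 = 8 * \<omega>" and \<eta>: "I 1 = - 56 * \<omega> - 3/2 * \<eta>"
    and lim: "(\<lambda>n. I n * (1 + sqrt 2) ^ (4 * n) * (real n * sqrt (real n))) \<longlonglongrightarrow> C"
    and C: "C > 0" "C\<^sup>2 = 2 * sqrt 2 * pi ^ 3"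
  shows "(\<lambda>n. cf_p cf_a cf_b n / cf_q cf_a cf_b n) \<longlonglongrightarrow> - 3 * \<eta> / \<omega>" (is ?lim)
    and "(\<lambda>n. - 3 * \<eta> / \<omega> - cf_p cf_a cf_b n / cf_q cf_a cf_b n)
           \<sim>[sequentially] (\<lambda>n. (192 * pi ^ 3 / \<omega> ^ 2) / (1 + sqrt 2) ^ (8 * n + 8))" (is ?asy)
proof -
  have \<omega>: "\<omega> > 0" using pos[of 0] I0 by simp
  let ?p = "cf_p cf_a cf_b" and ?q = "cf_q cf_a cf_b"
  define c :: "nat \<Rightarrow> real" where "c n = (\<Prod>k<n. (2 * real k + 1) ^ 3)" for n
  have c_Suc: "c (Suc n) = (2 * real n + 1) ^ 3 * c n" for n by (simp add: c_def mult.commute)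
  have c_pos: "c n > 0" for n unfolding c_def by (intro prod_pos) auto
  define J where "J n = c n * I n" for n
  have J_pos: "J n > 0" for n using pos c_pos by (simp add: J_def)
  have J_rec: "J (n+2) = cf_a (n+1) * J (n+1) - (2 * real n + 1) ^ 6 * J n" for n
  proof -
    have "(2 * real n + 3) ^ 3 * I (n+2) = cf_a (n+1) * I (n+1) - (2 * real n + 1) ^ 3 * I n"
    proof -
      have "(2 * real n + 3) ^ 3 = 8 * (real n + 3/2) ^ 3" "(2 * real n + 1) ^ 3 = 8 * (real n + 1/2) ^ 3" by algebra+
      moreover have "cf_a (n+1) = 8 * (2 * (real n + 1) * (17 * (real n + 1)\<^sup>2 + 3/4))"
        by (simp add: cf_a_def algebra_simps)
      ultimately show ?thesis using rec[of n] by algebra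
    qed
    then have "(2 * real n + 1) ^ 3 * c n * ((2 * real n + 3) ^ 3 * I (n+2)) = (2 * real n + 1) ^ 3 * c n * (cf_a (n+1) * I (n+1) - (2 * real n + 1) ^ 3 * I n)"
      by simp
    moreover have "c (n+2) = (2 * real n + 3) ^ 3 * ((2 * real n + 1) ^ 3 * c n)"
      using c_Suc[of "n+1"] c_Suc[of n] by (simp add: algebra_simps)
    moreover have "(2 * real n + 1) ^ 6 = (2 * real n + 1) ^ 3 * (2 * real n + 1) ^ 3" by (simp add: power_add[symmetric])
    ultimately show ?thesis unfolding J_def using c_Suc[of n] by (simp add: algebra_simps)
  qed
  have J01: "J 0 = 8 * \<omega>" "J 1 = I 1" using I0 by (auto simp: J_def c_def)
  define \<beta> where "\<beta> = I 1 + 56 * \<omega>"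
  \<comment> \<open>The index is shifted by one: \<open>J (n+1)\<close> goes with the n-th
    convergent. The first entries fit because \<open>J 1\<close> is beta minus 56 omega = 112 (omega
    / 2), and \<open>J 0\<close> is 8 omega = 16 (omega / 2).\<close>
  have lin: "J (n+1) = - \<omega> / 2 * ?p n + \<beta> * ?q n \<and> J (n+2) = - \<omega> / 2 * ?p (n+1) + \<beta> * ?q (n+1)" for n
  proof (induction n)
    case 0
    have "J 2 = cf_a 1 * J 1 - J 0" using J_rec[of 0] by (simp add: numeral_2_eq_2)
    then show ?case using J01 by (simp add: \<beta>_def cf_a_def cf_b_def algebra_simps numeral_2_eq_2)
  next
    case (Suc n)
    have n1: "2 * real (n+1) + 1 = 2 * real n + 3" by simp
    have b: "cf_b (Suc n) = - ((2 * real n + 3) ^ 6)" unfolding cf_b_def n1[symmetric] by simp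
    have n3: "Suc (Suc (Suc n)) = n + 3" "n + 1 + 2 = n + 3" "n + 1 + 1 = n + 2" "Suc n + 1 = n + 2" "Suc n + 2 = n + 3" by simp_all
    have "?p (n+2) = cf_a (n+2) * ?p (n+1) - (2 * real n + 3) ^ 6 * ?p n"
      "?q (n+2) = cf_a (n+2) * ?q (n+1) - (2 * real n + 3) ^ 6 * ?q n"
      using b by simp_all
    moreover have "J (n+3) = cf_a (n+2) * J (n+2) - (2 * real n + 3) ^ 6 * J (n+1)"
      using J_rec[of "n+1"] unfolding n1 n3 .
    ultimately have "J (n+3) = - \<omega> / 2 * ?p (n+2) + \<beta> * ?q (n+2)" using Suc by algebra
    then show ?case using Suc unfolding n3 by simp
  qed
  \<comment> \<open>The Casoratian of the denominators and \<open>J\<close>; the successive factors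
    (2 n + 3)^6 accumulate in the square of \<open>c\<close>.\<close>
  have D: "?q (n+1) * J (n+1) - ?q n * J (n+2) = 8 * \<omega> * (c (n+1))\<^sup>2" for n
  proof (induction n)
    case 0
    have "J 2 = cf_a 1 * J 1 - J 0" using J_rec[of 0] by (simp add: numeral_2_eq_2)
    then show ?case using J01 by (simp add: c_def numeral_2_eq_2)
  next
    case (Suc n)
    have n1: "2 * real (n+1) + 1 = 2 * real n + 3" by simp
    have b: "cf_b (Suc n) = - ((2 * real n + 3) ^ 6)" unfolding cf_b_def n1[symmetric] by simp
    have n3: "Suc (Suc (Suc n)) = n + 3" "n + 1 + 2 = n + 3" "n + 1 + 1 = n + 2" "Suc n + 1 = n + 2" "Suc n + 2 = n + 3" by simp_all
    have "?q (n+2) = cf_a (n+2) * ?q (n+1) - (2 * real n + 3) ^ 6 * ?q n"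
      using b by simp_all
    moreover have "J (n+3) = cf_a (n+2) * J (n+2) - (2 * real n + 3) ^ 6 * J (n+1)"
      using J_rec[of "n+1"] unfolding n1 n3 .
    moreover have "c (n+2) = (2 * real n + 3) ^ 3 * c (n+1)" using c_Suc[of "n+1"] by (simp add: algebra_simps)
    ultimately have "?q (n+2) * J (n+2) - ?q (n+1) * J (n+3) = 8 * \<omega> * (c (n+2))\<^sup>2" using Suc by algebra
    then show ?case unfolding n3 by simp
  qed
  define R where "R n = ?q n / J (n+1)" for n
  have R_Suc: "R (Suc n) = R n + 8 * \<omega> / ((2 * real n + 3) ^ 3 * (I (n+1) * I (n+2)))" for n
  proof -
    have n2: "n + 1 + 1 = n + 2" "Suc n = n + 1" by simp_all
    have "R (Suc n) - R n = (?q (n+1) * J (n+1) - ?q n * J (n+2)) / (J (n+1) * J (n+2))"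
    proof -
      have "x / u - y / v = (x * v - y * u) / (v * u)" if "u > 0" "v > 0" for x y u v :: real
        using that by (simp add: field_simps)
      from this[OF J_pos[of "n+2"] J_pos[of "n+1"]] show ?thesis unfolding R_def n2 .
    qed
    also have "\<dots> = 8 * \<omega> * (c (n+1))\<^sup>2 / (c (n+1) * I (n+1) * (((2 * real n + 3) ^ 3 * c (n+1)) * I (n+2)))"
    proof -
      have "c (n+2) = (2 * real n + 3) ^ 3 * c (n+1)" using c_Suc[of "n+1"] by (simp add: algebra_simps)
      then show ?thesis unfolding D unfolding J_def by (simp only:)
    qed
    also have "\<dots> = 8 * \<omega> / ((2 * real n + 3) ^ 3 * (I (n+1) * I (n+2)))"
      using c_pos[of "n+1"] by (simp add: power2_eq_square)
    finally show ?thesis by simp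
  qed
  have R_pos: "R n > 0" for n
  proof (induction n)
    case 0 show ?case using J_pos[of 1] by (simp add: R_def)
  next
    case (Suc n)
    have "8 * \<omega> / ((2 * real n + 3) ^ 3 * (I (n+1) * I (n+2))) > 0"
      using \<omega> pos by (intro divide_pos_pos mult_pos_pos zero_less_power) auto
    then show ?case using Suc R_Suc[of n] by simp
  qed
  \<comment> \<open>The integrals decay like g^(-n) n^(-3/2). In the increments of \<open>R\<close>
    the powers of n cancel against (2 n + 3)^3, so \<open>R\<close> grows like the powers of g^2 =
    (1 + sqrt 2)^8.\<close>
  define g :: real where "g = (1 + sqrt 2) ^ 4"
  define \<kappa> where "\<kappa> = g\<^sup>2"
  have g: "g = 17 + 12 * sqrt 2" unfolding g_def
    by (simp add: power4_eq_xxxx algebra_simps)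
  have g1: "g > 1" using g by (simp add: add_pos_nonneg)
  have l1: "\<kappa> > 1" unfolding \<kappa>_def using g1 by (simp add: one_less_power)
  have gg: "(1 + sqrt 2) ^ (4 * n) = g ^ n" for n unfolding g_def power_mult ..
  define \<rho> where "\<rho> n = R n / \<kappa> ^ n" for n
  define d where "d n = 8 * \<omega> / ((2 * real n + 3) ^ 3 * (I (n+1) * I (n+2)) * \<kappa> ^ Suc n)" for n
  have rho_rec: "\<rho> (Suc n) = 1 / \<kappa> * \<rho> n + d n" for n
    unfolding \<rho>_def R_Suc d_def using l1 by (simp add: add_divide_distrib)
  have d_lim: "d \<longlonglongrightarrow> \<omega> * g / C\<^sup>2"
  proof -
    define x where "x n = I n * (1 + sqrt 2) ^ (4 * n) * (real n * sqrt (real n))" for n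
    have x: "x \<longlonglongrightarrow> C" unfolding x_def using lim .
    define r where "r n = (real (n+1) * sqrt (real (n+1)) * (real (n+2) * sqrt (real (n+2)))) / (2 * real n + 3) ^ 3" for n
    have r: "r \<longlonglongrightarrow> 1/8" unfolding r_def by real_asymp
    have "d n = 8 * \<omega> * g * r n / (x (n+1) * x (n+2))" for n
    proof -
      define s1 s2 where "s1 = real (n+1) * sqrt (real (n+1))" and "s2 = real (n+2) * sqrt (real (n+2))"
      have s: "s1 > 0" "s2 > 0" by (auto simp: s1_def s2_def)
      have "\<kappa> ^ Suc n * g = g ^ (n+1) * g ^ (n+2)" 
      proof -
        have "2 * Suc n + 1 = (n + 1) + (n + 2)" by simp
        then show ?thesis unfolding \<kappa>_def by (metis power_mult power_add power_one_right)
      qed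
      then have 1: "x (n+1) * x (n+2) = I (n+1) * I (n+2) * (\<kappa> ^ Suc n * g) * (s1 * s2)"
        unfolding x_def gg s1_def[symmetric] s2_def[symmetric] by (simp only: mult_ac)
      have "d n = 8 * \<omega> * g * (s1 * s2 / (2 * real n + 3) ^ 3) / (I (n+1) * I (n+2) * (\<kappa> ^ Suc n * g) * (s1 * s2))"
        unfolding d_def using s g1 by (simp add: mult_ac)
      then show ?thesis unfolding 1 r_def s1_def s2_def .
    qed
    moreover have "(\<lambda>n. 8 * \<omega> * g * r n / (x (n+1) * x (n+2))) \<longlonglongrightarrow> 8 * \<omega> * g * (1/8) / (C * C)"
      by (intro tendsto_intros r LIMSEQ_ignore_initial_segment[OF x]) (use C in auto)
    moreover have "d = (\<lambda>n. 8 * \<omega> * g * r n / (x (n+1) * x (n+2)))" using calculation(1) by (rule ext)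
    ultimately show ?thesis by (simp add: power2_eq_square)
  qed
  have "\<rho> \<longlonglongrightarrow> (\<omega> * g / C\<^sup>2) / (1 - 1 / \<kappa>)"
    using l1 rho_rec d_lim by (intro linear_recurrence_limit) auto
  also have "(\<omega> * g / C\<^sup>2) / (1 - 1 / \<kappa>) = \<omega> * \<kappa> / (96 * pi ^ 3)"
  proof -
    \<comment> \<open>As 1/g = 17 - 12 sqrt 2, one has g^2 - 1 = 24 sqrt 2 g, and multiplication by
      the 2 sqrt 2 in C^2 gives 96 g. The 192 of the error term is twice this 96.\<close>
    have "96 * (17 + 12 * s) = 2 * s * ((17 + 12 * s)\<^sup>2 - 1)" if s: "s * s = 2" for s :: real
    proof -
      have "2 * s * ((17 + 12 * s)\<^sup>2 - 1) = 288 * (s * s) * s + 816 * (s * s) + 576 * s"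
        by (simp add: power2_eq_square algebra_simps)
      then show ?thesis unfolding s by simp
    qed
    then have 96: "96 * g = 2 * sqrt 2 * (\<kappa> - 1)" unfolding \<kappa>_def g by simp
    have "(\<omega> * g / C\<^sup>2) / (1 - 1 / \<kappa>) = \<omega> * \<kappa> * (g / ((2 * sqrt 2 * (\<kappa> - 1)) * pi ^ 3))"
      unfolding C(2) using l1 by (simp add: field_simps)
    also have "\<dots> = \<omega> * \<kappa> * (g / (96 * g * pi ^ 3))" unfolding 96 ..
    finally show ?thesis using g1 by simp
  qed
  finally have rho_lim: "\<rho> \<longlonglongrightarrow> \<omega> * \<kappa> / (96 * pi ^ 3)" .
  have rho_pos: "\<rho> n > 0" for n unfolding \<rho>_def using R_pos l1 by simp
  \<comment> \<open>By \<open>lin\<close> and beta = -3/2 eta, the error is 2 / omega times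
    \<open>J (n+1)\<close> divided by the n-th denominator, that is 2 / (omega R).\<close>
  have diff: "- 3 * \<eta> / \<omega> - ?p n / ?q n = 2 / (\<omega> * \<rho> n * \<kappa> ^ n)" for n
  proof -
    have q: "?q n = R n * J (n+1)" "?q n > 0" using R_pos[of n] J_pos[of "n+1"] by (auto simp: R_def zero_less_divide_iff)
    have "\<beta> = - 3 / 2 * \<eta>" unfolding \<beta>_def \<eta> by simp
    moreover have "- 3 * h / w - x / y = 2 / w * ((- w / 2 * x + - 3 / 2 * h * y) / y)" if "w > 0" "y > 0" for h w x y :: real
      using that by (simp add: field_simps)
    ultimately have "- 3 * \<eta> / \<omega> - ?p n / ?q n = 2 / \<omega> * ((- \<omega> / 2 * ?p n + \<beta> * ?q n) / ?q n)"
      using \<omega> q(2) by simp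
    also have "\<dots> = 2 / (\<omega> * R n)" using lin[of n] q J_pos[of "n+1"] by simp
    finally show ?thesis unfolding \<rho>_def using l1 by simp
  qed
  have pw: "(1 + sqrt 2) ^ (8 * n + 8) = \<kappa> ^ n * \<kappa>" for n :: nat
  proof -
    have "8 * n + 8 = 4 * (2 * (n+1))" by simp
    then show ?thesis unfolding \<kappa>_def g_def by (simp only: power_mult) (simp add: power_add[symmetric] power_mult[symmetric])
  qed
  show asy: ?asy
  proof (rule asymp_equivI')
    have "(\<lambda>n. (2 * \<omega> * \<kappa> / (192 * pi ^ 3)) / \<rho> n) \<longlonglongrightarrow> (2 * \<omega> * \<kappa> / (192 * pi ^ 3)) / (\<omega> * \<kappa> / (96 * pi ^ 3))"
      by (intro tendsto_intros rho_lim) (use \<omega> l1 in auto)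
    also have "(2 * \<omega> * \<kappa> / (192 * pi ^ 3)) / (\<omega> * \<kappa> / (96 * pi ^ 3)) = 1" using \<omega> l1 by simp
    also have "(\<lambda>n. (2 * \<omega> * \<kappa> / (192 * pi ^ 3)) / \<rho> n)
       = (\<lambda>n. (- 3 * \<eta> / \<omega> - ?p n / ?q n) / (192 * pi ^ 3 / \<omega> ^ 2 / (1 + sqrt 2) ^ (8 * n + 8)))"
    proof
      fix n
      show "(2 * \<omega> * \<kappa> / (192 * pi ^ 3)) / \<rho> n = (- 3 * \<eta> / \<omega> - ?p n / ?q n) / (192 * pi ^ 3 / \<omega> ^ 2 / (1 + sqrt 2) ^ (8 * n + 8))"
        unfolding diff pw using \<omega> l1 rho_pos[of n] by (simp add: field_simps power2_eq_square)
    qed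
    finally show "(\<lambda>n. (- 3 * \<eta> / \<omega> - ?p n / ?q n) / (192 * pi ^ 3 / \<omega> ^ 2 / (1 + sqrt 2) ^ (8 * n + 8))) \<longlonglongrightarrow> 1" .
  qed
  show ?lim
  proof -
    have "(\<lambda>n. (192 * pi ^ 3 / \<omega> ^ 2 / \<kappa>) * (1 / \<kappa>) ^ n) \<longlonglongrightarrow> (192 * pi ^ 3 / \<omega> ^ 2 / \<kappa>) * 0"
      by (intro tendsto_intros LIMSEQ_power_zero) (use l1 in auto)
    also have "(\<lambda>n. (192 * pi ^ 3 / \<omega> ^ 2 / \<kappa>) * (1 / \<kappa>) ^ n) = (\<lambda>n. 192 * pi ^ 3 / \<omega> ^ 2 / (1 + sqrt 2) ^ (8 * n + 8))"
      
    proof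
      fix n
      have "c / l * (1 / l) ^ n = c / (l ^ n * l)" for c l :: real by (simp add: power_divide mult.commute)
      then show "192 * pi ^ 3 / \<omega> ^ 2 / \<kappa> * (1 / \<kappa>) ^ n = 192 * pi ^ 3 / \<omega> ^ 2 / (1 + sqrt 2) ^ (8 * n + 8)"
        unfolding pw .
    qed
    finally have "(\<lambda>n. - 3 * \<eta> / \<omega> - ?p n / ?q n) \<longlonglongrightarrow> 0"
      using tendsto_asymp_equiv_cong[OF asy] by simp
    then have "(\<lambda>n. - 3 * \<eta> / \<omega> - (- 3 * \<eta> / \<omega> - ?p n / ?q n)) \<longlonglongrightarrow> - 3 * \<eta> / \<omega> - 0"
      by (intro tendsto_diff tendsto_const)
    then show ?thesis by simp
  qed
qed

section \<open>Theta series\<close>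

text \<open>The sum of q^(n^2) over all integers n, folded onto n >= 1. The type covers real
  arguments, where the elliptic integrals live, as well as the complex ones needed for
  modularity.\<close>

definition theta :: "'a::{real_normed_field,banach} \<Rightarrow> 'a" where
  "theta q = 1 + 2 * (\<Sum>n. q ^ ((Suc n)\<^sup>2))"

text \<open>The exponents are the triangular numbers; over all integers each is attained twice,
  whence the factor 2 in \<open>has_sum_psi\<close>.\<close>

definition psi :: "'a::{real_normed_field,banach} \<Rightarrow> 'a" where
  "psi q = (\<Sum>n. q ^ (n * Suc n div 2))"

lemma norm_power_le_of_le:
  fixes q :: "'a::{real_normed_field,banach}"
  assumes "norm q < 1" "n \<le> m"
  shows "norm (q ^ m) \<le> norm q ^ n"
  using assms by (simp add: norm_power power_decreasing)

lemma summable_norm_theta: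
  fixes q :: "'a::{real_normed_field,banach}"
  assumes "norm q < 1"
  shows "summable (\<lambda>n. norm (q ^ ((Suc n)\<^sup>2)))"
proof (rule summable_comparison_test')
  show "summable (\<lambda>n. norm q ^ n)" using assms by (simp add: summable_geometric)
  show "norm (norm (q ^ ((Suc n)\<^sup>2))) \<le> norm q ^ n" for n
    using norm_power_le_of_le[OF assms, of n "(Suc n)\<^sup>2"] by (simp add: power2_eq_square)
qed

lemma summable_norm_psi:
  fixes q :: "'a::{real_normed_field,banach}"
  assumes "norm q < 1"
  shows "summable (\<lambda>n. norm (q ^ (n * Suc n div 2)))"
proof (rule summable_comparison_test')
  show "summable (\<lambda>n. norm q ^ n)" using assms by (simp add: summable_geometric)
  show "norm (norm (q ^ (n * Suc n div 2))) \<le> norm q ^ n" for n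
  proof -
    have "n \<le> n * Suc n div 2" by (cases n) auto
    then show ?thesis using norm_power_le_of_le[OF assms] by simp
  qed
qed

lemma theta_of_real: "norm q < 1 \<Longrightarrow> theta (of_real q) = of_real (theta (q :: real))"
proof -
  assume q: "norm q < 1"
  have sm: "summable (\<lambda>n. q ^ ((Suc n)\<^sup>2))" using summable_norm_cancel[OF summable_norm_theta[OF q]] .
  show ?thesis
    unfolding theta_def of_real_power[symmetric] suminf_of_real[OF sm, symmetric] by simp
qed

lemma has_sum_theta:
  fixes q :: "'a::{real_normed_field,banach}"
  assumes q: "norm q < 1"
  shows "((\<lambda>n::int. q ^ nat (n\<^sup>2)) has_sum theta q) UNIV"
proof -
  define S where "S = (\<Sum>n. q ^ ((Suc n)\<^sup>2))"
  have "(\<lambda>n. q ^ ((Suc n)\<^sup>2)) sums S"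
    unfolding S_def using summable_norm_cancel[OF summable_norm_theta[OF q]] by (rule summable_sums)
  from norm_summable_imp_has_sum[OF summable_norm_theta[OF q] this]
  have S: "((\<lambda>n. q ^ ((Suc n)\<^sup>2)) has_sum S) UNIV" .
  have sq: "nat ((int (Suc n))\<^sup>2) = (Suc n)\<^sup>2" "nat ((- int (Suc n))\<^sup>2) = (Suc n)\<^sup>2" for n
  proof -
    have "(int (Suc n))\<^sup>2 = int ((Suc n)\<^sup>2)" "(- int (Suc n))\<^sup>2 = int ((Suc n)\<^sup>2)"
      by (simp_all del: of_nat_Suc)
    then show "nat ((int (Suc n))\<^sup>2) = (Suc n)\<^sup>2" "nat ((- int (Suc n))\<^sup>2) = (Suc n)\<^sup>2" by (metis nat_int)+
  qed
  have 1: "((\<lambda>n::int. q ^ nat (n\<^sup>2)) has_sum S) (range (\<lambda>n. int (Suc n)))"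
    by (subst has_sum_reindex) (use S in \<open>auto simp: o_def sq inj_on_def simp del: of_nat_Suc power_Suc\<close>)
  have 2: "((\<lambda>n::int. q ^ nat (n\<^sup>2)) has_sum S) (range (\<lambda>n. - int (Suc n)))"
    by (subst has_sum_reindex) (use S in \<open>auto simp: o_def sq inj_on_def simp del: of_nat_Suc power_Suc\<close>)
  have 3: "((\<lambda>n::int. q ^ nat (n\<^sup>2)) has_sum 1) {0}"
    using has_sum_finite[of "{0::int}" "\<lambda>n::int. q ^ nat (n\<^sup>2)"] by simp
  have "((\<lambda>n::int. q ^ nat (n\<^sup>2)) has_sum (1 + (S + S))) ({0} \<union> (range (\<lambda>n. int (Suc n)) \<union> range (\<lambda>n. - int (Suc n))))"
    by (intro has_sum_Un_disjoint 1 2 3) auto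
  moreover have "{0} \<union> (range (\<lambda>n. int (Suc n)) \<union> range (\<lambda>n. - int (Suc n))) = UNIV"
  proof -
    have "x \<in> {0} \<union> (range (\<lambda>n. int (Suc n)) \<union> range (\<lambda>n. - int (Suc n)))" for x :: int
    proof (cases "x = 0 \<or> x > 0")
      case True
      then show ?thesis using image_eqI[of x "\<lambda>n. int (Suc n)" "nat (x - 1)" UNIV] by auto
    next
      case False
      then have "x = - int (Suc (nat (- x - 1)))" by auto
      then show ?thesis by blast
    qed
    then show ?thesis by blast
  qed
  moreover have "1 + (S + S) = theta q" by (simp add: theta_def S_def)
  ultimately show ?thesis by simp
qed

lemma has_sum_psi:
  fixes q :: "'a::{real_normed_field,banach}"
  assumes q: "norm q < 1"
  shows "((\<lambda>n::int. q ^ nat (n * (n + 1) div 2)) has_sum (2 * psi q)) UNIV"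
proof -
  have "(\<lambda>n. q ^ (n * Suc n div 2)) sums psi q"
    unfolding psi_def using summable_norm_cancel[OF summable_norm_psi[OF q]] by (rule summable_sums)
  from norm_summable_imp_has_sum[OF summable_norm_psi[OF q] this]
  have S: "((\<lambda>n. q ^ (n * Suc n div 2)) has_sum psi q) UNIV" .
  have sq: "nat (int n * (int n + 1) div 2) = n * Suc n div 2" for n
  proof -
    have "int n * (int n + 1) = int (n * Suc n)" by (simp add: algebra_simps)
    then have "int n * (int n + 1) div 2 = int (n * Suc n div 2)" by (simp only: zdiv_int of_nat_numeral)
    then show ?thesis by (simp only: nat_int)
  qed
  have sq': "nat ((- int (Suc n)) * (- int (Suc n) + 1) div 2) = n * Suc n div 2" for n
  proof -
    have "(- int (Suc n)) * (- int (Suc n) + 1) = int n * (int n + 1)" by (simp add: algebra_simps)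
    then show ?thesis unfolding sq[symmetric] by (simp only:)
  qed
  have inj: "inj (\<lambda>n. - int (Suc n))" by (auto simp: inj_on_def)
  have 1: "((\<lambda>n::int. q ^ nat (n * (n + 1) div 2)) has_sum psi q) (range int)"
    unfolding has_sum_reindex[OF inj_of_nat] o_def sq by (rule S)
  have 2: "((\<lambda>n::int. q ^ nat (n * (n + 1) div 2)) has_sum psi q) (range (\<lambda>n. - int (Suc n)))"
    unfolding has_sum_reindex[OF inj] o_def sq' by (rule S)
  have "((\<lambda>n::int. q ^ nat (n * (n + 1) div 2)) has_sum (psi q + psi q)) (range int \<union> range (\<lambda>n. - int (Suc n)))"
    by (intro has_sum_Un_disjoint 1 2) auto
  moreover have "range int \<union> range (\<lambda>n. - int (Suc n)) = UNIV"
  proof -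
    have "x \<in> range int \<union> range (\<lambda>n. - int (Suc n))" for x :: int
    proof (cases "x \<ge> 0")
      case True
      then show ?thesis using image_eqI[of x int "nat x" UNIV] by auto
    next
      case False
      then have "x = - int (Suc (nat (- x - 1)))" by auto
      then show ?thesis by blast
    qed
    then show ?thesis by blast
  qed
  moreover have "psi q + psi q = 2 * psi q" by simp
  ultimately show ?thesis by (simp only:)
qed

lemma parity_power: "(- q) ^ nat (n\<^sup>2) = (if even n then 1 else - 1) * (q :: 'a :: comm_ring_1) ^ nat (n\<^sup>2)"
  unfolding uminus_power_if by (simp add: even_nat_iff)

lemma theta_add_theta_minus:
  fixes q :: "'a::{real_normed_field,banach}"
  assumes q: "norm q < 1"
  shows "theta q + theta (- q) = 2 * theta (q ^ 4)"
proof -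
  have q4: "norm (q ^ 4) < 1" using q by (simp add: norm_power power_less_one_iff)
  have "((\<lambda>n::int. q ^ nat (n\<^sup>2) + (- q) ^ nat (n\<^sup>2)) has_sum (theta q + theta (- q))) UNIV"
    by (intro has_sum_add has_sum_theta) (use q in auto)
  then have "((\<lambda>n::int. 2 * q ^ nat (n\<^sup>2)) has_sum (theta q + theta (- q))) {n. even n}"
    by (subst has_sum_cong_neutral[where T = UNIV and g = "\<lambda>n::int. q ^ nat (n\<^sup>2) + (- q) ^ nat (n\<^sup>2)"])
       (auto simp: parity_power)
  moreover have "{n::int. even n} = range (\<lambda>m. 2 * m)" by (auto elim: evenE)
  ultimately have "((\<lambda>m::int. 2 * q ^ nat ((2 * m)\<^sup>2)) has_sum (theta q + theta (- q))) UNIV"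
    by (simp add: has_sum_reindex inj_on_def o_def)
  moreover have "q ^ nat ((2 * m)\<^sup>2) = (q ^ 4) ^ nat (m\<^sup>2)" for m :: int
    by (simp add: power_mult_distrib nat_mult_distrib power_mult)
  ultimately have "((\<lambda>m::int. 2 * (q ^ 4) ^ nat (m\<^sup>2)) has_sum (theta q + theta (- q))) UNIV" by simp
  moreover have "((\<lambda>m::int. 2 * (q ^ 4) ^ nat (m\<^sup>2)) has_sum (2 * theta (q ^ 4))) UNIV"
    by (intro has_sum_cmult_right has_sum_theta q4)
  ultimately show ?thesis by (rule has_sum_unique)
qed

text \<open>Only odd n survive in the difference, and (2 m + 1)^2 = 8 (m (m + 1) / 2) + 1.\<close>

lemma theta_diff_theta_minus:
  fixes q :: "'a::{real_normed_field,banach}"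
  assumes q: "norm q < 1"
  shows "theta q - theta (- q) = 4 * q * psi (q ^ 8)"
proof -
  have q8: "norm (q ^ 8) < 1" using q by (simp add: norm_power power_less_one_iff)
  have "((\<lambda>n::int. q ^ nat (n\<^sup>2) + - ((- q) ^ nat (n\<^sup>2))) has_sum (theta q + - theta (- q))) UNIV"
    by (intro has_sum_add has_sum_uminusI has_sum_theta) (use q in auto)
  then have "((\<lambda>n::int. 2 * q ^ nat (n\<^sup>2)) has_sum (theta q - theta (- q))) {n. odd n}"
    by (subst has_sum_cong_neutral[where T = UNIV and g = "\<lambda>n::int. q ^ nat (n\<^sup>2) + - ((- q) ^ nat (n\<^sup>2))"])
       (auto simp: parity_power)
  moreover have "{n::int. odd n} = range (\<lambda>m. 2 * m + 1)" by (auto elim: oddE)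
  ultimately have "((\<lambda>m::int. 2 * q ^ nat ((2 * m + 1)\<^sup>2)) has_sum (theta q - theta (- q))) UNIV"
    by (simp add: has_sum_reindex inj_on_def o_def)
  moreover have "q ^ nat ((2 * m + 1)\<^sup>2) = q * (q ^ 8) ^ nat (m * (m + 1) div 2)" for m :: int
  proof -
    have "even (m * (m + 1))" by simp
    then obtain k where k: "m * (m + 1) = 2 * k" by (elim evenE)
    have "m * (m + 1) \<ge> 0" by (cases "m \<ge> 0") (auto intro: mult_nonpos_nonpos)
    then have k0: "k \<ge> 0" using k by simp
    have "(2 * m + 1)\<^sup>2 = 4 * (m * (m + 1)) + 1" by (simp add: power2_eq_square algebra_simps)
    then have "nat ((2 * m + 1)\<^sup>2) = Suc (8 * nat k)" using k k0 by simp
    then show ?thesis using k by (simp add: power_mult)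
  qed
  ultimately have "((\<lambda>m::int. 2 * q * (q ^ 8) ^ nat (m * (m + 1) div 2)) has_sum (theta q - theta (- q))) UNIV"
    by (simp add: mult.assoc)
  moreover have "((\<lambda>m::int. 2 * q * (q ^ 8) ^ nat (m * (m + 1) div 2)) has_sum (2 * q * (2 * psi (q ^ 8)))) UNIV"
    by (intro has_sum_cmult_right has_sum_psi q8)
  ultimately show ?thesis using has_sum_unique by fastforce
qed

text \<open>Absolute summability in each variable makes the sum over the lattice unconditional, and
  it is on such sums that the regroupings for squares of \<open>theta\<close> and \<open>psi\<close>
  are carried out.\<close>

lemma has_sum_int_product:
  fixes f g :: "int \<Rightarrow> 'a::{real_normed_field,banach}"
  assumes f: "f abs_summable_on UNIV" "(f has_sum a) UNIV" and g: "g abs_summable_on UNIV" "(g has_sum b) UNIV"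
  shows "((\<lambda>(m, n). f m * g n) has_sum (a * b)) UNIV"
proof -
  obtain G where G: "((\<lambda>n. norm (g n)) has_sum G) UNIV" using g(1) by (auto simp: summable_on_def)
  have "(\<lambda>(m, n). norm (f m) * norm (g n)) summable_on (UNIV \<times> UNIV)"
  proof (rule summable_on_SigmaI)
    show "((\<lambda>n. case (m, n) of (m, n) \<Rightarrow> norm (f m) * norm (g n)) has_sum (norm (f m) * G)) UNIV" for m
      by simp (intro has_sum_cmult_right G)
    show "(\<lambda>m. norm (f m) * G) summable_on UNIV" by (intro summable_on_cmult_left f(1))
  qed auto
  then have "(\<lambda>(m, n). f m * g n) abs_summable_on (UNIV \<times> UNIV)"
    by (simp add: case_prod_unfold norm_mult)
  then have "(\<lambda>(m, n). f m * g n) summable_on (UNIV \<times> UNIV)"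
    by (rule abs_summable_summable)
  moreover have "((\<lambda>n. case (m, n) of (m, n) \<Rightarrow> f m * g n) has_sum (f m * b)) UNIV" for m
    by simp (intro has_sum_cmult_right g(2))
  moreover have "((\<lambda>m. f m * b) has_sum (a * b)) UNIV" by (intro has_sum_cmult_left f(2))
  ultimately have "((\<lambda>(m, n). f m * g n) has_sum (a * b)) (UNIV \<times> UNIV)"
    by (intro has_sum_SigmaI[where g = "\<lambda>m. f m * b"]) auto
  then show ?thesis by simp
qed

lemma abs_summable_theta_psi:
  fixes q :: "'a::{real_normed_field,banach}"
  assumes q: "norm q < 1"
  shows "(\<lambda>n::int. q ^ nat (n\<^sup>2)) abs_summable_on UNIV"
    and "(\<lambda>n::int. q ^ nat (n * (n + 1) div 2)) abs_summable_on UNIV"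
  using has_sum_imp_summable[OF has_sum_theta[of "norm q"]] has_sum_imp_summable[OF has_sum_psi[of "norm q"]] q
  by (simp_all add: norm_power)

lemma has_sum_theta_square:
  fixes q :: "'a::{real_normed_field,banach}"
  assumes q: "norm q < 1"
  shows "((\<lambda>(m::int, n::int). q ^ nat (m\<^sup>2) * q ^ nat (n\<^sup>2)) has_sum (theta q)\<^sup>2) UNIV"
  unfolding power2_eq_square[of "theta q"]
  by (intro has_sum_int_product abs_summable_theta_psi has_sum_theta q)

text \<open>The lattice points with \<open>m + n\<close> even are exactly those of the form \<open>(a + b, a - b)\<close>.\<close>

lemma theta_square_add:
  fixes q :: "'a::{real_normed_field,banach}"
  assumes q: "norm q < 1"
  shows "(theta q)\<^sup>2 + (theta (- q))\<^sup>2 = 2 * (theta (q\<^sup>2))\<^sup>2"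
proof -
  let ?f = "\<lambda>q::'a. \<lambda>(m::int, n::int). q ^ nat (m\<^sup>2) * q ^ nat (n\<^sup>2)"
  let ?h = "\<lambda>(a::int, b::int). (a + b, a - b)"
  have q2: "norm (q\<^sup>2) < 1" using q by (simp add: norm_power power_less_one_iff)
  have "((\<lambda>x. ?f q x + ?f (- q) x) has_sum ((theta q)\<^sup>2 + (theta (- q))\<^sup>2)) UNIV"
    by (intro has_sum_add has_sum_theta_square) (use q in auto)
  then have "((\<lambda>x. 2 * ?f q x) has_sum ((theta q)\<^sup>2 + (theta (- q))\<^sup>2)) {(m, n). even (m + n)}"
    by (subst has_sum_cong_neutral[where T = UNIV and g = "\<lambda>x. ?f q x + ?f (- q) x"])
       (auto simp: parity_power split: if_splits)
  moreover have "{(m::int, n::int). even (m + n)} = range ?h"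
  proof -
    have "(m, n) \<in> range ?h" if mn: "even (m + n)" for m n :: int
    proof -
      obtain a where a: "m + n = 2 * a" using mn by (elim evenE)
      then have "(m, n) = ?h (a, m - a)" by auto
      then show ?thesis by blast
    qed
    then show ?thesis by auto
  qed
  moreover have "inj ?h" by (auto simp: inj_on_def)
  ultimately have "((\<lambda>x. 2 * ?f q (?h x)) has_sum ((theta q)\<^sup>2 + (theta (- q))\<^sup>2)) UNIV"
    by (simp add: has_sum_reindex o_def)
  moreover have "?f q (?h x) = ?f (q\<^sup>2) x" for x
  proof (cases x)
    case (Pair a b)
    have "nat ((a + b)\<^sup>2) + nat ((a - b)\<^sup>2) = 2 * (nat (a\<^sup>2) + nat (b\<^sup>2))"
    proof -
      have "(a + b)\<^sup>2 + (a - b)\<^sup>2 = 2 * (a\<^sup>2 + b\<^sup>2)" by (simp add: power2_eq_square algebra_simps)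
      then have "nat ((a + b)\<^sup>2 + (a - b)\<^sup>2) = nat (2 * (a\<^sup>2 + b\<^sup>2))" by simp
      then show ?thesis by (simp add: nat_add_distrib nat_mult_distrib)
    qed
    then show ?thesis unfolding Pair by (simp add: power_add[symmetric] power_mult[symmetric])
  qed
  ultimately have "((\<lambda>x. 2 * ?f (q\<^sup>2) x) has_sum ((theta q)\<^sup>2 + (theta (- q))\<^sup>2)) UNIV" by simp
  moreover have "((\<lambda>x. 2 * ?f (q\<^sup>2) x) has_sum (2 * (theta (q\<^sup>2))\<^sup>2)) UNIV"
    by (intro has_sum_cmult_right has_sum_theta_square q2)
  ultimately show ?thesis by (rule has_sum_unique)
qed

text \<open>Squaring \<open>theta_add_theta_minus\<close> and inserting
  \<open>theta_square_add\<close> at q and at q^2 leaves only the mixed product. Together with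
  \<open>theta_square_add\<close> it says, for 0 < q < 1, that theta(q^2)^2 and theta(-q^2)^2 are
  the arithmetic and the geometric mean of theta(q)^2 and theta(-q)^2.\<close>

lemma theta_mult_theta_minus:
  fixes q :: "'a::{real_normed_field,banach}"
  assumes q: "norm q < 1"
  shows "theta q * theta (- q) = (theta (- (q\<^sup>2)))\<^sup>2"
proof -
  have q2: "norm (q\<^sup>2) < 1" using q by (simp add: norm_power power_less_one_iff)
  have "(theta (q\<^sup>2))\<^sup>2 + (theta (- (q\<^sup>2)))\<^sup>2 = 2 * (theta (q ^ 4))\<^sup>2"
    using theta_square_add[OF q2] by (simp add: power_mult[symmetric])
  moreover have "(theta q + theta (- q))\<^sup>2 = 4 * (theta (q ^ 4))\<^sup>2"
    unfolding theta_add_theta_minus[OF q] by (simp add: power_mult_distrib)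
  moreover have "(theta q + theta (- q))\<^sup>2 = (theta q)\<^sup>2 + (theta (- q))\<^sup>2 + 2 * (theta q * theta (- q))"
    by (simp add: power2_eq_square algebra_simps)
  ultimately have "2 * (theta q * theta (- q)) = 4 * (theta (q ^ 4))\<^sup>2 - 2 * (theta (q\<^sup>2))\<^sup>2"
    unfolding theta_square_add[OF q] by (simp add: eq_diff_eq add.commute)
  also have "\<dots> = 2 * (2 * (theta (q ^ 4))\<^sup>2 - (theta (q\<^sup>2))\<^sup>2)" by (simp add: right_diff_distrib)
  also have "2 * (theta (q ^ 4))\<^sup>2 - (theta (q\<^sup>2))\<^sup>2 = (theta (- (q\<^sup>2)))\<^sup>2"
    unfolding \<open>(theta (q\<^sup>2))\<^sup>2 + (theta (- (q\<^sup>2)))\<^sup>2 = 2 * (theta (q ^ 4))\<^sup>2\<close>[symmetric] by simp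
  finally have "2 * (theta q * theta (- q)) = 2 * (theta (- (q\<^sup>2)))\<^sup>2" .
  then show ?thesis by simp
qed

text \<open>The complementary side of the step of means: if a1, b1 are the two means of a, b, then
  a1^2 - b1^2 = ((a - b) / 2)^2.\<close>

lemma theta_fourth_diff_square:
  fixes q :: "'a::{real_normed_field,banach}"
  assumes q: "norm q < 1"
  shows "(theta (q\<^sup>2)) ^ 4 - (theta (- (q\<^sup>2))) ^ 4 = (((theta q)\<^sup>2 - (theta (- q))\<^sup>2) / 2)\<^sup>2"
proof -
  have "4 * ((theta (q\<^sup>2)) ^ 4 - (theta (- (q\<^sup>2))) ^ 4) = (2 * (theta (q\<^sup>2))\<^sup>2)\<^sup>2 - 4 * ((theta (- (q\<^sup>2)))\<^sup>2)\<^sup>2"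
    by (simp add: power_mult_distrib power_mult[symmetric] right_diff_distrib)
  also have "\<dots> = ((theta q)\<^sup>2 - (theta (- q))\<^sup>2)\<^sup>2"
    unfolding theta_square_add[OF q, symmetric] theta_mult_theta_minus[OF q, symmetric]
    by (simp add: power2_eq_square algebra_simps)
  finally show ?thesis by (simp add: power_divide eq_divide_eq mult.commute)
qed

section \<open>Differentiability, positivity and behaviour at 0 of the theta functions\<close>

definition theta_coeff :: "nat \<Rightarrow> 'a::{real_normed_field,banach}" where
  "theta_coeff n = (if n = 0 then 1 else if \<exists>k. n = k\<^sup>2 then 2 else 0)"

lemma theta_powser:
  fixes q :: "'a::{real_normed_field,banach}"
  assumes q: "norm q < 1"
  shows "(\<lambda>n. theta_coeff n * q ^ n) sums theta q"
proof -
  have "(\<lambda>n. 2 * q ^ ((Suc n)\<^sup>2)) sums (2 * (\<Sum>n. q ^ ((Suc n)\<^sup>2)))"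
    by (intro sums_mult summable_sums summable_norm_cancel[OF summable_norm_theta[OF q]])
  moreover have "theta_coeff ((Suc n)\<^sup>2) = (2 :: 'a)" for n by (auto simp: theta_coeff_def)
  ultimately have "(\<lambda>n. theta_coeff ((Suc n)\<^sup>2) * q ^ ((Suc n)\<^sup>2)) sums (2 * (\<Sum>n. q ^ ((Suc n)\<^sup>2)))"
    by (simp only:)
  then have "(\<lambda>n. theta_coeff (n\<^sup>2) * q ^ (n\<^sup>2)) sums (2 * (\<Sum>n. q ^ ((Suc n)\<^sup>2)) + theta_coeff (0\<^sup>2) * q ^ (0\<^sup>2))"
    by (rule sums_Suc_iff[THEN iffD1])
  then have *: "(\<lambda>n. theta_coeff (n\<^sup>2) * q ^ (n\<^sup>2)) sums theta q"
    by (simp add: theta_def theta_coeff_def add.commute)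
  have "strict_mono (\<lambda>n::nat. n\<^sup>2)" by (intro strict_monoI power_strict_mono) auto
  moreover have "theta_coeff n * q ^ n = 0" if "n \<notin> range (\<lambda>n::nat. n\<^sup>2)" for n
    using that unfolding theta_coeff_def by (auto simp: image_iff intro!: gr0I)
  ultimately show ?thesis using * by (subst (asm) sums_mono_reindex) auto
qed

definition theta' :: "'a::{real_normed_field,banach} \<Rightarrow> 'a" where
  "theta' q = (\<Sum>n. diffs theta_coeff n * q ^ n)"

lemma theta_has_derivative:
  fixes q :: "'a::{real_normed_field,banach}"
  assumes q: "norm q < 1"
  shows "(theta has_field_derivative theta' q) (at q)"
proof -
  obtain r where r: "norm q < r" "r < 1" using dense[OF q] by blast
  have "((\<lambda>q. \<Sum>n. theta_coeff n * q ^ n) has_field_derivative theta' q) (at q)"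
    unfolding theta'_def
  proof (rule termdiffs_strong)
    show "summable (\<lambda>n. theta_coeff n * (of_real r :: 'a) ^ n)"
      using theta_powser[of "of_real r :: 'a"] r norm_ge_zero[of q] by (auto simp: sums_iff)
    show "norm q < norm (of_real r :: 'a)" using r norm_ge_zero[of q] by simp
  qed
  moreover have "\<forall>\<^sub>F x in nhds q. (\<Sum>n. theta_coeff n * x ^ n) = theta x"
  proof -
    have "\<forall>\<^sub>F x in nhds q. x \<in> ball 0 1" using q by (intro eventually_nhds_in_open) auto
    then show ?thesis by eventually_elim (use theta_powser in \<open>auto simp: sums_iff\<close>)
  qed
  ultimately show ?thesis by (subst (asm) DERIV_cong_ev[OF refl _ refl]) auto
qed

lemma theta'_continuous_0: "isCont (theta' :: real \<Rightarrow> real) 0" "theta' (0::real) = 2" "theta (0::real) = 1"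
proof -
  have "summable (\<lambda>n. diffs theta_coeff n * (1/2 :: real) ^ n)"
    by (rule termdiff_converges[where K = 1]) (use sums_summable[OF theta_powser[where 'a = real]] in auto)
  then show "isCont (theta' :: real \<Rightarrow> real) 0" unfolding theta'_def[abs_def] by (intro isCont_powser) auto
  show "theta' (0::real) = 2"
    unfolding theta'_def powser_zero by (simp add: diffs_def theta_coeff_def) (rule exI[of _ 1], simp)
  show "theta (0::real) = 1" unfolding theta_def by (simp add: power_0_left)
qed

lemma theta_holomorphic: "theta holomorphic_on ball (0::complex) 1"
  unfolding holomorphic_on_def field_differentiable_def
  by (intro ballI exI, rule has_field_derivative_at_within, rule theta_has_derivative) simp

lemma theta_pos_real:
  fixes q :: real assumes "0 \<le> q" "q < 1"
  shows "theta q \<ge> 1 + 2 * q" "theta q \<le> 1 + 2 * q / (1 - q)" "psi q \<ge> 1" "theta q > 0" "psi q > 0"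
    "theta (- q) \<ge> 1 - 2 * q / (1 - q)"
proof -
  have sm: "summable (\<lambda>n. q ^ ((Suc n)\<^sup>2))" using summable_norm_cancel[OF summable_norm_theta[of q]] assms by simp
  have sm': "summable (\<lambda>n. (- q) ^ ((Suc n)\<^sup>2))" using summable_norm_cancel[OF summable_norm_theta[of "-q"]] assms by simp
  have le: "q ^ ((Suc n)\<^sup>2) \<le> q * q ^ n" for n
    using power_decreasing[of "Suc n" "(Suc n)\<^sup>2" q] assms by (simp add: power2_eq_square)
  have "(\<lambda>n. q * q ^ n) sums (q * (1 / (1 - q)))" using assms by (intro sums_mult geometric_sums) auto
  then have g: "summable (\<lambda>n. q * q ^ n)" "(\<Sum>n. q * q ^ n) = q / (1 - q)" by (auto simp: sums_iff)
  have "q ^ ((Suc 0)\<^sup>2) \<le> (\<Sum>n. q ^ ((Suc n)\<^sup>2))"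
    using sum_le_suminf[OF sm, of "{0}"] assms by auto
  then show 1: "theta q \<ge> 1 + 2 * q" by (simp add: theta_def)
  have "(\<Sum>n. q ^ ((Suc n)\<^sup>2)) \<le> q / (1 - q)" unfolding g(2)[symmetric] using sm g(1) le by (intro suminf_le) auto
  then show "theta q \<le> 1 + 2 * q / (1 - q)" by (simp add: theta_def)
  have "(\<Sum>n. - (q * q ^ n)) \<le> (\<Sum>n. (- q) ^ ((Suc n)\<^sup>2))"
  proof (rule suminf_le)
    show "- (q * q ^ n) \<le> (- q) ^ ((Suc n)\<^sup>2)" for n
      using le[of n] assms by (smt (verit) power_minus_Bit0 uminus_power_if zero_le_power)
  qed (use g sm' in \<open>auto intro: summable_minus\<close>)
  then show "theta (- q) \<ge> 1 - 2 * q / (1 - q)" using g by (simp add: theta_def suminf_minus)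
  have "summable (\<lambda>n. q ^ (n * Suc n div 2))" using summable_norm_cancel[OF summable_norm_psi[of q]] assms by simp
  from sum_le_suminf[OF this, of "{0}"] assms show 2: "psi q \<ge> 1" by (auto simp: psi_def)
  show "theta q > 0" "psi q > 0" using 1 2 assms by auto
qed

lemma power_two_power_tendsto_0:
  fixes q :: real assumes "0 \<le> q" "q < 1"
  shows "(\<lambda>n. q ^ (2 ^ n)) \<longlonglongrightarrow> 0"
proof (rule tendsto_sandwich[OF _ _ tendsto_const LIMSEQ_power_zero[of q]])
  show "\<forall>\<^sub>F n in sequentially. q ^ 2 ^ n \<le> q ^ n"
    using assms by (intro always_eventually allI power_decreasing) (auto intro: less_imp_le)
qed (use assms in auto)

lemma theta_isCont: "\<bar>q\<bar> < 1 \<Longrightarrow> isCont (theta :: real \<Rightarrow> real) q"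
  using theta_has_derivative[of q] DERIV_isCont by auto

lemma psi_isCont_0: "isCont (psi :: real \<Rightarrow> real) 0" "psi (0::real) = 1"
proof -
  show p0: "psi (0::real) = 1"
  proof -
    have "(0::real) ^ (n * Suc n div 2) = (if n = 0 then 1 else 0)" for n by (cases n) auto
    then show ?thesis unfolding psi_def
      by (subst suminf_finite[of "{0}"]) auto
  qed
  have b: "norm (psi q - 1) \<le> \<bar>q\<bar> / (1 - \<bar>q\<bar>)" if "\<bar>q\<bar> < 1" for q :: real
  proof -
    have sm: "summable (\<lambda>n. norm (q ^ (n * Suc n div 2)))" using summable_norm_psi[of q] that by simp
    have "(\<lambda>n. \<bar>q\<bar> * \<bar>q\<bar> ^ n) sums (\<bar>q\<bar> * (1 / (1 - \<bar>q\<bar>)))" using that by (intro sums_mult geometric_sums) auto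
    then have g: "summable (\<lambda>n. \<bar>q\<bar> * \<bar>q\<bar> ^ n)" "(\<Sum>n. \<bar>q\<bar> * \<bar>q\<bar> ^ n) = \<bar>q\<bar> / (1 - \<bar>q\<bar>)" by (auto simp: sums_iff)
    have sm1: "summable (\<lambda>n. norm (q ^ (Suc n * Suc (Suc n) div 2)))" using summable_Suc_iff[THEN iffD2, OF sm] .
    have "psi q - 1 = (\<Sum>n. q ^ (Suc n * Suc (Suc n) div 2))"
      unfolding psi_def using suminf_split_head[OF summable_norm_cancel[OF sm]] by simp
    then have "norm (psi q - 1) \<le> (\<Sum>n. norm (q ^ (Suc n * Suc (Suc n) div 2)))"
      using summable_norm[OF sm1] by simp
    also have "\<dots> \<le> (\<Sum>n. \<bar>q\<bar> * \<bar>q\<bar> ^ n)"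
    proof (rule suminf_le[OF _ sm1 g(1)])
      fix n
      have "Suc n \<le> Suc n * Suc (Suc n) div 2" by simp
      then show "norm (q ^ (Suc n * Suc (Suc n) div 2)) \<le> \<bar>q\<bar> * \<bar>q\<bar> ^ n"
        using norm_power_le_of_le[of q "Suc n"] that by (simp del: mult_Suc_right mult_Suc)
    qed
    finally show ?thesis using g(2) by simp
  qed
  have "((\<lambda>q. psi q - 1) \<longlongrightarrow> 0) (at (0::real))"
  proof (rule Lim_null_comparison)
    have "\<forall>\<^sub>F q in at (0::real). q \<in> ball 0 1" by (intro eventually_at_in_open') auto
    then show "\<forall>\<^sub>F q in at (0::real). norm (psi q - 1) \<le> \<bar>q\<bar> / (1 - \<bar>q\<bar>)" by eventually_elim (use b in auto)
    show "((\<lambda>q. \<bar>q\<bar> / (1 - \<bar>q\<bar>)) \<longlongrightarrow> 0) (at (0::real))" by (rule tendsto_eq_intros refl | simp)+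
  qed
  then show "isCont (psi :: real \<Rightarrow> real) 0" unfolding isCont_def p0 using LIM_zero_iff by blast
qed

text \<open>By \<open>theta_mult_theta_minus\<close> the value is nonnegative, and a zero at q would
  propagate to q^2, q^4, and so on, which tend to 0, where \<open>theta\<close> is continuous with
  value 1.\<close>

lemma theta_minus_pos_real:
  fixes q :: real assumes q: "0 \<le> q" "q < 1"
  shows "theta (- q) > 0"
proof (rule ccontr)
  assume neg: "\<not> theta (- q) > 0"
  have nq: "norm q < 1" using q by simp
  have "theta q * theta (- q) = (theta (- (q\<^sup>2)))\<^sup>2" using theta_mult_theta_minus[OF nq] .
  then have "theta (- q) \<ge> 0" using theta_pos_real(4)[OF q] zero_le_power2[of "theta (- (q\<^sup>2))"]
    by (metis mult_less_0_iff not_le)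
  with neg have z: "theta (- q) = 0" by simp
  have "theta (- (q ^ 2 ^ n)) = 0" for n
  proof (induction n)
    case (Suc n)
    have "norm (q ^ 2 ^ n) < 1" using q by (simp add: power_less_one_iff)
    from theta_mult_theta_minus[OF this] Suc have "theta (- ((q ^ 2 ^ n)\<^sup>2)) = 0" by simp
    then show ?case by (simp add: power_mult[symmetric] mult.commute)
  qed (use z in simp)
  then have "(\<lambda>n. theta (- (q ^ 2 ^ n))) \<longlonglongrightarrow> 0" by simp
  moreover have "(\<lambda>n. theta (- (q ^ 2 ^ n))) \<longlonglongrightarrow> theta (- 0)"
    by (intro isCont_tendsto_compose[OF theta_isCont] tendsto_minus power_two_power_tendsto_0 q) auto
  ultimately show False using theta'_continuous_0(3) LIMSEQ_unique by fastforce
qed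

lemma theta_square_diff:
  fixes q :: "'a::{real_normed_field,banach}"
  assumes q: "norm q < 1"
  shows "(theta q)\<^sup>2 - (theta (- q))\<^sup>2 = 8 * q * psi (q ^ 8) * theta (q ^ 4)"
proof -
  have "(theta q)\<^sup>2 - (theta (- q))\<^sup>2 = (theta q - theta (- q)) * (theta q + theta (- q))"
    by (simp add: power2_eq_square algebra_simps)
  then show ?thesis unfolding theta_add_theta_minus[OF q] theta_diff_theta_minus[OF q] by simp
qed

text \<open>On pairs (m, n) with m + n even, (m, n) = (a + b, a - b) turns T(m) + T(n) into 2 T(a) +
  b^2 for the triangular numbers T. The reflection n -> -1 - n preserves T(n) and exchanges the
  parities of m + n, so the odd pairs contribute the same amount.\<close>

lemma psi_square:
  fixes q :: "'a::{real_normed_field,banach}"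
  assumes q: "norm q < 1"
  shows "(psi q)\<^sup>2 = psi (q\<^sup>2) * theta q"
proof -
  let ?T = "\<lambda>n::int. n * (n + 1) div 2"
  let ?f = "\<lambda>(m::int, n::int). q ^ nat (?T m) * q ^ nat (?T n)"
  let ?h = "\<lambda>(a::int, b::int). (a + b, a - b)"
  let ?k = "\<lambda>(a::int, b::int). (a, - 1 - b)"
  let ?E = "{(m::int, n::int). even (m + n)}"
  define s where "s = 2 * psi (q\<^sup>2) * theta q"
  have q2: "norm (q\<^sup>2) < 1" using q by (simp add: norm_power power_less_one_iff)
  have T: "2 * ?T n = n * (n + 1)" "?T n \<ge> 0" for n
  proof -
    show "2 * ?T n = n * (n + 1)" by simp
    moreover have "n * (n + 1) \<ge> 0" by (cases "n \<ge> 0") (auto intro: mult_nonpos_nonpos)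
    ultimately show "?T n \<ge> 0" by linarith
  qed
  have "((\<lambda>(a, b). (q\<^sup>2) ^ nat (?T a) * q ^ nat (b\<^sup>2)) has_sum s) UNIV"
    unfolding s_def by (intro has_sum_int_product abs_summable_theta_psi has_sum_theta has_sum_psi q q2)
  moreover have "?f (?h x) = (\<lambda>(a, b). (q\<^sup>2) ^ nat (?T a) * q ^ nat (b\<^sup>2)) x" for x
  proof (cases x)
    case (Pair a b)
    have "u + v = 2 * r + b\<^sup>2" if "2 * u = (a + b) * (a + b + 1)" "2 * v = (a - b) * (a - b + 1)" "2 * r = a * (a + 1)" for u v r
    proof -
      have "2 * (u + v) = (a + b) * (a + b + 1) + (a - b) * (a - b + 1)" using that by simp
      also have "\<dots> = 2 * (a * (a + 1)) + 2 * b\<^sup>2" by (simp add: power2_eq_square algebra_simps)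
      also have "\<dots> = 2 * (2 * r + b\<^sup>2)" unfolding that(3)[symmetric] by simp
      finally show ?thesis by simp
    qed
    from this[OF T(1) T(1) T(1)] have "?T (a + b) + ?T (a - b) = 2 * ?T a + b\<^sup>2" .
    then have "nat (?T (a + b) + ?T (a - b)) = nat (2 * ?T a + b\<^sup>2)" by (rule arg_cong)
    then have "nat (?T (a + b)) + nat (?T (a - b)) = 2 * nat (?T a) + nat (b\<^sup>2)"
      using T(2)[of "a + b"] T(2)[of "a - b"] T(2)[of a] by (simp only: nat_add_distrib nat_mult_distrib mult_nonneg_nonneg zero_le_power2) simp
    then show ?thesis unfolding Pair by (simp only: prod.case power_add[symmetric] power_mult[symmetric])
  qed
  ultimately have h: "((\<lambda>x. ?f (?h x)) has_sum s) UNIV" by simp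
  have "inj ?h" by (auto simp: inj_on_def)
  moreover have "?E = range ?h"
  proof -
    have "(m, n) \<in> range ?h" if mn: "even (m + n)" for m n :: int
    proof -
      obtain a where a: "m + n = 2 * a" using mn by (elim evenE)
      then have "(m, n) = ?h (a, m - a)" by auto
      then show ?thesis by blast
    qed
    then show ?thesis by auto
  qed
  ultimately have E: "(?f has_sum s) ?E" using h by (simp add: has_sum_reindex o_def)
  have k: "?f (?k x) = ?f x" for x
  proof (cases x)
    case (Pair a b)
    have "(- 1 - b) * (- 1 - b + 1) = b * (b + 1)" by (simp add: algebra_simps)
    then show ?thesis unfolding Pair by (simp only: prod.case)
  qed
  have "((\<lambda>x. ?f (?k x)) has_sum s) ?E" unfolding k by (rule E)
  moreover have "inj_on ?k ?E" by (auto simp: inj_on_def)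
  ultimately have "(?f has_sum s) (?k ` ?E)" using has_sum_reindex[of ?k ?E ?f s] by (simp only: o_def)
  moreover have "?k ` ?E = - ?E"
  proof -
    have "(m, n) \<in> ?k ` ?E" if "odd (m + n)" for m n :: int
      using that by (intro image_eqI[of _ _ "(m, - 1 - n)"]) auto
    then show ?thesis by auto
  qed
  ultimately have "(?f has_sum (s + s)) (?E \<union> - ?E)" by (intro has_sum_Un_disjoint E) auto
  moreover have "(?f has_sum (2 * psi q * (2 * psi q))) UNIV"
    by (intro has_sum_int_product abs_summable_theta_psi has_sum_psi q)
  ultimately have "s + s = 2 * psi q * (2 * psi q)" using has_sum_unique by (simp only: Compl_partition) blast
  then have "4 * (psi q)\<^sup>2 = 4 * (psi (q\<^sup>2) * theta q)" unfolding s_def by (simp add: power2_eq_square mult_ac)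
  then show ?thesis by simp
qed

text \<open>In classical notation the second identity is theta_3^4 - theta_4^4 = theta_2^4, with
  theta_2 already expressed by the triangular series. Its explicit factor q governs everything that
  happens near q = 0.\<close>

lemma theta_diff_psi_norm:
  fixes q :: "'a::{real_normed_field,banach}"
  assumes q: "norm q < 1"
  shows "(theta q)\<^sup>2 - (theta (- q))\<^sup>2 = 8 * q * (psi (q ^ 4))\<^sup>2"
    and "(theta q) ^ 4 - (theta (- q)) ^ 4 = 16 * q * (psi (q\<^sup>2)) ^ 4"
proof -
  have n: "norm (q ^ 4) < 1" "norm (q\<^sup>2) < 1" using q by (auto simp: norm_power power_less_one_iff)
  show 1: "(theta q)\<^sup>2 - (theta (- q))\<^sup>2 = 8 * q * (psi (q ^ 4))\<^sup>2"
    unfolding theta_square_diff[OF q] psi_square[OF n(1)] by (simp add: power_mult[symmetric])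
  have "x ^ 4 - y ^ 4 = (x\<^sup>2 - y\<^sup>2) * (x\<^sup>2 + y\<^sup>2)" for x y :: 'a
    by (simp add: power2_eq_square power4_eq_xxxx algebra_simps)
  then have "(theta q) ^ 4 - (theta (- q)) ^ 4 = ((theta q)\<^sup>2 - (theta (- q))\<^sup>2) * ((theta q)\<^sup>2 + (theta (- q))\<^sup>2)" .
  also have "\<dots> = 16 * q * (psi ((q\<^sup>2)\<^sup>2) * theta (q\<^sup>2))\<^sup>2"
    unfolding 1 theta_square_add[OF q] by (simp add: power_mult_distrib power_mult[symmetric])
  also have "psi ((q\<^sup>2)\<^sup>2) * theta (q\<^sup>2) = (psi (q\<^sup>2))\<^sup>2" by (rule psi_square[OF n(2), symmetric])
  finally show "(theta q) ^ 4 - (theta (- q)) ^ 4 = 16 * q * (psi (q\<^sup>2)) ^ 4" by (simp add: power_mult[symmetric])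
qed

lemma theta_diff_psi:
  fixes q :: real assumes q: "0 < q" "q < 1"
  shows "(theta q)\<^sup>2 - (theta (- q))\<^sup>2 = 8 * q * (psi (q ^ 4))\<^sup>2"
    and "(theta q) ^ 4 - (theta (- q)) ^ 4 = 16 * q * (psi (q\<^sup>2)) ^ 4"
  using theta_diff_psi_norm[of q] q by auto

text \<open>Both sides of the next identity are multiplied by the same factor under \<open>q \<mapsto> q\<^sup>2\<close>, so their
  quotient is constant along \<open>q, q\<^sup>2, q\<^sup>4, \<dots>\<close> and can be read off at \<open>q = 0\<close>.\<close>

lemma theta_log_derivative:
  fixes q :: real assumes q: "0 < q" "q < 1"
  shows "q * (- theta' (- q) / theta (- q) - theta' q / theta q) = - ((theta q) ^ 4 - (theta (- q)) ^ 4) / 4"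
proof -
  define w where "w q = q * (- theta' (- q) / theta (- q) - theta' q / theta q)" for q :: real
  define V where "V q = (theta q) ^ 4 - (theta (- q)) ^ 4" for q :: real
  define f where "f q = ln (theta (- q)) - ln (theta q)" for q :: real
  have pos: "theta q > 0" "theta (- q) > 0" if "0 < q" "q < 1" for q :: real
    using theta_pos_real(4)[of q] theta_minus_pos_real[of q] that by auto
  have f: "(f has_real_derivative w q / q) (at q)" if q: "0 < q" "q < 1" for q
  proof -
    have "((\<lambda>q. theta (- q)) has_real_derivative theta' (- q) * (- 1)) (at q)"
      using q by (intro DERIV_chain2[OF theta_has_derivative]) (auto intro!: derivative_eq_intros)
    moreover have "(theta has_real_derivative theta' q) (at q)" using q by (intro theta_has_derivative) auto
    ultimately show ?thesis unfolding f_def w_def using pos[OF q] q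
      by (auto intro!: derivative_eq_intros simp: field_simps)
  qed
  \<comment> \<open>The step of means, written for the logarithm \<open>f\<close> of theta(-q) /
    theta(q), is a functional equation between \<open>f\<close> at q^2 and \<open>f\<close> at q.
    Differentiating it relates the values of \<open>w\<close>; \<open>V\<close> obeys the same
    relation.\<close>
  have step: "w (q\<^sup>2) * V q = w q * V (q\<^sup>2)" if q: "0 < q" "q < 1" for q
  proof -
    have q2: "0 < q\<^sup>2" "q\<^sup>2 < 1" using q by (auto simp: power_less_one_iff)
    have n: "norm q < 1" using q by simp
    define a b where "a = (theta q)\<^sup>2" and "b = (theta (- q))\<^sup>2"
    have ab: "a > 0" "b > 0" using pos[OF q] by (auto simp: a_def b_def)
    have feq: "2 * f (t\<^sup>2) = f t + ln 2 - ln (1 + exp (2 * f t))" if t: "0 < t" "t < 1" for t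
    proof -
      have nt: "norm t < 1" using t by simp
      have t2: "0 < t\<^sup>2" "t\<^sup>2 < 1" using t by (auto simp: power_less_one_iff)
      have "2 * f (t\<^sup>2) = ln ((theta (- (t\<^sup>2)))\<^sup>2) - ln ((theta (t\<^sup>2))\<^sup>2)"
        unfolding f_def using pos[OF t2] by (simp add: ln_realpow right_diff_distrib)
      also have "(theta (- (t\<^sup>2)))\<^sup>2 = theta t * theta (- t)" using theta_mult_theta_minus[OF nt] by simp
      also have "(theta (t\<^sup>2))\<^sup>2 = (theta t)\<^sup>2 * (1 + exp (2 * f t)) / 2"
      proof -
        have "exp (2 * f t) = (theta (- t) / theta t)\<^sup>2"
          unfolding f_def using pos[OF t] by (simp add: exp_double exp_diff power_divide)
        then have "(theta t)\<^sup>2 * (1 + exp (2 * f t)) = (theta t)\<^sup>2 + (theta (- t))\<^sup>2"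
          using pos[OF t] by (simp add: power_divide field_simps)
        then show ?thesis unfolding theta_square_add[OF nt] by simp
      qed
      also have "ln (theta t * theta (- t)) = ln (theta t) + ln (theta (- t))" using pos[OF t] by (simp add: ln_mult)
      also have "ln ((theta t)\<^sup>2 * (1 + exp (2 * f t)) / 2) = 2 * ln (theta t) + ln (1 + exp (2 * f t)) - ln 2"
      proof -
        have "1 + exp (2 * f t) > 0" by (simp add: add_pos_pos)
        then show ?thesis using pos[OF t] by (simp add: ln_div ln_mult ln_realpow)
      qed
      finally show ?thesis unfolding f_def by simp
    qed
    have d1: "((\<lambda>t. 2 * f (t\<^sup>2)) has_real_derivative 2 * (w (q\<^sup>2) / q\<^sup>2 * (2 * q))) (at q)"
      by (intro DERIV_cmult DERIV_chain2[where f = f and g = "\<lambda>t. t\<^sup>2", OF f[OF q2]]) (auto intro!: derivative_eq_intros)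
    have e: "1 + exp (2 * f q) = (a + b) / a" "exp (2 * f q) = b / a"
    proof -
      show "exp (2 * f q) = b / a"
        unfolding f_def a_def b_def using pos[OF q] by (simp add: exp_double exp_diff power_divide)
      then show "1 + exp (2 * f q) = (a + b) / a" using ab by (simp add: field_simps)
    qed
    have d2: "((\<lambda>t. f t + ln 2 - ln (1 + exp (2 * f t))) has_real_derivative w q / q - (1 / (1 + exp (2 * f q))) * (exp (2 * f q) * (2 * (w q / q)))) (at q)"
    proof -
      have "1 + exp (2 * f q) > 0" by (simp add: add_pos_pos)
      then show ?thesis by (auto intro!: derivative_eq_intros f[OF q])
    qed
    have ev: "\<forall>\<^sub>F t in nhds q. 2 * f (t\<^sup>2) = f t + ln 2 - ln (1 + exp (2 * f t))"
    proof -
      have "\<forall>\<^sub>F t in nhds q. t \<in> {0<..<1}" using q by (intro eventually_nhds_in_open) auto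
      then show ?thesis by eventually_elim (use feq in auto)
    qed
    have "2 * (w (q\<^sup>2) / q\<^sup>2 * (2 * q)) = w q / q - (1 / (1 + exp (2 * f q))) * (exp (2 * f q) * (2 * (w q / q)))"
      by (rule DERIV_unique[OF DERIV_cong_ev[OF refl ev refl, THEN iffD1, OF d1] d2])
    moreover have "2 * (w (q\<^sup>2) / q\<^sup>2 * (2 * q)) = 4 * w (q\<^sup>2) * (1 / q)" using q by (simp add: power2_eq_square)
    moreover have "(1 / (1 + exp (2 * f q))) * (exp (2 * f q) * (2 * (w q / q))) = (w q * (2 * b / (a + b))) * (1 / q)"
    proof -
      have "(1 / ((a + b) / a)) * (b / a) = b / (a + b)" using ab by simp
      then have "(1 / (1 + exp (2 * f q))) * exp (2 * f q) = b / (a + b)"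
        by (rule trans[OF arg_cong2[where f = "\<lambda>x y. (1 / x) * y", OF e]])
      then have "(1 / (1 + exp (2 * f q))) * exp (2 * f q) * (2 * (w q / q)) = b / (a + b) * (2 * (w q / q))" by (rule arg_cong)
      then show ?thesis by (simp add: mult_ac)
    qed
    moreover have "w q / q - w q * (2 * b / (a + b)) * (1 / q) = (w q - w q * (2 * b / (a + b))) * (1 / q)"
      by (simp add: diff_divide_distrib)
    ultimately have "4 * w (q\<^sup>2) * (1 / q) = (w q - w q * (2 * b / (a + b))) * (1 / q)"
      by (simp only:)
    moreover have "\<And>x y. x * (1 / q) = y * (1 / q) \<Longrightarrow> x = y" using q by simp
    ultimately have "4 * w (q\<^sup>2) = w q - w q * (2 * b / (a + b))" by blast
    also have "\<dots> = w q * (1 - 2 * b / (a + b))" by (simp add: right_diff_distrib)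
    also have "1 - 2 * b / (a + b) = (a - b) / (a + b)"
    proof -
      have "1 = (a + b) / (a + b)" using ab by simp
      then show ?thesis by (metis (no_types) add_diff_add diff_divide_distrib mult_2 add.commute add_diff_cancel_left diff_add_eq_diff_diff_swap)
    qed
    finally have w: "4 * w (q\<^sup>2) = w q * ((a - b) / (a + b))" .
    have V1: "V q = (a - b) * (a + b)" unfolding V_def a_def b_def by algebra
    have V2: "4 * V (q\<^sup>2) = (a - b)\<^sup>2"
      unfolding V_def theta_fourth_diff_square[OF n] a_def b_def by (simp add: power_divide)
    have "4 * (w (q\<^sup>2) * V q) = (4 * w (q\<^sup>2)) * ((a - b) * (a + b))" unfolding V1 by (simp only: mult.assoc)
    also have "\<dots> = w q * ((a - b) / (a + b)) * ((a - b) * (a + b))" unfolding w ..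
    also have "\<dots> = w q * (4 * V (q\<^sup>2))" unfolding V2 using ab by (simp add: power2_eq_square)
    finally show ?thesis by simp
  qed
  have Vpos: "V q > 0" if q: "0 < q" "q < 1" for q
    unfolding V_def theta_diff_psi(2)[OF q] using theta_pos_real(5)[of "q\<^sup>2"] q by (simp add: power_less_one_iff)
  have const: "w (q ^ 2 ^ n) / V (q ^ 2 ^ n) = w q / V q" for n
  proof (induction n)
    case (Suc n)
    have qn: "0 < q ^ 2 ^ n" "q ^ 2 ^ n < 1" using q by (simp_all add: power_less_one_iff)
    have qn2: "0 < (q ^ 2 ^ n)\<^sup>2" "(q ^ 2 ^ n)\<^sup>2 < 1" using qn q by (simp_all add: power_less_one_iff)
    have "w ((q ^ 2 ^ n)\<^sup>2) / V ((q ^ 2 ^ n)\<^sup>2) = w (q ^ 2 ^ n) / V (q ^ 2 ^ n)"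
      using step[OF qn] Vpos[OF qn] Vpos[OF qn2] by (simp add: frac_eq_eq)
    then show ?case using Suc by (simp add: power_mult[symmetric] mult.commute)
  qed simp
  have wV: "w x / V x = (- theta' (- x) / theta (- x) - theta' x / theta x) / (16 * (psi (x\<^sup>2)) ^ 4)" if x: "0 < x" "x < 1" for x
    unfolding w_def V_def theta_diff_psi(2)[OF x] using x by simp
  have x0: "(\<lambda>n. q ^ 2 ^ n) \<longlonglongrightarrow> 0" using q by (intro power_two_power_tendsto_0) auto
  have mx0: "(\<lambda>n. - (q ^ 2 ^ n)) \<longlonglongrightarrow> 0" using tendsto_minus[OF x0] by simp
  have xx0: "(\<lambda>n. (q ^ 2 ^ n)\<^sup>2) \<longlonglongrightarrow> 0" using tendsto_power[OF x0, of 2] by simp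
  have th0: "isCont (theta :: real \<Rightarrow> real) 0" by (rule theta_isCont) simp
  have "(\<lambda>n. (- theta' (- (q ^ 2 ^ n)) / theta (- (q ^ 2 ^ n)) - theta' (q ^ 2 ^ n) / theta (q ^ 2 ^ n)) / (16 * (psi ((q ^ 2 ^ n)\<^sup>2)) ^ 4))
    \<longlonglongrightarrow> (- theta' 0 / theta 0 - theta' 0 / theta 0) / (16 * (psi 0) ^ 4 :: real)"
    by (intro tendsto_intros isCont_tendsto_compose[OF theta'_continuous_0(1)] isCont_tendsto_compose[OF th0]
        isCont_tendsto_compose[OF psi_isCont_0(1)] x0 mx0 xx0) (auto simp: theta'_continuous_0 psi_isCont_0)
  moreover have "(- theta' (- (q ^ 2 ^ n)) / theta (- (q ^ 2 ^ n)) - theta' (q ^ 2 ^ n) / theta (q ^ 2 ^ n)) / (16 * (psi ((q ^ 2 ^ n)\<^sup>2)) ^ 4) = w q / V q" for n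
    using wV[of "q ^ 2 ^ n"] const[of n] q by (simp add: power_less_one_iff)
  \<comment> \<open>The values theta'(0) = 2 and theta(0) = psi(0) = 1 give (-2 - 2) / 16.\<close>
  ultimately have "w q / V q = - 1 / 4" by (simp add: LIMSEQ_const_iff theta'_continuous_0 psi_isCont_0)
  then show ?thesis using Vpos[OF q] unfolding w_def V_def by (simp add: field_simps)
qed

section \<open>The arithmetic-geometric mean and the inversion formula\<close>

text \<open>A complete elliptic integral, equal for positive a, b to pi divided by their
  arithmetic-geometric mean. In this form the invariance under a step of the mean is a matter of
  substitution.\<close>

definition agm_integral :: "real \<Rightarrow> real \<Rightarrow> ennreal" where
  "agm_integral a b = (\<integral>\<^sup>+y. ennreal (1 / sqrt ((y\<^sup>2 + a\<^sup>2) * (y\<^sup>2 + b\<^sup>2))) \<partial>lborel)"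

lemma nn_integral_even:
  fixes f :: "real \<Rightarrow> ennreal"
  assumes [measurable]: "f \<in> borel_measurable borel" and even: "\<And>x. f (- x) = f x"
  shows "(\<integral>\<^sup>+x. f x \<partial>lborel) = 2 * (\<integral>\<^sup>+x\<in>{0<..}. f x \<partial>lborel)"
proof -
  have "(\<integral>\<^sup>+x. f x \<partial>lborel) = (\<integral>\<^sup>+x. f x * indicator {0<..} x + f x * indicator {..<0} x \<partial>lborel)"
  proof (rule nn_integral_cong_AE)
    show "AE x in lborel. f x = f x * indicator {0<..} x + f x * indicator {..<0} x"
      using AE_lborel_singleton[of "0::real"] by eventually_elim (auto split: split_indicator)
  qed
  also have "\<dots> = (\<integral>\<^sup>+x. f x * indicator {0<..} x \<partial>lborel) + (\<integral>\<^sup>+x. f x * indicator {..<0} x \<partial>lborel)"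
    by (rule nn_integral_add) auto
  also have "(\<integral>\<^sup>+x. f x * indicator {..<0} x \<partial>lborel) = (\<integral>\<^sup>+x. f (- x) * indicator {..<0} (- x) \<partial>lborel)"
    using nn_integral_real_affine[of "\<lambda>x. f x * indicator {..<0} x" "- 1" 0] by simp
  also have "\<dots> = (\<integral>\<^sup>+x. f x * indicator {0<..} x \<partial>lborel)"
    by (rule nn_integral_cong) (auto simp: even split: split_indicator)
  finally show ?thesis by (simp add: mult_2)
qed

lemma cosh_quadratic_quotient:
  assumes "a > 0"
  shows "cosh_quadratic (b / a) u = (a + b * exp u) * (a + b * exp (- u)) / a\<^sup>2"
proof -
  have "exp u * exp (- u) = 1" by (simp add: exp_minus)
  then have "(a + b * exp u) * (a + b * exp (- u)) = a\<^sup>2 + b\<^sup>2 + a * b * (exp u + exp (- u))"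
    by algebra
  also have "\<dots> = a\<^sup>2 * cosh_quadratic (b / a) u"
    unfolding cosh_quadratic_def cosh_def using assms by (simp add: field_simps power2_eq_square)
  finally show ?thesis using assms by simp
qed

text \<open>By homogeneity the integral depends only on b / a, up to the factor 1 / a. It is the
  common end point of two different substitutions, one for the pair a, b and one for the pair of its
  means.\<close>

lemma cosh_integral_0_nn_integral:
  assumes a: "a > 0" and b: "b > 0"
  shows "(\<integral>\<^sup>+u. ennreal (1 / sqrt ((a + b * exp u) * (a + b * exp (- u)))) \<partial>lborel) = ennreal (cosh_integral 0 (b / a) / a)"
proof -
  have s: "b / a > 0" using a b by simp
  have int: "integrable lborel (\<lambda>u. cosh_quadratic (b / a) u powr (- (1/2)))" by (rule cosh_quadratic_powr_integrable[OF s]) simp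
  have eq: "cosh_quadratic (b / a) u powr (- (1/2)) / a = 1 / sqrt ((a + b * exp u) * (a + b * exp (- u)))" for u
  proof -
    have E: "cosh_quadratic (b / a) u > 0" using cosh_quadratic_ge[OF s] by simp
    have "cosh_quadratic (b / a) u powr (- (1/2)) = 1 / sqrt (cosh_quadratic (b / a) u)"
      using E by (simp add: powr_minus_divide powr_half_sqrt)
    also have "sqrt (cosh_quadratic (b / a) u) = sqrt ((a + b * exp u) * (a + b * exp (- u))) / a"
      unfolding cosh_quadratic_quotient[OF a] real_sqrt_divide using a by simp
    finally show ?thesis using a by simp
  qed
  have "(\<integral>\<^sup>+u. ennreal (cosh_quadratic (b / a) u powr (- (1/2)) / a) \<partial>lborel) = ennreal (LINT u|lborel. cosh_quadratic (b / a) u powr (- (1/2)) / a)"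
    using int a by (intro nn_integral_eq_integral integrable_divide) auto
  then show ?thesis unfolding eq by (simp add: cosh_integral_def eq[symmetric])
qed

text \<open>Substitution y = sqrt (a b) exp (u / 2) on the half line, doubled by evenness.\<close>

lemma agm_integral_eq_cosh_integral:
  assumes a: "a > 0" and b: "b > 0"
  shows "agm_integral a b = ennreal (cosh_integral 0 (b / a) / a)"
proof -
  let ?f = "\<lambda>y. 1 / sqrt ((y\<^sup>2 + a\<^sup>2) * (y\<^sup>2 + b\<^sup>2))" and ?g = "\<lambda>u. sqrt (a * b) * exp (u / 2)"
    and ?P = "\<lambda>u. (a + b * exp u) * (a + b * exp (- u))"
  have ab: "a * b > 0" using a b by simp
  have rng: "range ?g = {0<..}"
  proof -
    have "x \<in> range ?g" if "x > 0" for x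
      using that ab by (intro image_eqI[of x ?g "2 * ln (x / sqrt (a * b))"]) auto
    then show ?thesis using ab by auto
  qed
  have "agm_integral a b = 2 * (\<integral>\<^sup>+x\<in>{0<..}. ennreal (?f x) \<partial>lborel)"
    unfolding agm_integral_def by (rule nn_integral_even) auto
  also have "(\<integral>\<^sup>+x\<in>{0<..}. ennreal (?f x) \<partial>lborel) = (\<integral>\<^sup>+x\<in>range ?g. ennreal (?f x) \<partial>lborel)" unfolding rng ..
  also have "\<dots> = (\<integral>\<^sup>+u\<in>UNIV. ennreal (\<bar>?g u / 2\<bar> * ?f (?g u)) \<partial>lborel)"
  proof (rule nn_integral_change_of_variables)
    show "range ?g \<in> sets borel" unfolding rng by simp
    show "(?g has_real_derivative ?g u / 2) (at u within UNIV)" for u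
      by (auto intro!: derivative_eq_intros)
    show "inj ?g" using ab by (auto intro!: injI)
    show "(\<lambda>x. indicator (range ?g) x * ?f x) \<in> borel_measurable borel" unfolding rng by measurable
  qed auto
  also have "\<dots> = (\<integral>\<^sup>+u. ennreal (1/2) * ennreal (1 / sqrt (?P u)) \<partial>lborel)"
  proof (rule nn_integral_cong)
    fix u :: real
    have g: "?g u > 0" using ab by simp
    have "(exp (u / 2))\<^sup>2 = exp u" by (simp add: exp_double[symmetric])
    then have g2: "(?g u)\<^sup>2 = a * b * exp u" using ab by (simp add: power_mult_distrib)
    have "exp u * exp (- u) = 1" by (simp add: exp_minus)
    then have "(a * b * exp u + a\<^sup>2) * (a * b * exp u + b\<^sup>2) = a * b * exp u * ?P u" by algebra
    then have "sqrt (((?g u)\<^sup>2 + a\<^sup>2) * ((?g u)\<^sup>2 + b\<^sup>2)) = sqrt ((?g u)\<^sup>2 * ?P u)" unfolding g2 by simp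
    also have "\<dots> = ?g u * sqrt (?P u)" using g by (simp only: real_sqrt_mult real_sqrt_abs abs_of_pos)
    finally have s: "sqrt (((?g u)\<^sup>2 + a\<^sup>2) * ((?g u)\<^sup>2 + b\<^sup>2)) = ?g u * sqrt (?P u)" .
    have "\<bar>x / 2\<bar> * (1 / (x * y)) = 1 / 2 * (1 / y)" if "x > 0" for x y :: real using that by simp
    from this[OF g] have fg: "\<bar>?g u / 2\<bar> * ?f (?g u) = 1 / 2 * (1 / sqrt (?P u))" unfolding s .
    have "0 \<le> 1 / sqrt (?P u)" using a b by simp
    then show "ennreal (\<bar>?g u / 2\<bar> * ?f (?g u)) * indicator UNIV u = ennreal (1/2) * ennreal (1 / sqrt (?P u))"
      unfolding fg indicator_UNIV mult_1_right by (intro ennreal_mult) auto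
  qed
  also have "\<dots> = ennreal (1/2) * ennreal (cosh_integral 0 (b / a) / a)"
    unfolding cosh_integral_0_nn_integral[OF a b, symmetric] by (rule nn_integral_cmult) measurable
  also have "2 * \<dots> = ennreal (cosh_integral 0 (b / a) / a)"
  proof -
    have "2 * (ennreal (1/2) * x) = x" for x
    proof -
      have "(2 :: ennreal) * ennreal (1/2) = ennreal (2 * (1/2))" by (subst ennreal_mult) auto
      then show ?thesis by (simp add: mult.assoc[symmetric])
    qed
    then show ?thesis .
  qed
  finally show ?thesis .
qed

text \<open>Gauss's invariance: y = (t - a b / t) / 2 with t = sqrt (a b) exp (u / 2), that is y =
  sqrt (a b) sinh (u / 2), leads for the means of a, b to the integral over u that
  \<open>agm_integral_eq_cosh_integral\<close> produces for a, b themselves. Here y covers the whole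
  line, so no doubling by evenness occurs.\<close>

lemma agm_integral_AGM:
  assumes a: "a > 0" and b: "b > 0"
  shows "agm_integral ((a + b) / 2) (sqrt (a * b)) = ennreal (cosh_integral 0 (b / a) / a)"
proof -
  let ?f = "\<lambda>y. 1 / sqrt ((y\<^sup>2 + ((a + b) / 2)\<^sup>2) * (y\<^sup>2 + (sqrt (a * b))\<^sup>2))"
    and ?g = "\<lambda>u. sqrt (a * b) * sinh (u / 2)" and ?g' = "\<lambda>u. sqrt (a * b) * cosh (u / 2) / 2"
    and ?P = "\<lambda>u. (a + b * exp u) * (a + b * exp (- u))"
  have ab: "a * b > 0" using a b by simp
  have rng: "range ?g = UNIV"
  proof -
    have "x \<in> range ?g" for x
      using ab a b by (intro image_eqI[of x ?g "2 * arsinh (x / sqrt (a * b))"]) (auto simp: sinh_arsinh_real)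
    then show ?thesis by auto
  qed
  have "agm_integral ((a + b) / 2) (sqrt (a * b)) = (\<integral>\<^sup>+x\<in>range ?g. ennreal (?f x) \<partial>lborel)"
    unfolding agm_integral_def rng by simp
  also have "\<dots> = (\<integral>\<^sup>+u\<in>UNIV. ennreal (\<bar>?g' u\<bar> * ?f (?g u)) \<partial>lborel)"
  proof (rule nn_integral_change_of_variables)
    show "range ?g \<in> sets borel" unfolding rng by simp
    show "(?g has_real_derivative ?g' u) (at u within UNIV)" for u
      by (auto intro!: derivative_eq_intros)
    show "inj ?g"
    proof (rule injI)
      fix x y assume "?g x = ?g y"
      then have "arsinh (sinh (x / 2)) = arsinh (sinh (y / 2))" using a b by simp
      then show "x = y" by (simp add: arsinh_sinh_real)
    qed
    show "(\<lambda>x. indicator (range ?g) x * ?f x) \<in> borel_measurable borel" unfolding rng by measurable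
  qed auto
  also have "\<dots> = (\<integral>\<^sup>+u. ennreal (1 / sqrt (?P u)) \<partial>lborel)"
  proof (rule nn_integral_cong)
    fix u :: real
    have g: "?g' u > 0" using ab by simp
    have g2: "(?g u)\<^sup>2 = a * b * (sinh (u / 2))\<^sup>2" "(?g' u)\<^sup>2 = a * b * (cosh (u / 2))\<^sup>2 / 4" "(sqrt (a * b))\<^sup>2 = a * b"
      using ab a b by (simp_all add: power_mult_distrib power_divide)
    have c: "(cosh (u / 2))\<^sup>2 = (sinh (u / 2))\<^sup>2 + 1" by (rule cosh_square_eq)
    have "cosh u = 2 * (sinh (u / 2))\<^sup>2 + 1"
      using cosh_double[of "u / 2"] c by simp
    then have e: "exp u + exp (- u) = 4 * (sinh (u / 2))\<^sup>2 + 2" unfolding cosh_def by simp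
    have ee: "exp u * exp (- u) = 1" by (simp add: exp_minus)
    have P: "?P u = a\<^sup>2 + b\<^sup>2 + a * b * (4 * (sinh (u / 2))\<^sup>2 + 2)"
      unfolding e[symmetric] using ee by algebra
    have "(a * b * X + ((a + b) / 2)\<^sup>2) * (a * b * X + a * b) = a * b * (X + 1) / 4 * (a\<^sup>2 + b\<^sup>2 + a * b * (4 * X + 2))" for X
      by (simp add: power2_eq_square field_simps)
    then have "sqrt (((?g u)\<^sup>2 + ((a + b) / 2)\<^sup>2) * ((?g u)\<^sup>2 + (sqrt (a * b))\<^sup>2)) = sqrt ((?g' u)\<^sup>2 * ?P u)"
      unfolding g2 c P by simp
    also have "\<dots> = ?g' u * sqrt (?P u)" using g by (simp only: real_sqrt_mult real_sqrt_abs abs_of_pos)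
    finally have s: "sqrt (((?g u)\<^sup>2 + ((a + b) / 2)\<^sup>2) * ((?g u)\<^sup>2 + (sqrt (a * b))\<^sup>2)) = ?g' u * sqrt (?P u)" .
    have "\<bar>x\<bar> * (1 / (x * y)) = 1 / y" if "x > 0" for x y :: real using that by simp
    from this[OF g] have "\<bar>?g' u\<bar> * ?f (?g u) = 1 / sqrt (?P u)" unfolding s .
    then show "ennreal (\<bar>?g' u\<bar> * ?f (?g u)) * indicator UNIV u = ennreal (1 / sqrt (?P u))" by simp
  qed
  also have "\<dots> = ennreal (cosh_integral 0 (b / a) / a)" by (rule cosh_integral_0_nn_integral[OF a b])
  finally show ?thesis .
qed

lemma cosh_integral_0_AGM:
  assumes a: "a > 0" and b: "b > 0"
  shows "cosh_integral 0 (sqrt (a * b) / ((a + b) / 2)) / ((a + b) / 2) = cosh_integral 0 (b / a) / a"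
proof -
  have p: "(a + b) / 2 > 0" "sqrt (a * b) > 0" using a b by auto
  have "ennreal (cosh_integral 0 (sqrt (a * b) / ((a + b) / 2)) / ((a + b) / 2)) = ennreal (cosh_integral 0 (b / a) / a)"
    using agm_integral_eq_cosh_integral[OF p] agm_integral_AGM[OF a b] by (simp only:)
  moreover have "cosh_integral 0 (sqrt (a * b) / ((a + b) / 2)) / ((a + b) / 2) \<ge> 0" "cosh_integral 0 (b / a) / a \<ge> 0"
    using cosh_integral_nonneg p a by (auto intro!: divide_nonneg_pos)
  ultimately show ?thesis by (simp only: ennreal_inj)
qed

lemma cosh_integral_0_1: "cosh_integral 0 1 = pi"
proof -
  have i: "integrable lborel (\<lambda>v::real. 1 / (1 + 1 * v\<^sup>2))" "(LINT v|lborel. 1 / (1 + 1 * v\<^sup>2)) = (pi / sqrt 1 :: real)"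
    using inverse_1_plus_square_integral[of 1] by (auto simp: has_bochner_integral_iff)
  have "ennreal (cosh_integral 0 1) = agm_integral 1 1" using agm_integral_eq_cosh_integral[of 1 1] by simp
  also have "\<dots> = (\<integral>\<^sup>+v. ennreal (1 / (1 + 1 * v\<^sup>2)) \<partial>lborel)"
    unfolding agm_integral_def
  proof (rule nn_integral_cong)
    fix y :: real
    have "sqrt ((y\<^sup>2 + 1\<^sup>2) * (y\<^sup>2 + 1\<^sup>2)) = 1 + 1 * y\<^sup>2" by (simp add: add.commute)
    then show "ennreal (1 / sqrt ((y\<^sup>2 + 1\<^sup>2) * (y\<^sup>2 + 1\<^sup>2))) = ennreal (1 / (1 + 1 * y\<^sup>2))" by (simp only:)
  qed
  also have "\<dots> = ennreal pi"
    using nn_integral_eq_integral[OF i(1)] i(2) by simp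
  finally show ?thesis using cosh_integral_nonneg[of 0 1] by (simp add: ennreal_inj)
qed

lemma cosh_integral_0_eq_half_line:
  assumes c: "c > 0"
  shows "ennreal (cosh_integral 0 c) = 2 * (\<integral>\<^sup>+u\<in>{0..}. ennreal (1 / sqrt ((1 + c * exp u) * (1 + c * exp (- u)))) \<partial>lborel)"
proof -
  have "ennreal (cosh_integral 0 c) = (\<integral>\<^sup>+u. ennreal (1 / sqrt ((1 + c * exp u) * (1 + c * exp (- u)))) \<partial>lborel)"
    using cosh_integral_0_nn_integral[of 1 c] c by simp
  also have "\<dots> = 2 * (\<integral>\<^sup>+u\<in>{0<..}. ennreal (1 / sqrt ((1 + c * exp u) * (1 + c * exp (- u)))) \<partial>lborel)"
    by (rule nn_integral_even) (auto simp: mult.commute)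
  also have "(\<integral>\<^sup>+u\<in>{0<..}. ennreal (1 / sqrt ((1 + c * exp u) * (1 + c * exp (- u)))) \<partial>lborel)
     = (\<integral>\<^sup>+u\<in>{0..}. ennreal (1 / sqrt ((1 + c * exp u) * (1 + c * exp (- u)))) \<partial>lborel)"
  proof (rule nn_integral_cong_AE)
    show "AE u in lborel. ennreal (1 / sqrt ((1 + c * exp u) * (1 + c * exp (- u)))) * indicator {0<..} u
       = ennreal (1 / sqrt ((1 + c * exp u) * (1 + c * exp (- u)))) * indicator {0..} u"
      using AE_lborel_singleton[of "0::real"] by eventually_elim (auto split: split_indicator)
  qed
  finally show ?thesis .
qed

text \<open>For u >= 0 the term exp (- u) may be replaced by exp u, and the integral becomes
  elementary. Together with the upper bound this determines the integral as -2 ln c up to a bounded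
  error; that precision is enough, because the error gets divided by 2^n.\<close>

lemma cosh_integral_0_lower:
  assumes c: "c > 0"
  shows "cosh_integral 0 c \<ge> - 2 * ln c"
proof -
  have "(\<integral>\<^sup>+u. ennreal (1 / (1 + c * exp u)) * indicator {0..} u \<partial>lborel) = ennreal (- ln c - (- ln (c + exp (- 0))))"
  proof (rule nn_integral_FTC_atLeast)
    show "((\<lambda>u. - ln (c + exp (- u))) has_real_derivative 1 / (1 + c * exp u)) (at u)" for u
    proof -
      have "exp (- u) / (c + exp (- u)) = 1 / (1 + c * exp u)"
      proof -
        have "c + exp (- u) > 0" "1 + c * exp u > 0" using c by (auto intro!: add_pos_pos)
        moreover have "exp (- u) * exp u = 1" by (simp add: exp_minus)
        ultimately show ?thesis by (simp add: frac_eq_eq algebra_simps)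
      qed
      moreover have "c + exp (- u) > 0" using c by (auto intro!: add_pos_pos)
      ultimately show ?thesis by (auto intro!: derivative_eq_intros)
    qed
    have "((\<lambda>u::real. exp (- u)) \<longlongrightarrow> 0) at_top" by real_asymp
    then have "((\<lambda>u. - ln (c + exp (- u))) \<longlongrightarrow> - ln (c + 0)) at_top"
      using c by (intro tendsto_intros) auto
    then show "((\<lambda>u. - ln (c + exp (- u))) \<longlongrightarrow> - ln c) at_top" by simp
    show "(0::real) \<le> 1 / (1 + c * exp u)" for u using c by (simp add: add_nonneg_nonneg)
  qed measurable
  moreover have "(\<integral>\<^sup>+u. ennreal (1 / (1 + c * exp u)) * indicator {0..} u \<partial>lborel)
    \<le> (\<integral>\<^sup>+u\<in>{0..}. ennreal (1 / sqrt ((1 + c * exp u) * (1 + c * exp (- u)))) \<partial>lborel)"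
  proof (rule nn_integral_mono)
    fix u :: real
    have "1 / (1 + c * exp u) \<le> 1 / sqrt ((1 + c * exp u) * (1 + c * exp (- u)))" if u: "u \<ge> 0"
    proof -
      have p: "1 + c * exp u > 0" "1 + c * exp (- u) > 0" using c by (auto intro!: add_pos_pos)
      have "(1 + c * exp u) * (1 + c * exp (- u)) \<le> (1 + c * exp u) * (1 + c * exp u)"
        using u c p by (intro mult_left_mono) auto
      then have "sqrt ((1 + c * exp u) * (1 + c * exp (- u))) \<le> sqrt ((1 + c * exp u) * (1 + c * exp u))"
        by (rule real_sqrt_le_mono)
      also have "\<dots> = 1 + c * exp u" using p by simp
      finally show ?thesis using p by (intro divide_left_mono) auto
    qed
    then show "ennreal (1 / (1 + c * exp u)) * indicator {0..} u
      \<le> ennreal (1 / sqrt ((1 + c * exp u) * (1 + c * exp (- u)))) * indicator {0..} u"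
      by (auto split: split_indicator intro!: ennreal_leI)
  qed
  ultimately have "2 * ennreal (ln (c + 1) - ln c) \<le> ennreal (cosh_integral 0 c)"
    unfolding cosh_integral_0_eq_half_line[OF c] by (intro mult_left_mono) (auto simp: algebra_simps)
  then have "ennreal (2 * (ln (c + 1) - ln c)) \<le> ennreal (cosh_integral 0 c)"
    using c by (subst ennreal_mult) (auto simp: ennreal_numeral)
  then have "2 * (ln (c + 1) - ln c) \<le> cosh_integral 0 c" using cosh_integral_nonneg by (simp add: ennreal_le_iff)
  moreover have "ln (c + 1) \<ge> 0" using c by simp
  ultimately show ?thesis by simp
qed

text \<open>The factor 1 + c exp (- u) >= 1 is dropped. In terms of w = sqrt (1 + c exp u) the
  antiderivative is ln (w - 1) - ln (w + 1), and (w - 1) (w + 1) = c at u = 0 isolates ln c.\<close>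

lemma cosh_integral_0_upper:
  assumes c: "0 < c" "c \<le> 1"
  shows "cosh_integral 0 c \<le> 4 * ln 3 - 2 * ln c"
proof -
  define w where "w u = sqrt (1 + c * exp u)" for u
  have w: "w u > 1" "(w u)\<^sup>2 = 1 + c * exp u" for u
  proof -
    have "1 + c * exp u > 1" using c by simp
    then show "w u > 1" "(w u)\<^sup>2 = 1 + c * exp u" unfolding w_def by auto
  qed
  have "(\<integral>\<^sup>+u. ennreal (1 / w u) * indicator {0..} u \<partial>lborel) = ennreal (0 - (ln (w 0 - 1) - ln (w 0 + 1)))"
  proof (rule nn_integral_FTC_atLeast)
    show "((\<lambda>u. ln (w u - 1) - ln (w u + 1)) has_real_derivative 1 / w u) (at u)" for u
    proof -
      have p: "1 + c * exp u > 0" using c by (auto intro!: add_pos_pos)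
      have "(w has_real_derivative c * exp u / (2 * w u)) (at u)"
        unfolding w_def using p by (auto intro!: derivative_eq_intros simp: field_simps)
      then have w': "(w has_real_derivative ((w u)\<^sup>2 - 1) / (2 * w u)) (at u)" unfolding w(2) by simp
      have "((\<lambda>u. ln (w u - 1) - ln (w u + 1)) has_real_derivative
         1 / (w u - 1) * (((w u)\<^sup>2 - 1) / (2 * w u) - 0) - 1 / (w u + 1) * (((w u)\<^sup>2 - 1) / (2 * w u) + 0)) (at u)"
        using w(1)[of u] by (intro DERIV_diff DERIV_chain2[OF DERIV_ln_divide] DERIV_add w' DERIV_const) auto
      moreover have "1 / (x - 1) * ((x\<^sup>2 - 1) / (2 * x) - 0) - 1 / (x + 1) * ((x\<^sup>2 - 1) / (2 * x) + 0) = 1 / x" if "x > 1" for x :: real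
      proof -
        have x: "x\<^sup>2 - 1 = (x - 1) * (x + 1)" by (simp add: power2_eq_square algebra_simps)
        have "1 / (x - 1) * ((x\<^sup>2 - 1) / (2 * x) - 0) = (x + 1) / (2 * x)"
          "1 / (x + 1) * ((x\<^sup>2 - 1) / (2 * x) + 0) = (x - 1) / (2 * x)" unfolding x using that by auto
        moreover have "(x + 1) / (2 * x) - (x - 1) / (2 * x) = 1 / x" using that by (simp add: diff_divide_distrib[symmetric])
        ultimately show ?thesis by simp
      qed
      ultimately show ?thesis using w(1)[of u] by simp
    qed
    show "((\<lambda>u. ln (w u - 1) - ln (w u + 1)) \<longlongrightarrow> 0) at_top"
      unfolding w_def using c(1) by real_asymp
    show "(0::real) \<le> 1 / w u" for u using w(1)[of u] by simp
  qed (simp add: w_def)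
  moreover have "(\<integral>\<^sup>+u\<in>{0..}. ennreal (1 / sqrt ((1 + c * exp u) * (1 + c * exp (- u)))) \<partial>lborel)
    \<le> (\<integral>\<^sup>+u. ennreal (1 / w u) * indicator {0..} u \<partial>lborel)"
  proof (rule nn_integral_mono)
    fix u :: real
    have "1 / sqrt ((1 + c * exp u) * (1 + c * exp (- u))) \<le> 1 / w u"
    proof -
      have p: "1 + c * exp u > 0" "1 + c * exp (- u) \<ge> 1" using c by (auto intro!: add_pos_pos)
      have "1 + c * exp u \<le> (1 + c * exp u) * (1 + c * exp (- u))"
        using mult_left_mono[OF p(2), of "1 + c * exp u"] p by simp
      then have "w u \<le> sqrt ((1 + c * exp u) * (1 + c * exp (- u)))"
        unfolding w_def by (rule real_sqrt_le_mono)
      then show ?thesis using w(1)[of u] by (intro frac_le) auto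
    qed
    then show "ennreal (1 / sqrt ((1 + c * exp u) * (1 + c * exp (- u)))) * indicator {0..} u
      \<le> ennreal (1 / w u) * indicator {0..} u"
      by (auto split: split_indicator intro!: ennreal_leI)
  qed
  ultimately have "ennreal (cosh_integral 0 c) \<le> 2 * ennreal (ln (w 0 + 1) - ln (w 0 - 1))"
    unfolding cosh_integral_0_eq_half_line[OF c(1)] by (intro mult_left_mono) auto
  moreover have "ln (w 0 - 1) \<le> ln (w 0 + 1)" using w(1)[of 0] by simp
  ultimately have "ennreal (cosh_integral 0 c) \<le> ennreal (2 * (ln (w 0 + 1) - ln (w 0 - 1)))"
    by (subst ennreal_mult) (auto simp: ennreal_numeral)
  then have "cosh_integral 0 c \<le> 2 * (ln (w 0 + 1) - ln (w 0 - 1))"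
    using \<open>ln (w 0 - 1) \<le> ln (w 0 + 1)\<close> by (simp add: ennreal_le_iff)
  moreover have "ln (w 0 - 1) = ln c - ln (w 0 + 1)"
  proof -
    have "(w 0 - 1) * (w 0 + 1) = c" using w(2)[of 0] by (simp add: power2_eq_square algebra_simps)
    then have "ln c = ln (w 0 - 1) + ln (w 0 + 1)" using w(1)[of 0] by (metis add_pos_pos diff_gt_0_iff_gt ln_mult_pos zero_less_one less_trans)
    then show ?thesis by simp
  qed
  moreover have "ln (w 0 + 1) \<le> ln 3"
  proof -
    have "w 0 \<le> sqrt 4" unfolding w_def using c by (intro real_sqrt_le_mono) auto
    then show ?thesis using w(1)[of 0] by simp
  qed
  ultimately show ?thesis by simp
qed

text \<open>Monotonicity permits a modulus to be identified through the values of its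
  integrals.\<close>

lemma cosh_integral_0_strict_decreasing:
  assumes x: "0 < x" "x < y"
  shows "cosh_integral 0 y < cosh_integral 0 x"
proof (rule ccontr)
  assume "\<not> cosh_integral 0 y < cosh_integral 0 x"
  then have le: "cosh_integral 0 x \<le> cosh_integral 0 y" by simp
  let ?f = "\<lambda>s u. cosh_quadratic s u powr (- (1/2))"
  have int: "integrable lborel (?f s)" if "s > 0" for s using that by (intro cosh_quadratic_powr_integrable) auto
  have pos: "?f x u - ?f y u > 0" for u
  proof -
    have "x\<^sup>2 < y\<^sup>2" using x by (intro power_strict_mono) auto
    moreover have "x * cosh u < y * cosh u" using x by simp
    ultimately have "cosh_quadratic x u < cosh_quadratic y u" unfolding cosh_quadratic_def by linarith
    moreover have "cosh_quadratic x u > 0" using cosh_quadratic_ge[OF x(1)] by simp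
    ultimately show ?thesis using powr_less_mono2_neg[of "- (1/2)" "cosh_quadratic x u" "cosh_quadratic y u"] by simp
  qed
  have "(LINT u|lborel. ?f x u - ?f y u) = cosh_integral 0 x - cosh_integral 0 y"
    unfolding cosh_integral_def using x by (subst Bochner_Integration.integral_diff) (auto intro!: int)
  moreover have "(LINT u|lborel. ?f x u - ?f y u) \<ge> 0" by (intro integral_nonneg_AE) (use pos in \<open>auto intro: less_imp_le\<close>)
  ultimately have "(LINT u|lborel. ?f x u - ?f y u) = 0" using le by simp
  then have "AE u in lborel. ?f x u - ?f y u = 0"
    using x int by (subst (asm) integral_nonneg_eq_0_iff_AE) (use pos in \<open>auto intro: less_imp_le\<close>)
  then have "AE u in (lborel :: real measure). False" using pos by (elim AE_mp) (auto intro!: AE_I2 simp: less_le)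
  then show False by (auto simp: AE_iff_measurable[OF _ refl])
qed

text \<open>For 0 < q < 1 the square of the theta constant theta_2. Divided by theta(q)^2 it is the
  modulus complementary to theta(-q)^2 / theta(q)^2.\<close>

definition theta_c :: "real \<Rightarrow> real" where
  "theta_c q = sqrt ((theta q) ^ 4 - (theta (- q)) ^ 4)"

lemma theta_positive:
  fixes q :: real assumes q: "0 < q" "q < 1"
  shows "theta q > 0" "theta (- q) > 0" "theta_c q > 0" "(theta_c q)\<^sup>2 = (theta q) ^ 4 - (theta (- q)) ^ 4"
    "theta (- q) < theta q" "theta_c q < (theta q)\<^sup>2"
proof -
  show p: "theta q > 0" "theta (- q) > 0" using theta_pos_real(4)[of q] theta_minus_pos_real[of q] q by auto
  have "q\<^sup>2 < 1" using q by (simp add: power_less_one_iff)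
  then have d: "(theta q) ^ 4 - (theta (- q)) ^ 4 > 0"
    unfolding theta_diff_psi(2)[OF q] using theta_pos_real(5)[of "q\<^sup>2"] q by simp
  then show "theta_c q > 0" "(theta_c q)\<^sup>2 = (theta q) ^ 4 - (theta (- q)) ^ 4" unfolding theta_c_def by auto
  show "theta (- q) < theta q" using d p by (intro power_less_imp_less_base[of "theta (- q)" 4]) auto
  have "theta_c q < sqrt ((theta q) ^ 4)" unfolding theta_c_def using p by (intro real_sqrt_less_mono) simp
  also have "sqrt ((theta q) ^ 4) = (theta q)\<^sup>2" using real_sqrt_abs[of "(theta q)\<^sup>2"] by (simp add: power_mult[symmetric])
  finally show "theta_c q < (theta q)\<^sup>2" .
qed

lemma theta_double:
  fixes q :: real assumes q: "0 < q" "q < 1"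
  shows "((theta q)\<^sup>2 + (theta (- q))\<^sup>2) / 2 = (theta (q\<^sup>2))\<^sup>2"
    and "sqrt ((theta q)\<^sup>2 * (theta (- q))\<^sup>2) = (theta (- (q\<^sup>2)))\<^sup>2"
    and "theta_c (q\<^sup>2) = ((theta q)\<^sup>2 - (theta (- q))\<^sup>2) / 2"
proof -
  have n: "norm q < 1" using q by simp
  note p = theta_positive[OF q]
  show "((theta q)\<^sup>2 + (theta (- q))\<^sup>2) / 2 = (theta (q\<^sup>2))\<^sup>2" unfolding theta_square_add[OF n] by simp
  show "sqrt ((theta q)\<^sup>2 * (theta (- q))\<^sup>2) = (theta (- (q\<^sup>2)))\<^sup>2"
    unfolding theta_mult_theta_minus[OF n, symmetric] using p by (simp add: real_sqrt_mult)
  have "(theta (- q))\<^sup>2 < (theta q)\<^sup>2" using p by (intro power_strict_mono) auto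
  then show "theta_c (q\<^sup>2) = ((theta q)\<^sup>2 - (theta (- q))\<^sup>2) / 2"
    unfolding theta_c_def theta_fourth_diff_square[OF n] by (simp add: real_sqrt_divide)
qed

text \<open>The integral divided by theta(q)^2 does not change under q -> q^2, a step of the mean.
  It therefore equals its limit at q = 0, where the modulus is 1 and
  \<open>cosh_integral_0_1\<close> applies.\<close>

lemma cosh_integral_theta:
  fixes q :: real assumes q: "0 < q" "q < 1"
  shows "cosh_integral 0 ((theta (- q))\<^sup>2 / (theta q)\<^sup>2) = pi * (theta q)\<^sup>2"
proof -
  define M where "M q = cosh_integral 0 ((theta (- q))\<^sup>2 / (theta q)\<^sup>2) / (theta q)\<^sup>2" for q :: real
  have step: "M (q\<^sup>2) = M q" if q: "0 < q" "q < 1" for q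
    using cosh_integral_0_AGM[of "(theta q)\<^sup>2" "(theta (- q))\<^sup>2"] theta_positive[OF q]
    unfolding M_def theta_double[OF q] by simp
  have "M (q ^ 2 ^ n) = M q" for n
  proof (induction n)
    case (Suc n)
    have "0 < q ^ 2 ^ n" "q ^ 2 ^ n < 1" using q by (simp_all add: power_less_one_iff)
    from step[OF this] Suc show ?case by (simp add: power_mult[symmetric] mult.commute)
  qed simp
  moreover have "(\<lambda>n. M (q ^ 2 ^ n)) \<longlonglongrightarrow> cosh_integral 0 ((theta (- 0))\<^sup>2 / (theta 0)\<^sup>2) / (theta 0)\<^sup>2"
  proof -
    have x0: "(\<lambda>n. q ^ 2 ^ n) \<longlonglongrightarrow> 0" using q by (intro power_two_power_tendsto_0) auto
    have mx0: "(\<lambda>n. - (q ^ 2 ^ n)) \<longlonglongrightarrow> - 0" by (intro tendsto_minus x0)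
    have th0: "isCont (theta :: real \<Rightarrow> real) 0" "isCont (theta :: real \<Rightarrow> real) (- 0)" by (auto intro!: theta_isCont)
    have "isCont (cosh_integral 0) ((theta (- 0))\<^sup>2 / (theta 0)\<^sup>2)"
      by (rule DERIV_isCont, rule cosh_integral_has_derivative) (simp add: theta'_continuous_0)
    then show ?thesis unfolding M_def
      by (intro tendsto_intros isCont_tendsto_compose[of _ "cosh_integral 0"] isCont_tendsto_compose[OF th0(1) x0]
         isCont_tendsto_compose[OF th0(2) mx0]) (auto simp: theta'_continuous_0)
  qed
  ultimately have "M q = pi" using cosh_integral_0_1 by (simp add: LIMSEQ_const_iff theta'_continuous_0)
  then show ?thesis using theta_positive[OF q] unfolding M_def by (simp add: field_simps)
qed

text \<open>The complementary integral is doubled by \<open>q \<mapsto> q\<^sup>2\<close>, so it is a multiple of \<open>ln q\<close>; the factor is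
  determined by the logarithmic growth of the integral at the degenerate end.\<close>

lemma cosh_integral_theta_c:
  fixes q :: real assumes q: "0 < q" "q < 1"
  shows "cosh_integral 0 (theta_c q / (theta q)\<^sup>2) = - ln q * (theta q)\<^sup>2"
proof -
  define N where "N q = cosh_integral 0 (theta_c q / (theta q)\<^sup>2) / (theta q)\<^sup>2" for q :: real
  have step: "N (q\<^sup>2) = 2 * N q" if q: "0 < q" "q < 1" for q
  proof -
    have q2: "0 < q\<^sup>2" "q\<^sup>2 < 1" using q by (auto simp: power_less_one_iff)
    define a b where "a = (theta q)\<^sup>2" and "b = (theta (- q))\<^sup>2"
    have a1: "(theta (q\<^sup>2))\<^sup>2 = (a + b) / 2" and c1: "theta_c (q\<^sup>2) = (a - b) / 2"
      using theta_double[OF q] by (simp_all add: a_def b_def)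
    \<comment> \<open>In the complementary family the step of means leads from q^2 back to q: the
      means of theta(q^2)^2 and theta_c(q^2) are theta(q)^2 / 2 and theta_c(q) / 2. The halves do
      not change the modulus but double the normalised integral.\<close>
    have "theta_c q = sqrt ((a + b) * (a - b))"
      unfolding theta_c_def a_def b_def by (rule arg_cong[where f = sqrt]) algebra
    also have "\<dots> = 2 * sqrt ((a + b) / 2 * ((a - b) / 2))"
      using real_sqrt_mult[of 4 "(a + b) / 2 * ((a - b) / 2)"] by simp
    finally have c: "sqrt ((a + b) / 2 * ((a - b) / 2)) = theta_c q / 2" by simp
    have s: "((a + b) / 2 + (a - b) / 2) / 2 = a / 2" by (simp add: field_simps)
    have "cosh_integral 0 ((theta_c q / 2) / (a / 2)) / (a / 2) = N (q\<^sup>2)"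
      using cosh_integral_0_AGM[of "(theta (q\<^sup>2))\<^sup>2" "theta_c (q\<^sup>2)"] theta_positive[OF q2]
      unfolding N_def a1 c1 c s by simp
    then show ?thesis unfolding N_def a_def by (simp add: mult.commute)
  qed
  define x where "x n = q ^ 2 ^ n" for n :: nat
  have x: "0 < x n" "x n < 1" for n using q by (simp_all add: power_less_one_iff x_def)
  have N: "N (x n) = 2 ^ n * N q" for n
  proof (induction n)
    case (Suc n)
    have "x (Suc n) = (x n)\<^sup>2" by (simp add: x_def power_mult[symmetric] mult.commute)
    then show ?case using step[OF x[of n]] Suc by simp
  qed (simp add: x_def)
  define d where "d n = ln (16 * (psi ((x n)\<^sup>2)) ^ 4 / (theta (x n)) ^ 4)" for n
  \<comment> \<open>The main term has the order 2^n of the integral itself, while \<open>d\<close>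
    converges; after division by 2^n both bounds tend to -ln q.\<close>
  have ln: "- 2 * ln (theta_c (x n) / (theta (x n))\<^sup>2) = - (2 ^ n * ln q) - d n" for n
  proof -
    note p = theta_positive[OF x[of n]]
    have psi: "psi ((x n)\<^sup>2) > 0" using theta_pos_real(5)[of "(x n)\<^sup>2"] x[of n] by (simp add: power_less_one_iff)
    have "2 * ln (theta_c (x n) / (theta (x n))\<^sup>2) = ln ((theta_c (x n) / (theta (x n))\<^sup>2)\<^sup>2)"
      using p by (simp add: ln_realpow)
    also have "(theta_c (x n) / (theta (x n))\<^sup>2)\<^sup>2 = x n * (16 * (psi ((x n)\<^sup>2)) ^ 4 / (theta (x n)) ^ 4)"
      unfolding power_divide p(4) theta_diff_psi(2)[OF x[of n]] by (simp add: power_mult[symmetric])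
    also have "ln \<dots> = ln (x n) + d n" unfolding d_def using x[of n] psi p by (intro ln_mult_pos) auto
    also have "ln (x n) = 2 ^ n * ln q" unfolding x_def using q by (simp add: ln_realpow)
    finally show ?thesis by simp
  qed
  have x0: "x \<longlonglongrightarrow> 0" unfolding x_def using q by (intro power_two_power_tendsto_0) auto
  have xx0: "(\<lambda>n. (x n)\<^sup>2) \<longlonglongrightarrow> 0" using tendsto_power[OF x0, of 2] by simp
  have th0: "isCont (theta :: real \<Rightarrow> real) 0" by (rule theta_isCont) simp
  have a: "(\<lambda>n. (theta (x n))\<^sup>2) \<longlonglongrightarrow> 1"
    using tendsto_power[OF isCont_tendsto_compose[OF th0 x0], of 2] by (simp add: theta'_continuous_0)
  have d: "d \<longlonglongrightarrow> ln (16 * (psi 0) ^ 4 / (theta 0) ^ 4)"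
    unfolding d_def
    by (intro tendsto_intros isCont_tendsto_compose[OF th0 x0] isCont_tendsto_compose[OF psi_isCont_0(1) xx0])
      (auto simp: theta'_continuous_0 psi_isCont_0)
  have half: "(\<lambda>n. (1/2::real) ^ n) \<longlonglongrightarrow> 0" by (intro LIMSEQ_power_zero) auto
  have KN: "cosh_integral 0 (theta_c (x n) / (theta (x n))\<^sup>2) = 2 ^ n * (N q * (theta (x n))\<^sup>2)" for n
    using N[of n] theta_positive[OF x[of n]] unfolding N_def by (simp add: field_simps)
  have lower: "- ln q - d n * (1/2) ^ n \<le> N q * (theta (x n))\<^sup>2" for n
  proof -
    have "- (2 ^ n * ln q) - d n \<le> 2 ^ n * (N q * (theta (x n))\<^sup>2)"
      using cosh_integral_0_lower[of "theta_c (x n) / (theta (x n))\<^sup>2"] theta_positive[OF x[of n]] unfolding ln KN by simp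
    then have "(- (2 ^ n * ln q) - d n) / 2 ^ n \<le> N q * (theta (x n))\<^sup>2" by (simp add: field_simps)
    then show ?thesis by (simp add: diff_divide_distrib power_divide)
  qed
  have upper: "N q * (theta (x n))\<^sup>2 \<le> - ln q + (4 * ln 3 - d n) * (1/2) ^ n" for n
  proof -
    have "2 ^ n * (N q * (theta (x n))\<^sup>2) \<le> 4 * ln 3 + (- (2 ^ n * ln q) - d n)"
      using cosh_integral_0_upper[of "theta_c (x n) / (theta (x n))\<^sup>2"] theta_positive[OF x[of n]] unfolding ln[symmetric] KN by simp
    then have "N q * (theta (x n))\<^sup>2 \<le> (4 * ln 3 + (- (2 ^ n * ln q) - d n)) / 2 ^ n" by (simp add: field_simps)
    then show ?thesis by (simp add: diff_divide_distrib add_divide_distrib power_divide)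
  qed
  have "(\<lambda>n. N q * (theta (x n))\<^sup>2) \<longlonglongrightarrow> - ln q"
  proof (rule tendsto_sandwich)
    show "\<forall>\<^sub>F n in sequentially. - ln q - d n * (1/2) ^ n \<le> N q * (theta (x n))\<^sup>2" using lower by (rule always_eventually[OF allI])
    show "\<forall>\<^sub>F n in sequentially. N q * (theta (x n))\<^sup>2 \<le> - ln q + (4 * ln 3 - d n) * (1/2) ^ n" using upper by (rule always_eventually[OF allI])
    have "(\<lambda>n. - ln q - d n * (1/2) ^ n) \<longlonglongrightarrow> - ln q - ln (16 * (psi 0) ^ 4 / (theta 0) ^ 4) * 0"
      by (intro tendsto_intros d half)
    then show "(\<lambda>n. - ln q - d n * (1/2) ^ n) \<longlonglongrightarrow> - ln q" by simp
    have "(\<lambda>n. - ln q + (4 * ln 3 - d n) * (1/2) ^ n) \<longlonglongrightarrow> - ln q + (4 * ln 3 - ln (16 * (psi 0) ^ 4 / (theta 0) ^ 4)) * 0"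
      by (intro tendsto_intros d half)
    then show "(\<lambda>n. - ln q + (4 * ln 3 - d n) * (1/2) ^ n) \<longlonglongrightarrow> - ln q" by simp
  qed
  moreover have "(\<lambda>n. N q * (theta (x n))\<^sup>2) \<longlonglongrightarrow> N q * 1" by (intro tendsto_intros a)
  ultimately have "N q = - ln q" using LIMSEQ_unique by fastforce
  then show ?thesis using theta_positive[OF q] unfolding N_def by (simp add: field_simps)
qed

text \<open>Let K be \<open>cosh_integral 0\<close>. For the modulus x at exp (- pi t) the quotient
  K(sqrt (1 - x^2)) / K(x) is t, and at exp (- pi / t) it is 1 / t. This quotient is strictly
  increasing in x, so the two moduli are complementary, and a comparison of the integrals gives the
  factor t.\<close>

lemma theta_S_real_square:
  fixes t :: real assumes t: "t > 0"
  shows "(theta (exp (- pi / t)))\<^sup>2 = t * (theta (exp (- pi * t)))\<^sup>2"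
    and "theta_c (exp (- pi / t)) = t * (theta (- exp (- pi * t)))\<^sup>2"
proof -
  define q q' where "q = exp (- pi * t)" and "q' = exp (- pi / t)"
  have q: "0 < q" "q < 1" and q': "0 < q'" "q' < 1" using t by (auto simp: q_def q'_def)
  have l: "ln q = - pi * t" "ln q' = - pi / t" by (simp_all add: q_def q'_def)
  define a b c where "a = (theta q)\<^sup>2" and "b = (theta (- q))\<^sup>2" and "c = theta_c q"
  define a' b' c' where "a' = (theta q')\<^sup>2" and "b' = (theta (- q'))\<^sup>2" and "c' = theta_c q'"
  have p: "a > 0" "b > 0" "c > 0" "a' > 0" "b' > 0" "c' > 0"
    using theta_positive[OF q] theta_positive[OF q'] by (auto simp: a_def b_def c_def a'_def b'_def c'_def)
  have pyth: "c\<^sup>2 = a\<^sup>2 - b\<^sup>2" "c'\<^sup>2 = a'\<^sup>2 - b'\<^sup>2"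
    using theta_positive(4)[OF q] theta_positive(4)[OF q']
    by (auto simp: a_def b_def c_def a'_def b'_def c'_def power_mult[symmetric])
  have K: "cosh_integral 0 (b / a) = pi * a" "cosh_integral 0 (c / a) = pi * t * a" "cosh_integral 0 (b' / a') = pi * a'" "cosh_integral 0 (c' / a') = pi / t * a'"
    using cosh_integral_theta[OF q] cosh_integral_theta[OF q'] cosh_integral_theta_c[OF q] cosh_integral_theta_c[OF q'] l
    by (simp_all add: a_def b_def c_def a'_def b'_def c'_def)
  define x y x' y' where "x = b / a" and "y = c / a" and "x' = b' / a'" and "y' = c' / a'"
  have pos: "x > 0" "y > 0" "x' > 0" "y' > 0" using p by (auto simp: x_def y_def x'_def y'_def)
  have sq: "y\<^sup>2 = 1 - x\<^sup>2" "x'\<^sup>2 = 1 - y'\<^sup>2"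
    using p pyth by (auto simp: x_def y_def x'_def y'_def power_divide field_simps)
  have r: "cosh_integral 0 y = t * cosh_integral 0 x" "cosh_integral 0 x' = t * cosh_integral 0 y'"
    using K t by (auto simp: x_def y_def x'_def y'_def)
  have "y' = x"
  proof (rule ccontr)
    assume "y' \<noteq> x"
    then consider "y' < x" | "x < y'" by linarith
    then show False
    proof cases
      case 1
      then have "y'\<^sup>2 < x\<^sup>2" using pos by (intro power_strict_mono) auto
      then have "y\<^sup>2 < x'\<^sup>2" unfolding sq by simp
      then have "y < x'" using pos by (intro power_less_imp_less_base[of y 2]) auto
      then have "cosh_integral 0 x' < cosh_integral 0 y" using pos by (intro cosh_integral_0_strict_decreasing)
      moreover have "t * cosh_integral 0 x < t * cosh_integral 0 y'" using t cosh_integral_0_strict_decreasing[OF _ 1] pos by simp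
      ultimately show False using r by simp
    next
      case 2
      then have "x\<^sup>2 < y'\<^sup>2" using pos by (intro power_strict_mono) auto
      then have "x'\<^sup>2 < y\<^sup>2" unfolding sq by simp
      then have "x' < y" using pos by (intro power_less_imp_less_base[of x' 2]) auto
      then have "cosh_integral 0 y < cosh_integral 0 x'" using pos by (intro cosh_integral_0_strict_decreasing)
      moreover have "t * cosh_integral 0 y' < t * cosh_integral 0 x" using t cosh_integral_0_strict_decreasing[OF _ 2] pos by simp
      ultimately show False using r by simp
    qed
  qed
  then have "pi / t * a' = pi * a" using K by (simp add: x_def y'_def)
  then have a': "a' = t * a" using t by (simp add: field_simps)
  then show "(theta (exp (- pi / t)))\<^sup>2 = t * (theta (exp (- pi * t)))\<^sup>2"
    unfolding a_def a'_def q_def q'_def .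
  have "c' = y' * a'" using p by (simp add: y'_def)
  then have "c' = x * a'" unfolding \<open>y' = x\<close> .
  also have "\<dots> = t * b" unfolding a' x_def using p by simp
  finally show "theta_c (exp (- pi / t)) = t * (theta (- exp (- pi * t)))\<^sup>2"
    unfolding c'_def b_def q_def q'_def .
qed

section \<open>Product expansion of the cusp form\<close>

definition qpoch :: "nat \<Rightarrow> 'a::comm_ring_1 \<Rightarrow> 'a" where
  "qpoch n z = (\<Prod>k<n. 1 - z ^ Suc k)"

definition euler :: "complex \<Rightarrow> complex" where
  "euler z = prodinf (\<lambda>k. 1 - z ^ Suc k)"

lemma qpoch_0 [simp]: "qpoch 0 z = 1" and qpoch_Suc: "qpoch (Suc n) z = qpoch n z * (1 - z ^ Suc n)"
  by (simp_all add: qpoch_def)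

lemma one_minus_power_nonzero:
  fixes z :: complex assumes "norm z < 1" "n > 0"
  shows "1 - z ^ n \<noteq> 0"
proof
  assume "1 - z ^ n = 0"
  then have "norm (z ^ n) = 1" by simp
  moreover have "norm (z ^ n) < 1" unfolding norm_power using assms by (subst power_less_one_iff) auto
  ultimately show False by simp
qed

lemma qpoch_nonzero: "norm z < 1 \<Longrightarrow> qpoch n z \<noteq> (0::complex)"
  unfolding qpoch_def using one_minus_power_nonzero by (simp add: prod_zero_iff del: power_Suc)

lemma qpoch_LIMSEQ:
  assumes z: "norm z < 1"
  shows "(\<lambda>n. qpoch n z) \<longlonglongrightarrow> euler z" "euler z \<noteq> 0"
proof -
  have "summable (\<lambda>k. norm z * norm z ^ k)" using z by (intro summable_mult summable_geometric) auto
  then have "summable (\<lambda>k. norm ((1 - z ^ Suc k) - 1))" by (simp add: norm_mult norm_power)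
  then have c: "convergent_prod (\<lambda>k. 1 - z ^ Suc k)"
    by (intro abs_convergent_prod_imp_convergent_prod summable_imp_abs_convergent_prod)
  show "(\<lambda>n. qpoch n z) \<longlonglongrightarrow> euler z"
    unfolding qpoch_def euler_def by (rule has_prod_imp_tendsto'[OF convergent_prod_has_prod[OF c]])
  show "euler z \<noteq> 0" unfolding euler_def
    by (rule prodinf_nonzero[OF c]) (rule one_minus_power_nonzero[OF z], simp)
qed

lemma qpoch_LIMSEQ_double:
  assumes z: "norm z < 1"
  shows "(\<lambda>n. qpoch (2 * n) z) \<longlonglongrightarrow> euler z"
  using LIMSEQ_subseq_LIMSEQ[OF qpoch_LIMSEQ(1)[OF z], of "\<lambda>n. 2 * n"] by (simp add: strict_mono_def o_def)

text \<open>A finite form, due to Shanks, of Gauss' product for \<open>psi\<close>.\<close>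

lemma shanks_identity:
  fixes x :: "'a::field" and P :: "nat \<Rightarrow> 'a"
  assumes P0: "P 0 = 1" and P: "\<And>n. (1 - x ^ (2*n+1)) * P (Suc n) = (1 - x ^ (2*n+2)) * P n"
    and nz: "\<And>n. P n \<noteq> 0" "\<And>n. 1 - x ^ (2*n+1) \<noteq> 0"
  shows "(\<Sum>s<n. P n / P s * x ^ (s * (2*n+1))) = (\<Sum>s<2*n. x ^ (s * Suc s div 2))"
proof (induction n)
  case (Suc n)
  define X y Z where "X = x ^ (2*n+1)" and "y = x ^ (2*n)" and "Z = x ^ (n * (2*n+1))"
  have Xy: "X = y * x" by (simp add: X_def y_def)
  have e: "x ^ (2*n+2) = X * x" "x ^ (n * (2*n+3)) = Z * y" "x ^ ((2*n+1) * (n+1)) = Z * X"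
    unfolding X_def y_def Z_def power_add[symmetric] power_Suc2[symmetric]
    by (intro arg_cong[where f = "\<lambda>n. x ^ n"]; simp add: algebra_simps)+
  define S where "S = (\<Sum>s<n. x ^ (s * (2*n+1)) / P s)"
  define S' where "S' = (\<Sum>s<n. x ^ (s * (2*n+3)) / P s)"
  define U where "U s = (1 - x ^ (2 * s)) * x ^ (s * (2*n+1)) / P s" for s
  \<comment> \<open>The recurrence for \<open>P\<close> turns the difference of the two summands
    into a difference of consecutive values of \<open>U\<close>; moreover \<open>U 0\<close> =
    0.\<close>
  have tele: "(1 - X * x) * (x ^ (s * (2*n+3)) / P s) - (1 - X) * (x ^ (s * (2*n+1)) / P s) = U (Suc s) - U s" for s
  proof -
    define w v where "w = x ^ (2 * s)" and "v = x ^ (s * (2*n+1))"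
    have e: "x ^ (s * (2*n+3)) = v * w" "x ^ (Suc s * (2*n+1)) = v * X" "x ^ (2 * s+1) = w * x" "x ^ (2 * Suc s) = x ^ (2 * s+2)"
      unfolding X_def w_def v_def power_add[symmetric] power_Suc2[symmetric]
      by (intro arg_cong[where f = "\<lambda>n. x ^ n"]; simp add: algebra_simps)+
    have "(1 - x ^ (2 * s+2)) / P (Suc s) = (1 - x ^ (2 * s+1)) / P s"
      unfolding frac_eq_eq[OF nz(1)[of "Suc s"] nz(1)[of s]] by (rule P[of s, symmetric])
    then have "U (Suc s) = (1 - w * x) * (v * X) / P s"
      unfolding U_def e by (metis times_divide_eq_left)
    moreover have "(1 - X * x) * (v * w) - (1 - X) * v = (1 - w * x) * (v * X) - (1 - w) * v" by (simp add: algebra_simps)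
    ultimately show ?thesis
      unfolding U_def e(1) w_def[symmetric] v_def[symmetric]
      by (simp only: times_divide_eq_right diff_divide_distrib[symmetric])
  qed
  have "(1 - X * x) * S' - (1 - X) * S = (\<Sum>s<n. U (Suc s) - U s)"
    unfolding S_def S'_def sum_distrib_left sum_subtractf[symmetric] by (intro sum.cong refl tele)
  also have "\<dots> = U n - U 0" by (rule sum_lessThan_telescope)
  also have "\<dots> = (1 - y) * Z / P n" by (simp add: U_def y_def Z_def)
  finally have 1: "(1 - X * x) * S' = (1 - X) * S + (1 - y) * Z / P n" by (simp add: algebra_simps)
  have "(1 - X) * (P (Suc n) * (S' + Z * y / P n)) = P n * ((1 - X * x) * S' + (1 - X * x) * (Z * y / P n))"
    using P[of n] unfolding e X_def[symmetric] by (simp add: mult.assoc[symmetric] distrib_left)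
  also have "\<dots> = P n * ((1 - X) * S) + P n * (((1 - y) * Z + (1 - X * x) * (Z * y)) / P n)"
    unfolding 1 by (simp add: distrib_left add_divide_distrib)
  also have "\<dots> = P n * ((1 - X) * S) + ((1 - y) * Z + (1 - X * x) * (Z * y))" using nz(1)[of n] by simp
  also have "(1 - y) * Z + (1 - X * x) * (Z * y) = (1 - X) * (Z + Z * X)" unfolding Xy by (simp add: algebra_simps)
  also have "P n * ((1 - X) * S) + (1 - X) * (Z + Z * X) = (1 - X) * (P n * S + Z + Z * X)" by (simp add: algebra_simps)
  finally have 2: "P (Suc n) * (S' + Z * y / P n) = P n * S + Z + Z * X"
    using nz(2)[of n] unfolding X_def[symmetric] by simp
  have "(\<Sum>s<Suc n. P (Suc n) / P s * x ^ (s * (2 * Suc n + 1))) = P (Suc n) * (S' + Z * y / P n)"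
  proof -
    have "2 * Suc n + 1 = 2 * n + 3" by simp
    then show ?thesis unfolding S'_def e(2)[symmetric] by (simp only: sum.lessThan_Suc distrib_left sum_distrib_left) simp
  qed
  also have "\<dots> = P n * S + Z + Z * X" by (rule 2)
  also have "P n * S = (\<Sum>s<2*n. x ^ (s * Suc s div 2))"
    unfolding Suc[symmetric] S_def sum_distrib_left by simp
  also have "(\<Sum>s<2*n. x ^ (s * Suc s div 2)) + Z + Z * X = (\<Sum>s<2 * Suc n. x ^ (s * Suc s div 2))"
  proof -
    have "2 * n * Suc (2 * n) div 2 = n * (2*n+1)" "Suc (2*n) * Suc (Suc (2*n)) div 2 = (2*n+1) * (n+1)"
    proof -
      have "2 * n * Suc (2 * n) = 2 * (n * (2*n+1))" "Suc (2*n) * Suc (Suc (2*n)) = 2 * ((2*n+1) * (n+1))" by (simp_all add: algebra_simps)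
      then show "2 * n * Suc (2 * n) div 2 = n * (2*n+1)" "Suc (2*n) * Suc (Suc (2*n)) div 2 = (2*n+1) * (n+1)" by (simp_all only: nonzero_mult_div_cancel_left[of 2] numeral_neq_zero)
    qed
    moreover have "2 * Suc n = Suc (Suc (2 * n))" by simp
    ultimately show ?thesis unfolding e(3)[symmetric] unfolding Z_def by (simp only: sum.lessThan_Suc)
  qed
  finally show ?case .
qed simp

text \<open>\<open>shanks_identity\<close> with P n the square of \<open>qpoch n\<close> at z^2 over
  \<open>qpoch (2 * n)\<close> at z. The right side tends to \<open>psi z\<close>. On the left the
  terms with s >= 1 are O(n |z|^n), so only the term s = 0 survives, and it tends to the quotient of
  the infinite products.\<close>

lemma psi_product:
  assumes z: "norm z < 1"
  shows "psi z * euler z = (euler (z\<^sup>2))\<^sup>2"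
proof -
  have z2: "norm (z\<^sup>2) < 1" using z by (simp add: norm_power power_less_one_iff)
  define P where "P n = (qpoch n (z\<^sup>2))\<^sup>2 / qpoch (2 * n) z" for n
  define L where "L = (euler (z\<^sup>2))\<^sup>2 / euler z"
  have nz: "P n \<noteq> 0" for n using qpoch_nonzero[OF z] qpoch_nonzero[OF z2] by (simp add: P_def)
  have L: "P \<longlonglongrightarrow> L" "L \<noteq> 0"
    unfolding P_def L_def using qpoch_LIMSEQ[OF z2] qpoch_LIMSEQ_double[OF z] qpoch_LIMSEQ(2)[OF z]
    by (auto intro!: tendsto_intros)
  have rec: "(1 - z ^ (2*n+1)) * P (Suc n) = (1 - z ^ (2*n+2)) * P n" for n
  proof -
    have e: "2 * Suc n = Suc (Suc (2 * n))" "Suc (2*n) = 2*n+1" "Suc (2*n+1) = 2*n+2" by simp_all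
    have e4: "(z\<^sup>2) ^ Suc n = z ^ (2*n+2)" unfolding power_mult[symmetric] by simp
    have nz': "1 - z ^ (2*n+1) \<noteq> 0" "1 - z ^ (2*n+2) \<noteq> 0" by (rule one_minus_power_nonzero[OF z], simp)+
    have "a * ((u * b)\<^sup>2 / (v * a * b)) = b * (u\<^sup>2 / v)" if "a \<noteq> 0" "b \<noteq> 0" for a b u v :: complex
      using that by (simp add: power_mult_distrib power2_eq_square)
    from this[OF nz'] show ?thesis unfolding P_def e(1) qpoch_Suc unfolding e(2,3) e4 .
  qed
  have shanks: "(\<Sum>s<n. P n / P s * z ^ (s * (2*n+1))) = (\<Sum>s<2*n. z ^ (s * Suc s div 2))" for n
    by (rule shanks_identity[OF _ rec nz one_minus_power_nonzero[OF z]]) (simp_all add: P_def)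
  have "(\<lambda>n. \<Sum>s<n. z ^ (s * Suc s div 2)) \<longlonglongrightarrow> psi z"
    unfolding psi_def using summable_LIMSEQ[OF summable_norm_cancel[OF summable_norm_psi[OF z]]] .
  from LIMSEQ_subseq_LIMSEQ[OF this, of "\<lambda>n. 2 * n"]
  have 1: "(\<lambda>n. \<Sum>s<2*n. z ^ (s * Suc s div 2)) \<longlonglongrightarrow> psi z" by (simp add: strict_mono_def o_def)
  have "(\<lambda>n. 1 / P n) \<longlonglongrightarrow> 1 / L" by (intro tendsto_intros L)
  then obtain C where C: "\<And>n. norm (1 / P n) \<le> C" using convergent_imp_Bseq[of "\<lambda>n. 1 / P n"] unfolding Bseq_def convergent_def by blast
  have asymp_const: "C \<ge> 0" using C[of 0] norm_ge_zero order_trans by blast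
  define R where "R n = (\<Sum>s\<in>{1..<n}. 1 / P s * z ^ (s * (2*n+1)))" for n
  have "R \<longlonglongrightarrow> 0"
  proof (rule Lim_null_comparison)
    have "(\<lambda>n. of_nat n * norm z ^ n) \<longlonglongrightarrow> 0" using z by (intro powser_times_n_limit_0) auto
    then show "(\<lambda>n. C * (of_nat n * norm z ^ n)) \<longlonglongrightarrow> 0" using tendsto_mult_right_zero by blast
    show "\<forall>\<^sub>F n in sequentially. norm (R n) \<le> C * (of_nat n * norm z ^ n)"
    proof (intro always_eventually allI)
      fix n
      have "norm (R n) \<le> (\<Sum>s\<in>{1..<n}. C * norm z ^ n)"
        unfolding R_def
      proof (rule sum_norm_le)
        fix s assume s: "s \<in> {1..<n}"
        have "n \<le> 1 * (2*n+1)" by simp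
        also have "\<dots> \<le> s * (2*n+1)" using s by (intro mult_right_mono) auto
        finally have "norm z ^ (s * (2*n+1)) \<le> norm z ^ n" using z by (intro power_decreasing) auto
        then show "norm (1 / P s * z ^ (s * (2*n+1))) \<le> C * norm z ^ n"
          unfolding norm_mult norm_power using C[of s] asymp_const by (intro mult_mono) auto
      qed
      also have "\<dots> = real (n - 1) * (C * norm z ^ n)" by simp
      also have "\<dots> \<le> real n * (C * norm z ^ n)" using asymp_const by (intro mult_right_mono) auto
      finally show "norm (R n) \<le> C * (of_nat n * norm z ^ n)" by (simp add: mult_ac)
    qed
  qed
  then have 2: "(\<lambda>n. P n * (1 + R n)) \<longlonglongrightarrow> L * (1 + 0)" by (intro tendsto_intros L)
  have "\<forall>\<^sub>F n in sequentially. P n * (1 + R n) = (\<Sum>s<2*n. z ^ (s * Suc s div 2))"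
  proof (rule eventually_mono[OF eventually_ge_at_top[of 1]])
    fix n :: nat assume n: "n \<ge> 1"
    have "{..<n} = insert 0 {1..<n}" using n by auto
    then have "(\<Sum>s<n. P n / P s * z ^ (s * (2*n+1))) = P n / P 0 + (\<Sum>s\<in>{1..<n}. P n / P s * z ^ (s * (2*n+1)))" by simp
    also have "P n / P 0 = P n" by (simp add: P_def)
    also have "(\<Sum>s\<in>{1..<n}. P n / P s * z ^ (s * (2*n+1))) = P n * R n"
      unfolding R_def sum_distrib_left by (intro sum.cong) auto
    finally show "P n * (1 + R n) = (\<Sum>s<2*n. z ^ (s * Suc s div 2))" unfolding shanks by (simp add: distrib_left)
  qed
  then have "\<forall>\<^sub>F n in sequentially. (\<Sum>s<2*n. z ^ (s * Suc s div 2)) = P n * (1 + R n)" by eventually_elim simp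
  with 1 have "(\<lambda>n. P n * (1 + R n)) \<longlonglongrightarrow> psi z" by (rule Lim_transform_eventually)
  with 2 have "psi z = L" using LIMSEQ_unique by fastforce
  then show ?thesis unfolding L_def using qpoch_LIMSEQ(2)[OF z] by simp
qed

text \<open>For odd k the factors 1 + z^k and 1 - z^k of the two products combine to 1 - z^(2 k);
  for even k they coincide. With the lengths 2 n and n the identity is exact at every finite
  stage.\<close>

lemma euler_minus:
  assumes z: "norm z < 1"
  shows "euler (- z) * euler z * euler (z ^ 4) = (euler (z\<^sup>2)) ^ 3"
proof -
  have z': "norm (- z) < 1" "norm (z\<^sup>2) < 1" "norm (z ^ 4) < 1" using z by (simp_all add: norm_power power_less_one_iff)
  have "qpoch (2*n) (- z) * qpoch (2*n) z * qpoch n (z ^ 4) = qpoch (2*n) (z\<^sup>2) * (qpoch n (z\<^sup>2))\<^sup>2" for n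
  proof (induction n)
    case (Suc n)
    define a b where "a = z ^ (2*n+1)" and "b = z ^ (2*n+2)"
    have e: "2 * Suc n = Suc (Suc (2 * n))" by simp
    have p1: "(- z) ^ Suc (2*n) = - a" "(- z) ^ Suc (Suc (2*n)) = b" "z ^ Suc (2*n) = a" "z ^ Suc (Suc (2*n)) = b"
      by (simp_all add: a_def b_def uminus_power_if)
    have p2: "(z ^ 4) ^ Suc n = b\<^sup>2" "(z\<^sup>2) ^ Suc (2*n) = a\<^sup>2" "(z\<^sup>2) ^ Suc (Suc (2*n)) = b\<^sup>2" "(z\<^sup>2) ^ Suc n = b"
      unfolding a_def b_def power_mult[symmetric] by (rule arg_cong[where f = "\<lambda>n. z ^ n"], simp)+
    have "x * (1 - - a) * (1 - b) * (y * (1 - a) * (1 - b)) * (u * (1 - b\<^sup>2)) = v * (1 - a\<^sup>2) * (1 - b\<^sup>2) * (w * (1 - b))\<^sup>2"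
      if "x * y * u = v * w\<^sup>2" for x y u v w
    proof -
      have "x * (1 - - a) * (1 - b) * (y * (1 - a) * (1 - b)) * (u * (1 - b\<^sup>2)) = (x * y * u) * ((1 - a\<^sup>2) * (1 - b\<^sup>2) * (1 - b)\<^sup>2)"
        by (simp add: power2_eq_square algebra_simps)
      then show ?thesis unfolding that by (simp add: power_mult_distrib mult_ac)
    qed
    from this[OF Suc] show ?case unfolding e qpoch_Suc p1 p2 .
  qed simp
  then have "(\<lambda>n. qpoch (2*n) (- z) * qpoch (2*n) z * qpoch n (z ^ 4)) \<longlonglongrightarrow> euler (z\<^sup>2) * (euler (z\<^sup>2))\<^sup>2"
    using tendsto_mult[OF qpoch_LIMSEQ_double[OF z'(2)] tendsto_power[OF qpoch_LIMSEQ(1)[OF z'(2)], of 2]] by simp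
  moreover have "(\<lambda>n. qpoch (2*n) (- z) * qpoch (2*n) z * qpoch n (z ^ 4)) \<longlonglongrightarrow> euler (- z) * euler z * euler (z ^ 4)"
    by (intro tendsto_mult qpoch_LIMSEQ_double qpoch_LIMSEQ z z')
  ultimately have "euler (z\<^sup>2) * (euler (z\<^sup>2))\<^sup>2 = euler (- z) * euler z * euler (z ^ 4)" by (rule LIMSEQ_unique)
  then show ?thesis by (simp add: power3_eq_cube power2_eq_square mult.assoc)
qed

definition theta_form :: "'a::{real_normed_field,banach} \<Rightarrow> 'a" where
  "theta_form q = ((theta q) ^ 4 - (theta (- q)) ^ 4) * (theta q * theta (- q))\<^sup>2 / 16"

text \<open>Contains Gauss' product: theta(-y) is \<open>euler y\<close> squared over
  \<open>euler\<close> at y^2. Indeed \<open>psi_square\<close> at -y expresses theta(-y) by values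
  of \<open>psi\<close>, whose products are known from \<open>psi_product\<close> and are related by
  \<open>euler_minus\<close>.\<close>

lemma psi_theta_minus_product:
  assumes y: "norm y < 1"
  shows "psi y * theta (- y) = euler y * euler (y\<^sup>2)"
proof -
  have y': "norm (- y) < 1" "norm (y\<^sup>2) < 1" using y by (simp_all add: norm_power power_less_one_iff)
  define u v w u' where "u = euler y" and "v = euler (y\<^sup>2)" and "w = euler ((y\<^sup>2)\<^sup>2)" and "u' = euler (- y)"
  have nz: "u \<noteq> 0" "v \<noteq> 0" "w \<noteq> 0" "u' \<noteq> 0"
    unfolding u_def v_def w_def u'_def using y y' by (auto intro!: qpoch_LIMSEQ(2) simp: norm_power power_less_one_iff)
  have 1: "psi y * u = v\<^sup>2" "psi (y\<^sup>2) * v = w\<^sup>2" "psi (- y) * u' = v\<^sup>2"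
    using psi_product[OF y] psi_product[OF y'(2)] psi_product[OF y'(1)] by (simp_all add: u_def v_def w_def u'_def)
  have 2: "u' * u * w = v ^ 3" using euler_minus[OF y] by (simp add: u_def v_def w_def u'_def power_mult[symmetric])
  have 3: "(psi (- y))\<^sup>2 = psi (y\<^sup>2) * theta (- y)" using psi_square[OF y'(1)] by simp
  have e1: "psi y = v\<^sup>2 / u" "psi (y\<^sup>2) = w\<^sup>2 / v" "psi (- y) = v\<^sup>2 / u'" "u' = v ^ 3 / (u * w)"
    using 1 2 nz by (auto simp: field_simps)
  have e2: "psi (- y) = u * w / v" unfolding e1(3) e1(4) using nz by (simp add: power2_eq_square power3_eq_cube)
  have "theta (- y) = (u * w / v)\<^sup>2 * v / w\<^sup>2"
    using 3 nz unfolding e1(2) e2 by (simp add: field_simps)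
  also have "\<dots> = u\<^sup>2 / v" using nz by (simp add: power2_eq_square)
  finally show ?thesis unfolding e1(1) u_def[symmetric] v_def[symmetric] using nz by (simp add: power2_eq_square)
qed

lemma theta_form_product:
  assumes z: "norm z < 1"
  shows "theta_form z = z * (euler (z\<^sup>2) * euler (z ^ 4)) ^ 4"
proof -
  have z2: "norm (z\<^sup>2) < 1" using z by (simp add: norm_power power_less_one_iff)
  have "theta_form z = z * (psi (z\<^sup>2) * theta (- (z\<^sup>2))) ^ 4"
    unfolding theta_form_def theta_diff_psi_norm(2)[OF z] theta_mult_theta_minus[OF z]
    by (simp add: power_mult_distrib power_mult[symmetric])
  also have "\<dots> = z * (euler (z\<^sup>2) * euler (z ^ 4)) ^ 4"
    unfolding psi_theta_minus_product[OF z2] by (simp add: power_mult[symmetric])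
  finally show ?thesis .
qed

lemma theta_form_holomorphic: "theta_form holomorphic_on ball (0::complex) 1"
proof -
  have "(\<lambda>z. theta (- z)) holomorphic_on ball (0::complex) 1"
  proof -
    have "(theta \<circ> uminus) holomorphic_on ball (0::complex) 1"
      by (rule holomorphic_on_compose_gen[OF _ theta_holomorphic]) (auto intro: holomorphic_intros)
    then show ?thesis by (simp add: o_def)
  qed
  then show ?thesis unfolding theta_form_def[abs_def] by (intro holomorphic_intros theta_holomorphic) auto
qed

section \<open>Taylor coefficients of the infinite product\<close>

definition fps_complex :: "real fps \<Rightarrow> complex fps" where
  "fps_complex f = Abs_fps (\<lambda>n. of_real (fps_nth f n))"

lemma fps_complex_simps:
  "fps_complex 1 = 1" "fps_complex fps_X = fps_X" "fps_complex (f - g) = fps_complex f - fps_complex g"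
  "fps_complex (f * g) = fps_complex f * fps_complex g"
  by (simp_all add: fps_complex_def fps_eq_iff fps_mult_nth fps_one_nth)

lemma fps_complex_power: "fps_complex (f ^ n) = fps_complex f ^ n"
  by (induction n) (simp_all add: fps_complex_simps)

lemma fps_complex_prod: "fps_complex (\<Prod>k\<in>A. f k) = (\<Prod>k\<in>A. fps_complex (f k))"
  by (induction A rule: infinite_finite_induct) (simp_all add: fps_complex_simps)

text \<open>The truncation point is independent of the coefficient, so that one product yields all
  coefficients up to \<open>N\<close>, whereas \<open>f_coeff\<close> truncates at the index of the
  coefficient that it extracts.\<close>

definition eta_quotient_fps :: "nat \<Rightarrow> real fps" where
  "eta_quotient_fps N = fps_X * (\<Prod>k\<in>{1..N}. (1 - fps_X ^ (2*k)) ^ 4 * (1 - fps_X ^ (4*k)) ^ 4)"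

definition eta_quotient_prod :: "nat \<Rightarrow> complex \<Rightarrow> complex" where
  "eta_quotient_prod N z = z * (\<Prod>k\<in>{1..N}. (1 - z ^ (2*k)) ^ 4 * (1 - z ^ (4*k)) ^ 4)"

lemma eta_quotient_expansion: "eta_quotient_prod N has_fps_expansion fps_complex (eta_quotient_fps N)"
proof -
  have x: "(\<lambda>z. (1 - z ^ m) ^ 4) has_fps_expansion (1 - fps_X ^ m :: complex fps) ^ 4" for m
    unfolding power4_eq_xxxx by (intro fps_expansion_intros)
  show ?thesis
    unfolding eta_quotient_prod_def[abs_def] eta_quotient_fps_def fps_complex_simps fps_complex_prod fps_complex_power
    by (intro fps_expansion_intros x)
qed

lemma fps_nth_mult_one_minus_power:
  "n < m \<Longrightarrow> fps_nth (f * (1 - fps_X ^ m) ^ j) n = fps_nth (f :: 'a :: comm_ring_1 fps) n"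
proof (induction j)
  case (Suc j)
  have "f * (1 - fps_X ^ m) ^ Suc j = f * (1 - fps_X ^ m) ^ j - f * (1 - fps_X ^ m) ^ j * fps_X ^ m"
    by (simp add: algebra_simps)
  then show ?case using Suc by (simp add: fps_X_power_mult_right_nth)
qed simp

lemma eta_quotient_fps_nth: "n \<le> N \<Longrightarrow> fps_nth (eta_quotient_fps N) n = f_coeff n"
proof (induction N rule: dec_induct)
  case base
  show ?case by (simp add: eta_quotient_fps_def f_coeff_def)
next
  case (step N)
  have "eta_quotient_fps (Suc N) = eta_quotient_fps N * (1 - fps_X ^ (2 * Suc N)) ^ 4 * (1 - fps_X ^ (4 * Suc N)) ^ 4"
    unfolding eta_quotient_fps_def by (simp add: mult.assoc)
  moreover have "n < 2 * Suc N" "n < 4 * Suc N" using step by auto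
  ultimately show ?case using step by (simp only: fps_nth_mult_one_minus_power)
qed

text \<open>255 = 2^8 - 1 is the value at 1 of the majorant (1 + x)^4 (1 + x^2)^4 - 1, reached here
  as 16 times 15 plus 15.\<close>

lemma norm_eta_factor_le:
  fixes w :: complex assumes w: "norm w \<le> 1"
  shows "norm ((1 - w) ^ 4 * (1 - w\<^sup>2) ^ 4 - 1) \<le> 255 * norm w"
proof -
  have p4: "norm ((1 - w) ^ 4 - 1) \<le> 15 * norm w" if w: "norm w \<le> 1" for w :: complex
  proof -
    have "(1 - w) ^ 4 - 1 = w * (w ^ 3 - 4 * w\<^sup>2 + 6 * w - 4)"
      by (simp add: power4_eq_xxxx power3_eq_cube power2_eq_square algebra_simps)
    moreover have "norm (w ^ 3 - 4 * w\<^sup>2 + 6 * w - 4) \<le> 15"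
    proof -
      have "norm (w ^ 3 - 4 * w\<^sup>2 + 6 * w - 4) \<le> norm (w ^ 3 - 4 * w\<^sup>2 + 6 * w) + norm (4 :: complex)" by (rule norm_triangle_ineq4)
      also have "norm (w ^ 3 - 4 * w\<^sup>2 + 6 * w) \<le> norm (w ^ 3 - 4 * w\<^sup>2) + norm (6 * w)" by (rule norm_triangle_ineq)
      also have "norm (w ^ 3 - 4 * w\<^sup>2) \<le> norm (w ^ 3) + norm (4 * w\<^sup>2)" by (rule norm_triangle_ineq4)
      finally show ?thesis
        using w power_le_one[OF norm_ge_zero w, of 3] power_le_one[OF norm_ge_zero w, of 2] by (simp add: norm_mult norm_power)
    qed
    ultimately show ?thesis using mult_left_mono[of "norm (w ^ 3 - 4 * w\<^sup>2 + 6 * w - 4)" 15 "norm w"] by (simp add: norm_mult mult.commute)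
  qed
  have w2: "norm (w\<^sup>2) \<le> norm w" "norm (w\<^sup>2) \<le> 1"
    using mult_right_mono[OF w norm_ge_zero[of w]] w by (auto simp: norm_mult power2_eq_square)
  have "norm (1 - w) \<le> 2" using w norm_triangle_ineq4[of 1 w] by simp
  then have n4: "norm ((1 - w) ^ 4) \<le> 2 ^ 4" unfolding norm_power by (intro power_mono) auto
  have "(1 - w) ^ 4 * (1 - w\<^sup>2) ^ 4 - 1 = (1 - w) ^ 4 * ((1 - w\<^sup>2) ^ 4 - 1) + ((1 - w) ^ 4 - 1)"
    by (simp add: algebra_simps)
  then have "norm ((1 - w) ^ 4 * (1 - w\<^sup>2) ^ 4 - 1) \<le> norm ((1 - w) ^ 4) * norm ((1 - w\<^sup>2) ^ 4 - 1) + norm ((1 - w) ^ 4 - 1)"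
    unfolding norm_mult[symmetric] by (simp only: norm_triangle_ineq)
  also have "\<dots> \<le> 2 ^ 4 * (15 * norm (w\<^sup>2)) + 15 * norm w"
    using n4 p4[OF w] p4[OF w2(2)] by (intro add_mono mult_mono) auto
  also have "\<dots> \<le> 255 * norm w" using w2 by simp
  finally show ?thesis .
qed

text \<open>The small disc suffices for comparing Taylor coefficients at 0; on it the factors differ
  from 1 by a geometric sequence, uniformly in z.\<close>

lemma eta_quotient_uniform_limit: "uniform_limit (ball 0 (1/2)) eta_quotient_prod theta_form sequentially"
proof -
  define g where "g k z = (1 - z ^ (2 * Suc k)) ^ 4 * (1 - z ^ (4 * Suc k)) ^ 4" for k and z :: complex
  let ?A = "cball (0::complex) (1/2)"
  have le: "norm (g k z - 1) \<le> 255 * (1/2) ^ k" if "z \<in> ?A" for k z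
  proof -
    have z: "norm z \<le> 1/2" using that by simp
    have "norm (z ^ (2 * Suc k)) = norm z ^ (2 * Suc k)" by (rule norm_power)
    also have "\<dots> \<le> norm z ^ k" using z by (intro power_decreasing) auto
    also have "\<dots> \<le> (1/2) ^ k" using z by (intro power_mono) auto
    finally have 1: "norm (z ^ (2 * Suc k)) \<le> (1/2) ^ k" .
    also have "(1/2::real) ^ k \<le> 1" by (intro power_le_one) auto
    finally have "norm (g k z - 1) \<le> 255 * norm (z ^ (2 * Suc k))"
      using norm_eta_factor_le[of "z ^ (2 * Suc k)"] unfolding g_def by (simp add: power_mult[symmetric] mult.commute[of _ 2] del: mult_Suc_right)
    then show ?thesis using 1 by linarith
  qed
  have "uniformly_convergent_on ?A (\<lambda>N z. \<Prod>n<N. g n z)"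
  proof (rule uniformly_convergent_on_prod')
    show "continuous_on ?A (g n)" for n unfolding g_def by (intro continuous_intros)
    show "uniformly_convergent_on ?A (\<lambda>N z. \<Sum>n<N. norm (g n z - 1))"
    proof (rule Weierstrass_m_test')
      show "norm (norm (g n z - 1)) \<le> 255 * (1/2) ^ n" if "z \<in> ?A" for n z using le[OF that] by simp
      show "summable (\<lambda>n. 255 * (1/2::real) ^ n)" by (intro summable_mult summable_geometric) auto
    qed
  qed simp
  then obtain l where l: "uniform_limit ?A (\<lambda>N z. \<Prod>n<N. g n z) l sequentially" unfolding uniformly_convergent_on_def by blast
  have eq: "eta_quotient_prod N z = z * (\<Prod>n<N. g n z)" for N z
    unfolding eta_quotient_prod_def g_def by (simp only: One_nat_def prod.atLeast1_atMost_eq)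
  have qp: "(\<Prod>n<N. g n z) = (qpoch N (z\<^sup>2) * qpoch N (z ^ 4)) ^ 4" for N z
    by (induction N) (simp_all add: g_def qpoch_Suc power_mult_distrib power_mult[symmetric] mult_ac del: power_Suc mult_Suc_right)
  have lz: "z * l z = theta_form z" if z: "z \<in> ?A" for z
  proof -
    have n: "norm z < 1" "norm (z\<^sup>2) < 1" "norm (z ^ 4) < 1" using z by (simp_all add: norm_power power_less_one_iff)
    have "(\<lambda>N. (qpoch N (z\<^sup>2) * qpoch N (z ^ 4)) ^ 4) \<longlonglongrightarrow> (euler (z\<^sup>2) * euler (z ^ 4)) ^ 4"
      by (intro tendsto_power tendsto_mult qpoch_LIMSEQ n)
    moreover have "(\<lambda>N. \<Prod>n<N. g n z) \<longlonglongrightarrow> l z" using tendsto_uniform_limitI[OF l z] .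
    ultimately have "l z = (euler (z\<^sup>2) * euler (z ^ 4)) ^ 4" unfolding qp using LIMSEQ_unique by blast
    then show ?thesis using theta_form_product[OF n(1)] by simp
  qed
  show ?thesis
  proof (rule uniform_limitI)
    fix e :: real assume "e > 0"
    from uniform_limitD[OF l this] show "\<forall>\<^sub>F n in sequentially. \<forall>z\<in>ball 0 (1/2). dist (eta_quotient_prod n z) (theta_form z) < e"
    proof eventually_elim
      case (elim N)
      show ?case
      proof
        fix z :: complex assume z: "z \<in> ball 0 (1/2)"
        then have zA: "z \<in> ?A" by simp
        have "dist (eta_quotient_prod N z) (theta_form z) = norm z * dist (\<Prod>n<N. g n z) (l z)"
          unfolding lz[OF zA, symmetric] eq dist_norm norm_mult[symmetric] by (simp add: right_diff_distrib)
        also have "\<dots> \<le> 1 * dist (\<Prod>n<N. g n z) (l z)" using z by (intro mult_right_mono) auto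
        finally have "dist (eta_quotient_prod N z) (theta_form z) \<le> dist (\<Prod>n<N. g n z) (l z)" by simp
        then show "dist (eta_quotient_prod N z) (theta_form z) < e" using bspec[OF elim zA] by (rule le_less_trans)
      qed
    qed
  qed
qed

text \<open>The derivatives at 0 of the partial products converge to those of their uniform limit,
  and the n-th one is constant from N = n on. The series then converges in the whole unit disc
  because \<open>theta_form\<close> is holomorphic there.\<close>

lemma f_coeff_sums:
  fixes z :: complex assumes z: "norm z < 1"
  shows "(\<lambda>n. of_real (f_coeff n) * z ^ n) sums theta_form z"
proof -
  have "(deriv ^^ n) theta_form 0 / fact n = (of_real (f_coeff n) :: complex)" for n
  proof -
    have "(\<lambda>N. (deriv ^^ n) (eta_quotient_prod N) 0) \<longlonglongrightarrow> (deriv ^^ n) theta_form 0"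
      by (rule higher_deriv_complex_uniform_limit[OF eta_quotient_uniform_limit])
        (auto simp: eta_quotient_prod_def[abs_def] intro!: always_eventually holomorphic_intros)
    then have "(\<lambda>N. (deriv ^^ n) (eta_quotient_prod N) 0 / fact n) \<longlonglongrightarrow> (deriv ^^ n) theta_form 0 / fact n"
      by (intro tendsto_divide tendsto_const) auto
    moreover have "\<forall>\<^sub>F N in sequentially. (deriv ^^ n) (eta_quotient_prod N) 0 / fact n = of_real (f_coeff n)"
      using eventually_ge_at_top[of n]
      by eventually_elim (simp add: fps_nth_fps_expansion[OF eta_quotient_expansion, symmetric] fps_complex_def eta_quotient_fps_nth)
    ultimately have "(\<lambda>N. of_real (f_coeff n) :: complex) \<longlonglongrightarrow> (deriv ^^ n) theta_form 0 / fact n"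
      by (rule Lim_transform_eventually)
    then show ?thesis by (simp add: LIMSEQ_const_iff)
  qed
  then show ?thesis using holomorphic_power_series[OF theta_form_holomorphic, of z] z by simp
qed

section \<open>Hecke bound and absolute convergence of the L-series\<close>

lemma theta_form_of_real: "norm q < 1 \<Longrightarrow> theta_form (complex_of_real q) = of_real (theta_form q)"
  using theta_of_real[of q, where 'a = complex] theta_of_real[of "- q", where 'a = complex] by (simp add: theta_form_def)

lemma norm_exp_neg_pi_less_1: "Re w > 0 \<Longrightarrow> norm (exp (- (of_real pi * w))) < 1"
  by simp

lemma Re_inverse_pos: "Re w > 0 \<Longrightarrow> Re (1 / w) > 0"
  by (simp add: Re_divide complex_eq_iff sum_power2_gt_zero_iff)

lemma theta_exp_holomorphic:
  "(\<lambda>w. theta (exp (- (of_real pi * w)))) holomorphic_on {w. Re w > 0}"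
  "(\<lambda>w. theta (- exp (- (of_real pi * w)))) holomorphic_on {w. Re w > 0}"
  "(\<lambda>w. theta (exp (- (of_real pi * (1 / w))))) holomorphic_on {w. Re w > 0}"
  "(\<lambda>w. theta (- exp (- (of_real pi * (1 / w))))) holomorphic_on {w. Re w > 0}"
proof -
  have e: "(\<lambda>w. exp (- (of_real pi * w))) holomorphic_on {w. Re w > 0}" "(\<lambda>w. - exp (- (of_real pi * w))) holomorphic_on {w. Re w > 0}"
    by (intro holomorphic_intros)+
  have i: "(\<lambda>w. exp (- (of_real pi * (1 / w)))) holomorphic_on {w. Re w > 0}"
    by (intro holomorphic_intros) auto
  have i': "(\<lambda>w. - exp (- (of_real pi * (1 / w)))) holomorphic_on {w. Re w > 0}"
    by (intro holomorphic_intros) auto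
  note comp = holomorphic_on_compose_gen[OF _ theta_holomorphic, unfolded o_def]
  have m: "exp (- (of_real pi * w)) \<in> ball 0 1" "- exp (- (of_real pi * w)) \<in> ball 0 1"
    "exp (- (of_real pi * (1 / w))) \<in> ball 0 1" "- exp (- (of_real pi * (1 / w))) \<in> ball 0 1" if "w \<in> {w. Re w > 0}" for w
    using norm_exp_neg_pi_less_1[of w] norm_exp_neg_pi_less_1[OF Re_inverse_pos[of w]] that
    unfolding mem_ball_0 norm_minus_cancel mem_Collect_eq by blast+
  show "(\<lambda>w. theta (exp (- (of_real pi * w)))) holomorphic_on {w. Re w > 0}"
    by (rule comp[OF e(1)]) (use m(1) in blast)
  show "(\<lambda>w. theta (- exp (- (of_real pi * w)))) holomorphic_on {w. Re w > 0}"
    by (rule comp[OF e(2)]) (use m(2) in blast)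
  show "(\<lambda>w. theta (exp (- (of_real pi * (1 / w))))) holomorphic_on {w. Re w > 0}"
    by (rule comp[OF i]) (use m(3) in blast)
  show "(\<lambda>w. theta (- exp (- (of_real pi * (1 / w))))) holomorphic_on {w. Re w > 0}"
    by (rule comp[OF i']) (use m(4) in blast)
qed

text \<open>Extends identities from the positive reals, where the comparison of elliptic integrals
  proves them, to complex arguments.\<close>

lemma right_half_plane_continuation:
  assumes f: "f holomorphic_on {w. Re w > 0}" and g: "g holomorphic_on {w. Re w > 0}"
    and eq: "\<And>t. t > 0 \<Longrightarrow> f (of_real t) = g (of_real t)" and w: "Re w > 0"
  shows "f w = g w"
proof -
  have "f w - g w = 0"
  proof (rule analytic_continuation[where f = "\<lambda>w. f w - g w" and S = "{w. Re w > 0}" and U = "of_real ` {0<..}" and \<xi> = 1])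
    show "(\<lambda>w. f w - g w) holomorphic_on {w. Re w > 0}" by (intro holomorphic_intros f g)
    show "connected {w. Re w > 0}" by (intro convex_connected convex_halfspace_Re_gt)
    show "(1::complex) islimpt of_real ` {0<..}"
      unfolding islimpt_approachable
    proof (intro allI impI)
      fix e :: real assume e: "e > 0"
      show "\<exists>x'\<in>complex_of_real ` {0<..}. x' \<noteq> 1 \<and> dist x' 1 < e"
      proof (rule bexI[of _ "of_real (1 + e / 2)"])
        have "complex_of_real (1 + e / 2) - 1 = of_real (e / 2)" by simp
        then have "norm (complex_of_real (1 + e / 2) - 1) = norm (complex_of_real (e / 2))" by (rule arg_cong)
        then have "dist (complex_of_real (1 + e / 2)) 1 = e / 2" unfolding dist_norm norm_of_real using e by simp
        then show "complex_of_real (1 + e / 2) \<noteq> 1 \<and> dist (complex_of_real (1 + e / 2)) 1 < e" using e by auto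
        show "complex_of_real (1 + e / 2) \<in> complex_of_real ` {0<..}" using e by (intro imageI) simp
      qed
    qed
  qed (use eq w in \<open>auto simp: open_halfspace_Re_gt\<close>)
  then show ?thesis by simp
qed

lemma theta_exp_of_real:
  assumes "t > 0"
  shows "theta (exp (- (of_real pi * of_real t))) = (of_real (theta (exp (- pi * t))) :: complex)"
    and "theta (- exp (- (of_real pi * of_real t))) = (of_real (theta (- exp (- pi * t))) :: complex)"
proof -
  have e: "exp (- (of_real pi * of_real t)) = complex_of_real (exp (- pi * t))" by (simp add: exp_of_real[symmetric])
  have n: "norm (exp (- pi * t)) < 1" "norm (- exp (- pi * t)) < 1" using assms by auto
  show "theta (exp (- (of_real pi * of_real t))) = (of_real (theta (exp (- pi * t))) :: complex)"
    unfolding e by (rule theta_of_real[OF n(1)])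
  show "theta (- exp (- (of_real pi * of_real t))) = (of_real (theta (- exp (- pi * t))) :: complex)"
    unfolding e of_real_minus[symmetric] by (rule theta_of_real[OF n(2)])
qed

text \<open>The fourth powers of theta_3 and, in the next definition, of theta_4 at the nome exp (-
  pi w), so that w = - i tau and the right half plane replaces the upper one. Fourth powers avoid
  the square root in \<open>theta_c\<close>: theta_2^4 is the difference of the two, and all
  transformation formulas become polynomial.\<close>

definition thetaP :: "complex \<Rightarrow> complex" where "thetaP w = theta (exp (- (of_real pi * w))) ^ 4"
definition thetaQ :: "complex \<Rightarrow> complex" where "thetaQ w = theta (- exp (- (of_real pi * w))) ^ 4"

lemma theta_fourth_S:
  assumes w: "Re w > 0"
  shows "thetaP (1 / w) = w\<^sup>2 * thetaP w" "thetaQ (1 / w) = w\<^sup>2 * (thetaP w - thetaQ w)"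
proof -
  have P: "thetaP (1 / of_real t) = (of_real t)\<^sup>2 * thetaP (of_real t)"
    and Q: "thetaQ (1 / of_real t) = (of_real t)\<^sup>2 * (thetaP (of_real t) - thetaQ (of_real t))" if t: "t > 0" for t
  proof -
    have it: "1 / t > 0" using t by simp
    have c: "complex_of_real (1 / t) = 1 / of_real t" by simp
    have e: "- pi * (1 / t) = - pi / t" by simp
    define a a' b b' where "a = theta (exp (- pi * t))" and "a' = theta (exp (- pi / t))"
      and "b = theta (- exp (- pi * t))" and "b' = theta (- exp (- pi / t))"
    have 1: "thetaP (of_real t) = of_real (a ^ 4)" "thetaQ (of_real t) = of_real (b ^ 4)"
      "thetaP (1 / of_real t) = of_real (a' ^ 4)" "thetaQ (1 / of_real t) = of_real (b' ^ 4)"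
      unfolding thetaP_def thetaQ_def a_def a'_def b_def b'_def
      using theta_exp_of_real[OF t] theta_exp_of_real[OF it] unfolding c e by simp_all
    have 2: "a'\<^sup>2 = t * a\<^sup>2" using theta_S_real_square(1)[OF t] by (simp add: a_def a'_def)
    have 3: "theta_c (exp (- pi / t)) = t * b\<^sup>2" using theta_S_real_square(2)[OF t] by (simp add: b_def)
    have 4: "(theta_c (exp (- pi / t)))\<^sup>2 = a' ^ 4 - b' ^ 4"
      unfolding a'_def b'_def using t by (intro theta_positive(4)) auto
    have 5: "a' ^ 4 = t\<^sup>2 * a ^ 4" using arg_cong[OF 2, of "\<lambda>x. x\<^sup>2"] by (simp add: power_mult_distrib power_mult[symmetric])
    have "a' ^ 4 - b' ^ 4 = t\<^sup>2 * b ^ 4" using 4 unfolding 3 by (simp add: power_mult_distrib power_mult[symmetric])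
    then have 6: "b' ^ 4 = t\<^sup>2 * (a ^ 4 - b ^ 4)" using 5 by (simp add: right_diff_distrib)
    show "thetaP (1 / of_real t) = (of_real t)\<^sup>2 * thetaP (of_real t)"
      "thetaQ (1 / of_real t) = (of_real t)\<^sup>2 * (thetaP (of_real t) - thetaQ (of_real t))"
      unfolding 1 5 6 by simp_all
  qed
  have h: "(\<lambda>w. thetaP (1 / w)) holomorphic_on {w. Re w > 0}" "(\<lambda>w. w\<^sup>2 * thetaP w) holomorphic_on {w. Re w > 0}"
    "(\<lambda>w. thetaQ (1 / w)) holomorphic_on {w. Re w > 0}" "(\<lambda>w. w\<^sup>2 * (thetaP w - thetaQ w)) holomorphic_on {w. Re w > 0}"
    unfolding thetaP_def thetaQ_def by (intro holomorphic_intros theta_exp_holomorphic)+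
  show "thetaP (1 / w) = w\<^sup>2 * thetaP w"
    by (rule right_half_plane_continuation[OF h(1,2) _ w]) (rule P)
  show "thetaQ (1 / w) = w\<^sup>2 * (thetaP w - thetaQ w)"
    by (rule right_half_plane_continuation[OF h(3,4) _ w]) (rule Q)
qed

text \<open>This height is symmetric in the three theta constants, hence invariant under the whole modular group,
  and it dominates the square of the absolute value of the cusp form.\<close>

definition theta_height :: "complex \<Rightarrow> real" where
  "theta_height w = Re w ^ 4 * (norm (thetaP w) * norm (thetaQ w) * norm (thetaP w - thetaQ w))
     * (norm (thetaP w) + norm (thetaQ w) + norm (thetaP w - thetaQ w))"

text \<open>The translation multiplies q by (-1)^k. For odd k this exchanges \<open>thetaP\<close>
  and \<open>thetaQ\<close> and changes the sign of their difference.\<close>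

lemma theta_height_shift: "theta_height (w + \<i> * of_int k) = theta_height w"
proof -
  have "exp (- (of_real pi * (w + \<i> * of_int k))) = exp (- (of_real pi * w)) * exp (- (of_real pi * \<i> * of_int k))"
    unfolding exp_add[symmetric] by (simp add: algebra_simps)
  also have "exp (- (of_real pi * \<i> * of_int k)) = (if even k then 1 else - 1)"
  proof (cases "even k")
    case True
    then obtain m where "k = 2 * m" by (elim evenE)
    then have "- (of_real pi * \<i> * of_int k) = complex_of_real (2 * of_int (- m) * pi) * \<i>" by simp
    then show ?thesis using True exp_integer_2pi[of "of_int (- m)"] by (simp only: Ints_of_int if_True)
  next
    case False
    then obtain m where "k = 2 * m + 1" by (elim oddE)
    then have "- (of_real pi * \<i> * of_int k) = complex_of_real (2 * of_int (- m) * pi) * \<i> + (- (of_real pi * \<i>))" by (simp add: algebra_simps)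
    then have "exp (- (of_real pi * \<i> * of_int k)) = exp (- (of_real pi * \<i>))"
      using exp_integer_2pi[of "of_int (- m)"] by (simp only: exp_add Ints_of_int mult_1_left)
    also have "\<dots> = - 1" by (simp add: exp_minus)
    finally show ?thesis using False by simp
  qed
  finally have e: "exp (- (of_real pi * (w + \<i> * of_int k))) = (if even k then exp (- (of_real pi * w)) else - exp (- (of_real pi * w)))" by simp
  have r: "Re (w + \<i> * of_int k) = Re w" by simp
  show ?thesis
    unfolding theta_height_def thetaP_def thetaQ_def e r
    by (cases "even k") (simp_all add: norm_minus_commute mult_ac add_ac)
qed

text \<open>Up to the factor w^2 the inversion fixes \<open>thetaP\<close> and exchanges
  \<open>thetaQ\<close> with the difference. The height has degree 4 in these quantities, so a
  factor |w|^8 appears, and it is cancelled by the fourth power of Re (1/w) = Re w / |w|^2.\<close>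

lemma theta_height_inverse:
  assumes w: "Re w > 0"
  shows "theta_height (1 / w) = theta_height w"
proof -
  have n: "norm w > 0" using w by auto
  have r: "Re (1 / w) = Re w / (norm w)\<^sup>2" by (simp add: Re_divide cmod_power2)
  have d: "w\<^sup>2 * x - w\<^sup>2 * (x - y) = w\<^sup>2 * y" for x y by (simp add: algebra_simps)
  have "(x / y\<^sup>2) ^ 4 * ((y\<^sup>2 * a) * (y\<^sup>2 * c) * (y\<^sup>2 * b)) * (y\<^sup>2 * a + y\<^sup>2 * c + y\<^sup>2 * b) = x ^ 4 * (a * b * c) * (a + b + c)"
    if "y > 0" for x y a b c :: real
  proof -
    have "(y\<^sup>2 * a) * (y\<^sup>2 * c) * (y\<^sup>2 * b) = (y\<^sup>2) ^ 3 * (a * b * c)" by (simp add: power3_eq_cube mult_ac)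
    moreover have "y\<^sup>2 * a + y\<^sup>2 * c + y\<^sup>2 * b = y\<^sup>2 * (a + b + c)" by (simp add: distrib_left)
    moreover have "(x / y\<^sup>2) ^ 4 * ((y\<^sup>2) ^ 3 * (a * b * c)) * (y\<^sup>2 * (a + b + c)) = (x / y\<^sup>2) ^ 4 * (y\<^sup>2) ^ 4 * (a * b * c) * (a + b + c)"
      by (simp add: power_Suc2[of _ 3, simplified] mult_ac)
    moreover have "(x / y\<^sup>2) ^ 4 * (y\<^sup>2) ^ 4 = x ^ 4" using that by (simp add: power_divide)
    ultimately show ?thesis by simp
  qed
  from this[OF n] show ?thesis
    unfolding theta_height_def theta_fourth_S[OF w] d norm_mult norm_power r .
qed

lemma norm_theta_le:
  fixes q :: complex
  assumes "norm q \<le> r" "r < 1"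
  shows "norm (theta q) \<le> theta r"
proof -
  have r0: "r \<ge> 0" using assms norm_ge_zero order_trans by blast
  have nq: "norm q < 1" using assms by simp
  have sm: "summable (\<lambda>n. r ^ ((Suc n)\<^sup>2))" using summable_norm_cancel[OF summable_norm_theta[of r]] assms r0 by simp
  have "norm (\<Sum>n. q ^ ((Suc n)\<^sup>2)) \<le> (\<Sum>n. norm (q ^ ((Suc n)\<^sup>2)))" by (rule summable_norm[OF summable_norm_theta[OF nq]])
  also have "\<dots> \<le> (\<Sum>n. r ^ ((Suc n)\<^sup>2))"
    by (rule suminf_le[OF _ summable_norm_theta[OF nq] sm]) (use assms in \<open>auto simp: norm_power intro!: power_mono\<close>)
  finally have s: "norm (\<Sum>n. q ^ ((Suc n)\<^sup>2)) \<le> (\<Sum>n. r ^ ((Suc n)\<^sup>2))" .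
  have "norm (theta q) \<le> norm (1::complex) + norm (2 * (\<Sum>n. q ^ ((Suc n)\<^sup>2)))" unfolding theta_def by (rule norm_triangle_ineq)
  then show ?thesis using s unfolding theta_def by (simp add: norm_mult)
qed

lemma norm_psi_le:
  fixes q :: complex
  assumes "norm q \<le> r" "r < 1"
  shows "norm (psi q) \<le> psi r"
proof -
  have r0: "r \<ge> 0" using assms norm_ge_zero order_trans by blast
  have nq: "norm q < 1" using assms by simp
  have sm: "summable (\<lambda>n. r ^ (n * Suc n div 2))" using summable_norm_cancel[OF summable_norm_psi[of r]] assms r0 by simp
  have "norm (psi q) \<le> (\<Sum>n. norm (q ^ (n * Suc n div 2)))" unfolding psi_def by (rule summable_norm[OF summable_norm_psi[OF nq]])
  also have "\<dots> \<le> psi r" unfolding psi_def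
    by (rule suminf_le[OF _ summable_norm_psi[OF nq] sm]) (use assms in \<open>auto simp: norm_power intro!: power_mono\<close>)
  finally show ?thesis .
qed

text \<open>Both theta powers stay bounded, and their difference 16 q psi(q^2)^4 decays
  exponentially, which outweighs the fourth power of Re w.\<close>

lemma theta_height_bounded_strip: "\<exists>K. \<forall>w. Re w \<ge> 1/2 \<longrightarrow> theta_height w \<le> K"
proof -
  define r where "r = exp (- (pi / 2))"
  have r: "0 < r" "r < 1" by (auto simp: r_def)
  have r2: "0 < r\<^sup>2" "r\<^sup>2 < 1" using r by (auto simp: power_less_one_iff)
  define A where "A = theta r ^ 4"
  define B where "B = 16 * psi (r\<^sup>2) ^ 4"
  have A: "A > 0" unfolding A_def using theta_pos_real(4)[of r] r by simp
  have B: "B > 0" unfolding B_def using theta_pos_real(5)[of "r\<^sup>2"] r2 by simp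
  have "((\<lambda>y::real. y ^ 4 * exp (- (pi * y))) \<longlongrightarrow> 0) at_top" by real_asymp
  then obtain Y where Y: "\<And>y. y \<ge> Y \<Longrightarrow> norm (y ^ 4 * exp (- (pi * y)) - 0) < 1"
    unfolding tendsto_iff eventually_at_top_linorder dist_norm using zero_less_one by blast
  define C where "C = max 1 (Y ^ 4)"
  have C: "y ^ 4 * exp (- (pi * y)) \<le> C" if "y > 0" for y
  proof (cases "y \<ge> Y")
    case True then show ?thesis using Y[OF True] unfolding C_def by auto
  next
    case False
    have "y ^ 4 * exp (- (pi * y)) \<le> Y ^ 4 * 1" using False that by (intro mult_mono power_mono) auto
    then show ?thesis unfolding C_def by simp
  qed
  have "theta_height w \<le> C * (A * A * B) * (A + A + 2 * A)" if w: "Re w \<ge> 1/2" for w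
  proof -
    define q where "q = exp (- (of_real pi * w))"
    have nq: "norm q = exp (- (pi * Re w))" by (simp add: q_def)
    have qr: "norm q \<le> r" unfolding nq r_def using w by simp
    have q1: "norm q < 1" using qr r by simp
    have P: "norm (thetaP w) \<le> A" unfolding thetaP_def q_def[symmetric] A_def norm_power
      using norm_theta_le[OF qr r(2)] by (intro power_mono) auto
    have Q: "norm (thetaQ w) \<le> A" unfolding thetaQ_def q_def[symmetric] A_def norm_power
      using norm_theta_le[of "- q" r] qr r(2) by (intro power_mono) auto
    have "norm (q\<^sup>2) \<le> r\<^sup>2" unfolding norm_power using qr by (intro power_mono) auto
    then have "norm (psi (q\<^sup>2)) ^ 4 \<le> psi (r\<^sup>2) ^ 4" using norm_psi_le r2 by (intro power_mono) auto
    then have "16 * norm q * norm (psi (q\<^sup>2)) ^ 4 \<le> 16 * norm q * psi (r\<^sup>2) ^ 4" by (intro mult_left_mono) auto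
    then have D: "norm (thetaP w - thetaQ w) \<le> B * norm q"
      unfolding thetaP_def thetaQ_def q_def[symmetric] theta_diff_psi_norm(2)[OF q1] B_def by (simp add: norm_mult norm_power mult_ac)
    have D2: "norm (thetaP w - thetaQ w) \<le> 2 * A" using norm_triangle_ineq4[of "thetaP w" "thetaQ w"] P Q by simp
    have "Re w ^ 4 * (norm (thetaP w) * norm (thetaQ w) * norm (thetaP w - thetaQ w)) \<le> Re w ^ 4 * (A * A * (B * norm q))"
      using P Q D A B w by (intro mult_left_mono mult_mono) auto
    also have "\<dots> = Re w ^ 4 * exp (- (pi * Re w)) * (A * A * B)" unfolding nq by (simp add: mult_ac)
    also have "\<dots> \<le> C * (A * A * B)" using C[of "Re w"] w A B by (intro mult_right_mono) auto
    finally have 1: "Re w ^ 4 * (norm (thetaP w) * norm (thetaQ w) * norm (thetaP w - thetaQ w)) \<le> C * (A * A * B)" .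
    have asymp_const: "C \<ge> 0" unfolding C_def by simp
    have "norm (thetaP w) + norm (thetaQ w) + norm (thetaP w - thetaQ w) \<le> A + A + 2 * A" using P Q D2 by linarith
    then show ?thesis unfolding theta_height_def by (rule mult_mono[OF 1]) (use A B asymp_const in auto)
  qed
  then show ?thesis by blast
qed

text \<open>Reduction as for a fundamental domain: after a shift to |Im v| <= 1/2, either Re v >=
  1/2, or |v|^2 < 1/2 and inversion at least doubles the real part. The induction runs over the half
  planes Re w >= 2^(-n-1).\<close>

lemma theta_height_bounded: "\<exists>K\<ge>0. \<forall>w. Re w > 0 \<longrightarrow> theta_height w \<le> K"
proof -
  obtain K where K: "\<And>w. Re w \<ge> 1/2 \<Longrightarrow> theta_height w \<le> K" using theta_height_bounded_strip by blast
  have step: "\<forall>w. Re w \<ge> (1/2) ^ Suc n \<longrightarrow> theta_height w \<le> K" for n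
  proof (induction n)
    case 0 then show ?case using K by simp
  next
    case (Suc n)
    show ?case
    proof (intro allI impI)
      fix w assume w: "Re w \<ge> (1/2) ^ Suc (Suc n)"
      define k where "k = round (Im w)"
      define v where "v = w + \<i> * of_int (- k)"
      have v: "Re v = Re w" "Im v = Im w - of_int k" by (simp_all add: v_def)
      have Imv: "\<bar>Im v\<bar> \<le> 1/2" unfolding v k_def using of_int_round_abs_le[of "Im w"] by (simp add: abs_minus_commute)
      have pos: "Re v > 0" using w v(1) zero_less_power[of "1/2::real" "Suc (Suc n)"] by linarith
      have "theta_height v \<le> K"
      proof (cases "Re v \<ge> 1/2")
        case True then show ?thesis by (rule K)
      next
        case False
        have "(Re v)\<^sup>2 < (1/2)\<^sup>2" using False pos by (intro power_strict_mono) auto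
        moreover have "(Im v)\<^sup>2 \<le> (1/2)\<^sup>2" using Imv by (metis abs_ge_zero power2_abs power_mono)
        ultimately have n: "(norm v)\<^sup>2 < 1/2" unfolding cmod_power2 by (simp add: power2_eq_square)
        have n0: "(norm v)\<^sup>2 > 0" using pos by auto
        have "2 * Re v = Re v / (1/2)" by simp
        also have "\<dots> \<le> Re v / (norm v)\<^sup>2" using n n0 pos by (intro divide_left_mono) auto
        also have "\<dots> = Re (1 / v)" by (simp add: Re_divide cmod_power2)
        finally have "Re (1 / v) \<ge> (1/2) ^ Suc n" using w v(1) by simp
        then have "theta_height (1 / v) \<le> K" using Suc by blast
        then show ?thesis unfolding theta_height_inverse[OF pos] .
      qed
      then show "theta_height w \<le> K" unfolding v_def theta_height_shift .
    qed
  qed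
  have "theta_height w \<le> K" if w: "Re w > 0" for w
  proof -
    obtain n where "(1/2::real) ^ n < Re w" using real_arch_pow_inv[OF w, of "1/2"] by auto
    moreover have "(1/2::real) ^ Suc n \<le> (1/2) ^ n" by simp
    ultimately have "(1/2) ^ Suc n \<le> Re w" by linarith
    then show ?thesis using step[of n] by blast
  qed
  moreover have "K \<ge> 0"
  proof -
    have "theta_height 1 \<ge> 0" unfolding theta_height_def by simp
    then show ?thesis using K[of 1] by simp
  qed
  ultimately show ?thesis by blast
qed

text \<open>With P, Q, D the absolute values of \<open>thetaP\<close>, \<open>thetaQ\<close> and
  their difference, the squared absolute value is D^2 P Q / 256, at most P Q D (P + Q + D), which is
  the height without its power of Re w. The bound depends on |q| alone, hence holds on whole
  circles, as Parseval requires.\<close>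

lemma theta_form_bound: "\<exists>K\<ge>0. \<forall>y>0. \<forall>q::complex. norm q = exp (- (pi * y)) \<longrightarrow> (norm (theta_form q))\<^sup>2 \<le> K / y ^ 4"
proof -
  obtain K where K: "K \<ge> 0" "\<And>w. Re w > 0 \<Longrightarrow> theta_height w \<le> K" using theta_height_bounded by blast
  have "(norm (theta_form q))\<^sup>2 \<le> K / y ^ 4" if y: "y > 0" and q: "norm q = exp (- (pi * y))" for y and q :: complex
  proof -
    have q0: "q \<noteq> 0" using q by auto
    define w where "w = - Ln q / of_real pi"
    have "Re (Ln q) = ln (norm q)" using q0 by (rule Re_Ln)
    then have Rew: "Re w = y" unfolding w_def q by simp
    have qw: "exp (- (of_real pi * w)) = q" unfolding w_def using q0 by simp
    define P Q where "P = norm (thetaP w)" and "Q = norm (thetaQ w)"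
    define D where "D = norm (thetaP w - thetaQ w)"
    have nn: "P \<ge> 0" "Q \<ge> 0" "D \<ge> 0" by (auto simp: P_def Q_def D_def)
    have "(norm (theta_form q))\<^sup>2 = D\<^sup>2 * (P * Q) / 256"
      unfolding theta_form_def D_def P_def Q_def thetaP_def thetaQ_def qw
      by (simp add: norm_mult norm_divide norm_power power_mult_distrib power_divide power_mult[symmetric])
    also have "\<dots> \<le> P * Q * D * (P + Q + D)"
    proof -
      have "P * Q * D * D \<le> P * Q * D * (P + Q + D)" using nn by (intro mult_left_mono) auto
      moreover have "D\<^sup>2 * (P * Q) / 256 \<le> P * Q * D * D" using nn by (simp add: power2_eq_square mult_ac)
      ultimately show ?thesis by simp
    qed
    also have "\<dots> \<le> K / y ^ 4"
      using K(2)[of w] y unfolding theta_height_def Rew P_def[symmetric] Q_def[symmetric] D_def[symmetric]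
      by (simp add: pos_le_divide_eq mult_ac)
    finally show ?thesis .
  qed
  then show ?thesis using K(1) by blast
qed

section \<open>Mean squares of the coefficients and absolute convergence\<close>

lemma discrete_parseval:
  fixes c :: "nat \<Rightarrow> complex"
  assumes m: "m > 0"
  shows "(\<Sum>j<m. (norm (\<Sum>n<m. c n * cis (2 * pi * real j / real m) ^ n))\<^sup>2) = real m * (\<Sum>n<m. (norm (c n))\<^sup>2)"
proof -
  define \<omega> where "\<omega> = cis (2 * pi / real m)"
  have cis: "cis (2 * pi * real j / real m) = \<omega> ^ j" for j unfolding \<omega>_def Complex.DeMoivre by (simp add: mult.commute)
  have \<omega>m: "\<omega> ^ m = 1" unfolding \<omega>_def Complex.DeMoivre using m by (simp add: cis_2pi)
  have n\<omega>: "\<omega> * cnj \<omega> = 1" unfolding \<omega>_def by (simp add: cis_cnj cis_mult)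
  \<comment> \<open>The m powers of the root of unity are distinct; hence the geometric sums below
    have a ratio other than 1 and vanish off the diagonal.\<close>
  have inj: "inj_on (\<lambda>k. \<omega> ^ k) {..<m}"
    using Complex.bij_betw_roots_unity[OF m] unfolding bij_betw_def cis by simp
  have orth: "(\<Sum>j<m. (\<omega> ^ n * cnj \<omega> ^ k) ^ j) = (if n = k then of_nat m else 0)" if nk: "n < m" "k < m" for n k
  proof (cases "n = k")
    case True
    then show ?thesis by (simp add: power_mult_distrib[symmetric] n\<omega>)
  next
    case False
    define x where "x = \<omega> ^ n * cnj \<omega> ^ k"
    have "x \<noteq> 1"
    proof
      assume "x = 1"
      then have "\<omega> ^ n * (cnj \<omega> ^ k * \<omega> ^ k) = \<omega> ^ k" unfolding x_def by (simp add: mult.assoc[symmetric])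
      moreover have "cnj \<omega> ^ k * \<omega> ^ k = 1" using n\<omega> by (simp add: power_mult_distrib[symmetric] mult.commute)
      ultimately have "\<omega> ^ n = \<omega> ^ k" by simp
      then show False using inj nk False unfolding inj_on_def by blast
    qed
    moreover have "x ^ m = 1"
    proof -
      have "cnj \<omega> ^ m = 1" using \<omega>m by (metis complex_cnj_one complex_cnj_power)
      then show ?thesis unfolding x_def by (simp add: power_mult_distrib power_mult[symmetric] mult.commute[of _ m])
        (simp add: power_mult \<omega>m)
    qed
    ultimately have "(\<Sum>j<m. x ^ j) = 0" using sum_gp_strict[of x m] by simp
    then show ?thesis using False by (simp add: x_def)
  qed
  have "of_real ((norm (\<Sum>n<m. c n * (\<omega> ^ j) ^ n))\<^sup>2) = (\<Sum>n<m. \<Sum>k<m. c n * cnj (c k) * (\<omega> ^ n * cnj \<omega> ^ k) ^ j)" for j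
  proof -
    have "of_real ((norm (\<Sum>n<m. c n * (\<omega> ^ j) ^ n))\<^sup>2) = (\<Sum>n<m. c n * (\<omega> ^ j) ^ n) * cnj (\<Sum>n<m. c n * (\<omega> ^ j) ^ n)"
      by (rule complex_norm_square)
    also have "\<dots> = (\<Sum>n<m. \<Sum>k<m. (c n * (\<omega> ^ j) ^ n) * (cnj (c k) * (cnj \<omega> ^ j) ^ k))"
      by (simp add: sum_product)
    also have "\<dots> = (\<Sum>n<m. \<Sum>k<m. c n * cnj (c k) * (\<omega> ^ n * cnj \<omega> ^ k) ^ j)"
      by (intro sum.cong refl) (simp add: power_mult_distrib power_mult[symmetric] mult_ac)
    finally show ?thesis .
  qed
  then have "of_real (\<Sum>j<m. (norm (\<Sum>n<m. c n * (\<omega> ^ j) ^ n))\<^sup>2) = (\<Sum>j<m. \<Sum>n<m. \<Sum>k<m. c n * cnj (c k) * (\<omega> ^ n * cnj \<omega> ^ k) ^ j)"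
    by simp
  also have "\<dots> = (\<Sum>n<m. \<Sum>k<m. \<Sum>j<m. c n * cnj (c k) * (\<omega> ^ n * cnj \<omega> ^ k) ^ j)"
    by (rule trans[OF sum.swap sum.cong[OF refl sum.swap]])
  also have "\<dots> = (\<Sum>n<m. \<Sum>k<m. if n = k then of_nat m * of_real ((norm (c n))\<^sup>2) else 0)"
  proof (intro sum.cong refl)
    fix n k assume "n \<in> {..<m}" "k \<in> {..<m}"
    then have "(\<Sum>j<m. c n * cnj (c k) * (\<omega> ^ n * cnj \<omega> ^ k) ^ j) = c n * cnj (c k) * (if n = k then of_nat m else 0)"
      using orth[of n k] by (simp only: sum_distrib_left[symmetric] lessThan_iff)
    then show "(\<Sum>j<m. c n * cnj (c k) * (\<omega> ^ n * cnj \<omega> ^ k) ^ j) = (if n = k then of_nat m * of_real ((norm (c n))\<^sup>2) else 0)"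
      by (simp add: complex_norm_square del: of_real_power)
  qed
  also have "\<dots> = (\<Sum>n<m. of_nat m * of_real ((norm (c n))\<^sup>2))" by (intro sum.cong refl) simp
  also have "\<dots> = of_real (real m * (\<Sum>n<m. (norm (c n))\<^sup>2))" by (simp add: sum_distrib_left)
  finally show ?thesis unfolding cis of_real_eq_iff .
qed

text \<open>Parseval over the m-th roots of unity, applied to the truncation to degree below m,
  whose error on the circle tends to 0 with m. Finite sums thus replace the integral over the
  circle.\<close>

lemma power_series_mean_square_le:
  fixes c :: "nat \<Rightarrow> complex"
  assumes sums: "\<And>z. norm z = r \<Longrightarrow> (\<lambda>n. c n * z ^ n) sums f z" and abs: "summable (\<lambda>n. norm (c n) * r ^ n)"
    and M: "\<And>z. norm z = r \<Longrightarrow> norm (f z) \<le> M" and r: "r \<ge> 0"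
  shows "(\<Sum>n<N. (norm (c n))\<^sup>2 * r ^ (2 * n)) \<le> M\<^sup>2"
proof -
  define t where "t m = (\<Sum>n. norm (c (n + m)) * r ^ (n + m))" for m
  have t: "t \<longlonglongrightarrow> 0" unfolding t_def using suminf_exist_split2[OF abs] by simp
  have t0: "t m \<ge> 0" for m unfolding t_def using r summable_ignore_initial_segment[OF abs] by (intro suminf_nonneg) auto
  have poly: "norm (\<Sum>n<m. c n * z ^ n) \<le> M + t m" if z: "norm z = r" for m z
  proof -
    have sm: "summable (\<lambda>n. norm (c n * z ^ n))" using abs z by (simp add: norm_mult norm_power)
    have "f z = (\<Sum>n. c (n + m) * z ^ (n + m)) + (\<Sum>n<m. c n * z ^ n)"
      using sums[OF z] suminf_split_initial_segment[OF sums_summable[OF sums[OF z]], of m] by (simp add: sums_iff)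
    then have "(\<Sum>n<m. c n * z ^ n) = f z - (\<Sum>n. c (n + m) * z ^ (n + m))" by simp
    then have "norm (\<Sum>n<m. c n * z ^ n) \<le> norm (f z) + norm (\<Sum>n. c (n + m) * z ^ (n + m))"
      using norm_triangle_ineq4 by simp
    also have "norm (\<Sum>n. c (n + m) * z ^ (n + m)) \<le> (\<Sum>n. norm (c (n + m) * z ^ (n + m)))"
      using summable_ignore_initial_segment[OF sm, of m] by (rule summable_norm)
    also have "\<dots> = t m" unfolding t_def by (simp add: norm_mult norm_power z)
    finally show ?thesis using M[OF z] by simp
  qed
  have main: "(\<Sum>n<N. (norm (c n))\<^sup>2 * r ^ (2 * n)) \<le> (M + t m)\<^sup>2" if m: "m \<ge> N" "m > 0" for m
  proof -
    have "real m * (\<Sum>n<m. (norm (c n * of_real r ^ n))\<^sup>2) = (\<Sum>j<m. (norm (\<Sum>n<m. (c n * of_real r ^ n) * cis (2 * pi * real j / real m) ^ n))\<^sup>2)"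
      by (rule discrete_parseval[OF m(2), symmetric])
    also have "\<dots> \<le> (\<Sum>j<m. (M + t m)\<^sup>2)"
    proof (intro sum_mono power_mono)
      fix j
      have "norm (of_real r * cis (2 * pi * real j / real m)) = r" using r by (simp add: norm_mult)
      from poly[OF this, of m]
      show "norm (\<Sum>n<m. (c n * of_real r ^ n) * cis (2 * pi * real j / real m) ^ n) \<le> M + t m"
        by (simp add: power_mult_distrib mult.assoc)
    qed simp
    also have "\<dots> = real m * (M + t m)\<^sup>2" by simp
    finally have "real m * (\<Sum>n<m. (norm (c n * of_real r ^ n))\<^sup>2) \<le> real m * (M + t m)\<^sup>2" .
    then have "(\<Sum>n<m. (norm (c n * of_real r ^ n))\<^sup>2) \<le> (M + t m)\<^sup>2" using m by simp
    moreover have "(\<Sum>n<N. (norm (c n))\<^sup>2 * r ^ (2 * n)) \<le> (\<Sum>n<m. (norm (c n * of_real r ^ n))\<^sup>2)"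
    proof -
      have "(\<Sum>n<N. (norm (c n))\<^sup>2 * r ^ (2 * n)) \<le> (\<Sum>n<m. (norm (c n))\<^sup>2 * r ^ (2 * n))"
        using m r by (intro sum_mono2) auto
      also have "\<dots> = (\<Sum>n<m. (norm (c n * of_real r ^ n))\<^sup>2)"
        using r by (simp add: norm_mult norm_power power_mult_distrib power_mult[symmetric] mult.commute)
      finally show ?thesis .
    qed
    ultimately show ?thesis by linarith
  qed
  have "(\<lambda>m. (M + t m)\<^sup>2) \<longlonglongrightarrow> (M + 0)\<^sup>2" by (intro tendsto_intros t)
  then have "(\<Sum>n<N. (norm (c n))\<^sup>2 * r ^ (2 * n)) \<le> (M + 0)\<^sup>2"
  proof (rule tendsto_lowerbound)
    show "\<forall>\<^sub>F m in sequentially. (\<Sum>n<N. (norm (c n))\<^sup>2 * r ^ (2 * n)) \<le> (M + t m)\<^sup>2"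
      using eventually_ge_at_top[of "max N 1"] by eventually_elim (auto intro: main)
  qed simp
  then show ?thesis by simp
qed

lemma f_coeff_mean_square: "\<exists>K\<ge>0. \<forall>y>0. \<forall>N. (\<Sum>n<N. (f_coeff n)\<^sup>2 * exp (- (2 * pi * y * n))) \<le> K / y ^ 4"
proof -
  obtain K where K: "K \<ge> 0" "\<And>y q::complex. y > 0 \<Longrightarrow> norm q = exp (- (pi * y)) \<Longrightarrow> (norm (theta_form q))\<^sup>2 \<le> K / y ^ 4"
    using theta_form_bound by blast
  have "(\<Sum>n<N. (f_coeff n)\<^sup>2 * exp (- (2 * pi * y * n))) \<le> K / y ^ 4" if y: "y > 0" for y N
  proof -
    define r where "r = exp (- (pi * y))"
    have r: "0 < r" "r < 1" using y by (auto simp: r_def)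
    define s where "s = (1 + r) / 2"
    have s: "r < s" "s < 1" "s > 0" using r by (auto simp: s_def)
    have "norm (complex_of_real s) < 1" using s by simp
    from sums_summable[OF f_coeff_sums[OF this]]
    have sm: "summable (\<lambda>n. norm (complex_of_real (f_coeff n) * of_real r ^ n))"
      by (rule powser_insidea) (use r s in auto)
    have "(\<Sum>n<N. (norm (complex_of_real (f_coeff n)))\<^sup>2 * r ^ (2 * n)) \<le> (sqrt (K / y ^ 4))\<^sup>2"
    proof (rule power_series_mean_square_le[where f = theta_form])
      show "(\<lambda>n. complex_of_real (f_coeff n) * z ^ n) sums theta_form z" if "norm z = r" for z
        using that r by (intro f_coeff_sums) simp
      show "summable (\<lambda>n. norm (complex_of_real (f_coeff n)) * r ^ n)" using sm r by (simp add: norm_mult norm_power)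
      show "norm (theta_form z) \<le> sqrt (K / y ^ 4)" if "norm z = r" for z :: complex
        using K(2)[OF y, of z] that unfolding r_def by (intro real_le_rsqrt) auto
    qed (use r in simp)
    moreover have "r ^ (2 * n) = exp (- (2 * pi * y * n))" for n
      unfolding r_def exp_of_nat_mult[symmetric] by (simp add: mult_ac)
    ultimately show ?thesis using K(1) y by simp
  qed
  then show ?thesis using K(1) by blast
qed

text \<open>For 4^k <= n < 4^(k+1) take y = 4^(-k). Then exp (- 2 pi y n) >= exp (- 8 pi), the mean
  square is at most K 2^(8 k), and the weight n^(9/2) is at least 2^(9 k). A geometric series with
  ratio 1/2 remains.\<close>

lemma f_coeff_weighted_square_summable: "summable (\<lambda>n. (f_coeff n)\<^sup>2 / (real n ^ 4 * sqrt (real n)))"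
proof -
  obtain K where K: "K \<ge> 0" "\<And>y N. y > 0 \<Longrightarrow> (\<Sum>n<N. (f_coeff n)\<^sup>2 * exp (- (2 * pi * y * real n))) \<le> K / y ^ 4"
    using f_coeff_mean_square by blast
  define y where "y k = (1/4::real) ^ k" for k :: nat
  define v where "v k = (1/2::real) ^ (9 * k)" for k :: nat
  have y: "y k > 0" "v k > 0" for k by (auto simp: y_def v_def)
  have v0: "v k \<ge> 0" for k using y(2)[of k] by simp
  have bound: "(f_coeff n)\<^sup>2 / (real n ^ 4 * sqrt (real n)) \<le> exp (8 * pi) * (\<Sum>k<N. v k * ((f_coeff n)\<^sup>2 * exp (- (2 * pi * y k * real n))))" if n: "n < N" for n N
  proof (cases "n = 0")
    case True
    then show ?thesis using v0 by (auto intro!: sum_nonneg mult_nonneg_nonneg)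
  next
    case False
    then obtain k where k: "4 ^ k \<le> n" "n < 4 ^ (k + 1)" using ex_power_ivl1[of 4 n] by auto
    have rk: "4 ^ k \<le> real n" "real n < 4 ^ (k + 1)"
      using k by (metis of_nat_le_iff of_nat_numeral of_nat_power, metis of_nat_less_iff of_nat_numeral of_nat_power)
    \<comment> \<open>Places the block index \<open>k\<close> below \<open>N\<close>, so that its
      term occurs in the finite sum over k.\<close>
    have "k < 4 ^ k" by (rule power_gt_expt) simp
    then have kN: "k < N" using k n by simp
    have n0: "real n > 0" using False by simp
    have "2 ^ k = sqrt ((2 ^ k)\<^sup>2)" by simp
    also have "(2 ^ k)\<^sup>2 = (4::real) ^ k" by (simp add: power_mult[symmetric] mult.commute[of k]) (simp add: power_mult)
    finally have "2 ^ k \<le> sqrt (real n)" using rk(1) by simp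
    moreover have "(4 ^ k) ^ 4 \<le> real n ^ 4" using rk(1) by (intro power_mono) auto
    ultimately have "(4 ^ k) ^ 4 * 2 ^ k \<le> real n ^ 4 * sqrt (real n)" by (intro mult_mono) auto
    moreover have "(4 ^ k) ^ 4 * 2 ^ k = (2::real) ^ (9 * k)"
    proof -
      have "(4::real) = 2 ^ 2" by simp
      then have "(4 ^ k) ^ 4 * 2 ^ k = (2::real) ^ (2 * k * 4 + k)" by (simp only: power_mult power_add)
      then show ?thesis by (simp add: algebra_simps)
    qed
    ultimately have le: "2 ^ (9 * k) \<le> real n ^ 4 * sqrt (real n)" by simp
    have "(f_coeff n)\<^sup>2 / (real n ^ 4 * sqrt (real n)) \<le> (f_coeff n)\<^sup>2 / 2 ^ (9 * k)"
      using le n0 by (intro divide_left_mono) auto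
    also have "\<dots> = v k * (f_coeff n)\<^sup>2 * 1" by (simp add: v_def power_divide)
    also have "\<dots> \<le> v k * (f_coeff n)\<^sup>2 * (exp (8 * pi) * exp (- (2 * pi * y k * real n)))"
    proof (intro mult_left_mono)
      have "y k * real n \<le> y k * 4 ^ (k + 1)" using rk(2) y[of k] by (intro mult_left_mono) auto
      also have "\<dots> = 4" by (simp add: y_def power_divide)
      finally have "2 * pi * (y k * real n) \<le> 2 * pi * 4" by (intro mult_left_mono) auto
      then show "1 \<le> exp (8 * pi) * exp (- (2 * pi * y k * real n))"
        unfolding exp_add[symmetric] by (simp add: mult.assoc)
    qed (use y[of k] in auto)
    also have "\<dots> = exp (8 * pi) * (v k * ((f_coeff n)\<^sup>2 * exp (- (2 * pi * y k * real n))))" by (simp only: mult_ac)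
    also have "\<dots> \<le> exp (8 * pi) * (\<Sum>k<N. v k * ((f_coeff n)\<^sup>2 * exp (- (2 * pi * y k * real n))))"
      using kN v0 by (intro mult_left_mono member_le_sum) (auto intro!: mult_nonneg_nonneg)
    finally show ?thesis .
  qed
  have "(\<Sum>n<N. (f_coeff n)\<^sup>2 / (real n ^ 4 * sqrt (real n))) \<le> exp (8 * pi) * (K * 2)" for N
  proof -
    have "(\<Sum>n<N. (f_coeff n)\<^sup>2 / (real n ^ 4 * sqrt (real n)))
      \<le> (\<Sum>n<N. exp (8 * pi) * (\<Sum>k<N. v k * ((f_coeff n)\<^sup>2 * exp (- (2 * pi * y k * real n)))))"
      by (intro sum_mono bound) simp
    also have "\<dots> = exp (8 * pi) * (\<Sum>k<N. v k * (\<Sum>n<N. (f_coeff n)\<^sup>2 * exp (- (2 * pi * y k * real n))))"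
      unfolding sum_distrib_left[symmetric] by (subst sum.swap) (simp add: sum_distrib_left)
    also have "\<dots> \<le> exp (8 * pi) * (\<Sum>k<N. v k * (K / y k ^ 4))"
      using y by (intro mult_left_mono sum_mono K(2)) (auto intro: less_imp_le)
    also have "(\<Sum>k<N. v k * (K / y k ^ 4)) = K * (\<Sum>k<N. (1/2) ^ k)"
    proof -
      have "v k / y k ^ 4 = (1/2) ^ k" for k
      proof -
        have "y k ^ 4 = (1/2) ^ (8 * k)"
        proof -
          have "(1/4::real) = (1/2) ^ 2" by (simp add: power2_eq_square)
          then have "y k ^ 4 = (1/2) ^ (2 * k * 4)" unfolding y_def by (simp only: power_mult)
          then show ?thesis by (simp add: mult.commute)
        qed
        moreover have "v k = (1/2) ^ (8 * k) * (1/2) ^ k" unfolding v_def power_add[symmetric] by simp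
        ultimately show ?thesis by simp
      qed
      then have "v k * (K / y k ^ 4) = K * (1/2) ^ k" for k by (metis times_divide_eq_right mult.commute)
      then show ?thesis by (simp add: sum_distrib_left)
    qed
    also have "exp (8 * pi) * (K * (\<Sum>k<N. (1/2::real) ^ k)) \<le> exp (8 * pi) * (K * 2)"
    proof -
      have "(\<Sum>k<N. (1/2::real) ^ k) \<le> (\<Sum>k. (1/2) ^ k)" by (intro sum_le_suminf summable_geometric) auto
      also have "\<dots> = 2" by (simp add: suminf_geometric)
      finally show ?thesis using K(1) by (intro mult_left_mono) auto
    qed
    finally show ?thesis .
  qed
  then show ?thesis
    by (intro summableI_nonneg_bounded[where x = "exp (8 * pi) * (K * 2)"]) auto
qed

text \<open>The arithmetic-geometric inequality splits |a_n| / n^3 into a_n^2 / n^(9/2), controlled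
  by the mean square, and n^(-3/2).\<close>

lemma L_series_abs_summable: "summable (\<lambda>n. \<bar>f_coeff n\<bar> / real n ^ 3)"
proof (rule summable_comparison_test')
  have "summable (\<lambda>n. real n powr (- (3/2)))" by (subst summable_real_powr_iff) simp
  then show "summable (\<lambda>n. (f_coeff n)\<^sup>2 / (real n ^ 4 * sqrt (real n)) + real n powr (- (3/2)))"
    by (intro summable_add f_coeff_weighted_square_summable)
  show "norm (\<bar>f_coeff n\<bar> / real n ^ 3) \<le> (f_coeff n)\<^sup>2 / (real n ^ 4 * sqrt (real n)) + real n powr (- (3/2))" if "n \<ge> 1" for n
  proof -
    define s where "s = sqrt (real n)"
    have s: "s > 0" "s\<^sup>2 = real n" using that by (auto simp: s_def)
    have "real n powr (- (3/2)) = 1 / (real n powr 1 * real n powr (1/2))"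
      unfolding powr_add[symmetric] by (simp add: powr_minus_divide)
    also have "\<dots> = 1 / s ^ 3" using that s by (simp add: powr_half_sqrt s_def[symmetric] power3_eq_cube power2_eq_square)
    finally have p: "real n powr (- (3/2)) = 1 / s ^ 3" .
    define x where "x = \<bar>f_coeff n\<bar>"
    have "2 * (x / s ^ 6) \<le> x\<^sup>2 / s ^ 9 + 1 / s ^ 3"
    proof -
      have "0 \<le> (x / s ^ 3 - 1)\<^sup>2 * (s ^ 3 / s ^ 6)" using s by simp
      also have "(x / s ^ 3 - 1)\<^sup>2 = x\<^sup>2 / s ^ 6 - 2 * (x / s ^ 3) + 1"
        by (simp add: power2_diff power_divide power_mult[symmetric])
      also have "(x\<^sup>2 / s ^ 6 - 2 * (x / s ^ 3) + 1) * (s ^ 3 / s ^ 6) = x\<^sup>2 / s ^ 9 - 2 * (x / s ^ 6) + 1 / s ^ 3"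
      proof -
        have e: "s ^ 3 / s ^ 6 = 1 / s ^ 3" using s by (simp add: divide_simps power_add[symmetric])
        have "s ^ 6 * s ^ 3 = s ^ 9" "s ^ 3 * s ^ 3 = s ^ 6" unfolding power_add[symmetric] by simp_all
        then have "x\<^sup>2 / s ^ 6 * (1 / s ^ 3) = x\<^sup>2 / s ^ 9" "x / s ^ 3 * (1 / s ^ 3) = x / s ^ 6"
          by (simp_all only: times_divide_times_eq mult_1_right)
        then show ?thesis unfolding e by (simp only: left_diff_distrib distrib_right mult.assoc mult_1_left)
      qed
      finally show ?thesis by simp
    qed
    moreover have "x / s ^ 6 \<ge> 0" using s by (simp add: x_def)
    ultimately have "x / s ^ 6 \<le> x\<^sup>2 / s ^ 9 + 1 / s ^ 3" by linarith
    moreover have "real n ^ 3 = s ^ 6" "real n ^ 4 * s = s ^ 9"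
      unfolding s(2)[symmetric] power_mult[symmetric] power_Suc2[symmetric] by simp_all
    ultimately show ?thesis unfolding p s_def[symmetric] by (simp add: x_def)
  qed
qed

section \<open>The integral at 0 as an L-value\<close>

lemma f_coeff_abs_summable:
  assumes r: "0 \<le> r" "r < 1"
  shows "summable (\<lambda>n. \<bar>f_coeff n\<bar> * r ^ n)"
proof -
  define s where "s = (1 + r) / 2"
  have s: "r < s" "s < 1" "s > 0" using r by (auto simp: s_def)
  have "norm (complex_of_real s) < 1" using s by simp
  from sums_summable[OF f_coeff_sums[OF this]]
  have "summable (\<lambda>n. norm (complex_of_real (f_coeff n) * of_real r ^ n))"
    by (rule powser_insidea) (use r s in auto)
  then show ?thesis using r by (simp add: norm_mult norm_power)
qed

lemma f_coeff_sums_real: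
  assumes q: "0 \<le> q" "q < 1"
  shows "(\<lambda>n. f_coeff n * q ^ n) sums theta_form q"
proof -
  have "(\<lambda>n. complex_of_real (f_coeff n * q ^ n)) sums of_real (theta_form q)"
    using f_coeff_sums[of "of_real q"] theta_form_of_real[of q] q by simp
  then show ?thesis by (simp only: sums_of_real_iff)
qed

lemma theta_form_eq_theta_c:
  fixes q :: real assumes q: "0 < q" "q < 1"
  shows "theta_form q = (theta_c q)\<^sup>2 * ((theta q)\<^sup>2 * (theta (- q))\<^sup>2) / 16"
  unfolding theta_form_def theta_positive(4)[OF q] by (simp add: power_mult_distrib)

lemma theta_form_nonneg:
  fixes q :: real assumes q: "0 < q" "q < 1"
  shows "theta_form q \<ge> 0"
  by (simp add: theta_form_eq_theta_c[OF q])

lemma theta_form_continuous_on: "continuous_on {-1<..<1} (theta_form :: real \<Rightarrow> real)"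
proof -
  have "continuous_on {-1<..<1} (theta :: real \<Rightarrow> real)"
    by (intro continuous_at_imp_continuous_on ballI theta_isCont) auto
  moreover have "continuous_on {-1<..<1} (\<lambda>x::real. theta (- x))"
    by (rule continuous_on_compose2[OF calculation]) (auto intro!: continuous_intros)
  ultimately show ?thesis unfolding theta_form_def[abs_def] by (intro continuous_intros) auto
qed

text \<open>The Fricke involution of level 8: the inversion between t and 1/t combined with the step
  of means from exp (- pi t / 2) to its square exp (- pi t).\<close>

lemma theta_form_S:
  fixes t :: real assumes t: "t > 0"
  shows "theta_form (exp (- pi / t)) = t ^ 4 / 4 * theta_form (exp (- pi * (t / 2)))"
proof -
  define p q q' where "p = exp (- pi * (t / 2))" and "q = exp (- pi * t)" and "q' = exp (- pi / t)"
  have p: "0 < p" "p < 1" and q: "0 < q" "q < 1" and q': "0 < q'" "q' < 1" using t by (auto simp: p_def q_def q'_def)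
  have pq: "q = p\<^sup>2" unfolding p_def q_def exp_of_nat_mult[symmetric] power2_eq_square exp_add[symmetric] by simp
  define a b where "a = (theta p)\<^sup>2" and "b = (theta (- p))\<^sup>2"
  have ab: "a > 0" "b > 0" using theta_positive[OF p] by (auto simp: a_def b_def)
  have A: "(theta q)\<^sup>2 = (a + b) / 2" and B: "(theta (- q))\<^sup>2 = sqrt (a * b)" and c: "theta_c q = (a - b) / 2"
    using theta_double[OF p] unfolding pq a_def b_def by auto
  have A': "(theta q')\<^sup>2 = t * (theta q)\<^sup>2" and c': "theta_c q' = t * (theta (- q))\<^sup>2"
    using theta_S_real_square[OF t] by (auto simp: q_def q'_def)
  have "((theta (- q'))\<^sup>2)\<^sup>2 = ((theta q')\<^sup>2)\<^sup>2 - (theta_c q')\<^sup>2"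
    unfolding theta_positive(4)[OF q'] by (simp add: power_mult[symmetric])
  also have "\<dots> = t\<^sup>2 * ((theta q) ^ 4 - (theta (- q)) ^ 4)"
    unfolding A' c' by (simp add: power_mult_distrib power_mult[symmetric] right_diff_distrib)
  also have "\<dots> = (t * theta_c q)\<^sup>2" unfolding power_mult_distrib theta_positive(4)[OF q] ..
  finally have sq: "((theta (- q'))\<^sup>2)\<^sup>2 = (t * theta_c q)\<^sup>2" .
  have B': "(theta (- q'))\<^sup>2 = t * theta_c q"
    by (rule power2_eq_imp_eq[OF sq]) (use t theta_positive(3)[OF q] in auto)
  have "theta_form q' = (t * sqrt (a * b))\<^sup>2 * ((t * ((a + b) / 2)) * (t * ((a - b) / 2))) / 16"
    unfolding theta_form_eq_theta_c[OF q'] A' B' c' A B c ..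
  also have "\<dots> = t\<^sup>2 * (a * b) * ((t * ((a + b) / 2)) * (t * ((a - b) / 2))) / 16"
    using ab by (simp add: power_mult_distrib)
  also have "\<dots> = t ^ 4 / 4 * ((a\<^sup>2 - b\<^sup>2) * (a * b) / 16)"
  proof -
    have "t\<^sup>2 * (a * b) * ((t * (u / 2)) * (t * (v / 2))) / 16 = t ^ 4 / 4 * ((u * v) * (a * b) / 16)" for u v
      by (simp add: power2_eq_square power4_eq_xxxx)
    moreover have "(a + b) * (a - b) = a\<^sup>2 - b\<^sup>2" by (simp add: power2_eq_square algebra_simps)
    ultimately show ?thesis by (simp only:)
  qed
  also have "(a\<^sup>2 - b\<^sup>2) * (a * b) / 16 = theta_form p"
    unfolding theta_form_def a_def b_def by (simp add: power_mult[symmetric] power_mult_distrib)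
  finally show ?thesis by (simp only: p_def q'_def)
qed

section \<open>The modulus as a change of variable\<close>

definition theta_modulus :: "real \<Rightarrow> real" where
  "theta_modulus t = (theta (- exp (- pi * t)))\<^sup>2 / (theta (exp (- pi * t)))\<^sup>2"

text \<open>The logarithmic derivative of theta(-q) / theta(q) is given by
  \<open>theta_log_derivative\<close>; the square contributes a factor 2, and dq/dt = - pi
  q.\<close>

lemma theta_modulus_derivative:
  assumes t: "t > 0"
  shows "(theta_modulus has_real_derivative
    pi / 2 * theta_modulus t * ((theta (exp (- pi * t))) ^ 4 - (theta (- exp (- pi * t))) ^ 4)) (at t)"
proof -
  define q where "q = exp (- pi * t)"
  have q: "0 < q" "q < 1" using t by (auto simp: q_def)
  note pos = theta_positive[OF q]
  have e: "((\<lambda>t. exp (- pi * t)) has_real_derivative - pi * q) (at t)" "((\<lambda>t. - exp (- pi * t)) has_real_derivative pi * q) (at t)"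
    unfolding q_def by (auto intro!: derivative_eq_intros)
  have th: "norm (exp (- pi * t)) < 1" "norm (- exp (- pi * t)) < 1" using t by auto
  have dA: "((\<lambda>t. theta (exp (- pi * t))) has_real_derivative theta' q * (- pi * q)) (at t)"
    using DERIV_chain2[OF theta_has_derivative[OF th(1)] e(1)] by (simp add: q_def)
  have dB: "((\<lambda>t. theta (- exp (- pi * t))) has_real_derivative theta' (- q) * (pi * q)) (at t)"
    using DERIV_chain2[OF theta_has_derivative[OF th(2)] e(2)] by (simp add: q_def)
  define A B where "A = theta q" and "B = theta (- q)"
  have AB: "A > 0" "B > 0" using pos by (auto simp: A_def B_def)
  have AA: "(theta (exp (- pi * t)))\<^sup>2 \<noteq> 0" using AB unfolding A_def q_def by simp
  have d: "(theta_modulus has_real_derivative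
     ((of_nat 2 * (theta' (- q) * (pi * q) * B ^ (2 - Suc 0))) * A\<^sup>2 - B\<^sup>2 * (of_nat 2 * (theta' q * (- pi * q) * A ^ (2 - Suc 0)))) / (A\<^sup>2 * A\<^sup>2)) (at t)"
    using DERIV_divide[OF DERIV_power[OF dB, of 2] DERIV_power[OF dA, of 2] AA]
    unfolding theta_modulus_def[abs_def] A_def B_def q_def .
  have gen: "((of_nat 2 * (v * B ^ (2 - Suc 0))) * A\<^sup>2 - B\<^sup>2 * (of_nat 2 * (u * A ^ (2 - Suc 0)))) / (A\<^sup>2 * A\<^sup>2) = 2 * (B\<^sup>2 / A\<^sup>2) * (v / B - u / A)" for u v
    using AB by (simp add: field_simps power2_eq_square)
  have "theta' (- q) * (pi * q) / B - theta' q * (- pi * q) / A = - pi * (q * (- theta' (- q) / B - theta' q / A))"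
    by (simp add: algebra_simps)
  also have "\<dots> = pi / 4 * (A ^ 4 - B ^ 4)"
  proof -
    have "- p * (- (x - y) / 4) = p / 4 * (x - y)" for p x y :: real by (simp add: field_simps)
    then show ?thesis unfolding A_def B_def theta_log_derivative[OF q] .
  qed
  finally have f: "theta' (- q) * (pi * q) / B - theta' q * (- pi * q) / A = pi / 4 * (A ^ 4 - B ^ 4)" .
  have m: "theta_modulus t = B\<^sup>2 / A\<^sup>2" by (simp add: theta_modulus_def q_def A_def B_def)
  have "2 * x * (pi / 4 * y) = pi / 2 * x * y" for x y by simp
  then have "2 * (B\<^sup>2 / A\<^sup>2) * (theta' (- q) * (pi * q) / B - theta' q * (- pi * q) / A) = pi / 2 * theta_modulus t * (A ^ 4 - B ^ 4)"
    unfolding f m .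
  then show ?thesis using d unfolding gen by (simp only: A_def B_def q_def)
qed

lemma theta_modulus_range:
  assumes t: "t > 0"
  shows "0 < theta_modulus t" "theta_modulus t < 1" "theta_modulus (1 / t) = sqrt (1 - (theta_modulus t)\<^sup>2)"
proof -
  define q q' where "q = exp (- pi * t)" and "q' = exp (- pi / t)"
  have q: "0 < q" "q < 1" and q': "0 < q'" "q' < 1" using t by (auto simp: q_def q'_def)
  note p = theta_positive[OF q] theta_positive[OF q']
  have m: "theta_modulus t = (theta (- q))\<^sup>2 / (theta q)\<^sup>2" "theta_modulus (1 / t) = (theta (- q'))\<^sup>2 / (theta q')\<^sup>2"
    by (simp_all add: theta_modulus_def q_def q'_def)
  show "0 < theta_modulus t" unfolding m using p by simp
  have "(theta (- q))\<^sup>2 < (theta q)\<^sup>2" using p by (intro power_strict_mono) auto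
  then show "theta_modulus t < 1" unfolding m using p by simp
  have A': "(theta q')\<^sup>2 = t * (theta q)\<^sup>2" and c': "theta_c q' = t * (theta (- q))\<^sup>2"
    using theta_S_real_square[OF t] by (auto simp: q_def q'_def)
  have "(theta_modulus (1 / t))\<^sup>2 = (((theta q')\<^sup>2)\<^sup>2 - (theta_c q')\<^sup>2) / ((theta q')\<^sup>2)\<^sup>2"
    unfolding m theta_positive(4)[OF q'] by (simp add: power_divide power_mult[symmetric])
  also have "\<dots> = 1 - (theta_modulus t)\<^sup>2"
    unfolding A' c' m using t p by (simp add: power_divide power_mult_distrib diff_divide_distrib)
  finally have "sqrt ((theta_modulus (1 / t))\<^sup>2) = sqrt (1 - (theta_modulus t)\<^sup>2)" by simp
  moreover have "theta_modulus (1 / t) > 0" unfolding m using p by simp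
  ultimately show "theta_modulus (1 / t) = sqrt (1 - (theta_modulus t)\<^sup>2)" by simp
qed

lemma theta_modulus_strict_mono:
  assumes s: "0 < s" and st: "s < t"
  shows "theta_modulus s < theta_modulus t"
proof (rule DERIV_pos_imp_increasing[OF st])
  fix x assume "s \<le> x" "x \<le> t"
  then have x: "x > 0" using s by simp
  have q: "0 < exp (- pi * x)" "exp (- pi * x) < 1" using x by auto
  have "(theta (exp (- pi * x))) ^ 4 - (theta (- exp (- pi * x))) ^ 4 > 0"
    using theta_positive(3,4)[OF q] by (metis zero_less_power)
  then show "\<exists>y. (theta_modulus has_real_derivative y) (at x) \<and> 0 < y"
    using theta_modulus_derivative[OF x] theta_modulus_range(1)[OF x]
    by (intro exI conjI) (assumption, intro mult_pos_pos, auto)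
qed

lemma theta_modulus_tendsto_1: "(theta_modulus \<longlongrightarrow> 1) at_top"
proof -
  have e: "((\<lambda>t::real. exp (- pi * t)) \<longlongrightarrow> 0) at_top" by real_asymp
  have me: "((\<lambda>t::real. - exp (- pi * t)) \<longlongrightarrow> 0) at_top" using tendsto_minus[OF e] by simp
  have th0: "isCont (theta :: real \<Rightarrow> real) 0" by (rule theta_isCont) simp
  have "(theta_modulus \<longlongrightarrow> (theta 0)\<^sup>2 / (theta 0)\<^sup>2) at_top"
    unfolding theta_modulus_def[abs_def]
    by (intro tendsto_intros isCont_tendsto_compose[OF th0 e] isCont_tendsto_compose[OF th0 me]) (simp add: theta'_continuous_0)
  then show ?thesis by (simp add: theta'_continuous_0)
qed

text \<open>Values near 1 come from the limit at infinity, small values from the complementary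
  relation between t and 1/t, and intermediate ones from continuity.\<close>

lemma theta_modulus_image: "theta_modulus ` {0<..} = {0<..<1}"
proof -
  have big: "\<exists>t>0. theta_modulus t > v" if "v < 1" for v
  proof -
    have "\<forall>\<^sub>F t in at_top. theta_modulus t > v \<and> t > 0"
      using order_tendstoD(1)[OF theta_modulus_tendsto_1 that] eventually_gt_at_top by (rule eventually_conj)
    from eventually_happens'[OF trivial_limit_at_top_linorder this] obtain t where "theta_modulus t > v \<and> t > 0" ..
    then show ?thesis by blast
  qed
  have "v \<in> theta_modulus ` {0<..}" if v: "0 < v" "v < 1" for v
  proof -
    obtain t2 where t2: "t2 > 0" "theta_modulus t2 > v" using big v by blast
    have "sqrt (1 - v\<^sup>2) < 1" using v by simp
    then obtain t where t: "t > 0" "theta_modulus t > sqrt (1 - v\<^sup>2)" using big by blast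
    define t1 where "t1 = 1 / t"
    have "sqrt (1 - v\<^sup>2) \<ge> 0" using v by (simp add: abs_square_le_1)
    then have "(sqrt (1 - v\<^sup>2))\<^sup>2 < (theta_modulus t)\<^sup>2" using t by (intro power_strict_mono) auto
    moreover have "(sqrt (1 - v\<^sup>2))\<^sup>2 = 1 - v\<^sup>2" using v by (simp add: abs_square_le_1)
    ultimately have "1 - (theta_modulus t)\<^sup>2 < v\<^sup>2" by simp
    then have "sqrt (1 - (theta_modulus t)\<^sup>2) < sqrt (v\<^sup>2)" by (rule real_sqrt_less_mono)
    then have t1: "t1 > 0" "theta_modulus t1 < v" unfolding t1_def theta_modulus_range(3)[OF t(1)] using v t by auto
    have "t1 < t2"
    proof (rule ccontr)
      assume "\<not> t1 < t2"
      then have "theta_modulus t2 \<le> theta_modulus t1"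
        using theta_modulus_strict_mono[OF t2(1), of t1] by (cases "t1 = t2") auto
      then show False using t1 t2 by simp
    qed
    moreover have "continuous_on {t1..t2} theta_modulus"
      using t1 by (intro DERIV_continuous_on[OF has_field_derivative_at_within[OF theta_modulus_derivative]]) auto
    ultimately obtain x where "t1 \<le> x" "x \<le> t2" "theta_modulus x = v"
      using IVT'[of theta_modulus t1 v t2] t1 t2 by auto
    then show ?thesis using t1 by (intro image_eqI[of v theta_modulus x]) auto
  qed
  then show ?thesis using theta_modulus_range by auto
qed

lemma exp_neg_pi_measurable:
  "(\<lambda>t. indicator {0<..} t * (c * theta_form (exp (- pi * t)))) \<in> borel_measurable (borel :: real measure)" for c :: real
  by (rule borel_measurable_indicator_times_continuous_on)
    (auto intro!: continuous_intros continuous_on_compose2[OF theta_form_continuous_on] simp: less_trans[of "-1" 0])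

text \<open>The squared integral pi^2 theta(q)^4 cancels the denominator of the modulus, and the
  derivative supplies theta_c(q)^2. What is left, pi^3 theta(q)^2 theta(-q)^2 theta_c(q)^2, is 16
  pi^3 times the form of weight 4.\<close>

lemma reduced_integral_0_theta: "(\<integral>\<^sup>+s\<in>{0<..<1}. ennreal (2 * (cosh_integral 0 s)\<^sup>2) \<partial>lborel)
    = (\<integral>\<^sup>+t\<in>{0<..}. ennreal (16 * pi ^ 3 * theta_form (exp (- pi * t))) \<partial>lborel)"
proof -
  let ?g' = "\<lambda>t. pi / 2 * theta_modulus t * ((theta (exp (- pi * t))) ^ 4 - (theta (- exp (- pi * t))) ^ 4)"
  have eq: "\<bar>?g' t\<bar> * (2 * (cosh_integral 0 (theta_modulus t))\<^sup>2) = 16 * pi ^ 3 * theta_form (exp (- pi * t))" if t: "t > 0" for t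
  proof -
    define q where "q = exp (- pi * t)"
    have q: "0 < q" "q < 1" using t by (auto simp: q_def)
    note p = theta_positive[OF q]
    have "?g' t \<ge> 0" unfolding q_def[symmetric] p(4)[symmetric] using theta_modulus_range(1)[OF t] by simp
    then have "\<bar>?g' t\<bar> = ?g' t" by simp
    moreover have "cosh_integral 0 (theta_modulus t) = pi * (theta q)\<^sup>2"
      unfolding theta_modulus_def q_def[symmetric] by (rule cosh_integral_theta[OF q])
    ultimately have "\<bar>?g' t\<bar> * (2 * (cosh_integral 0 (theta_modulus t))\<^sup>2)
       = pi / 2 * ((theta (- q))\<^sup>2 / (theta q)\<^sup>2) * (theta_c q)\<^sup>2 * (2 * (pi * (theta q)\<^sup>2)\<^sup>2)"
      unfolding p(4) by (simp only: theta_modulus_def q_def)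
    also have "\<dots> = 16 * pi ^ 3 * ((theta_c q)\<^sup>2 * ((theta q)\<^sup>2 * (theta (- q))\<^sup>2) / 16)"
    proof -
      have "pi / 2 * (b / a) * c * (2 * (pi * a)\<^sup>2) = 16 * pi ^ 3 * (c * (a * b) / 16)" if "a > 0" for a b c :: real
        using that by (simp add: power2_eq_square power3_eq_cube)
      from this[of "(theta q)\<^sup>2"] show ?thesis using p by simp
    qed
    finally show ?thesis unfolding theta_form_eq_theta_c[OF q, symmetric] unfolding q_def .
  qed
  have "(\<integral>\<^sup>+s\<in>theta_modulus ` {0<..}. ennreal (2 * (cosh_integral 0 s)\<^sup>2) \<partial>lborel) = (\<integral>\<^sup>+t\<in>{0<..}. ennreal (\<bar>?g' t\<bar> * (2 * (cosh_integral 0 (theta_modulus t))\<^sup>2)) \<partial>lborel)"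
  proof (rule nn_integral_change_of_variables)
    show "(theta_modulus has_real_derivative ?g' t) (at t within {0<..})" if "t \<in> {0<..}" for t
      by (rule has_field_derivative_at_within, rule theta_modulus_derivative) (use that in simp)
    show "inj_on theta_modulus {0<..}"
    proof (rule inj_onI)
      fix x y :: real assume "x \<in> {0<..}" "y \<in> {0<..}" "theta_modulus x = theta_modulus y"
      then show "x = y" using theta_modulus_strict_mono[of x y] theta_modulus_strict_mono[of y x]
        by (cases x y rule: linorder_cases) auto
    qed
    show "theta_modulus ` {0<..} \<in> sets borel" unfolding theta_modulus_image by simp
    show "(\<lambda>x. indicator (theta_modulus ` {0<..}) x * (2 * (cosh_integral 0 x)\<^sup>2)) \<in> borel_measurable borel"
      unfolding theta_modulus_image
      by (rule borel_measurable_indicator_times_continuous_on)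
        (auto intro!: continuous_intros continuous_on_subset[OF cosh_integral_continuous_on])
    have "(\<lambda>x. indicator {0<..} x * (\<bar>?g' x\<bar> * (2 * (cosh_integral 0 (theta_modulus x))\<^sup>2))) = (\<lambda>x. indicator {0<..} x * (16 * pi ^ 3 * theta_form (exp (- pi * x))))"
      using eq by (auto simp: fun_eq_iff split: split_indicator)
    then show "(\<lambda>x. indicator {0<..} x * (\<bar>?g' x\<bar> * (2 * (cosh_integral 0 (theta_modulus x))\<^sup>2))) \<in> borel_measurable borel"
      using exp_neg_pi_measurable by (simp only:)
  qed auto
  also have "\<dots> = (\<integral>\<^sup>+t\<in>{0<..}. ennreal (16 * pi ^ 3 * theta_form (exp (- pi * t))) \<partial>lborel)"
  proof (rule nn_integral_cong)
    fix t :: real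
    show "ennreal (\<bar>?g' t\<bar> * (2 * (cosh_integral 0 (theta_modulus t))\<^sup>2)) * indicator {0<..} t = ennreal (16 * pi ^ 3 * theta_form (exp (- pi * t))) * indicator {0<..} t"
      using eq[of t] by (cases "t > 0") simp_all
  qed
  finally show ?thesis unfolding theta_modulus_image .
qed

text \<open>With t = 1/u the Jacobian 1 / u^2 meets the factor u^4 / 4 of
  \<open>theta_form_S\<close> and leaves u^2, the kernel of a Mellin transform at s = 3.\<close>

lemma theta_form_integral_inverse:
  "(\<integral>\<^sup>+t\<in>{0<..}. ennreal (16 * pi ^ 3 * theta_form (exp (- pi * t))) \<partial>lborel)
    = (\<integral>\<^sup>+u\<in>{0<..}. ennreal (4 * pi ^ 3 * (u\<^sup>2 * theta_form (exp (- pi * (u / 2))))) \<partial>lborel)"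
proof -
  let ?f = "\<lambda>t. 16 * pi ^ 3 * theta_form (exp (- pi * t))"
  have img: "(\<lambda>u. 1 / u) ` {0<..} = {0::real<..}"
  proof -
    have "x \<in> (\<lambda>u. 1 / u) ` {0<..}" if "x > 0" for x :: real using that by (intro image_eqI[of _ _ "1 / x"]) auto
    then show ?thesis by auto
  qed
  have eq: "\<bar>- (1 / u\<^sup>2)\<bar> * ?f (1 / u) = 4 * pi ^ 3 * (u\<^sup>2 * theta_form (exp (- pi * (u / 2))))" if u: "u > 0" for u :: real
  proof -
    have "- pi * (1 / u) = - pi / u" by simp
    then have "?f (1 / u) = 16 * pi ^ 3 * (u ^ 4 / 4 * theta_form (exp (- pi * (u / 2))))" using theta_form_S[OF u] by (simp only:)
    moreover have "\<bar>- (1 / u\<^sup>2)\<bar> * (16 * pi ^ 3 * (u ^ 4 / 4 * x)) = 4 * pi ^ 3 * (u\<^sup>2 * x)" for x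
      using u by (simp add: power2_eq_square power4_eq_xxxx)
    ultimately show ?thesis by (simp only:)
  qed
  have "(\<integral>\<^sup>+t\<in>(\<lambda>u. 1 / u) ` {0<..}. ennreal (?f t) \<partial>lborel) = (\<integral>\<^sup>+u\<in>{0<..}. ennreal (\<bar>- (1 / u\<^sup>2)\<bar> * ?f (1 / u)) \<partial>lborel)"
  proof (rule nn_integral_change_of_variables)
    show "((\<lambda>u. 1 / u) has_real_derivative - (1 / u\<^sup>2)) (at u within {0<..})" if "u \<in> {0<..}" for u :: real
      using that by (auto intro!: derivative_eq_intros simp: power2_eq_square)
    show "inj_on (\<lambda>u. 1 / u) {0::real<..}" by (auto simp: inj_on_def)
    show "(\<lambda>u. 1 / u) ` {0::real<..} \<in> sets borel" unfolding img by simp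
    show "(\<lambda>x. indicator ((\<lambda>u. 1 / u) ` {0<..}) x * ?f x) \<in> borel_measurable borel"
      unfolding img by (rule exp_neg_pi_measurable)
    show "0 \<le> ?f (1 / u)" if "u \<in> {0<..}" for u
      using that by (intro mult_nonneg_nonneg theta_form_nonneg) auto
    have "(\<lambda>u. indicator {0<..} u * (\<bar>- (1 / u\<^sup>2)\<bar> * ?f (1 / u))) = (\<lambda>u. indicator {0<..} u * (4 * pi ^ 3 * (u\<^sup>2 * theta_form (exp (- pi * (u / 2))))))"
      using eq by (auto simp: fun_eq_iff split: split_indicator)
    moreover have "(\<lambda>u. indicator {0<..} u * (4 * pi ^ 3 * (u\<^sup>2 * theta_form (exp (- pi * (u / 2)))))) \<in> borel_measurable borel"
      by (rule borel_measurable_indicator_times_continuous_on)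
        (auto intro!: continuous_intros continuous_on_compose2[OF theta_form_continuous_on] simp: less_trans[of "-1" 0])
    ultimately show "(\<lambda>u. indicator {0<..} u * (\<bar>- (1 / u\<^sup>2)\<bar> * ?f (1 / u))) \<in> borel_measurable borel" by (simp only:)
  qed auto
  also have "\<dots> = (\<integral>\<^sup>+u\<in>{0<..}. ennreal (4 * pi ^ 3 * (u\<^sup>2 * theta_form (exp (- pi * (u / 2))))) \<partial>lborel)"
  proof (rule nn_integral_cong)
    fix u :: real
    show "ennreal (\<bar>- (1 / u\<^sup>2)\<bar> * ?f (1 / u)) * indicator {0<..} u = ennreal (4 * pi ^ 3 * (u\<^sup>2 * theta_form (exp (- pi * (u / 2))))) * indicator {0<..} u"
      using eq[of u] by (cases "u > 0") simp_all
  qed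
  finally show ?thesis unfolding img .
qed

section \<open>The Mellin transform at s = 3, term by term\<close>

lemma laplace_transform_square:
  assumes c: "c > 0"
  shows "has_bochner_integral lborel (\<lambda>u::real. indicator {0<..} u * (u\<^sup>2 * exp (- (c * u)))) (2 / c ^ 3)"
proof -
  have "has_bochner_integral lborel (\<lambda>x::real. x\<^sup>2 * exp (- x) * indicator {0..} x) 2"
  proof (rule has_bochner_integral_nn_integral)
    have "(\<integral>\<^sup>+x. ennreal (x\<^sup>2 * exp (- x) * indicator {0..} x) \<partial>lborel) = (\<integral>\<^sup>+x. ennreal (x ^ 2 * exp (- x)) * indicator {0..} x \<partial>lborel)"
      by (rule nn_integral_cong) (auto split: split_indicator)
    then show "(\<integral>\<^sup>+x. ennreal (x\<^sup>2 * exp (- x) * indicator {0..} x) \<partial>lborel) = ennreal 2"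
      unfolding nn_intergal_power_times_exp_Ici by (simp add: numeral_2_eq_2)
  qed (auto split: split_indicator)
  then have "has_bochner_integral lborel (\<lambda>u::real. (0 + c * u)\<^sup>2 * exp (- (0 + c * u)) * indicator {0..} (0 + c * u)) (2 /\<^sub>R \<bar>c\<bar>)"
    using c by (subst (asm) lborel_has_bochner_integral_real_affine_iff[of c _ _ 0]) auto
  from has_bochner_integral_mult_right[OF this, of "1 / c\<^sup>2"]
  have h: "has_bochner_integral lborel (\<lambda>u::real. 1 / c\<^sup>2 * ((0 + c * u)\<^sup>2 * exp (- (0 + c * u)) * indicator {0..} (0 + c * u))) (1 / c\<^sup>2 * (2 /\<^sub>R \<bar>c\<bar>))" .
  have "1 / c\<^sup>2 * (2 /\<^sub>R \<bar>c\<bar>) = 2 / c ^ 3" using c by (simp add: power2_eq_square power3_eq_cube divide_inverse)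
  moreover have "1 / c\<^sup>2 * ((0 + c * u)\<^sup>2 * exp (- (0 + c * u)) * indicator {0..} (0 + c * u)) = indicator {0<..} u * (u\<^sup>2 * exp (- (c * u)))" for u
    using c by (cases u "0::real" rule: linorder_cases) (auto simp: power_mult_distrib zero_le_mult_iff split: split_indicator)
  ultimately show ?thesis using h by simp
qed

text \<open>The i-th term has c = pi i / 2 in \<open>laplace_transform_square\<close>, and 2 / c^3 =
  16 / (pi^3 i^3). The interchange of sum and integral rests on
  \<open>L_series_abs_summable\<close>.\<close>

lemma theta_form_mellin:
  "integrable lborel (\<lambda>u. indicator {0<..} u * (u\<^sup>2 * theta_form (exp (- pi * (u / 2)))))"
  "(LINT u|lborel. indicator {0<..} u * (u\<^sup>2 * theta_form (exp (- pi * (u / 2))))) = 16 / pi ^ 3 * L_f_3"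
proof -
  define f where "f i u = f_coeff i * (indicator {0<..} u * (u\<^sup>2 * exp (- (pi * real i / 2 * u))))" for i and u :: real
  \<comment> \<open>At i = 0 the exponential does not decay; the vanishing coefficient removes this
    term, in agreement with the value 0 of a division by \<open>real 0 ^ 3\<close>.\<close>
  have f0: "f_coeff 0 = 0" by (simp add: f_coeff_def)
  have bi: "has_bochner_integral lborel (f i) (f_coeff i * (16 / (pi ^ 3 * real i ^ 3)))" for i
  proof (cases "i = 0")
    case True
    then have "f i = (\<lambda>u. 0)" by (simp add: f_def f0 fun_eq_iff)
    then show ?thesis using True by (simp add: f0 has_bochner_integral_iff)
  next
    case False
    then have "pi * real i / 2 > 0" by (intro divide_pos_pos mult_pos_pos) auto
    from has_bochner_integral_mult_right[OF laplace_transform_square[OF this], of "f_coeff i"]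
    show ?thesis unfolding f_def by (simp add: power_divide power_mult_distrib)
  qed
  have bn: "has_bochner_integral lborel (\<lambda>u. norm (f i u)) (\<bar>f_coeff i\<bar> * (16 / (pi ^ 3 * real i ^ 3)))" for i
  proof (cases "i = 0")
    case True then show ?thesis by (simp add: f_def f0 has_bochner_integral_iff)
  next
    case False
    then have "pi * real i / 2 > 0" by (intro divide_pos_pos mult_pos_pos) auto
    from has_bochner_integral_mult_right[OF laplace_transform_square[OF this], of "\<bar>f_coeff i\<bar>"]
    show ?thesis unfolding f_def by (simp add: power_divide power_mult_distrib abs_mult)
  qed
  have int: "integrable lborel (f i)" for i using bi[of i] by (simp add: has_bochner_integral_iff)
  have ex: "exp (- (pi * real i / 2 * u)) = exp (- pi * (u / 2)) ^ i" for i u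
    unfolding exp_of_nat_mult[symmetric] by (simp add: mult_ac)
  have sm: "summable (\<lambda>i. norm (f i u))" for u
  proof (cases "u > 0")
    case True
    then have "0 \<le> exp (- pi * (u / 2))" "exp (- pi * (u / 2)) < 1" by auto
    from summable_mult[OF f_coeff_abs_summable[OF this], of "u\<^sup>2"] True
    show ?thesis unfolding f_def ex by (simp add: abs_mult mult_ac)
  qed (simp add: f_def)
  have smi: "summable (\<lambda>i. LINT u|lborel. norm (f i u))"
  proof -
    have "(LINT u|lborel. norm (f i u)) = 16 / pi ^ 3 * (\<bar>f_coeff i\<bar> / real i ^ 3)" for i
      using bn[of i] by (simp add: has_bochner_integral_iff)
    then show ?thesis using summable_mult[OF L_series_abs_summable, of "16 / pi ^ 3"] by simp
  qed
  have sum: "(\<Sum>i. f i u) = indicator {0<..} u * (u\<^sup>2 * theta_form (exp (- pi * (u / 2))))" for u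
  proof (cases "u > 0")
    case True
    then have "0 \<le> exp (- pi * (u / 2))" "exp (- pi * (u / 2)) < 1" by auto
    from sums_mult[OF f_coeff_sums_real[OF this], of "u\<^sup>2"]
    have "(\<lambda>i. f i u) sums (u\<^sup>2 * theta_form (exp (- pi * (u / 2))))" unfolding f_def ex using True by (simp add: mult_ac)
    then show ?thesis using True by (simp add: sums_iff)
  qed (simp add: f_def)
  show "integrable lborel (\<lambda>u. indicator {0<..} u * (u\<^sup>2 * theta_form (exp (- pi * (u / 2)))))"
    using integrable_suminf[OF int _ smi] sm unfolding sum by simp
  have "(\<lambda>i. LINT u|lborel. f i u) sums (LINT u|lborel. (\<Sum>i. f i u))"
    by (rule sums_integral[OF int _ smi]) (use sm in simp)
  moreover have "(LINT u|lborel. f i u) = 16 / pi ^ 3 * (f_coeff i / real i ^ 3)" for i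
    using bi[of i] by (simp add: has_bochner_integral_iff)
  ultimately have s: "(\<lambda>i. 16 / pi ^ 3 * (f_coeff i / real i ^ 3)) sums (LINT u|lborel. indicator {0<..} u * (u\<^sup>2 * theta_form (exp (- pi * (u / 2)))))"
    unfolding sum by simp
  have "summable (\<lambda>i. f_coeff i / real i ^ 3)"
    by (rule summable_norm_cancel) (use L_series_abs_summable in simp)
  then have "(\<lambda>i. f_coeff i / real i ^ 3) sums (\<Sum>i. f_coeff i / real i ^ 3)" by (rule summable_sums)
  then have "(\<lambda>i. f_coeff (Suc i) / real (Suc i) ^ 3) sums (\<Sum>i. f_coeff i / real i ^ 3)"
    using f0 by (subst sums_Suc_iff) simp
  then have "L_f_3 = (\<Sum>i. f_coeff i / real i ^ 3)" unfolding L_f_3_def by (simp only: sums_iff)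
  then have "(\<lambda>i. 16 / pi ^ 3 * (f_coeff i / real i ^ 3)) sums (16 / pi ^ 3 * L_f_3)"
    using sums_mult[OF summable_sums[OF \<open>summable (\<lambda>i. f_coeff i / real i ^ 3)\<close>], of "16 / pi ^ 3"] by (simp only:)
  from sums_unique2[OF s this]
  show "(LINT u|lborel. indicator {0<..} u * (u\<^sup>2 * theta_form (exp (- pi * (u / 2))))) = 16 / pi ^ 3 * L_f_3" .
qed

text \<open>64 is the product of the 4 left by the inversion and the 16 of the Mellin transform, the
  powers of pi cancelling. Equality is first reached in \<open>ennreal\<close> and brought back by
  the nonnegativity of both sides.\<close>

lemma reduced_integral_0_eq: "reduced_integral 0 = 64 * L_f_3"
proof -
  let ?h = "\<lambda>u. indicator {0<..} u * (u\<^sup>2 * theta_form (exp (- pi * (u / 2))))"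
  have h0: "?h u \<ge> 0" for u using theta_form_nonneg[of "exp (- pi * (u / 2))"] by (auto split: split_indicator)
  have int: "integrable lborel (\<lambda>s. indicator {0<..<1} s *\<^sub>R (2 * (cosh_integral 0 s)\<^sup>2))"
    using reduced_integral_integrable[of 0] by (simp add: set_integrable_def)
  have reduced_integral: "reduced_integral 0 = (LINT s|lborel. indicator {0<..<1} s *\<^sub>R (2 * (cosh_integral 0 s)\<^sup>2))"
    unfolding reduced_integral_def set_lebesgue_integral_def mult_0_right power_0 mult_1_right ..
  have "ennreal (reduced_integral 0) = (\<integral>\<^sup>+s. ennreal (indicator {0<..<1} s *\<^sub>R (2 * (cosh_integral 0 s)\<^sup>2)) \<partial>lborel)"
    unfolding reduced_integral by (rule nn_integral_eq_integral[OF int, symmetric]) simp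
  also have "\<dots> = (\<integral>\<^sup>+s\<in>{0<..<1}. ennreal (2 * (cosh_integral 0 s)\<^sup>2) \<partial>lborel)"
    by (rule nn_integral_cong) (auto split: split_indicator)
  also have "\<dots> = (\<integral>\<^sup>+u\<in>{0<..}. ennreal (4 * pi ^ 3 * (u\<^sup>2 * theta_form (exp (- pi * (u / 2))))) \<partial>lborel)"
    unfolding reduced_integral_0_theta theta_form_integral_inverse ..
  also have "\<dots> = (\<integral>\<^sup>+u. ennreal (4 * pi ^ 3 * ?h u) \<partial>lborel)"
    by (rule nn_integral_cong) (auto split: split_indicator)
  also have "\<dots> = ennreal (LINT u|lborel. 4 * pi ^ 3 * ?h u)"
    using h0 by (intro nn_integral_eq_integral integrable_mult_right theta_form_mellin(1)) simp
  also have "(LINT u|lborel. 4 * pi ^ 3 * ?h u) = 64 * L_f_3"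
    unfolding integral_mult_right_zero theta_form_mellin(2) by simp
  finally have e: "ennreal (reduced_integral 0) = ennreal (64 * L_f_3)" .
  have "(LINT u|lborel. ?h u) \<ge> 0" by (rule Bochner_Integration.integral_nonneg[OF h0])
  then have "L_f_3 \<ge> 0" unfolding theta_form_mellin(2) zero_le_mult_iff using zero_less_divide_iff[of 16 "pi ^ 3"] pi_gt_zero by auto
  moreover have "reduced_integral 0 \<ge> 0" using reduced_integral_pos[of 0] by simp
  ultimately show ?thesis using e by (simp add: ennreal_inj)
qed

theorem theorem3p1:
  shows "(\<lambda>n. cf_p cf_a cf_b n / cf_q cf_a cf_b n) \<longlonglongrightarrow> - 3 * eta_plus / omega_plus \<and>
         (\<lambda>n. - 3 * eta_plus / omega_plus - cf_p cf_a cf_b n / cf_q cf_a cf_b n)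
           \<sim>[sequentially] (\<lambda>n. (192 * pi ^ 3 / omega_plus ^ 2) / (1 + sqrt 2) ^ (8 * n + 8))"
proof
  have I0: "reduced_integral 0 = 8 * omega_plus" unfolding reduced_integral_0_eq omega_plus_def by simp
  have I1: "reduced_integral 1 = - 56 * omega_plus - 3/2 * eta_plus" unfolding eta_plus_def I3_eq_reduced_integral by (simp add: field_simps)
  note * = continued_fraction_asymptotics[OF reduced_integral_pos reduced_integral_recurrence I0 I1 reduced_integral_asymptotics asymp_const]
  show "(\<lambda>n. cf_p cf_a cf_b n / cf_q cf_a cf_b n) \<longlonglongrightarrow> - 3 * eta_plus / omega_plus" by (rule *(1))
  show "(\<lambda>n. - 3 * eta_plus / omega_plus - cf_p cf_a cf_b n / cf_q cf_a cf_b n)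
           \<sim>[sequentially] (\<lambda>n. (192 * pi ^ 3 / omega_plus ^ 2) / (1 + sqrt 2) ^ (8 * n + 8))" by (rule *(2))
qed

end
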